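(* Consider the two conditions: (R) (regularity condition) $g$ is strictly concave at every $\xi\in\operatorname{ri}\mathcal U$ with $\xi\notin\mathcal D$; (J) (jump process condition) there exists an event of full $\mathbb P$-probability on which, for all $x,y\in\mathbb Z^2$, every point of $\operatorname{supp}\mu_{x,y}$ is isolated. The following hold for $\mathbb P$-almost every $\omega$ and all $\xi\in\operatorname{ri}\mathcal U$. (a) $\xi\in(\operatorname{ri}\mathcal U)\setminus\mathcal V^\omega$ if and only if the following is true: $\gamma^{x,\xi+}=\gamma^{x,\xi-}$ for all $x\in\mathbb Z^2$ and all these geodesics coalesce. (b) Under (R), $\xi\in(\operatorname{ri}\mathcal U)\setminus\mathcal V^\omega$ if and only if the following is true: there exists a unique $\mathcal U_\xi$-directed semi-infinite geodesic out of every $x\in\mathbb Z^2$ and all these geodesics coalesce. (c) Under (J), the existence of $x\in\mathbb Z^2$ such that $\gamma^{x,\xi+}=\gamma^{x,\xi-}$ implies that $\gamma^{y,\xi+}=\gamma^{y,\xi-}$ for all $y\in\mathbb Z^2$, all these geodesics coalesce, and $\xi\in(\operatorname{ri}\mathcal U)\setminus\mathcal V^\omega$. (d) Assume both (R) and (J). Suppose there exists $x\in\mathbb Z^2$ such that $\gamma^{x,\xi+}=\gamma^{x,\xi-}$. Then there is a unique $\mathcal U_\xi$-directed semi-infinite geodesic out of every $x\in\mathbb Z^2$, all these geodesics coalesce, and $\xi\in(\operatorname{ri}\mathcal U)\setminus\mathcal V^\omega$.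
   Context: Directions. $e_1=e_+=(1,0)$, $e_2=e_-=(0,1)$, $\hat e=e_1+e_2$. $\mathcal U=\{te_1+(1-t)e_2:0\le t\le1\}$, $\operatorname{ri}\mathcal U=\mathcal U\setminus\{e_1,e_2\}$. For $\zeta,\eta\in\mathbb R^2$ with $\zeta\cdot\hat e=\eta\cdot\hat e$, $\zeta\prec\eta$ (resp. $\zeta\preceq\eta$) means $\zeta\cdot e_1<\eta\cdot e_1$ (resp. $\le$). Intervals $[\zeta,\eta]$, $]\zeta,\eta[$ etc. in $\mathcal U$ and monotone limits $\zeta\nearrow\xi$, $\zeta\searrow\xi$ refer to this order. Vector inequalities $x\le y$, $x<y$ are coordinatewise. $\sigma$ denotes a sign in $\{-,+\}$. Last-passage percolation. $(\Omega,\mathcal F,\mathbb P)$ is a Polish probability space with a group $\{T_x\}_{x\in\mathbb Z^2}$ of measurable $\mathbb P$-preserving bijections ($T_0=$ identity, $T_xT_y=T_{x+y}$) and real random variables (weights) $\omega_x$, $x\in\mathbb Z^2$, with $\omega_y(T_x\omega)=\omega_{x+y}(\omega)$, that are i.i.d. with continuous distribution, positive variance, and $\mathbb E|\omega_0|^p<\infty$ for some $p>2$. An up-right path has steps in $\{e_1,e_2\}$ and is indexed so that $\pi_k\cdot\hat e=k$. For $x\le y$, $k=x\cdot\hat e$, $m=y\cdot\hat e$, $G_{x,y}=\max\sum_{i=k}^{m-1}\omega_{\pi_i}$ over up-right paths from $x$ to $y$; a maximizer is a (finite) geodesic (a.s. unique). The shape function is the deterministic, concave, symmetric, 1-homogeneous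 $g:\mathbb R_+^2\to\mathbb R$ with a.s. $\lim_n\max_{x\in\mathbb Z_+^2,|x|_1=n}|G_{0,x}-g(x)|/n=0$. For $\xi\in\operatorname{ri}\mathcal U$: $\nabla g(\xi\pm)\cdot e_1=\lim_{\varepsilon\searrow0}\frac{g(\xi\pm\varepsilon e_1)-g(\xi)}{\pm\varepsilon}$, $\nabla g(\xi\pm)\cdot e_2=\lim_{\varepsilon\searrow0}\frac{g(\xi\mp\varepsilon e_2)-g(\xi)}{\mp\varepsilon}$. $\mathcal D=\{\xi\in\operatorname{ri}\mathcal U: g\text{ differentiable at }\xi\}$. $\mathcal U_{\xi\sigma}=\{\zeta\in\operatorname{ri}\mathcal U:g(\zeta)-g(\xi)=\nabla g(\xi\sigma)\cdot(\zeta-\xi)\}$, $\mathcal U_\xi=\mathcal U_{\xi-}\cup\mathcal U_{\xi+}=[\underline\xi,\overline\xi]$. $g$ is strictly concave at $\xi$ if $\mathcal U_\xi=\{\xi\}$. Busemann process. On $\Omega$ there is a fixed family of real random variables $B^{\xi\sigma}(x,y)=B^{\xi\sigma}_{x,y}$ ($x,y\in\mathbb Z^2$, $\xi\in\operatorname{ri}\mathcal U$, $\sigma\in\{-,+\}$), measurable in $(x,y,\omega,\xi)$, constructed in earlier work, with these properties. (B1) On one $T$-invariant event of probability one, for all $x,y,z,\xi,\sigma$: $B^{\xi\sigma}(x+z,y+z,\omega)=B^{\xi\sigma}(x,y,T_z\omega)$; $B^{\xi\sigma}(x,y)+B^{\xi\sigma}(y,z)=B^{\xi\sigma}(x,z)$;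 $\min_{i}B^{\xi\sigma}(x,x+e_i)=\omega_x$; for $\xi\prec\xi'$, $B^{\xi-}(x,x+e_1)\ge B^{\xi+}(x,x+e_1)\ge B^{\xi'-}(x,x+e_1)\ge B^{\xi'+}(x,x+e_1)$ and the reversed inequalities with $e_2$ in place of $e_1$; $B^{\xi-}(x,y)=\lim_{\zeta\nearrow\xi}B^{\zeta\sigma}(x,y)$ and $B^{\xi+}(x,y)=\lim_{\zeta\searrow\xi}B^{\zeta\sigma}(x,y)$; $B^{\xi\sigma}(x,x+e_i)\to\infty$ as $\xi\to e_{3-i}$. (B2) $B^{\xi\sigma}(x,y)$ is integrable and $\mathbb E[B^{\xi\sigma}(x,x+e_i)]=\nabla g(\xi\sigma)\cdot e_i$. (B3) If $\nabla g(\zeta\sigma)=\nabla g(\eta\sigma)$ then $B^{\zeta\sigma}\equiv B^{\eta\sigma}$. (B4) For any $I\subset\mathbb Z^2$, $\{(\omega_x,B^{\xi\sigma}(x,y)):x\in I,y\ge x,\sigma,\xi\}$ is independent of $\{\omega_x: x\not\ge z\ \forall z\in I\}$. (B5) For each fixed $\xi$, a.s.: $B^{\xi\sigma}(x,x+e_1)\ne B^{\xi\sigma}(x,x+e_2)$ for all $x,\sigma$; $n^{-1}\max_{x\in\mathbb Z_+^2,|x|_1=n}|B^{\xi\sigma}(0,x)-x\cdot\nabla g(\xi\sigma)|\to0$; if $\xi\in\mathcal D$ then $B^{\xi+}=B^{\xi-}$; if $\xi,\underline\xi,\overline\xi\in\mathcal D$ then $B^{\xi\pm}(x,y)=\lim_n(G_{x,v_n}-G_{y,v_n})$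 whenever $|v_n|\to\infty$, $v_n/n\to\xi$. Geodesics. A semi-infinite geodesic out of $x$ is a semi-infinite up-right path started at $x$ all of whose finite segments are geodesics. It is directed into $\mathcal A\subset\mathcal U$ ($\mathcal A$-directed) if all limit points of $\pi_n/n$ as $n\to\infty$ lie in $\mathcal A$. Two semi-infinite paths $\pi,\pi'$ coalesce if there is $k$ with $\pi_n=\pi'_n$ for all $n\ge k$. The Busemann geodesic $\gamma^{x,\xi\sigma}$ starts at $x$ and from its current point $z$ steps to $z+e_1$ if $B^{\xi\sigma}(z,z+e_1)<B^{\xi\sigma}(z,z+e_2)$, to $z+e_2$ if $>$ holds, and to $z+e_\sigma$ if equality holds; it is a.s. a semi-infinite geodesic. Busemann measures. For $x,y\in\mathbb Z^2$ and a compact interval $K\subset\operatorname{ri}\mathcal U$, $\mu^K_{x,y}$ is the signed measure on $K$ with $\mu^K_{x,y}(]\zeta,\eta])=B^{\eta+}_{x,y}-B^{\zeta+}_{x,y}$ and $\mu^K_{x,y}([\zeta,\eta[)=B^{\eta-}_{x,y}-B^{\zeta-}_{x,y}$ for $\zeta\prec\eta$, $[\zeta,\eta]\subset K$. $\operatorname{supp}\mu_{x,y}=\bigcup_{\zeta\prec\eta\text{ in }\operatorname{ri}\mathcal U}\operatorname{supp}\mu^{[\zeta,\eta]}_{x,y}$, where the support of a signed measure is the smallest closed set whose complement has zero total variation measure. $\mathcal V^\omega=\bigcup_{x,y\in\mathbb Z^2}\operatorname{supp}\mu_{x,y}\subset\operatorname{ri}\mathcal U$. *)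

theory Defs
  imports "HOL-Probability.Probability" "HOL-Library.Product_Order"
begin

section \<open>Directions\<close>

type_synonym site = "int \<times> int"

datatype sign = Minus | Plus

abbreviation (input) e1 :: "'a::zero_neq_one \<times> 'a" where "e1 \<equiv> (1, 0)"
abbreviation (input) e2 :: "'a::zero_neq_one \<times> 'a" where "e2 \<equiv> (0, 1)"
abbreviation (input) ehat :: "'a::zero_neq_one \<times> 'a" where "ehat \<equiv> (1, 1)"

fun e_sign :: "sign \<Rightarrow> site" where
  "e_sign Plus = e1"
| "e_sign Minus = e2"

fun sign_val :: "sign \<Rightarrow> real" where
  "sign_val Plus = 1"
| "sign_val Minus = - 1"

definition U_dir :: "(real \<times> real) set" where
  "U_dir = {t *\<^sub>R e1 + (1 - t) *\<^sub>R e2 | t. 0 \<le> t \<and> t \<le> 1}"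

definition riU :: "(real \<times> real) set" where
  "riU = U_dir - {e1, e2}"

definition prec :: "real \<times> real \<Rightarrow> real \<times> real \<Rightarrow> bool" (infix "\<prec>" 50) where
  "\<zeta> \<prec> \<eta> \<longleftrightarrow> \<zeta> \<bullet> ehat = \<eta> \<bullet> ehat \<and> \<zeta> \<bullet> e1 < \<eta> \<bullet> e1"

definition preceq :: "real \<times> real \<Rightarrow> real \<times> real \<Rightarrow> bool" (infix "\<preceq>" 50) where
  "\<zeta> \<preceq> \<eta> \<longleftrightarrow> \<zeta> \<bullet> ehat = \<eta> \<bullet> ehat \<and> \<zeta> \<bullet> e1 \<le> \<eta> \<bullet> e1"

definition dir_cc :: "real \<times> real \<Rightarrow> real \<times> real \<Rightarrow> (real \<times> real) set" where
  "dir_cc \<zeta> \<eta> = {\<xi> \<in> U_dir. \<zeta> \<preceq> \<xi> \<and> \<xi> \<preceq> \<eta>}"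

definition dir_oc :: "real \<times> real \<Rightarrow> real \<times> real \<Rightarrow> (real \<times> real) set" where
  "dir_oc \<zeta> \<eta> = {\<xi> \<in> U_dir. \<zeta> \<prec> \<xi> \<and> \<xi> \<preceq> \<eta>}"

definition dir_co :: "real \<times> real \<Rightarrow> real \<times> real \<Rightarrow> (real \<times> real) set" where
  "dir_co \<zeta> \<eta> = {\<xi> \<in> U_dir. \<zeta> \<preceq> \<xi> \<and> \<xi> \<prec> \<eta>}"

definition from_left :: "real \<times> real \<Rightarrow> (real \<times> real) filter" where
  "from_left \<xi> = at \<xi> within {\<zeta> \<in> riU. \<zeta> \<prec> \<xi>}"

definition from_right :: "real \<times> real \<Rightarrow> (real \<times> real) filter" where
  "from_right \<xi> = at \<xi> within {\<zeta> \<in> riU. \<xi> \<prec> \<zeta>}"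

definition rvec :: "site \<Rightarrow> real \<times> real" where
  "rvec x = (real_of_int (fst x), real_of_int (snd x))"


section \<open>Paths and last-passage times\<close>

definition lev :: "site \<Rightarrow> int" where
  "lev x = fst x + snd x"

text \<open>Paths are indexed by level: \<open>\<pi> k\<close> is the site of \<open>\<pi>\<close> on the antidiagonal of level \<open>k\<close>.
  For finite paths only the values on \<open>{lev x..lev y}\<close> are relevant.\<close>

definition up_right_path :: "site \<Rightarrow> site \<Rightarrow> (int \<Rightarrow> site) \<Rightarrow> bool" where
  "up_right_path x y \<pi> \<longleftrightarrow> x \<le> y \<and> \<pi> (lev x) = x \<and> \<pi> (lev y) = y \<and>
     (\<forall>i\<in>{lev x..<lev y}. \<pi> (i + 1) - \<pi> i \<in> {e1, e2})"

definition path_weight :: "(site \<Rightarrow> real) \<Rightarrow> (int \<Rightarrow> site) \<Rightarrow> int \<Rightarrow> int \<Rightarrow> real" where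
  "path_weight w \<pi> k m = (\<Sum>i\<in>{k..<m}. w (\<pi> i))"

definition LPT :: "(site \<Rightarrow> real) \<Rightarrow> site \<Rightarrow> site \<Rightarrow> real" where
  "LPT w x y = Max {path_weight w \<pi> (lev x) (lev y) | \<pi>. up_right_path x y \<pi>}"

definition geodesic :: "(site \<Rightarrow> real) \<Rightarrow> site \<Rightarrow> site \<Rightarrow> (int \<Rightarrow> site) \<Rightarrow> bool" where
  "geodesic w x y \<pi> \<longleftrightarrow> up_right_path x y \<pi> \<and> path_weight w \<pi> (lev x) (lev y) = LPT w x y"

text \<open>A semi-infinite path out of \<open>x\<close> has index set \<open>{lev x..}\<close>; extensionality outside this set
  makes equality of functions the same as equality of paths.\<close>

definition semi_inf_path :: "site \<Rightarrow> (int \<Rightarrow> site) \<Rightarrow> bool" where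
  "semi_inf_path x \<pi> \<longleftrightarrow> \<pi> \<in> extensional {lev x..} \<and> \<pi> (lev x) = x \<and>
     (\<forall>i\<ge>lev x. \<pi> (i + 1) - \<pi> i \<in> {e1, e2})"

definition semi_inf_geodesic :: "(site \<Rightarrow> real) \<Rightarrow> site \<Rightarrow> (int \<Rightarrow> site) \<Rightarrow> bool" where
  "semi_inf_geodesic w x \<pi> \<longleftrightarrow> semi_inf_path x \<pi> \<and>
     (\<forall>k m. lev x \<le> k \<and> k \<le> m \<longrightarrow> geodesic w (\<pi> k) (\<pi> m) \<pi>)"

definition seq_limit_points :: "(nat \<Rightarrow> 'a::topological_space) \<Rightarrow> 'a set" where
  "seq_limit_points X = {l. \<exists>r::nat \<Rightarrow> nat. strict_mono r \<and> (X \<circ> r) \<longlonglongrightarrow> l}"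

definition directed_into :: "(real \<times> real) set \<Rightarrow> (int \<Rightarrow> site) \<Rightarrow> bool" where
  "directed_into A \<pi> \<longleftrightarrow> seq_limit_points (\<lambda>n. rvec (\<pi> (int n)) /\<^sub>R real n) \<subseteq> A"

definition coalesce :: "(int \<Rightarrow> site) \<Rightarrow> (int \<Rightarrow> site) \<Rightarrow> bool" where
  "coalesce \<pi> \<pi>' \<longleftrightarrow> (\<exists>k. \<forall>n\<ge>k. \<pi> n = \<pi>' n)"


section \<open>The shape function\<close>

text \<open>Shape functions are total functions in HOL; only their values on the closed first quadrant
  matter. The two coordinates of \<open>grad g \<xi> \<sigma>\<close> are limits from opposite sides, so that the
  \<open>Plus\<close> gradient looks in the direction of increasing \<open>\<prec>\<close> in both.\<close>

definition grad :: "(real \<times> real \<Rightarrow> real) \<Rightarrow> real \<times> real \<Rightarrow> sign \<Rightarrow> real \<times> real" where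
  "grad g \<xi> \<sigma> =
    (Lim (at_right 0) (\<lambda>\<epsilon>. (g (\<xi> + (sign_val \<sigma> * \<epsilon>) *\<^sub>R e1) - g \<xi>) / (sign_val \<sigma> * \<epsilon>)),
     Lim (at_right 0) (\<lambda>\<epsilon>. (g (\<xi> - (sign_val \<sigma> * \<epsilon>) *\<^sub>R e2) - g \<xi>) / (- (sign_val \<sigma> * \<epsilon>))))"

definition diff_dirs :: "(real \<times> real \<Rightarrow> real) \<Rightarrow> (real \<times> real) set" where
  "diff_dirs g = {\<xi> \<in> riU. g differentiable (at \<xi>)}"

definition U_sign :: "(real \<times> real \<Rightarrow> real) \<Rightarrow> real \<times> real \<Rightarrow> sign \<Rightarrow> (real \<times> real) set" where
  "U_sign g \<xi> \<sigma> = {\<zeta> \<in> riU. g \<zeta> - g \<xi> = grad g \<xi> \<sigma> \<bullet> (\<zeta> - \<xi>)}"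

definition U_of :: "(real \<times> real \<Rightarrow> real) \<Rightarrow> real \<times> real \<Rightarrow> (real \<times> real) set" where
  "U_of g \<xi> = U_sign g \<xi> Minus \<union> U_sign g \<xi> Plus"

definition strictly_concave_at :: "(real \<times> real \<Rightarrow> real) \<Rightarrow> real \<times> real \<Rightarrow> bool" where
  "strictly_concave_at g \<xi> \<longleftrightarrow> U_of g \<xi> = {\<xi>}"

definition regularity_condition :: "(real \<times> real \<Rightarrow> real) \<Rightarrow> bool" where
  "regularity_condition g \<longleftrightarrow> (\<forall>\<xi> \<in> riU. \<xi> \<notin> diff_dirs g \<longrightarrow> strictly_concave_at g \<xi>)"


section \<open>Signed measures\<close>

definition signed_measure :: "'a measure \<Rightarrow> ('a set \<Rightarrow> real) \<Rightarrow> bool" where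
  "signed_measure N \<nu> \<longleftrightarrow> \<nu> {} = 0 \<and>
     (\<forall>A::nat \<Rightarrow> 'a set. range A \<subseteq> sets N \<and> disjoint_family A \<longrightarrow> (\<lambda>i. \<nu> (A i)) sums \<nu> (\<Union>i. A i))"

definition total_variation :: "'a measure \<Rightarrow> ('a set \<Rightarrow> real) \<Rightarrow> 'a set \<Rightarrow> ennreal" where
  "total_variation N \<nu> A =
     (SUP P\<in>{P. finite P \<and> P \<subseteq> sets N \<and> disjoint P \<and> \<Union>P = A}. \<Sum>S\<in>P. ennreal \<bar>\<nu> S\<bar>)"

definition signed_support :: "'a::topological_space set \<Rightarrow> ('a set \<Rightarrow> real) \<Rightarrow> 'a set" where
  "signed_support K \<nu> =
     \<Inter>{F. closed F \<and> F \<subseteq> K \<and> total_variation (restrict_space borel K) \<nu> (K - F) = 0}"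


section \<open>Busemann geodesics and Busemann measures\<close>

text \<open>A Busemann realization \<open>b\<close> gives the value \<open>b \<xi> \<sigma> x y\<close> at a fixed outcome; only directions
  in \<^const>\<open>riU\<close> matter.\<close>

type_synonym busemann = "real \<times> real \<Rightarrow> sign \<Rightarrow> site \<Rightarrow> site \<Rightarrow> real"

definition busemann_step :: "busemann \<Rightarrow> real \<times> real \<Rightarrow> sign \<Rightarrow> site \<Rightarrow> site" where
  "busemann_step b \<xi> \<sigma> z =
     (if b \<xi> \<sigma> z (z + e1) < b \<xi> \<sigma> z (z + e2) then z + e1
      else if b \<xi> \<sigma> z (z + e1) > b \<xi> \<sigma> z (z + e2) then z + e2
      else z + e_sign \<sigma>)"

definition busemann_geodesic :: "busemann \<Rightarrow> site \<Rightarrow> real \<times> real \<Rightarrow> sign \<Rightarrow> int \<Rightarrow> site" where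
  "busemann_geodesic b x \<xi> \<sigma> =
     restrict (\<lambda>k. (busemann_step b \<xi> \<sigma> ^^ nat (k - lev x)) x) {lev x..}"

text \<open>The two families of half-open intervals determine the measure on \<open>K = [\<zeta>,\<eta>]\<close>, \<open>\<zeta> \<prec> \<eta>\<close>,
  including its atoms at the end points; extensionality makes it unique as a set function.\<close>

definition is_busemann_measure ::
  "busemann \<Rightarrow> site \<Rightarrow> site \<Rightarrow> (real \<times> real) set \<Rightarrow> ((real \<times> real) set \<Rightarrow> real) \<Rightarrow> bool" where
  "is_busemann_measure b x y K \<nu> \<longleftrightarrow>
     signed_measure (restrict_space borel K) \<nu> \<and>
     \<nu> \<in> extensional (sets (restrict_space borel K)) \<and>
     (\<forall>\<zeta>\<in>riU. \<forall>\<eta>\<in>riU. \<zeta> \<prec> \<eta> \<and> dir_cc \<zeta> \<eta> \<subseteq> K \<longrightarrow>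
        \<nu> (dir_oc \<zeta> \<eta>) = b \<eta> Plus x y - b \<zeta> Plus x y \<and>
        \<nu> (dir_co \<zeta> \<eta>) = b \<eta> Minus x y - b \<zeta> Minus x y)"

definition busemann_measure ::
  "busemann \<Rightarrow> site \<Rightarrow> site \<Rightarrow> (real \<times> real) set \<Rightarrow> (real \<times> real) set \<Rightarrow> real" where
  "busemann_measure b x y K = (THE \<nu>. is_busemann_measure b x y K \<nu>)"

definition busemann_support :: "busemann \<Rightarrow> site \<Rightarrow> site \<Rightarrow> (real \<times> real) set" where
  "busemann_support b x y =
     \<Union>{signed_support (dir_cc \<zeta> \<eta>) (busemann_measure b x y (dir_cc \<zeta> \<eta>))
       | \<zeta> \<eta>. \<zeta> \<in> riU \<and> \<eta> \<in> riU \<and> \<zeta> \<prec> \<eta>}"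

definition exceptional_dirs :: "busemann \<Rightarrow> (real \<times> real) set" where
  "exceptional_dirs b = (\<Union>x. \<Union>y. busemann_support b x y)"

definition jump_process_condition :: "'a measure \<Rightarrow> ('a \<Rightarrow> busemann) \<Rightarrow> bool" where
  "jump_process_condition M B \<longleftrightarrow>
     (\<exists>E \<in> sets M. measure M E = 1 \<and>
        (\<forall>\<omega>\<in>E. \<forall>x y. \<forall>\<xi> \<in> busemann_support (B \<omega>) x y. \<xi> isolated_in busemann_support (B \<omega>) x y))"


section \<open>The standing assumptions\<close>

definition quadrant_sphere :: "nat \<Rightarrow> site set" where
  "quadrant_sphere n = {x. 0 \<le> x \<and> \<bar>fst x\<bar> + \<bar>snd x\<bar> = int n}"

locale lpp = prob_space M
  for M :: "'a::polish_space measure" +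
  fixes T :: "site \<Rightarrow> 'a \<Rightarrow> 'a"
    and wt :: "'a \<Rightarrow> site \<Rightarrow> real"
    and g :: "real \<times> real \<Rightarrow> real"
  assumes sets_borel: "sets M = sets borel"
    and T_measurable: "\<And>x. T x \<in> measurable M M"
    and T_preserving: "\<And>x. distr M M (T x) = M"
    and T_bij: "\<And>x. bij (T x)"
    and T_zero: "T 0 = id"
    and T_add: "\<And>x y. T x \<circ> T y = T (x + y)"
    and wt_shift: "\<And>x y \<omega>. wt (T x \<omega>) y = wt \<omega> (x + y)"
    and wt_indep: "indep_vars (\<lambda>_. borel) (\<lambda>x \<omega>. wt \<omega> x) UNIV"
    and wt_ident: "\<And>x. distr M borel (\<lambda>\<omega>. wt \<omega> x) = distr M borel (\<lambda>\<omega>. wt \<omega> 0)"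
    and wt_continuous: "continuous_on UNIV (cdf (distr M borel (\<lambda>\<omega>. wt \<omega> 0)))"
    and wt_variance: "variance (\<lambda>\<omega>. wt \<omega> 0) > 0"
    and wt_moment: "\<exists>p>2. integrable M (\<lambda>\<omega>. \<bar>wt \<omega> 0\<bar> powr p)"
    and g_concave: "concave_on {v. 0 \<le> v} g"
    and g_symmetric: "\<And>a b. 0 \<le> a \<Longrightarrow> 0 \<le> b \<Longrightarrow> g (a, b) = g (b, a)"
    and g_homogeneous: "\<And>c v. 0 \<le> c \<Longrightarrow> 0 \<le> v \<Longrightarrow> g (c *\<^sub>R v) = c * g v"
    and g_shape: "AE \<omega> in M.
          (\<lambda>n. Max ((\<lambda>x. \<bar>LPT (wt \<omega>) 0 x - g (rvec x)\<bar>) ` quadrant_sphere n) / real n) \<longlonglongrightarrow> 0"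

text \<open>In \<open>B4\<close>, the two arguments of \<^const>\<open>prob_space.indep_set\<close> are the \<open>\<sigma>\<close>-algebras generated by the
  two families of random variables. In \<open>B5_limit\<close>, \<open>\<zeta>\<close> and \<open>\<eta>\<close> are the end points of
  \<^term>\<open>U_of g \<xi>\<close>.\<close>

locale busemann_process = lpp M T wt g
  for M :: "'a::polish_space measure"
    and T :: "site \<Rightarrow> 'a \<Rightarrow> 'a"
    and wt :: "'a \<Rightarrow> site \<Rightarrow> real"
    and g :: "real \<times> real \<Rightarrow> real" +
  fixes B :: "'a \<Rightarrow> busemann"
  assumes B_measurable: "\<And>\<sigma>. (\<lambda>(x, y, \<omega>, \<xi>). B \<omega> \<xi> \<sigma> x y) \<in> borel_measurable
          (count_space UNIV \<Otimes>\<^sub>M (count_space UNIV \<Otimes>\<^sub>M (M \<Otimes>\<^sub>M restrict_space borel riU)))"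
    and B1: "\<exists>E \<in> sets M. prob E = 1 \<and> (\<forall>z. T z -` E = E) \<and> (\<forall>\<omega>\<in>E.
       (\<forall>\<xi>\<in>riU. \<forall>\<sigma> x y z.
          B \<omega> \<xi> \<sigma> (x + z) (y + z) = B (T z \<omega>) \<xi> \<sigma> x y \<and>
          B \<omega> \<xi> \<sigma> x y + B \<omega> \<xi> \<sigma> y z = B \<omega> \<xi> \<sigma> x z) \<and>
       (\<forall>\<xi>\<in>riU. \<forall>\<sigma> x.
          min (B \<omega> \<xi> \<sigma> x (x + e1)) (B \<omega> \<xi> \<sigma> x (x + e2)) = wt \<omega> x) \<and>
       (\<forall>\<xi>\<in>riU. \<forall>\<xi>'\<in>riU. \<forall>x. \<xi> \<prec> \<xi>' \<longrightarrow>
          B \<omega> \<xi> Minus x (x + e1) \<ge> B \<omega> \<xi> Plus x (x + e1) \<and>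
          B \<omega> \<xi> Plus x (x + e1) \<ge> B \<omega> \<xi>' Minus x (x + e1) \<and>
          B \<omega> \<xi>' Minus x (x + e1) \<ge> B \<omega> \<xi>' Plus x (x + e1) \<and>
          B \<omega> \<xi> Minus x (x + e2) \<le> B \<omega> \<xi> Plus x (x + e2) \<and>
          B \<omega> \<xi> Plus x (x + e2) \<le> B \<omega> \<xi>' Minus x (x + e2) \<and>
          B \<omega> \<xi>' Minus x (x + e2) \<le> B \<omega> \<xi>' Plus x (x + e2)) \<and>
       (\<forall>\<xi>\<in>riU. \<forall>\<sigma> x y.
          ((\<lambda>\<zeta>. B \<omega> \<zeta> \<sigma> x y) \<longlongrightarrow> B \<omega> \<xi> Minus x y) (from_left \<xi>) \<and>
          ((\<lambda>\<zeta>. B \<omega> \<zeta> \<sigma> x y) \<longlongrightarrow> B \<omega> \<xi> Plus x y) (from_right \<xi>)) \<and>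
       (\<forall>\<sigma> x.
          filterlim (\<lambda>\<xi>. B \<omega> \<xi> \<sigma> x (x + e1)) at_top (at e2 within riU) \<and>
          filterlim (\<lambda>\<xi>. B \<omega> \<xi> \<sigma> x (x + e2)) at_top (at e1 within riU)))"
    and B2_integrable: "\<And>\<xi> \<sigma> x y. \<xi> \<in> riU \<Longrightarrow> integrable M (\<lambda>\<omega>. B \<omega> \<xi> \<sigma> x y)"
    and B2_e1: "\<And>\<xi> \<sigma> x. \<xi> \<in> riU \<Longrightarrow> expectation (\<lambda>\<omega>. B \<omega> \<xi> \<sigma> x (x + e1)) = grad g \<xi> \<sigma> \<bullet> e1"
    and B2_e2: "\<And>\<xi> \<sigma> x. \<xi> \<in> riU \<Longrightarrow> expectation (\<lambda>\<omega>. B \<omega> \<xi> \<sigma> x (x + e2)) = grad g \<xi> \<sigma> \<bullet> e2"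
    and B3: "\<And>\<zeta> \<eta> \<sigma> \<omega> x y. \<zeta> \<in> riU \<Longrightarrow> \<eta> \<in> riU \<Longrightarrow> grad g \<zeta> \<sigma> = grad g \<eta> \<sigma> \<Longrightarrow>
          B \<omega> \<zeta> \<sigma> x y = B \<omega> \<eta> \<sigma> x y"
    and B4: "\<And>I J K. J = {(x, y, \<xi>, \<sigma>). x \<in> I \<and> x \<le> y \<and> \<xi> \<in> riU} \<Longrightarrow>
          K = {x. \<forall>z\<in>I. \<not> z \<le> x} \<Longrightarrow>
          indep_set
            (sets (vimage_algebra (space M)
              (\<lambda>\<omega>. \<lambda>(x, y, \<xi>, \<sigma>)\<in>J. (wt \<omega> x, B \<omega> \<xi> \<sigma> x y)) (PiM J (\<lambda>_. borel))))
            (sets (vimage_algebra (space M) (\<lambda>\<omega>. \<lambda>x\<in>K. wt \<omega> x) (PiM K (\<lambda>_. borel))))"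
    and B5_no_tie: "\<And>\<xi>. \<xi> \<in> riU \<Longrightarrow>
          AE \<omega> in M. \<forall>x \<sigma>. B \<omega> \<xi> \<sigma> x (x + e1) \<noteq> B \<omega> \<xi> \<sigma> x (x + e2)"
    and B5_shape: "\<And>\<xi>. \<xi> \<in> riU \<Longrightarrow> AE \<omega> in M. \<forall>\<sigma>.
          (\<lambda>n. Max ((\<lambda>x. \<bar>B \<omega> \<xi> \<sigma> 0 x - rvec x \<bullet> grad g \<xi> \<sigma>\<bar>) ` quadrant_sphere n) / real n) \<longlonglongrightarrow> 0"
    and B5_diff: "\<And>\<xi>. \<xi> \<in> diff_dirs g \<Longrightarrow>
          AE \<omega> in M. \<forall>x y. B \<omega> \<xi> Plus x y = B \<omega> \<xi> Minus x y"
    and B5_limit: "\<And>\<xi> \<zeta> \<eta>. \<xi> \<in> diff_dirs g \<Longrightarrow> \<zeta> \<in> diff_dirs g \<Longrightarrow> \<eta> \<in> diff_dirs g \<Longrightarrow>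
          U_of g \<xi> = dir_cc \<zeta> \<eta> \<Longrightarrow>
          AE \<omega> in M. \<forall>\<sigma> x y. \<forall>v::nat \<Rightarrow> site.
            filterlim (\<lambda>n. norm (rvec (v n))) at_top sequentially \<and>
            (\<lambda>n. rvec (v n) /\<^sub>R real n) \<longlonglongrightarrow> \<xi> \<longrightarrow>
            (\<lambda>n. LPT (wt \<omega>) x (v n) - LPT (wt \<omega>) y (v n)) \<longlonglongrightarrow> B \<omega> \<xi> \<sigma> x y"

end

(* Almost surely, for every rational direction at once, the Busemann functions have no ties, Busemann
   paths are asymptotically directed into the affine piece of the shape function, and all of them
   coalesce. The last point is a Burton-Keane type argument: if two paths of a stationary step field
   stay apart, so do infinitely many, and with positive probability the weights in the gap between
   two of them can be chosen so low that no path enters the gap from far below; by stationarity such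
   gaps have positive density, but distinct gaps need distinct sites on a high antidiagonal, of which
   there are too few.

   At such an outcome the rest is deterministic. If B is locally constant in the direction near t, it
   agrees there with a rational direction, whose paths coalesce and have no ties. Conversely, if the
   plus and minus paths at t agree and coalesce, then monotonicity of the paths in the direction and
   their convergence from both sides make B(x,y) constant near t, because B(x,y) is a difference of
   weight sums along the paths up to their meeting point. Local constancy of B(x,y) at t is the
   complement of the support of the Busemann measure. Under (J) the Busemann functions are constant on
   each side of t, so the plus paths coalesce among themselves and so do the minus paths; one common
   path then forces all to agree. Under (R) every directed geodesic is squeezed between Busemann
   paths of nearby directions, which gives uniqueness. *)

theory Submission
  imports Defs
begin

section \<open>Lattice paths\<close>

text \<open>Each probabilistic input is almost sure only for a fixed direction, while the claim
  concerns uncountably many directions at one outcome. Hence \<open>busemann_realization\<close>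
  asks for the hard facts at rational directions only. Other directions are reached by comparing
  paths: one-sided limits select the sign, \<open>Minus\<close> from the left and
  \<open>Plus\<close> from the right, and transposing the lattice exchanges the two, so each
  one-sided argument is carried out once. The delicate case is a direction at the edge of a linear
  piece of the shape function, where approximating paths need not have the approximating asymptotic
  direction; this is why \<open>affine_between\<close> appears throughout. Blow-up of the increments
  at the axes keeps all asymptotic directions inside the open simplex. The weights below a gap can
  be prescribed because (B4) makes them independent of everything the paths do above it. The range
  of the weights is not known, so the gap is blocked by length: two weight levels of positive
  probability, a fixed amount apart, outweigh any bounded boundary cost over enough levels.\<close>

definition up_right_step :: "(site \<Rightarrow> site) \<Rightarrow> bool" where
  "up_right_step f \<longleftrightarrow> (\<forall>z. f z = z + e1 \<or> f z = z + e2)"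

lemma lev_add: "lev (x + y) = lev x + lev y"
  by (simp add: lev_def)

lemma lev_pair [simp]: "lev (a, b) = a + b"
  by (simp add: lev_def)

lemma site_eqI: "lev x = lev y \<Longrightarrow> fst x = fst y \<Longrightarrow> x = y"
  by (simp add: lev_def prod_eq_iff)

lemma lev_step:
  assumes "up_right_step f"
  shows "lev (f z) = lev z + 1"
proof -
  have "f z = z + e1 \<or> f z = z + e2" using assms unfolding up_right_step_def by blast
  then show ?thesis by (auto simp: lev_def)
qed

lemma lev_iterate: "up_right_step f \<Longrightarrow> lev ((f ^^ n) x) = lev x + int n"
  by (induction n) (simp_all add: lev_step)

lemma fst_step:
  assumes "up_right_step f"
  shows "fst (f z) = fst z \<or> fst (f z) = fst z + 1"
proof -
  have "f z = z + e1 \<or> f z = z + e2" using assms unfolding up_right_step_def by blast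
  then show ?thesis by auto
qed

lemma fst_step_le: "up_right_step f \<Longrightarrow> fst z \<le> fst (f z) \<and> fst (f z) \<le> fst z + 1"
  using fst_step[of f z] by auto

lemma fst_iterate_bounds:
  "up_right_step f \<Longrightarrow> fst x \<le> fst ((f ^^ n) x) \<and> fst ((f ^^ n) x) \<le> fst x + int n"
proof (induction n)
  case (Suc n)
  then show ?case using fst_step_le[of f "(f ^^ n) x"] by auto
qed simp

lemma snd_iterate_bounds:
  assumes "up_right_step f"
  shows "snd x \<le> snd ((f ^^ n) x) \<and> snd ((f ^^ n) x) \<le> snd x + int n"
  using fst_iterate_bounds[OF assms, of x n] lev_iterate[OF assms, of n x] by (auto simp: lev_def)

text \<open>Paths on a common antidiagonal cannot exchange order without meeting, because the first
  coordinate grows by 0 or 1; when they meet, \<open>dom\<close> decides the next step.\<close>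

lemma iterate_mono:
  assumes f: "up_right_step f" and g: "up_right_step g"
    and dom: "\<And>z. f z = z + e1 \<Longrightarrow> g z = z + e1"
    and lev: "lev x = lev y" and le: "fst x \<le> fst y"
  shows "fst ((f ^^ n) x) \<le> fst ((g ^^ n) y)"
proof (induction n)
  case (Suc n)
  let ?u = "(f ^^ n) x" and ?v = "(g ^^ n) y"
  have l: "lev ?u = lev ?v" using lev f g by (simp add: lev_iterate)
  show ?case
  proof (cases "fst ?u = fst ?v")
    case True
    then have uv: "?u = ?v" using l site_eqI by blast
    have "fst (f ?u) \<le> fst (g ?u)"
    proof (cases "f ?u = ?u + e1")
      case True then show ?thesis using dom by simp
    next
      case False
      then have "f ?u = ?u + e2" using f unfolding up_right_step_def by blast
      then show ?thesis using fst_step_le[OF g, of ?u] by simp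
    qed
    then show ?thesis using uv by simp
  next
    case False
    then have "fst ?u + 1 \<le> fst ?v" using Suc by simp
    then show ?thesis using fst_step_le[OF f, of ?u] fst_step_le[OF g, of ?v] by simp
  qed
qed (simp add: le)

text \<open>A discrete intermediate value argument: the difference of the first coordinates changes
  by at most 1 per step, so a change of order would pass through equality.\<close>

lemma never_meet_imp_ordered:
  fixes f g :: "nat \<Rightarrow> site"
  assumes f: "\<And>n. fst (f n) \<le> fst (f (Suc n)) \<and> fst (f (Suc n)) \<le> fst (f n) + 1"
    and g: "\<And>n. fst (g n) \<le> fst (g (Suc n)) \<and> fst (g (Suc n)) \<le> fst (g n) + 1"
    and lev: "\<And>n. lev (f n) = lev (g n)" and ne: "\<And>n. k \<le> n \<Longrightarrow> f n \<noteq> g n"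
    and le: "fst (g k) \<le> fst (f k)" and n: "k \<le> n"
  shows "fst (g n) < fst (f n)"
  using n
proof (induction n rule: dec_induct)
  case base
  have "fst (g k) \<noteq> fst (f k)" using ne[of k] lev[of k] site_eqI[of "f k" "g k"] by auto
  then show ?case using le by linarith
next
  case (step n)
  then have "fst (g (Suc n)) \<le> fst (f (Suc n))" using f[of n] g[of n] by linarith
  moreover have "fst (g (Suc n)) \<noteq> fst (f (Suc n))"
    using ne[of "Suc n"] step lev[of "Suc n"] site_eqI[of "f (Suc n)" "g (Suc n)"] by auto
  ultimately show ?case by linarith
qed

text \<open>Bolzano-Weierstrass is applied to the pair, along a prescribed subsequence, so that two
  paths can be compared at the same times.\<close>

lemma subseq_two_limits:
  fixes a b :: "nat \<Rightarrow> real" and s :: "nat \<Rightarrow> nat"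
  assumes "\<And>n. \<bar>a n\<bar> \<le> C" "\<And>n. \<bar>b n\<bar> \<le> C" and s: "strict_mono s"
  obtains r u v where "strict_mono r" "(\<lambda>n. a (s (r n))) \<longlonglongrightarrow> u" "(\<lambda>n. b (s (r n))) \<longlonglongrightarrow> v"
proof -
  have "compact ({-C..C} \<times> {-C..C})" by (intro compact_Times compact_Icc)
  moreover have "\<forall>n. (a (s n), b (s n)) \<in> {-C..C} \<times> {-C..C}"
    using assms by (auto simp: abs_le_iff minus_le_iff)
  ultimately obtain l r where r: "strict_mono (r::nat\<Rightarrow>nat)" "((\<lambda>n. (a (s n), b (s n))) \<circ> r) \<longlonglongrightarrow> l"
    by (rule seq_compactE[OF compact_imp_seq_compact])
  show thesis
    by (rule that[OF r(1), of "fst l" "snd l"]) (use tendsto_fst[OF r(2)] tendsto_snd[OF r(2)] in \<open>simp_all add: o_def\<close>)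
qed

lemma ratio_bound:
  fixes f :: "nat \<Rightarrow> site"
  assumes "\<And>n. fst (f n) \<le> fst (f (Suc n)) \<and> fst (f (Suc n)) \<le> fst (f n) + 1"
  shows "\<bar>real_of_int (fst (f n)) / real n\<bar> \<le> \<bar>real_of_int (fst (f 0))\<bar> + 1"
\<comment> \<open>At n = 0 the quotient is 0 by convention.\<close>
proof (cases "n = 0")
  case False
  have "fst (f 0) \<le> fst (f n) \<and> fst (f n) \<le> fst (f 0) + int n"
  proof (induction n)
    case (Suc n)
    then show ?case using assms[of n] by simp
  qed simp
  then have "\<bar>fst (f n)\<bar> \<le> \<bar>fst (f 0)\<bar> + int n" by linarith
  then have "\<bar>real_of_int (fst (f n))\<bar> \<le> \<bar>real_of_int (fst (f 0))\<bar> + real n"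
    by (metis (no_types, lifting) of_int_abs of_int_add of_int_le_iff of_int_of_nat_eq)
  also have "\<dots> \<le> (\<bar>real_of_int (fst (f 0))\<bar> + 1) * real n"
    using mult_left_mono[of 1 "real n" "\<bar>real_of_int (fst (f 0))\<bar>"] False by (simp add: algebra_simps)
  finally show ?thesis using False by (simp add: abs_divide divide_le_eq)
qed simp

subsection \<open>Asymptotic directions of paths\<close>

lemma bounded_two_limits:
  fixes a b :: "nat \<Rightarrow> real"
  assumes "\<And>n. \<bar>a n\<bar> \<le> C" "\<And>n. \<bar>b n\<bar> \<le> C"
  obtains r u v where "strict_mono r" "(\<lambda>n. a (r n)) \<longlonglongrightarrow> u" "(\<lambda>n. b (r n)) \<longlonglongrightarrow> v"
  by (rule subseq_two_limits[where s = "\<lambda>n. n", OF assms]) (auto simp: strict_mono_def)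

text \<open>u is the first coordinate of a limit point of \<open>\<rho> n\<close> divided by n. Here
  n counts steps rather than levels; \<open>seq_limit_points_path\<close> shows that the two
  normalizations have the same limit points.\<close>

definition asymp_dir :: "(nat \<Rightarrow> site) \<Rightarrow> real \<Rightarrow> bool" where
  "asymp_dir \<rho> u \<longleftrightarrow>
     (\<exists>k. strict_mono k \<and> (\<lambda>n. real_of_int (fst (\<rho> (k n))) / real (k n)) \<longlonglongrightarrow> u)"

lemma strict_mono_eventually_pos:
  fixes k :: "nat \<Rightarrow> nat"
  assumes "strict_mono k"
  shows "\<forall>\<^sub>F n in sequentially. 0 < k n"
  using seq_suble[OF assms]
  by (intro eventually_sequentiallyI[of 1]) (metis less_le_trans less_numeral_extra(1))

lemma const_div_subseq_tendsto_0:
  fixes k :: "nat \<Rightarrow> nat" and c :: real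
  assumes "strict_mono k"
  shows "(\<lambda>n. c / real (k n)) \<longlonglongrightarrow> 0"
proof -
  have "filterlim (\<lambda>n. real (k n)) at_top sequentially"
    using filterlim_compose[OF filterlim_real_sequentially filterlim_subseq[OF assms]] by (simp add: o_def)
  then show ?thesis by (intro tendsto_divide_0[OF tendsto_const] filterlim_at_top_imp_at_infinity)
qed

lemma ratio_limit_complement:
  fixes f g :: "nat \<Rightarrow> int"
  assumes sum: "\<And>n. f n + g n = l + int n" and k: "strict_mono k"
    and lim: "(\<lambda>n. real_of_int (f (k n)) / real (k n)) \<longlonglongrightarrow> u"
  shows "(\<lambda>n. real_of_int (g (k n)) / real (k n)) \<longlonglongrightarrow> 1 - u"
proof -
  have "(\<lambda>n. real_of_int l / real (k n) + 1 - real_of_int (f (k n)) / real (k n)) \<longlonglongrightarrow> 0 + 1 - u"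
    by (intro tendsto_intros lim const_div_subseq_tendsto_0 k)
  moreover have "\<forall>\<^sub>F n in sequentially.
      real_of_int l / real (k n) + 1 - real_of_int (f (k n)) / real (k n) = real_of_int (g (k n)) / real (k n)"
    using strict_mono_eventually_pos[OF k]
  proof eventually_elim
    case (elim n)
    have "real_of_int (g (k n)) = real_of_int l + real (k n) - real_of_int (f (k n))"
      using arg_cong[OF sum[of "k n"], of real_of_int] by simp
    then show ?case using elim by (simp add: add_divide_distrib diff_divide_distrib)
  qed
  ultimately show ?thesis by (simp add: Lim_transform_eventually)
qed

lemma asymp_dir_swap:
  assumes lev: "\<And>n. lev (\<rho> n) = l + int n"
  shows "asymp_dir (\<lambda>n. prod.swap (\<rho> n)) (1 - u) \<longleftrightarrow> asymp_dir \<rho> u"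
proof
  assume "asymp_dir \<rho> u"
  then obtain k where "strict_mono k" "(\<lambda>n. real_of_int (fst (\<rho> (k n))) / real (k n)) \<longlonglongrightarrow> u"
    unfolding asymp_dir_def by blast
  with ratio_limit_complement[of "\<lambda>n. fst (\<rho> n)" "\<lambda>n. snd (\<rho> n)" l k u] lev
  show "asymp_dir (\<lambda>n. prod.swap (\<rho> n)) (1 - u)" unfolding asymp_dir_def by (auto simp: lev_def)
next
  assume "asymp_dir (\<lambda>n. prod.swap (\<rho> n)) (1 - u)"
  then obtain k where "strict_mono k" "(\<lambda>n. real_of_int (snd (\<rho> (k n))) / real (k n)) \<longlonglongrightarrow> 1 - u"
    unfolding asymp_dir_def by auto
  with ratio_limit_complement[of "\<lambda>n. snd (\<rho> n)" "\<lambda>n. fst (\<rho> n)" l k "1 - u"] lev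
  show "asymp_dir \<rho> u" unfolding asymp_dir_def by (auto simp: lev_def add.commute)
qed

section \<open>Affine pieces of a function on the line\<close>

text \<open>The end points are unordered, since asymptotic directions may lie on either side of the
  direction of a path.\<close>

definition affine_between :: "(real \<Rightarrow> real) \<Rightarrow> real \<Rightarrow> real \<Rightarrow> bool" where
  "affine_between p s t \<longleftrightarrow> (\<exists>a c. \<forall>r\<in>{min s t..max s t}. p r = a + c * r)"

lemma affine_betweenI:
  "s \<le> t \<Longrightarrow> (\<And>r. s \<le> r \<Longrightarrow> r \<le> t \<Longrightarrow> p r = a + c * r) \<Longrightarrow> affine_between p s t"
  unfolding affine_between_def by (intro exI[of _ a] exI[of _ c]) auto

lemma affine_betweenE:
  assumes "affine_between p s t" "s \<le> t"
  obtains a c where "\<forall>r\<in>{s..t}. p r = a + c * r"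
  using assms unfolding affine_between_def by (metis max.absorb2 min.absorb1)

lemma affine_between_refl [simp]: "affine_between p t t"
  by (rule affine_betweenI[of _ _ _ "p t" 0]) auto

lemma affine_between_sym: "affine_between p s t \<longleftrightarrow> affine_between p t s"
  unfolding affine_between_def by (simp add: min.commute max.commute)

lemma affine_between_subset:
  assumes "affine_between p s t" "s' \<in> {min s t..max s t}" "t' \<in> {min s t..max s t}"
  shows "affine_between p s' t'"
proof -
  obtain a c where "\<forall>r\<in>{min s t..max s t}. p r = a + c * r"
    using assms(1) unfolding affine_between_def by blast
  moreover have "{min s' t'..max s' t'} \<subseteq> {min s t..max s t}" using assms by auto
  ultimately show ?thesis unfolding affine_between_def by blast
qed

lemma affine_lines_eq:
  fixes a b c d u v :: real
  assumes "a + c * u = b + d * u" "a + c * v = b + d * v" "u \<noteq> v"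
  shows "a = b \<and> c = d"
proof -
  have "(c - d) * (u - v) = 0" using assms by (simp add: algebra_simps)
  then show ?thesis using assms by simp
qed

text \<open>All large enough pieces contain both s and a fixed midpoint, so they lie on one line;
  continuity adds the end point t.\<close>

lemma affine_between_limit_right:
  assumes st: "s < t" and aff: "\<And>r. s < r \<Longrightarrow> r < t \<Longrightarrow> affine_between p s r" and cont: "isCont p t"
  shows "affine_between p s t"
proof -
  define m where "m = (s + t) / 2"
  have m: "s < m" "m < t" using st unfolding m_def by auto
  obtain a c where c: "\<forall>r\<in>{s..m}. p r = a + c * r"
    by (rule affine_betweenE[OF aff[OF m] less_imp_le[OF m(1)]])
  have all: "p r = a + c * r" if r: "s \<le> r" "r < t" for r
  proof (cases "r \<le> m")
    case False
    then have sr: "s < r" using m by simp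
    obtain b d where d: "\<forall>q\<in>{s..r}. p q = b + d * q"
      by (rule affine_betweenE[OF aff[OF sr r(2)] less_imp_le[OF sr]])
    have "p s = a + c * s" "p s = b + d * s" "p m = a + c * m" "p m = b + d * m"
      using c d m sr False by auto
    then have "a = b \<and> c = d" using m by (intro affine_lines_eq[of a c s b d m]) auto
    then show ?thesis using d sr by simp
  qed (use c r in auto)
  have lim: "((\<lambda>r. a + c * r) \<longlongrightarrow> a + c * t) (at_left t)" by (intro tendsto_intros)
  have "(p \<longlongrightarrow> p t) (at_left t)"
    using cont unfolding isCont_def by (rule tendsto_within_subset) simp
  moreover have "\<forall>\<^sub>F r in at_left t. p r = a + c * r"
    using st all by (intro eventually_at_leftI[of s]) auto
  ultimately have "((\<lambda>r. a + c * r) \<longlongrightarrow> p t) (at_left t)"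
    by (rule Lim_transform_eventually)
  then have "p t = a + c * t"
    by (rule tendsto_unique[OF trivial_limit_at_left_real _ lim])
  then have "p r = a + c * r" if "s \<le> r" "r \<le> t" for r
    using all that by (cases "r = t") auto
  then show ?thesis using st by (intro affine_betweenI[of _ _ _ a c]) auto
qed

lemma affine_between_reflect:
  "affine_between (\<lambda>t. p (1 - t)) s t \<longleftrightarrow> affine_between p (1 - s) (1 - t)"
proof -
  have *: "affine_between (\<lambda>t. p (1 - t)) s t" if aff: "affine_between p (1 - s) (1 - t)" for p s t
  proof -
    obtain a c where c: "\<forall>r\<in>{min (1-s) (1-t)..max (1-s) (1-t)}. p r = a + c * r"
      using aff unfolding affine_between_def by blast
    have "p (1 - r) = (a + c) + (-c) * r" if "r \<in> {min s t..max s t}" for r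
    proof -
      have "1 - r \<in> {min (1-s) (1-t)..max (1-s) (1-t)}" using that by simp linarith
      then show ?thesis using c by (simp add: algebra_simps)
    qed
    then show ?thesis unfolding affine_between_def by blast
  qed
  show ?thesis using *[of p s t] *[of "\<lambda>t. p (1 - t)" "1 - s" "1 - t"] by auto
qed

lemma affine_between_limit_left:
  assumes st: "t < s" and aff: "\<And>r. t < r \<Longrightarrow> r < s \<Longrightarrow> affine_between p s r" and cont: "isCont p t"
  shows "affine_between p s t"
proof -
  have "affine_between (\<lambda>r. p (1 - r)) (1 - s) (1 - t)"
  proof (rule affine_between_limit_right)
    show "isCont (\<lambda>r. p (1 - r)) (1 - t)"
      by (rule continuous_at_compose[of _ "\<lambda>r. 1 - r" p, unfolded o_def]) (use cont in auto)
  qed (use st aff in \<open>auto simp: affine_between_reflect\<close>)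
  then show ?thesis by (simp add: affine_between_reflect)
qed

section \<open>Busemann realizations\<close>

text \<open>Directions in \<^const>\<open>riU\<close> are parametrized by their first coordinate.\<close>

type_synonym realization = "real \<Rightarrow> sign \<Rightarrow> site \<Rightarrow> site \<Rightarrow> real"

text \<open>By the cocycle property this is \<open>\<beta> t \<sigma> (z + e2) (z + e1)\<close>, an
  increment along the antidiagonal. It is nonincreasing in the direction, so a larger t favours e1
  steps.\<close>

definition tilt :: "realization \<Rightarrow> real \<Rightarrow> sign \<Rightarrow> site \<Rightarrow> real" where
  "tilt \<beta> t \<sigma> z = \<beta> t \<sigma> z (z + e1) - \<beta> t \<sigma> z (z + e2)"

definition bstep :: "realization \<Rightarrow> real \<Rightarrow> sign \<Rightarrow> site \<Rightarrow> site" where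
  "bstep \<beta> t \<sigma> z =
     (if tilt \<beta> t \<sigma> z < 0 \<or> tilt \<beta> t \<sigma> z = 0 \<and> \<sigma> = Plus then z + e1 else z + e2)"

definition bpath :: "realization \<Rightarrow> real \<Rightarrow> sign \<Rightarrow> site \<Rightarrow> nat \<Rightarrow> site" where
  "bpath \<beta> t \<sigma> x n = (bstep \<beta> t \<sigma> ^^ n) x"

definition untied :: "realization \<Rightarrow> real \<Rightarrow> sign \<Rightarrow> bool" where
  "untied \<beta> t \<sigma> \<longleftrightarrow> (\<forall>z. tilt \<beta> t \<sigma> z \<noteq> 0)"

text \<open>The constant value is the left limit \<open>\<beta> t Minus\<close>; the value
  \<open>\<beta> t Plus\<close> may differ, so a jump at t is allowed. The bound on c keeps the
  neighbourhood inside the open interval of directions.\<close>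

definition left_const :: "realization \<Rightarrow> real \<Rightarrow> site \<Rightarrow> site \<Rightarrow> bool" where
  "left_const \<beta> t x y \<longleftrightarrow>
     (\<exists>c\<ge>0. c < t \<and> (\<forall>s \<sigma>. c < s \<longrightarrow> s < t \<longrightarrow> \<beta> s \<sigma> x y = \<beta> t Minus x y))"

definition right_const :: "realization \<Rightarrow> real \<Rightarrow> site \<Rightarrow> site \<Rightarrow> bool" where
  "right_const \<beta> t x y \<longleftrightarrow>
     (\<exists>c\<le>1. t < c \<and> (\<forall>s \<sigma>. t < s \<longrightarrow> s < c \<longrightarrow> \<beta> s \<sigma> x y = \<beta> t Plus x y))"

lemma up_right_bstep: "up_right_step (bstep \<beta> t \<sigma>)"
  by (simp add: up_right_step_def bstep_def)

lemma bpath_0 [simp]: "bpath \<beta> t \<sigma> x 0 = x"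
  by (simp add: bpath_def)

lemma bpath_Suc: "bpath \<beta> t \<sigma> x (Suc n) = bstep \<beta> t \<sigma> (bpath \<beta> t \<sigma> x n)"
  by (simp add: bpath_def)

lemma bpath_add: "bpath \<beta> t \<sigma> x (m + n) = bpath \<beta> t \<sigma> (bpath \<beta> t \<sigma> x m) n"
  by (simp add: bpath_def funpow_add add.commute[of m])

lemma lev_bpath: "lev (bpath \<beta> t \<sigma> x n) = lev x + int n"
  unfolding bpath_def by (rule lev_iterate[OF up_right_bstep])

lemma fst_bpath_Suc:
  "fst (bpath \<beta> t \<sigma> x n) \<le> fst (bpath \<beta> t \<sigma> x (Suc n)) \<and>
   fst (bpath \<beta> t \<sigma> x (Suc n)) \<le> fst (bpath \<beta> t \<sigma> x n) + 1"
  unfolding bpath_Suc by (rule fst_step_le[OF up_right_bstep])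

lemma bpath_ratio_bound: "\<bar>real_of_int (fst (bpath \<beta> t \<sigma> x n)) / real n\<bar> \<le> \<bar>real_of_int (fst x)\<bar> + 1"
  using ratio_bound[of "bpath \<beta> t \<sigma> x" n] fst_bpath_Suc by simp

lemma bpath_eq_iff_bstep_eq:
  "(\<forall>x n. bpath \<beta> t \<sigma> x n = bpath \<beta>' s \<tau> x n) \<longleftrightarrow> bstep \<beta> t \<sigma> = bstep \<beta>' s \<tau>"
proof
  assume *: "\<forall>x n. bpath \<beta> t \<sigma> x n = bpath \<beta>' s \<tau> x n"
  show "bstep \<beta> t \<sigma> = bstep \<beta>' s \<tau>"
    by (rule ext) (use *[rule_format, of _ 1] in \<open>simp add: bpath_def\<close>)
qed (simp add: bpath_def)

lemma bpath_step:
  "bpath \<beta> t \<sigma> x (Suc i) = bpath \<beta> t \<sigma> x i + e1 \<or> bpath \<beta> t \<sigma> x (Suc i) = bpath \<beta> t \<sigma> x i + e2"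
  unfolding bpath_Suc using up_right_bstep unfolding up_right_step_def by blast

lemma bpath_cong_upto:
  assumes "\<And>i. i < n \<Longrightarrow> bstep \<beta> t \<sigma> (bpath \<beta>' s \<tau> x i) = bstep \<beta>' s \<tau> (bpath \<beta>' s \<tau> x i)" "m \<le> n"
  shows "bpath \<beta> t \<sigma> x m = bpath \<beta>' s \<tau> x m"
  using assms(2)
proof (induction m)
  case (Suc m)
  then show ?case using assms(1)[of m] by (simp add: bpath_Suc)
qed simp

subsection \<open>Reflection across the diagonal\<close>

fun flip :: "sign \<Rightarrow> sign" where "flip Plus = Minus" | "flip Minus = Plus"

lemma flip_flip [simp]: "flip (flip \<sigma>) = \<sigma>" by (cases \<sigma>) auto

lemma flip_eq [simp]: "flip \<sigma> = Plus \<longleftrightarrow> \<sigma> = Minus" "flip \<sigma> = Minus \<longleftrightarrow> \<sigma> = Plus"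
  by (cases \<sigma>; simp)+

text \<open>Transposing the lattice exchanges e1 and e2, hence t and 1 - t as well as the two ways
  of breaking ties. Every statement about the left of t thus yields one about the right.\<close>

definition reflect :: "realization \<Rightarrow> realization" where
  "reflect \<beta> t \<sigma> x y = \<beta> (1 - t) (flip \<sigma>) (prod.swap x) (prod.swap y)"

lemma swap_add: "prod.swap (x + y) = prod.swap x + (prod.swap y :: site)"
  by (cases x; cases y) auto

lemma tilt_reflect: "tilt (reflect \<beta>) t \<sigma> z = - tilt \<beta> (1 - t) (flip \<sigma>) (prod.swap z)"
  by (simp add: tilt_def reflect_def swap_add)

lemma bstep_reflect: "bstep (reflect \<beta>) t \<sigma> z = prod.swap (bstep \<beta> (1 - t) (flip \<sigma>) (prod.swap z))"
  by (cases \<sigma>) (auto simp: bstep_def tilt_reflect swap_add)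

lemma bpath_reflect:
  "bpath (reflect \<beta>) t \<sigma> x n = prod.swap (bpath \<beta> (1 - t) (flip \<sigma>) (prod.swap x) n)"
  by (induction n) (simp_all add: bpath_Suc bstep_reflect)

lemma asymp_dir_bpath_reflect:
  "asymp_dir (bpath (reflect \<beta>) t \<sigma> x) u \<longleftrightarrow> asymp_dir (bpath \<beta> (1 - t) (flip \<sigma>) (prod.swap x)) (1 - u)"
  using asymp_dir_swap[of "bpath \<beta> (1 - t) (flip \<sigma>) (prod.swap x)" _ "1 - u", OF lev_bpath]
  by (simp add: bpath_reflect[abs_def])

lemma untied_reflect: "untied (reflect \<beta>) t \<sigma> \<longleftrightarrow> untied \<beta> (1 - t) (flip \<sigma>)"
  unfolding untied_def tilt_reflect by (metis neg_equal_0_iff_equal swap_swap)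

lemma left_const_reflect:
  "left_const (reflect \<beta>) t x y \<longleftrightarrow> right_const \<beta> (1 - t) (prod.swap x) (prod.swap y)"
proof
  assume "left_const (reflect \<beta>) t x y"
  then obtain c where c: "c \<ge> 0" "c < t"
      "\<forall>s \<sigma>. c < s \<longrightarrow> s < t \<longrightarrow> reflect \<beta> s \<sigma> x y = reflect \<beta> t Minus x y"
    unfolding left_const_def by blast
  show "right_const \<beta> (1 - t) (prod.swap x) (prod.swap y)"
    unfolding right_const_def
  proof (intro exI[of _ "1 - c"] conjI allI impI)
    fix s \<sigma> assume s: "1 - t < s" "s < 1 - c"
    show "\<beta> s \<sigma> (prod.swap x) (prod.swap y) = \<beta> (1 - t) Plus (prod.swap x) (prod.swap y)"
      using c(3)[rule_format, of "1 - s" "flip \<sigma>"] s by (simp add: reflect_def)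
  qed (use c in auto)
next
  assume "right_const \<beta> (1 - t) (prod.swap x) (prod.swap y)"
  then obtain c where c: "c \<le> 1" "1 - t < c"
      "\<forall>s \<sigma>. 1 - t < s \<longrightarrow> s < c \<longrightarrow>
         \<beta> s \<sigma> (prod.swap x) (prod.swap y) = \<beta> (1 - t) Plus (prod.swap x) (prod.swap y)"
    unfolding right_const_def by blast
  show "left_const (reflect \<beta>) t x y"
    unfolding left_const_def
  proof (intro exI[of _ "1 - c"] conjI allI impI)
    fix s \<sigma> assume s: "1 - c < s" "s < t"
    show "reflect \<beta> s \<sigma> x y = reflect \<beta> t Minus x y"
      using c(3)[rule_format, of "1 - s" "flip \<sigma>"] s by (simp add: reflect_def)
  qed (use c in auto)
qed

lemma filterlim_reflect_left:
  fixes f :: "real \<Rightarrow> 'b"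
  assumes "filterlim f F (at_right (1 - t))"
  shows "filterlim (\<lambda>s. f (1 - s)) F (at_left t)"
proof -
  have "filterlim (\<lambda>s. 1 - s) (at_right (1 - t)) (at_left t)"
    unfolding filterlim_at
    by (auto intro!: tendsto_eq_intros eventually_at_leftI[of "t - 1"])
  then show ?thesis by (rule filterlim_compose[OF assms])
qed

lemma filterlim_reflect_right:
  fixes f :: "real \<Rightarrow> 'b"
  assumes "filterlim f F (at_left (1 - t))"
  shows "filterlim (\<lambda>s. f (1 - s)) F (at_right t)"
proof -
  have "filterlim (\<lambda>s. 1 - s) (at_left (1 - t)) (at_right t)"
    unfolding filterlim_at
    by (auto intro!: tendsto_eq_intros eventually_at_rightI[of _ "t + 1"])
  then show ?thesis by (rule filterlim_compose[OF assms])
qed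

subsection \<open>The deterministic setting\<close>

text \<open>These two properties already make the Busemann paths optimal. They are kept apart
  because coalescence at rational directions has to be proved from them, before a full realization
  is available.\<close>

locale busemann_cocycle =
  fixes w :: "site \<Rightarrow> real" and \<beta> :: realization
  assumes cocycle: "\<And>t \<sigma> x y z. 0 < t \<Longrightarrow> t < 1 \<Longrightarrow> \<beta> t \<sigma> x y + \<beta> t \<sigma> y z = \<beta> t \<sigma> x z"
    and recovery: "\<And>t \<sigma> x. 0 < t \<Longrightarrow> t < 1 \<Longrightarrow> min (\<beta> t \<sigma> x (x + e1)) (\<beta> t \<sigma> x (x + e2)) = w x"

text \<open>The last three assumptions hold almost surely simultaneously for countably many directions;
  the arguments below extend them to all directions by monotonicity.\<close>

locale busemann_realization = busemann_cocycle w \<beta>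
  for w :: "site \<Rightarrow> real" and \<beta> :: realization +
  fixes p :: "real \<Rightarrow> real"
  assumes mono_e1: "\<And>s t \<sigma> \<tau> x. 0 < s \<Longrightarrow> s < t \<Longrightarrow> t < 1 \<Longrightarrow> \<beta> t \<tau> x (x + e1) \<le> \<beta> s \<sigma> x (x + e1)"
    and mono_e2: "\<And>s t \<sigma> \<tau> x. 0 < s \<Longrightarrow> s < t \<Longrightarrow> t < 1 \<Longrightarrow> \<beta> s \<sigma> x (x + e2) \<le> \<beta> t \<tau> x (x + e2)"
    and lim_left: "\<And>t \<sigma> x y. 0 < t \<Longrightarrow> t < 1 \<Longrightarrow> ((\<lambda>s. \<beta> s \<sigma> x y) \<longlongrightarrow> \<beta> t Minus x y) (at_left t)"
    and lim_right: "\<And>t \<sigma> x y. 0 < t \<Longrightarrow> t < 1 \<Longrightarrow> ((\<lambda>s. \<beta> s \<sigma> x y) \<longlongrightarrow> \<beta> t Plus x y) (at_right t)"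
    and blowup_e1: "\<And>\<sigma> x. filterlim (\<lambda>t. \<beta> t \<sigma> x (x + e1)) at_top (at_right 0)"
    and blowup_e2: "\<And>\<sigma> x. filterlim (\<lambda>t. \<beta> t \<sigma> x (x + e2)) at_top (at_left 1)"
    and cont: "continuous_on {0<..<1} p"
    and flat: "\<And>s t r r' \<sigma> x y. affine_between p s t \<Longrightarrow> 0 < s \<Longrightarrow> t < 1 \<Longrightarrow> s < r \<Longrightarrow> r < t \<Longrightarrow>
        s < r' \<Longrightarrow> r' < t \<Longrightarrow> \<beta> r \<sigma> x y = \<beta> r' \<sigma> x y"
    and rat_untied: "\<And>q \<sigma>. q \<in> \<rat> \<Longrightarrow> 0 < q \<Longrightarrow> q < 1 \<Longrightarrow> untied \<beta> q \<sigma>"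
    and rat_directed: "\<And>q \<sigma> x u r. q \<in> \<rat> \<Longrightarrow> 0 < q \<Longrightarrow> q < 1 \<Longrightarrow> asymp_dir (bpath \<beta> q \<sigma> x) u \<Longrightarrow>
        min q u < r \<Longrightarrow> r < max q u \<Longrightarrow> affine_between p q r"
    and rat_coalesce: "\<And>q \<sigma> x y. q \<in> \<rat> \<Longrightarrow> 0 < q \<Longrightarrow> q < 1 \<Longrightarrow>
        \<exists>m n. bpath \<beta> q \<sigma> x m = bpath \<beta> q \<sigma> y n"
begin

text \<open>Transposition exchanges the e1 and e2 assumptions and the left and right limits, so the
  list of assumptions is closed under it.\<close>

lemma reflected: "busemann_realization (w \<circ> prod.swap) (reflect \<beta>) (\<lambda>t. p (1 - t))"
proof unfold_locales
  fix t :: real and \<sigma> x y z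
  assume t: "0 < t" "t < 1"
  show "reflect \<beta> t \<sigma> x y + reflect \<beta> t \<sigma> y z = reflect \<beta> t \<sigma> x z"
    unfolding reflect_def by (rule cocycle) (use t in auto)
  show "min (reflect \<beta> t \<sigma> x (x + e1)) (reflect \<beta> t \<sigma> x (x + e2)) = (w \<circ> prod.swap) x"
    using recovery[of "1 - t" "flip \<sigma>" "prod.swap x"] t by (simp add: reflect_def swap_add min.commute)
  show "((\<lambda>s. reflect \<beta> s \<sigma> x y) \<longlongrightarrow> reflect \<beta> t Minus x y) (at_left t)"
    unfolding reflect_def flip.simps by (rule filterlim_reflect_left, rule lim_right) (use t in auto)
  show "((\<lambda>s. reflect \<beta> s \<sigma> x y) \<longlongrightarrow> reflect \<beta> t Plus x y) (at_right t)"
    unfolding reflect_def flip.simps by (rule filterlim_reflect_right, rule lim_left) (use t in auto)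
next
  fix s t :: real and \<sigma> \<tau> x
  assume t: "0 < s" "s < t" "t < 1"
  show "reflect \<beta> t \<tau> x (x + e1) \<le> reflect \<beta> s \<sigma> x (x + e1)"
    using mono_e2[of "1 - t" "1 - s" "flip \<tau>" "prod.swap x" "flip \<sigma>"] t by (simp add: reflect_def swap_add)
  show "reflect \<beta> s \<sigma> x (x + e2) \<le> reflect \<beta> t \<tau> x (x + e2)"
    using mono_e1[of "1 - t" "1 - s" "flip \<sigma>" "prod.swap x" "flip \<tau>"] t by (simp add: reflect_def swap_add)
next
  fix \<sigma> x
  show "filterlim (\<lambda>t. reflect \<beta> t \<sigma> x (x + e1)) at_top (at_right 0)"
    unfolding reflect_def swap_add
    by (rule filterlim_reflect_right) (use blowup_e2[of "flip \<sigma>" "prod.swap x"] in simp)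
  show "filterlim (\<lambda>t. reflect \<beta> t \<sigma> x (x + e2)) at_top (at_left 1)"
    unfolding reflect_def swap_add
    by (rule filterlim_reflect_left) (use blowup_e1[of "flip \<sigma>" "prod.swap x"] in simp)
next
  show "continuous_on {0<..<1} (\<lambda>t. p (1 - t))"
    by (intro continuous_on_compose2[OF cont] continuous_intros) auto
next
  fix s t r r' :: real and \<sigma> x y
  assume "affine_between (\<lambda>t. p (1 - t)) s t" "0 < s" "t < 1" "s < r" "r < t" "s < r'" "r' < t"
  then show "reflect \<beta> r \<sigma> x y = reflect \<beta> r' \<sigma> x y"
    unfolding affine_between_reflect affine_between_sym[of p "1 - s"] reflect_def
    by (intro flat[of "1 - t" "1 - s"]) auto
next
  fix q :: real and \<sigma> x y
  assume q: "q \<in> \<rat>" "0 < q" "q < 1"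
  then have q': "1 - q \<in> \<rat>" "0 < 1 - q" "1 - q < 1" by auto
  show "untied (reflect \<beta>) q \<sigma>" unfolding untied_reflect using q' by (rule rat_untied)
  show "\<exists>m n. bpath (reflect \<beta>) q \<sigma> x m = bpath (reflect \<beta>) q \<sigma> y n"
    unfolding bpath_reflect using rat_coalesce[OF q', of "flip \<sigma>" "prod.swap x" "prod.swap y"] by metis
  fix u r :: real
  assume u: "asymp_dir (bpath (reflect \<beta>) q \<sigma> x) u" and r: "min q u < r" "r < max q u"
  have "asymp_dir (bpath \<beta> (1 - q) (flip \<sigma>) (prod.swap x)) (1 - u)"
    using u asymp_dir_bpath_reflect by simp
  then have "affine_between p (1 - q) (1 - r)"
    by (rule rat_directed[OF q']) (use r in \<open>auto simp: min_def max_def split: if_splits\<close>)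
  then show "affine_between (\<lambda>t. p (1 - t)) q r" by (simp add: affine_between_reflect)
qed

end

subsection \<open>Paths and additive weights\<close>

context busemann_cocycle
begin

lemma beta_refl [simp]: "0 < t \<Longrightarrow> t < 1 \<Longrightarrow> \<beta> t \<sigma> x x = 0"
  using cocycle[of t \<sigma> x x x] by simp

lemma beta_anti: "0 < t \<Longrightarrow> t < 1 \<Longrightarrow> \<beta> t \<sigma> y x = - \<beta> t \<sigma> x y"
  using cocycle[of t \<sigma> x y x] by simp

lemma tilt_eq: "0 < t \<Longrightarrow> t < 1 \<Longrightarrow> tilt \<beta> t \<sigma> z = \<beta> t \<sigma> (z + e2) (z + e1)"
  using cocycle[of t \<sigma> "z + e2" z "z + e1"] beta_anti[of t \<sigma> "z + e2" z] by (simp add: tilt_def)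

lemma weight_le_step:
  assumes "0 < t" "t < 1" "y = x + e1 \<or> y = x + e2"
  shows "w x \<le> \<beta> t \<sigma> x y"
  using recovery[OF assms(1,2), of \<sigma> x] assms(3) by auto

lemma step_tight:
  assumes "0 < t" "t < 1" "untied \<beta> t \<sigma>" "y = x + e1 \<or> y = x + e2" "\<beta> t \<sigma> x y = w x"
  shows "y = bstep \<beta> t \<sigma> x"
proof -
  have "tilt \<beta> t \<sigma> x \<noteq> 0" using assms(3) unfolding untied_def by blast
  then show ?thesis
    using recovery[OF assms(1,2), of \<sigma> x] assms(4,5) unfolding bstep_def tilt_def
    by (auto simp: min_def split: if_splits)
qed

lemma bstep_weight: "0 < t \<Longrightarrow> t < 1 \<Longrightarrow> \<beta> t \<sigma> x (bstep \<beta> t \<sigma> x) = w x"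
  using recovery[of t \<sigma> x] by (auto simp: bstep_def tilt_def min_def split: if_splits)

text \<open>The weight is the smaller of the two forward increments, so each step contributes at
  least its weight; the cocycle property adds up the steps.\<close>

lemma sum_weights_le:
  assumes t: "0 < t" "t < 1"
    and path: "\<And>i. i < n \<Longrightarrow> \<rho> (Suc i) = \<rho> i + e1 \<or> \<rho> (Suc i) = \<rho> i + e2"
  shows "(\<Sum>i<n. w (\<rho> i)) \<le> \<beta> t \<sigma> (\<rho> 0) (\<rho> n)"
  using path
proof (induction n)
  case (Suc n)
  have "(\<Sum>i<n. w (\<rho> i)) \<le> \<beta> t \<sigma> (\<rho> 0) (\<rho> n)" by (rule Suc.IH, rule Suc.prems) simp
  moreover have "w (\<rho> n) \<le> \<beta> t \<sigma> (\<rho> n) (\<rho> (Suc n))"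
    by (rule weight_le_step[OF t Suc.prems[OF lessI]])
  ultimately show ?case using cocycle[OF t, of \<sigma> "\<rho> 0" "\<rho> n" "\<rho> (Suc n)"] by simp
qed (simp add: t)

text \<open>Equality in \<open>sum_weights_le\<close> forces equality at every step, and without
  ties only the Busemann step is tight.\<close>

lemma sum_weights_tight:
  assumes t: "0 < t" "t < 1" "untied \<beta> t \<sigma>"
    and path: "\<And>i. i < n \<Longrightarrow> \<rho> (Suc i) = \<rho> i + e1 \<or> \<rho> (Suc i) = \<rho> i + e2"
    and opt: "\<beta> t \<sigma> (\<rho> 0) (\<rho> n) \<le> (\<Sum>i<n. w (\<rho> i))" and m: "m \<le> n"
  shows "\<rho> m = bpath \<beta> t \<sigma> (\<rho> 0) m"
  using path opt m
proof (induction n arbitrary: m)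
  case (Suc n)
  have path': "\<rho> (Suc i) = \<rho> i + e1 \<or> \<rho> (Suc i) = \<rho> i + e2" if "i < n" for i
    by (rule Suc.prems(1)) (use that in simp)
  have a: "(\<Sum>i<n. w (\<rho> i)) \<le> \<beta> t \<sigma> (\<rho> 0) (\<rho> n)" 
    by (rule sum_weights_le[where \<rho> = \<rho>, OF t(1,2)]) (rule path')
  have b: "w (\<rho> n) \<le> \<beta> t \<sigma> (\<rho> n) (\<rho> (Suc n))"
    by (rule weight_le_step[OF t(1,2) Suc.prems(1)[OF lessI]])
  have c: "\<beta> t \<sigma> (\<rho> 0) (\<rho> n) + \<beta> t \<sigma> (\<rho> n) (\<rho> (Suc n)) = \<beta> t \<sigma> (\<rho> 0) (\<rho> (Suc n))"
    by (rule cocycle[OF t(1,2)])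
  have d: "\<beta> t \<sigma> (\<rho> 0) (\<rho> (Suc n)) \<le> (\<Sum>i<n. w (\<rho> i)) + w (\<rho> n)" using Suc.prems(2) by simp
  have opt': "\<beta> t \<sigma> (\<rho> 0) (\<rho> n) \<le> (\<Sum>i<n. w (\<rho> i))" using b c d by linarith
  have IH: "\<rho> m = bpath \<beta> t \<sigma> (\<rho> 0) m" if "m \<le> n" for m by (rule Suc.IH[OF path' opt' that])
  show ?case
  proof (cases "m = Suc n")
    case True
    have "\<beta> t \<sigma> (\<rho> n) (\<rho> (Suc n)) = w (\<rho> n)" using a b c d by linarith
    then have "\<rho> (Suc n) = bstep \<beta> t \<sigma> (\<rho> n)" by (rule step_tight[OF t Suc.prems(1)[OF lessI]])
    also have "\<dots> = bpath \<beta> t \<sigma> (\<rho> 0) (Suc n)" unfolding bpath_Suc by (rule arg_cong[OF IH[OF order_refl]])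
    finally show ?thesis using True by (simp only:)
  next
    case False
    then show ?thesis using Suc.prems(3) by (intro IH) simp
  qed
qed simp

text \<open>A Busemann path always takes the smaller increment, so it attains the bound of
  \<open>sum_weights_le\<close>; this is why it is a geodesic.\<close>

lemma bpath_weights:
  assumes "0 < t" "t < 1"
  shows "\<beta> t \<sigma> x (bpath \<beta> t \<sigma> x n) = (\<Sum>i<n. w (bpath \<beta> t \<sigma> x i))"
proof (induction n)
  case (Suc n)
  then show ?case
    using cocycle[of t \<sigma> x "bpath \<beta> t \<sigma> x n" "bpath \<beta> t \<sigma> x (Suc n)"] assms
      bstep_weight[of t \<sigma> "bpath \<beta> t \<sigma> x n"] by (simp add: bpath_Suc)
qed (use assms in simp)

text \<open>If two directions assign the same value to \<open>(x, y)\<close> and a path of one meets a path of the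
  other, then both path weights are optimal for both directions.\<close>

lemma crossing:
  assumes s: "0 < s" "s < 1" "untied \<beta> s \<sigma>" and t: "0 < t" "t < 1" "untied \<beta> t \<tau>"
    and eq: "\<beta> s \<sigma> x y = \<beta> t \<tau> x y" and meet: "bpath \<beta> s \<sigma> x m = bpath \<beta> t \<tau> y n"
  shows "bpath \<beta> t \<tau> x m = bpath \<beta> s \<sigma> x m"
proof -
  define z where "z = bpath \<beta> s \<sigma> x m"
  let ?X = "\<Sum>i<m. w (bpath \<beta> s \<sigma> x i)" and ?Y = "\<Sum>i<n. w (bpath \<beta> t \<tau> y i)"
  have 1: "\<beta> s \<sigma> x z = ?X" unfolding z_def by (rule bpath_weights) (use s in auto)
  have 2: "\<beta> t \<tau> y z = ?Y" unfolding z_def meet by (rule bpath_weights) (use t in auto)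
  have 3: "?Y \<le> \<beta> s \<sigma> y z"
    using sum_weights_le[OF s(1,2), of n "bpath \<beta> t \<tau> y" \<sigma>] bpath_step unfolding z_def meet by simp
  have "\<beta> s \<sigma> x y + \<beta> s \<sigma> y z = \<beta> s \<sigma> x z" "\<beta> t \<tau> x y + \<beta> t \<tau> y z = \<beta> t \<tau> x z"
    using cocycle s t by auto
  then have "\<beta> t \<tau> x z \<le> ?X" using 1 2 3 eq by linarith
  then have "\<beta> t \<tau> (bpath \<beta> s \<sigma> x 0) (bpath \<beta> s \<sigma> x m) \<le> ?X" by (simp add: z_def)
  then have "bpath \<beta> s \<sigma> x m = bpath \<beta> t \<tau> (bpath \<beta> s \<sigma> x 0) m"
    by (rule sum_weights_tight[where \<rho> = "bpath \<beta> s \<sigma> x", OF t bpath_step _ order_refl])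
  then show ?thesis by simp
qed

text \<open>Both paths are optimal from x to the common site, and for the untied direction
  \<open>sum_weights_tight\<close> leaves only one optimal path.\<close>

lemma bpath_eq_if_meet:
  assumes s: "0 < s" "s < 1" and t: "0 < t" "t < 1" "untied \<beta> t \<tau>"
    and meet: "bpath \<beta> s \<sigma> x m = bpath \<beta> t \<tau> x m" and i: "i \<le> m"
  shows "bpath \<beta> s \<sigma> x i = bpath \<beta> t \<tau> x i"
proof -
  let ?z = "bpath \<beta> s \<sigma> x m"
  let ?X = "\<Sum>i<m. w (bpath \<beta> s \<sigma> x i)" and ?Y = "\<Sum>i<m. w (bpath \<beta> t \<tau> x i)"
  have 1: "\<beta> s \<sigma> x ?z = ?X" by (rule bpath_weights[OF s])
  have 2: "\<beta> t \<tau> x ?z = ?Y" unfolding meet by (rule bpath_weights[OF t(1,2)])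
  have 3: "?Y \<le> \<beta> s \<sigma> x ?z"
    using sum_weights_le[OF s, of m "bpath \<beta> t \<tau> x" \<sigma>] bpath_step unfolding meet by simp
  have "\<beta> t \<tau> (bpath \<beta> s \<sigma> x 0) ?z \<le> ?X" using 1 2 3 by simp
  then have "bpath \<beta> s \<sigma> x i = bpath \<beta> t \<tau> (bpath \<beta> s \<sigma> x 0) i"
    by (rule sum_weights_tight[where \<rho> = "bpath \<beta> s \<sigma> x", OF t bpath_step _ i])
  then show ?thesis by simp
qed

end

subsection \<open>Monotonicity in the direction\<close>

context busemann_realization
begin

lemma tilt_mono: "0 < s \<Longrightarrow> s < t \<Longrightarrow> t < 1 \<Longrightarrow> tilt \<beta> t \<tau> z \<le> tilt \<beta> s \<sigma> z"
  unfolding tilt_def using mono_e1[of s t \<tau> z \<sigma>] mono_e2[of s t \<sigma> z \<tau>] by simp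

text \<open>One of the two directions has to be untied: with zero tilt at both, \<open>Plus\<close>
  at s would step e1 while \<open>Minus\<close> at t steps e2.\<close>

lemma bpath_mono:
  assumes st: "0 < s" "s < t" "t < 1" and un: "untied \<beta> s \<sigma> \<or> untied \<beta> t \<tau>"
    and le: "lev x = lev y" "fst x \<le> fst y"
  shows "fst (bpath \<beta> s \<sigma> x n) \<le> fst (bpath \<beta> t \<tau> y n)"
  unfolding bpath_def
proof (rule iterate_mono[of "bstep \<beta> s \<sigma>" "bstep \<beta> t \<tau>", OF up_right_bstep up_right_bstep _ le])
  fix z assume "bstep \<beta> s \<sigma> z = z + e1"
  then have "tilt \<beta> s \<sigma> z \<le> 0" unfolding bstep_def by (auto split: if_splits)
  moreover have "tilt \<beta> s \<sigma> z \<noteq> 0 \<or> tilt \<beta> t \<tau> z \<noteq> 0" using un unfolding untied_def by blast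
  ultimately have "tilt \<beta> t \<tau> z < 0" using tilt_mono[OF st, of \<tau> z \<sigma>] by linarith
  then show "bstep \<beta> t \<tau> z = z + e1" by (simp add: bstep_def)
qed

lemma isCont_p: "0 < t \<Longrightarrow> t < 1 \<Longrightarrow> isCont p t"
  using cont by (simp add: continuous_on_eq_continuous_at)

text \<open>Inside the piece the Busemann functions are constant by \<open>flat\<close>, and the
  left limit at its right end is the \<open>Minus\<close> value there.\<close>

lemma flat_left:
  assumes "affine_between p s t" "0 < s" "s < r" "r < t" "t < 1"
  shows "\<beta> r \<sigma> x y = \<beta> t Minus x y"
proof -
  have "\<forall>\<^sub>F r' in at_left t. \<beta> r' \<sigma> x y = \<beta> r \<sigma> x y"
  proof (rule eventually_at_leftI)
    show "\<beta> r' \<sigma> x y = \<beta> r \<sigma> x y" if "r' \<in> {s<..<t}" for r'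
      by (rule flat[OF assms(1)]) (use that assms in auto)
  qed (use assms in simp)
  then have "((\<lambda>r'. \<beta> r' \<sigma> x y) \<longlongrightarrow> \<beta> r \<sigma> x y) (at_left t)"
    by (rule tendsto_eventually)
  then show ?thesis
    by (rule tendsto_unique[OF trivial_limit_at_left_real _ lim_left]) (use assms in auto)
qed

lemma flat_right:
  assumes "affine_between p s t" "0 < s" "s < r" "r < t" "t < 1"
  shows "\<beta> r \<sigma> x y = \<beta> s Plus x y"
proof -
  have "\<forall>\<^sub>F r' in at_right s. \<beta> r' \<sigma> x y = \<beta> r \<sigma> x y"
  proof (rule eventually_at_rightI)
    show "\<beta> r' \<sigma> x y = \<beta> r \<sigma> x y" if "r' \<in> {s<..<t}" for r'
      by (rule flat[OF assms(1)]) (use that assms in auto)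
  qed (use assms in simp)
  then have "((\<lambda>r'. \<beta> r' \<sigma> x y) \<longlongrightarrow> \<beta> r \<sigma> x y) (at_right s)"
    by (rule tendsto_eventually)
  then show ?thesis
    by (rule tendsto_unique[OF trivial_limit_at_right_real _ lim_right]) (use assms in auto)
qed

text \<open>Affinity up to 1 would freeze the Busemann functions near 1 and contradict the blow-up
  of the e2 increments. Its use is to keep asymptotic directions away from the axes.\<close>

lemma not_affine_up_to_1:
  assumes q: "0 < q" "q < 1" and aff: "\<And>r. q < r \<Longrightarrow> r < 1 \<Longrightarrow> affine_between p q r"
  shows False
proof -
  define C where "C = \<beta> q Plus (0::site) (0 + e2)"
  have const: "\<beta> r Plus 0 (0 + e2) = C" if r: "q < r" "r < 1" for r
  proof -
    \<comment> \<open>A point beyond r is needed so that r lies in the interior of an affine piece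
      starting at q.\<close>
    have "r < (r + 1) / 2" "(r + 1) / 2 < 1" using r by auto
    then show ?thesis unfolding C_def
      by (intro flat_right[OF aff[of "(r + 1) / 2"]]) (use q r in auto)
  qed
  have "\<forall>\<^sub>F r in at_left 1. C + 1 \<le> \<beta> r Plus 0 (0 + e2)"
    using blowup_e2[of Plus 0] unfolding filterlim_at_top by blast
  moreover have "\<forall>\<^sub>F r in at_left 1. \<beta> r Plus 0 (0 + e2) = C"
    using const q by (intro eventually_at_leftI[of q]) auto
  ultimately have "\<forall>\<^sub>F r::real in at_left 1. False"
    by eventually_elim simp
  then show False by simp
qed

end

lemma (in busemann_realization) not_affine_down_to_0:
  assumes q: "0 < q" "q < 1" and aff: "\<And>r. 0 < r \<Longrightarrow> r < q \<Longrightarrow> affine_between p q r"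
  shows False
proof -
  interpret R: busemann_realization "w \<circ> prod.swap" "reflect \<beta>" "\<lambda>t. p (1 - t)" by (rule reflected)
  show False
    by (rule R.not_affine_up_to_1[of "1 - q"]) (use q aff in \<open>auto simp: affine_between_reflect\<close>)
qed

subsection \<open>Asymptotic directions\<close>

context busemann_realization
begin

lemma asymp_dir_bounds:
  assumes "asymp_dir (bpath \<beta> t \<sigma> x) u"
  shows "0 \<le> u" "u \<le> 1"
proof -
  obtain k where k: "strict_mono k" and
    lim: "(\<lambda>n. real_of_int (fst (bpath \<beta> t \<sigma> x (k n))) / real (k n)) \<longlonglongrightarrow> u"
    using assms unfolding asymp_dir_def by blast
  have l0: "(\<lambda>n. real_of_int (fst x) / real (k n)) \<longlonglongrightarrow> 0" by (rule const_div_subseq_tendsto_0[OF k])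
  have l1: "(\<lambda>n. real_of_int (fst x) / real (k n) + 1) \<longlonglongrightarrow> 0 + 1"
    by (intro tendsto_intros l0)
  have b: "fst x \<le> fst (bpath \<beta> t \<sigma> x n) \<and> fst (bpath \<beta> t \<sigma> x n) \<le> fst x + int n" for n
    unfolding bpath_def by (rule fst_iterate_bounds[OF up_right_bstep])
  show "0 \<le> u"
    by (rule tendsto_le[OF _ lim l0]) (use b in \<open>auto intro!: always_eventually divide_right_mono\<close>)
  have "u \<le> 0 + 1"
  proof (rule tendsto_le[OF _ l1 lim])
    show "\<forall>\<^sub>F n in sequentially. real_of_int (fst (bpath \<beta> t \<sigma> x (k n))) / real (k n)
        \<le> real_of_int (fst x) / real (k n) + 1"
      using strict_mono_eventually_pos[OF k]
    proof eventually_elim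
      case (elim n)
      have "real_of_int (fst (bpath \<beta> t \<sigma> x (k n))) \<le> real_of_int (fst x + int (k n))"
        using b[of "k n"] of_int_le_iff by blast
      then show ?case using elim by (simp add: field_simps)
    qed
  qed simp
  then show "u \<le> 1" by simp
qed

text \<open>\<open>rat_directed\<close> speaks only of points strictly between q and u. The axes are
  excluded by blow-up, and continuity of p then closes the piece at u.\<close>

lemma rat_asymp_dir:
  assumes q: "q \<in> \<rat>" "0 < q" "q < 1" and u: "asymp_dir (bpath \<beta> q \<sigma> x) u"
  shows "0 < u" "u < 1" "affine_between p q u"
proof -
  have aff: "affine_between p q r" if "min q u < r" "r < max q u" for r
    by (rule rat_directed[OF q u that])
  have bd: "0 \<le> u" "u \<le> 1" using asymp_dir_bounds[OF u] by auto
  show u0: "0 < u"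
  proof (rule ccontr)
    assume "\<not> 0 < u"
    then have "u = 0" using bd by simp
    then show False by (intro not_affine_down_to_0[OF q(2,3)] aff) (use q in simp_all)
  qed
  show u1: "u < 1"
  proof (rule ccontr)
    assume "\<not> u < 1"
    then have "u = 1" using bd by simp
    then show False by (intro not_affine_up_to_1[OF q(2,3)] aff) (use q in simp_all)
  qed
  show "affine_between p q u"
  proof (cases q u rule: linorder_cases)
    case less
    show ?thesis
      by (rule affine_between_limit_right[OF less aff isCont_p[OF u0 u1]]) (use less in simp_all)
  next
    case greater
    show ?thesis
      by (rule affine_between_limit_left[OF greater aff isCont_p[OF u0 u1]]) (use greater in simp_all)
  qed simp
qed

text \<open>A rational path with v < q < t stays on the left of the t-path, so it has a limit u with
  u \<le> v < q. The affine piece between u and q contains the segment from v to q, and q may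
  approach t.\<close>

lemma bpath_asymp_below:
  assumes t: "0 < t" "t < 1" and v: "asymp_dir (bpath \<beta> t \<sigma> x) v" and vt: "v < t"
  shows "0 < v \<and> affine_between p v t"
proof -
  obtain k where k: "strict_mono k" and
    lim: "(\<lambda>n. real_of_int (fst (bpath \<beta> t \<sigma> x (k n))) / real (k n)) \<longlonglongrightarrow> v"
    using v unfolding asymp_dir_def by blast
  have v0: "0 \<le> v" using asymp_dir_bounds[OF v] by simp
  have *: "0 < v \<and> affine_between p v q" if q: "q \<in> \<rat>" "v < q" "q < t" for q
  proof -
    have q01: "0 < q" "q < 1" using q v0 t by auto
    \<comment> \<open>The times k are thinned out until both paths have limits; the limit of the
      t-path remains v.\<close>
    obtain r u v' where r: "strict_mono (r :: nat \<Rightarrow> nat)"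
      and u: "(\<lambda>n. real_of_int (fst (bpath \<beta> q Plus x (k (r n)))) / real (k (r n))) \<longlonglongrightarrow> u"
      and v': "(\<lambda>n. real_of_int (fst (bpath \<beta> t \<sigma> x (k (r n)))) / real (k (r n))) \<longlonglongrightarrow> v'"
      by (rule subseq_two_limits[OF bpath_ratio_bound[of \<beta> q Plus x] bpath_ratio_bound[of \<beta> t \<sigma> x] k])
    have "v' = v" using LIMSEQ_subseq_LIMSEQ[OF lim r] v' LIMSEQ_unique by (auto simp: o_def)
    moreover have "u \<le> v'"
    proof (rule LIMSEQ_le[OF u v'])
      show "\<exists>N. \<forall>n\<ge>N. real_of_int (fst (bpath \<beta> q Plus x (k (r n)))) / real (k (r n))
          \<le> real_of_int (fst (bpath \<beta> t \<sigma> x (k (r n)))) / real (k (r n))"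
        using bpath_mono[OF q01(1) q(3) t(2)] rat_untied[OF q(1) q01]
        by (intro exI[of _ 0] allI impI divide_right_mono) auto
    qed
    ultimately have uv: "u \<le> v" by simp
    have "asymp_dir (bpath \<beta> q Plus x) u" unfolding asymp_dir_def
      using strict_mono_compose[OF k r] u by (intro exI[of _ "k \<circ> r"]) (auto simp: o_def)
    from rat_asymp_dir[OF q(1) q01 this] have "0 < u" "affine_between p q u" by auto
    then show ?thesis using uv q by (intro conjI affine_between_subset[of p q u v q]) simp_all
  qed
  have aff: "affine_between p v r" if r: "v < r" "r < t" for r
  proof -
    obtain q where "r < q" "q < t" "q \<in> \<rat>" using Rats_dense_in_real[OF r(2)] by auto
    then have "affine_between p v q" using * r by simp
    then show ?thesis by (rule affine_between_subset) (use r \<open>r < q\<close> in simp_all)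
  qed
  obtain q where "q \<in> \<rat>" "v < q" "q < t" using Rats_dense_in_real[OF vt] by auto
  then have "0 < v" using * by blast
  then show ?thesis using affine_between_limit_right[OF vt aff isCont_p[OF t]] by blast
qed

end

lemma (in busemann_realization) bpath_asymp_dir:
  assumes t: "0 < t" "t < 1" and v: "asymp_dir (bpath \<beta> t \<sigma> x) v"
  shows "0 < v \<and> v < 1 \<and> affine_between p v t"
proof -
  interpret R: busemann_realization "w \<circ> prod.swap" "reflect \<beta>" "\<lambda>t. p (1 - t)" by (rule reflected)
  show ?thesis
  proof (cases v t rule: linorder_cases)
    case less
    then show ?thesis using bpath_asymp_below[OF t v less] t by simp
  next
    case equal
    then show ?thesis using t by simp
  next
    case greater
    have "asymp_dir (bpath (reflect \<beta>) (1 - t) (flip \<sigma>) (prod.swap x)) (1 - v)"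
      using v by (simp add: asymp_dir_bpath_reflect)
    from R.bpath_asymp_below[OF _ _ this] t greater
    show ?thesis by (auto simp: affine_between_reflect)
  qed
qed

subsection \<open>Coalescence and local constancy\<close>

lemma bpath_meet_later:
  assumes "bpath \<beta> t \<sigma> x m = bpath \<beta> t \<sigma> y n"
  shows "bpath \<beta> t \<sigma> x (m + k) = bpath \<beta> t \<sigma> y (n + k)"
  using assms by (simp add: bpath_add)

lemma coalesce_if_same_level:
  assumes *: "\<And>x y. lev x = lev y \<Longrightarrow> fst y \<le> fst x \<Longrightarrow> \<exists>n. bpath \<beta> t \<sigma> x n = bpath \<beta> t \<sigma> y n"
  shows "\<exists>m n. bpath \<beta> t \<sigma> x m = bpath \<beta> t \<sigma> y n"
proof -
  \<comment> \<open>At most one of a and b is nonzero: the lower starting point is advanced to the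
    level of the other.\<close>
  define a b where "a = nat (lev y - lev x)" and "b = nat (lev x - lev y)"
  let ?x = "bpath \<beta> t \<sigma> x a" and ?y = "bpath \<beta> t \<sigma> y b"
  have "lev ?x = lev ?y" by (simp add: lev_bpath a_def b_def)
  then obtain n where "bpath \<beta> t \<sigma> ?x n = bpath \<beta> t \<sigma> ?y n"
    using *[of ?x ?y] *[of ?y ?x] by (metis linear)
  then show ?thesis by (metis bpath_add)
qed

context busemann_realization
begin

text \<open>Either \<^term>\<open>p\<close> is affine to the left of \<open>t\<close>, and then \<open>t\<close> inherits coalescence from a rational
  direction; or the path of a rational direction \<open>q < t\<close> from the right site must cross the
  \<open>t\<close>-path from the left site.\<close>

lemma coalesce_left:
  assumes t: "0 < t" "t < 1" and lc: "\<And>x y. left_const \<beta> t x y"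
  shows "untied \<beta> t Minus" and "\<exists>m n. bpath \<beta> t Minus x m = bpath \<beta> t Minus y n"
proof -
  \<comment> \<open>The rational direction depends on the pair x, y, because the intervals of
    constancy are not uniform over pairs.\<close>
  have rat_eq: "\<exists>q. q \<in> \<rat> \<and> 0 < q \<and> q < t \<and> (\<forall>\<sigma>. \<beta> q \<sigma> x y = \<beta> t Minus x y)" for x y
  proof -
    obtain c where c: "c \<ge> 0" "c < t" "\<forall>s \<sigma>. c < s \<longrightarrow> s < t \<longrightarrow> \<beta> s \<sigma> x y = \<beta> t Minus x y"
      using lc[of x y] unfolding left_const_def by blast
    obtain q where "c < q" "q < t" "q \<in> \<rat>" using Rats_dense_in_real[OF c(2)] by auto
    then show ?thesis using c by (intro exI[of _ q]) auto
  qed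
  have tilt_ne: "tilt \<beta> t Minus z \<noteq> 0" for z
  proof -
    obtain q where q: "q \<in> \<rat>" "0 < q" "q < t" "\<beta> q Plus (z + e2) (z + e1) = \<beta> t Minus (z + e2) (z + e1)"
      using rat_eq by blast
    have q1: "q < 1" using q t by simp
    have "tilt \<beta> q Plus z \<noteq> 0" using rat_untied[OF q(1,2) q1] unfolding untied_def by blast
    then show ?thesis using tilt_eq[OF t] tilt_eq[OF q(2) q1] q(4) by simp
  qed
  then show untied: "untied \<beta> t Minus" unfolding untied_def by blast
  show "\<exists>m n. bpath \<beta> t Minus x m = bpath \<beta> t Minus y n"
  proof (cases "\<exists>s>0. s < t \<and> affine_between p s t")
    case True
    then obtain s where s: "0 < s" "s < t" "affine_between p s t" by blast
    obtain q where q: "s < q" "q < t" "q \<in> \<rat>" using Rats_dense_in_real[OF s(2)] by auto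
    \<comment> \<open>On an affine piece one rational q serves all sites at once, so the whole step
      fields coincide.\<close>
    have "tilt \<beta> q Minus z = tilt \<beta> t Minus z" for z
      unfolding tilt_def using flat_left[OF s(3,1) q(1,2) t(2)] by simp
    then have "bstep \<beta> q Minus = bstep \<beta> t Minus" by (intro ext) (simp add: bstep_def)
    moreover have "\<exists>m n. bpath \<beta> q Minus x m = bpath \<beta> q Minus y n"
      by (rule rat_coalesce) (use q s t in simp_all)
    ultimately show ?thesis by (simp add: bpath_def)
  next
    case no_affine: False
    show ?thesis
    proof (rule coalesce_if_same_level)
      fix x y :: site assume le: "lev x = lev y" "fst y \<le> fst x"
      obtain q where q: "q \<in> \<rat>" "0 < q" "q < t" "\<beta> q Plus x y = \<beta> t Minus x y"
        using rat_eq by blast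
      have q1: "q < 1" using q t by simp
      have "\<exists>n. bpath \<beta> q Plus x n = bpath \<beta> t Minus y n"
      proof (rule ccontr)
        assume "\<nexists>n. bpath \<beta> q Plus x n = bpath \<beta> t Minus y n"
        \<comment> \<open>Without a meeting the q-path stays on the right, so the limits satisfy v
          \<le> u. Since p is not affine to the left of t, also v \<ge> t, and then the affine piece
          from q to u would reach t.\<close>
        then have lt: "fst (bpath \<beta> t Minus y n) < fst (bpath \<beta> q Plus x n)" for n
          by (intro never_meet_imp_ordered[where k = 0] fst_bpath_Suc) (use le in \<open>simp_all add: lev_bpath\<close>)
        define C where "C = \<bar>real_of_int (fst x)\<bar> + \<bar>real_of_int (fst y)\<bar> + 1"
        have bx: "\<bar>real_of_int (fst (bpath \<beta> q Plus x n)) / real n\<bar> \<le> C" for n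
          using bpath_ratio_bound[of \<beta> q Plus x n] unfolding C_def by linarith
        have by': "\<bar>real_of_int (fst (bpath \<beta> t Minus y n)) / real n\<bar> \<le> C" for n
          using bpath_ratio_bound[of \<beta> t Minus y n] unfolding C_def by linarith
        obtain r u v where r: "strict_mono (r :: nat \<Rightarrow> nat)"
          and u: "(\<lambda>n. real_of_int (fst (bpath \<beta> q Plus x (r n))) / real (r n)) \<longlonglongrightarrow> u"
          and v: "(\<lambda>n. real_of_int (fst (bpath \<beta> t Minus y (r n))) / real (r n)) \<longlonglongrightarrow> v"
          by (rule bounded_two_limits[OF bx by'])
        have vu: "v \<le> u"
          by (rule LIMSEQ_le[OF v u], intro exI[of _ 0] allI impI divide_right_mono)
            (use lt in \<open>simp_all add: less_imp_le\<close>)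
        have "asymp_dir (bpath \<beta> q Plus x) u" "asymp_dir (bpath \<beta> t Minus y) v"
          using r u v unfolding asymp_dir_def by blast+
        then have au: "affine_between p q u" and av: "0 < v" "affine_between p v t"
          using rat_asymp_dir[OF q(1,2) q1] bpath_asymp_dir[OF t] by blast+
        have "t \<le> v" using no_affine av by force
        then have "affine_between p q t"
          by (intro affine_between_subset[OF au]) (use vu q in simp_all)
        then show False using no_affine q by blast
      qed
      then obtain n where n: "bpath \<beta> q Plus x n = bpath \<beta> t Minus y n" by blast
      \<comment> \<open>The equal values at (x, y) are what allows \<open>crossing\<close> to
        replace the q-path from x by the t-path from x.\<close>
      have "bpath \<beta> t Minus x n = bpath \<beta> q Plus x n"
        by (rule crossing[OF q(2) q1 rat_untied[OF q(1,2) q1] t untied q(4) n])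
      then show "\<exists>n. bpath \<beta> t Minus x n = bpath \<beta> t Minus y n" using n by metis
    qed
  qed
qed

text \<open>If the limiting tilt is negative, nearby tilts are negative too; if it is nonnegative,
  monotonicity keeps the tilts to the left nonnegative, and \<open>Minus\<close> resolves ties in
  favour of e2. Hence \<open>Minus\<close> is the sign that fits an approach from the left.\<close>

lemma bpath_stable_left:
  assumes t: "0 < t" "t < 1"
  shows "\<exists>c\<ge>0. c < t \<and> (\<forall>s. c < s \<longrightarrow> s < t \<longrightarrow> (\<forall>i\<le>n. bpath \<beta> s Minus x i = bpath \<beta> t Minus x i))"
proof -
  have step: "\<forall>\<^sub>F s in at_left t. bstep \<beta> s Minus z = bstep \<beta> t Minus z" for z
  proof (cases "tilt \<beta> t Minus z < 0")
    case True
    have "((\<lambda>s. tilt \<beta> s Minus z) \<longlongrightarrow> tilt \<beta> t Minus z) (at_left t)"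
      unfolding tilt_def by (intro tendsto_intros lim_left t)
    from order_tendstoD(2)[OF this True] show ?thesis
      by eventually_elim (use True in \<open>simp add: bstep_def\<close>)
  next
    case False
    show ?thesis
    proof (rule eventually_at_leftI[of 0])
      show "bstep \<beta> s Minus z = bstep \<beta> t Minus z" if "s \<in> {0<..<t}" for s
        using tilt_mono[of s t Minus z Minus] that False t by (simp add: bstep_def)
    qed (rule t)
  qed
  have "\<forall>\<^sub>F s in at_left t. \<forall>i\<in>{..<n}. bstep \<beta> s Minus (bpath \<beta> t Minus x i) = bstep \<beta> t Minus (bpath \<beta> t Minus x i)"
    by (rule eventually_ball_finite) (simp, intro ballI step)
  then obtain c where c: "c < t" "\<And>s i. c < s \<Longrightarrow> s < t \<Longrightarrow> i < n \<Longrightarrow>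
      bstep \<beta> s Minus (bpath \<beta> t Minus x i) = bstep \<beta> t Minus (bpath \<beta> t Minus x i)"
    unfolding eventually_at_left_field lessThan_iff by blast
  show ?thesis
  proof (intro exI[of _ "max 0 c"] conjI allI impI)
    fix s i assume "max 0 c < s" "s < t" "i \<le> n"
    then show "bpath \<beta> s Minus x i = bpath \<beta> t Minus x i"
      by (intro bpath_cong_upto[of n]) (use c in auto)
  qed (use c t in auto)
qed

lemma left_const_if_meet:
  assumes t: "0 < t" "t < 1" and meet: "bpath \<beta> t Minus x m = bpath \<beta> t Minus y n"
  shows "left_const \<beta> t x y"
proof -
  have val: "\<beta> s Minus x y = (\<Sum>i<m. w (bpath \<beta> s Minus x i)) - (\<Sum>i<n. w (bpath \<beta> s Minus y i))"
    if "0 < s" "s < 1" "bpath \<beta> s Minus x m = bpath \<beta> s Minus y n" for s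
    using cocycle[OF that(1,2), of Minus x y "bpath \<beta> s Minus x m"]
      bpath_weights[OF that(1,2), of Minus x m] bpath_weights[OF that(1,2), of Minus y n] that(3) by simp
  obtain c1 where c1: "c1 \<ge> 0" "c1 < t"
      "\<forall>s. c1 < s \<longrightarrow> s < t \<longrightarrow> (\<forall>i\<le>m. bpath \<beta> s Minus x i = bpath \<beta> t Minus x i)"
    using bpath_stable_left[OF t, of m x] by blast
  obtain c2 where c2: "c2 \<ge> 0" "c2 < t"
      "\<forall>s. c2 < s \<longrightarrow> s < t \<longrightarrow> (\<forall>i\<le>n. bpath \<beta> s Minus y i = bpath \<beta> t Minus y i)"
    using bpath_stable_left[OF t, of n y] by blast
  define c where "c = max c1 c2"
  have minus: "\<beta> s Minus x y = \<beta> t Minus x y" if s: "c < s" "s < t" for s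
  proof -
    have x: "\<forall>i\<le>m. bpath \<beta> s Minus x i = bpath \<beta> t Minus x i" using c1 s unfolding c_def by simp
    have y: "\<forall>i\<le>n. bpath \<beta> s Minus y i = bpath \<beta> t Minus y i" using c2 s unfolding c_def by simp
    have "bpath \<beta> s Minus x m = bpath \<beta> s Minus y n" using x y meet by simp
    then have "\<beta> s Minus x y = (\<Sum>i<m. w (bpath \<beta> s Minus x i)) - (\<Sum>i<n. w (bpath \<beta> s Minus y i))"
      by (intro val) (use s t c1 in \<open>simp_all add: c_def\<close>)
    also have "\<dots> = (\<Sum>i<m. w (bpath \<beta> t Minus x i)) - (\<Sum>i<n. w (bpath \<beta> t Minus y i))"
      using x y by simp
    also have "\<dots> = \<beta> t Minus x y" by (rule val[OF t meet, symmetric])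
    finally show ?thesis .
  qed
  have "\<beta> s \<sigma> x y = \<beta> t Minus x y" if s: "c < s" "s < t" for s \<sigma>
  proof (cases \<sigma>)
    \<comment> \<open>The \<open>Plus\<close> value at s is the right limit of \<open>Minus\<close>
      values at directions that still lie between c and t.\<close>
    case Plus
    have "\<forall>\<^sub>F r in at_right s. \<beta> r Minus x y = \<beta> t Minus x y"
      by (rule eventually_at_rightI[OF _ s(2)]) (rule minus, use s in auto)
    then have "((\<lambda>r. \<beta> r Minus x y) \<longlongrightarrow> \<beta> t Minus x y) (at_right s)" by (rule tendsto_eventually)
    then have "\<beta> t Minus x y = \<beta> s Plus x y"
      by (rule tendsto_unique[OF trivial_limit_at_right_real _ lim_right]) (use s t c1 c_def in auto)
    then show ?thesis using Plus by simp
  qed (use minus s in simp)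
  then show ?thesis unfolding left_const_def
    by (intro exI[of _ c]) (use c1 c2 c_def in auto)
qed

end

context busemann_realization
begin

interpretation R: busemann_realization "w \<circ> prod.swap" "reflect \<beta>" "\<lambda>t. p (1 - t)"
  by (rule reflected)

lemma coalesce_right:
  assumes t: "0 < t" "t < 1" and rc: "\<And>x y. right_const \<beta> t x y"
  shows "untied \<beta> t Plus" and "\<exists>m n. bpath \<beta> t Plus x m = bpath \<beta> t Plus y n"
proof -
  have t': "0 < 1 - t" "1 - t < 1" using t by auto
  have lc: "left_const (reflect \<beta>) (1 - t) x y" for x y using rc by (simp add: left_const_reflect)
  show "untied \<beta> t Plus" using R.coalesce_left(1)[OF t' lc] by (simp add: untied_reflect)
  obtain m n where "bpath (reflect \<beta>) (1 - t) Minus (prod.swap x) m = bpath (reflect \<beta>) (1 - t) Minus (prod.swap y) n"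
    using R.coalesce_left(2)[OF t' lc] by blast
  then have "bpath \<beta> t Plus x m = bpath \<beta> t Plus y n" by (simp add: bpath_reflect inj_eq[OF inj_swap])
  then show "\<exists>m n. bpath \<beta> t Plus x m = bpath \<beta> t Plus y n" by blast
qed

lemma bpath_stable_right:
  assumes t: "0 < t" "t < 1"
  shows "\<exists>c\<le>1. t < c \<and> (\<forall>s. t < s \<longrightarrow> s < c \<longrightarrow> (\<forall>i\<le>n. bpath \<beta> s Plus x i = bpath \<beta> t Plus x i))"
proof -
  obtain c where c: "c \<ge> 0" "c < 1 - t" "\<forall>s. c < s \<longrightarrow> s < 1 - t \<longrightarrow>
      (\<forall>i\<le>n. bpath (reflect \<beta>) s Minus (prod.swap x) i = bpath (reflect \<beta>) (1 - t) Minus (prod.swap x) i)"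
    using R.bpath_stable_left[of "1 - t" n "prod.swap x"] t by auto
  show ?thesis
  proof (intro exI[of _ "1 - c"] conjI allI impI)
    fix s i assume "t < s" "s < 1 - c" "i \<le> n"
    then show "bpath \<beta> s Plus x i = bpath \<beta> t Plus x i"
      using c(3)[rule_format, of "1 - s" i] by (simp add: bpath_reflect inj_eq[OF inj_swap])
  qed (use c in auto)
qed

lemma right_const_if_meet:
  assumes t: "0 < t" "t < 1" and meet: "bpath \<beta> t Plus x m = bpath \<beta> t Plus y n"
  shows "right_const \<beta> t x y"
  using R.left_const_if_meet[of "1 - t" "prod.swap x" m "prod.swap y" n] t meet
  by (simp add: left_const_reflect bpath_reflect)

end

section \<open>Equivalence of local constancy with agreement and coalescence of paths\<close>

definition locally_const :: "realization \<Rightarrow> real \<Rightarrow> site \<Rightarrow> site \<Rightarrow> bool" where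
  "locally_const \<beta> t x y \<longleftrightarrow>
     left_const \<beta> t x y \<and> right_const \<beta> t x y \<and> \<beta> t Plus x y = \<beta> t Minus x y"

context busemann_realization
begin

theorem locally_const_iff:
  assumes t: "0 < t" "t < 1"
  shows "(\<forall>x y. locally_const \<beta> t x y) \<longleftrightarrow>
    bstep \<beta> t Plus = bstep \<beta> t Minus \<and> (\<forall>x y. \<exists>m n. bpath \<beta> t Plus x m = bpath \<beta> t Plus y n)"
proof
  assume lc: "\<forall>x y. locally_const \<beta> t x y"
  then have l: "left_const \<beta> t x y" and r: "right_const \<beta> t x y"
    and eq: "\<beta> t Plus x y = \<beta> t Minus x y" for x y
    unfolding locally_const_def by blast+
  have "bstep \<beta> t Plus z = bstep \<beta> t Minus z" for z
  proof -
    have "tilt \<beta> t Minus z \<noteq> 0" using coalesce_left(1)[OF t l] unfolding untied_def by blast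
    moreover have "tilt \<beta> t Plus z = tilt \<beta> t Minus z" unfolding tilt_def using eq by simp
    ultimately show ?thesis by (simp add: bstep_def)
  qed
  then show "bstep \<beta> t Plus = bstep \<beta> t Minus \<and> (\<forall>x y. \<exists>m n. bpath \<beta> t Plus x m = bpath \<beta> t Plus y n)"
    using coalesce_right(2)[OF t r] by blast
next
  assume *: "bstep \<beta> t Plus = bstep \<beta> t Minus \<and> (\<forall>x y. \<exists>m n. bpath \<beta> t Plus x m = bpath \<beta> t Plus y n)"
  then have pm: "bpath \<beta> t Plus x i = bpath \<beta> t Minus x i" for x i by (simp add: bpath_def)
  show "\<forall>x y. locally_const \<beta> t x y"
  proof (intro allI)
    fix x y
    obtain m n where meet: "bpath \<beta> t Plus x m = bpath \<beta> t Plus y n" using * by blast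
    then have "left_const \<beta> t x y" "right_const \<beta> t x y"
      using left_const_if_meet[OF t] right_const_if_meet[OF t] pm by metis+
    \<comment> \<open>Both signs yield the same difference of weight sums, so there is no jump at t
      itself.\<close>
    moreover have "\<beta> t \<sigma> x y = (\<Sum>i<m. w (bpath \<beta> t Minus x i)) - (\<Sum>i<n. w (bpath \<beta> t Minus y i))" for \<sigma>
      using cocycle[OF t, of \<sigma> x y "bpath \<beta> t \<sigma> x m"] bpath_weights[OF t, of \<sigma> x m]
        bpath_weights[OF t, of \<sigma> y n] meet by (cases \<sigma>) (simp_all add: pm)
    ultimately show "locally_const \<beta> t x y" unfolding locally_const_def by simp
  qed
qed

text \<open>The \<open>Plus\<close> path from y joins the common path from x, and so does the
  \<open>Minus\<close> path from y. Hence the two paths from y meet again, and uniqueness of optimal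
  paths makes them agree from the start.\<close>

theorem one_agreement_imp_all:
  assumes t: "0 < t" "t < 1" and l: "\<And>x y. left_const \<beta> t x y" and r: "\<And>x y. right_const \<beta> t x y"
    and x: "\<And>n. bpath \<beta> t Plus x n = bpath \<beta> t Minus x n"
  shows "bstep \<beta> t Plus = bstep \<beta> t Minus"
proof -
  have "bpath \<beta> t Plus y 1 = bpath \<beta> t Minus y 1" for y
  proof -
    obtain a b where ab: "bpath \<beta> t Plus y a = bpath \<beta> t Plus x b" using coalesce_right(2)[OF t r] by blast
    obtain c d where cd: "bpath \<beta> t Minus y c = bpath \<beta> t Minus x d" using coalesce_left(2)[OF t l] by blast
    \<comment> \<open>Comparing levels aligns the step counts of the two mergers.\<close>
    have "b + c = d + a" using arg_cong[OF ab, of lev] arg_cong[OF cd, of lev] by (simp add: lev_bpath)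
    then have idx: "b + (c + 1) = d + (a + 1)" by linarith
    have "bpath \<beta> t Plus y (a + (c + 1)) = bpath \<beta> t Minus x (b + (c + 1))"
      unfolding bpath_meet_later[OF ab] by (rule x)
    also have "\<dots> = bpath \<beta> t Minus y (c + (a + 1))"
      unfolding idx by (rule bpath_meet_later[OF cd, symmetric])
    finally have "bpath \<beta> t Plus y (a + (c + 1)) = bpath \<beta> t Minus y (a + (c + 1))"
      by (simp only: add.left_commute[of c])
    then show ?thesis by (rule bpath_eq_if_meet[OF t t coalesce_left(1)[OF t l]]) simp
  qed
  then show ?thesis by (intro ext) (simp add: bpath_def)
qed

end

subsection \<open>Uniqueness of directed geodesics under regularity\<close>

text \<open>The path is indexed by steps and compared on initial segments, as needed for comparison
  with Busemann paths from the same start.\<close>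

definition optimal_path :: "(site \<Rightarrow> real) \<Rightarrow> (nat \<Rightarrow> site) \<Rightarrow> bool" where
  "optimal_path w \<rho> \<longleftrightarrow> (\<forall>i. \<rho> (Suc i) = \<rho> i + e1 \<or> \<rho> (Suc i) = \<rho> i + e2) \<and>
     (\<forall>n \<rho>'. (\<forall>i<n. \<rho>' (Suc i) = \<rho>' i + e1 \<or> \<rho>' (Suc i) = \<rho>' i + e2) \<longrightarrow> \<rho>' 0 = \<rho> 0 \<longrightarrow> \<rho>' n = \<rho> n \<longrightarrow>
        (\<Sum>i<n. w (\<rho>' i)) \<le> (\<Sum>i<n. w (\<rho> i)))"

lemma optimal_path_step: "optimal_path w \<rho> \<Longrightarrow> \<rho> (Suc i) = \<rho> i + e1 \<or> \<rho> (Suc i) = \<rho> i + e2"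
  unfolding optimal_path_def by blast

lemma lev_optimal_path: "optimal_path w \<rho> \<Longrightarrow> lev (\<rho> n) = lev (\<rho> 0) + int n"
proof (induction n)
  case (Suc n)
  then have "lev (\<rho> (Suc n)) = lev (\<rho> n) + 1"
    using optimal_path_step[OF Suc.prems, of n] by (elim disjE) (simp_all add: lev_def)
  then show ?case using Suc by simp
qed simp

lemma fst_optimal_path_Suc:
  "optimal_path w \<rho> \<Longrightarrow> fst (\<rho> n) \<le> fst (\<rho> (Suc n)) \<and> fst (\<rho> (Suc n)) \<le> fst (\<rho> n) + 1"
  by (drule optimal_path_step[of _ _ n], elim disjE) simp_all

lemma swap_step_iff:
  "prod.swap x = prod.swap y + e1 \<or> prod.swap x = prod.swap y + e2 \<longleftrightarrow> x = y + e1 \<or> x = (y :: site) + e2"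
  by (cases x; cases y) auto

lemma optimal_path_swap:
  assumes "optimal_path w \<rho>"
  shows "optimal_path (w \<circ> prod.swap) (\<lambda>n. prod.swap (\<rho> n))"
  unfolding optimal_path_def
proof (intro conjI allI impI)
  show "prod.swap (\<rho> (Suc i)) = prod.swap (\<rho> i) + e1 \<or> prod.swap (\<rho> (Suc i)) = prod.swap (\<rho> i) + e2" for i
    unfolding swap_step_iff using assms by (rule optimal_path_step)
next
  fix n and \<rho>' :: "nat \<Rightarrow> site"
  assume p: "\<forall>i<n. \<rho>' (Suc i) = \<rho>' i + e1 \<or> \<rho>' (Suc i) = \<rho>' i + e2"
    and ends: "\<rho>' 0 = prod.swap (\<rho> 0)" "\<rho>' n = prod.swap (\<rho> n)"
  have "\<forall>i<n. prod.swap (\<rho>' (Suc i)) = prod.swap (\<rho>' i) + e1 \<or> prod.swap (\<rho>' (Suc i)) = prod.swap (\<rho>' i) + e2"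
    unfolding swap_step_iff by (rule p)
  moreover note assms[unfolded optimal_path_def, THEN conjunct2, THEN spec[of _ n], THEN spec[of _ "\<lambda>i. prod.swap (\<rho>' i)"]]
  ultimately have "(\<Sum>i<n. w (prod.swap (\<rho>' i))) \<le> (\<Sum>i<n. w (\<rho> i))" using ends by simp
  then show "(\<Sum>i<n. (w \<circ> prod.swap) (\<rho>' i)) \<le> (\<Sum>i<n. (w \<circ> prod.swap) (prod.swap (\<rho> i)))" by simp
qed

text \<open>The two forms in which (R) enters: at an end point of a linear piece g is
  differentiable, so the Busemann functions do not jump there, and two linear pieces with a common
  end point lie on one line.\<close>

definition regular :: "(real \<Rightarrow> real) \<Rightarrow> realization \<Rightarrow> bool" where
  "regular p \<beta> \<longleftrightarrow>
     (\<forall>s t x y. 0 < s \<and> s < 1 \<and> 0 < t \<and> t < 1 \<and> s \<noteq> t \<and> affine_between p s t \<longrightarrow>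
        \<beta> t Plus x y = \<beta> t Minus x y) \<and>
     (\<forall>s t r. 0 < s \<and> s < t \<and> t < r \<and> r < 1 \<and> affine_between p s t \<and> affine_between p t r \<longrightarrow>
        affine_between p s r)"

lemma regularD_eq:
  assumes "regular p \<beta>" "0 < s" "s < 1" "0 < t" "t < 1" "s \<noteq> t" "affine_between p s t"
  shows "\<beta> t Plus x y = \<beta> t Minus x y"
  using conjunct1[OF assms(1)[unfolded regular_def]] assms(2-) by metis

lemma regularD_extend:
  assumes "regular p \<beta>" "0 < s" "s < t" "t < r" "r < 1" "affine_between p s t" "affine_between p t r"
  shows "affine_between p s r"
  using conjunct2[OF assms(1)[unfolded regular_def]] assms(2-) by metis

lemma regular_reflect:
  assumes reg: "regular p \<beta>"
  shows "regular (\<lambda>t. p (1 - t)) (reflect \<beta>)"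
  unfolding regular_def affine_between_reflect
proof (intro conjI allI impI; elim conjE)
  fix s t :: real and x y
  assume st: "0 < s" "s < 1" "0 < t" "t < 1" "s \<noteq> t" and aff: "affine_between p (1 - s) (1 - t)"
  have "\<beta> (1 - t) Plus (prod.swap x) (prod.swap y) = \<beta> (1 - t) Minus (prod.swap x) (prod.swap y)"
    by (rule regularD_eq[OF reg _ _ _ _ _ aff]) (use st in simp_all)
  then show "reflect \<beta> t Plus x y = reflect \<beta> t Minus x y" by (simp add: reflect_def)
next
  fix s t r :: real
  assume *: "0 < s" "s < t" "t < r" "r < 1" "affine_between p (1 - s) (1 - t)" "affine_between p (1 - t) (1 - r)"
  have "affine_between p (1 - r) (1 - s)"
    by (rule regularD_extend[OF reg, of _ "1 - t"]) (use * in \<open>simp_all add: affine_between_sym\<close>)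
  then show "affine_between p (1 - s) (1 - r)" by (simp only: affine_between_sym)
qed

context busemann_realization
begin

lemma optimal_path_meets_rational:
  assumes opt: "optimal_path w \<rho>" and q: "q \<in> \<rat>" "0 < q" "q < 1"
    and meet: "\<rho> n = bpath \<beta> q \<sigma> (\<rho> 0) n" and m: "m \<le> n"
  shows "\<rho> m = bpath \<beta> q \<sigma> (\<rho> 0) m"
proof -
  let ?b = "bpath \<beta> q \<sigma> (\<rho> 0)"
  have path: "\<forall>i<n. ?b (Suc i) = ?b i + e1 \<or> ?b (Suc i) = ?b i + e2" using bpath_step by blast
  note spec[OF spec[OF conjunct2[OF opt[unfolded optimal_path_def]]], of n ?b]
  from mp[OF mp[OF mp[OF this path] bpath_0] meet[symmetric]]
  have "\<beta> q \<sigma> (\<rho> 0) (?b n) \<le> (\<Sum>i<n. w (\<rho> i))" by (simp only: bpath_weights[OF q(2,3)])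
  then have "\<beta> q \<sigma> (\<rho> 0) (\<rho> n) \<le> (\<Sum>i<n. w (\<rho> i))" by (simp only: meet)
  then show ?thesis
    by (rule sum_weights_tight[where \<rho> = \<rho>, OF q(2,3) rat_untied[OF q] optimal_path_step[OF opt] _ m])
qed

text \<open>The comparison direction is T, the right end of the maximal affine piece starting at t.
  The path of a rational q > T has all its limits beyond T, since otherwise the piece would extend;
  a geodesic directed into the piece can therefore not stay on its right. Letting q decrease to T
  gives the bound.\<close>

lemma optimal_path_upper:
  assumes t: "0 < t" "t < 1" and reg: "regular p \<beta>" and opt: "optimal_path w \<rho>"
    and dir: "\<And>v. asymp_dir \<rho> v \<Longrightarrow> 0 < v \<and> v < 1 \<and> affine_between p v t"
  shows "fst (\<rho> n) \<le> fst (bpath \<beta> t Plus (\<rho> 0) n)"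
proof -
  define A where "A = {r. t \<le> r \<and> r < 1 \<and> affine_between p t r}"
  define T where "T = Sup A"
  have tA: "t \<in> A" using t by (simp add: A_def)
  have bdd: "bdd_above A" unfolding A_def by (intro bdd_aboveI[of _ 1]) auto
  have A_le: "r \<le> T" if "r \<in> A" for r unfolding T_def by (rule cSup_upper[OF that bdd])
  have "T \<le> 1" unfolding T_def
  proof (rule cSup_least)
    show "A \<noteq> {}" using tA by blast
  qed (simp add: A_def)
  then have T: "t \<le> T" "T \<le> 1" using A_le[OF tA] by simp_all
  have below: "affine_between p t r" if r: "t < r" "r < T" for r
  proof -
    obtain a where a: "a \<in> A" "r < a" using r(2) less_cSupD[of A r] tA unfolding T_def by blast
    then have "affine_between p t a" by (simp add: A_def)
    then show ?thesis by (rule affine_between_subset) (use r a in simp_all)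
  qed
  have T1: "T < 1"
  proof (rule ccontr)
    assume "\<not> T < 1"
    then have "T = 1" using T by simp
    then show False by (intro not_affine_up_to_1[OF t]) (rule below, simp_all)
  qed
  have affT: "affine_between p t T"
  proof (cases "t = T")
    case False
    then have "t < T" using T by simp
    then show ?thesis
      by (rule affine_between_limit_right[OF _ below isCont_p[OF _ T1]]) (use t T in simp_all)
  qed simp
  have no_affine: "\<not> affine_between p T r" if r: "T < r" "r < 1" for r
  proof
    assume a: "affine_between p T r"
    have "affine_between p t r"
    proof (cases "t = T")
      case False
      then have "t < T" using T by simp
      then show ?thesis by (rule regularD_extend[OF reg t(1) _ r affT a])
    qed (use a in simp)
    then have "r \<in> A" using r T unfolding A_def by simp
    then show False using A_le[of r] r by simp
  qed
  \<comment> \<open>Regularity removes the jump at T, and flatness identifies the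
    \<open>Minus\<close> value at T with the \<open>Plus\<close> value at t.\<close>
  have step: "bstep \<beta> T Plus = bstep \<beta> t Plus"
  proof (cases "t = T")
    case False
    then have tT: "t < T" using T by simp
    define r where "r = (t + T) / 2"
    have r: "t < r" "r < T" using tT unfolding r_def by auto
    have "\<beta> T Plus x y = \<beta> T Minus x y" for x y
      by (rule regularD_eq[OF reg t _ T1 _ affT]) (use t tT in simp_all)
    also have "\<beta> T Minus x y = \<beta> t Plus x y" for x y
      using flat_left[OF affT t(1) r T1, of Plus x y] flat_right[OF affT t(1) r T1, of Plus x y] by simp
    finally show ?thesis by (intro ext) (simp add: bstep_def tilt_def)
  qed simp
  have rat: "fst (\<rho> n) \<le> fst (bpath \<beta> q Plus (\<rho> 0) n)" if q: "q \<in> \<rat>" "T < q" "q < 1" for q n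
  proof (rule ccontr)
    assume neg: "\<not> fst (\<rho> n) \<le> fst (bpath \<beta> q Plus (\<rho> 0) n)"
    let ?b = "bpath \<beta> q Plus (\<rho> 0)"
    have q0: "0 < q" using q t T by simp
    \<comment> \<open>A meeting at or after n would force agreement at n, by uniqueness of optimal
      paths for the rational direction.\<close>
    have ne: "\<rho> m \<noteq> ?b m" if "n \<le> m" for m
    proof
      assume "\<rho> m = ?b m"
      then have "\<rho> n = ?b n" by (rule optimal_path_meets_rational[OF opt q(1) q0 q(3) _ that])
      then show False using neg by simp
    qed
    have lev: "lev (\<rho> m) = lev (?b m)" for m
      unfolding lev_bpath by (rule lev_optimal_path[OF opt])
    have lt: "fst (?b m) < fst (\<rho> m)" if m: "n \<le> m" for m
      by (rule never_meet_imp_ordered[where f = \<rho> and g = ?b and k = n,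
            OF fst_optimal_path_Suc[OF opt] fst_bpath_Suc lev ne _ m])
        (use neg in simp_all)
    obtain r u v where r: "strict_mono (r :: nat \<Rightarrow> nat)"
      and u: "(\<lambda>n. real_of_int (fst (?b (r n))) / real (r n)) \<longlonglongrightarrow> u"
      and v: "(\<lambda>n. real_of_int (fst (\<rho> (r n))) / real (r n)) \<longlonglongrightarrow> v"
      by (rule bounded_two_limits[OF bpath_ratio_bound[of \<beta> q Plus "\<rho> 0"]
          ratio_bound[of \<rho>, OF fst_optimal_path_Suc[OF opt]]])
    have uv: "u \<le> v"
    proof (rule LIMSEQ_le[OF u v], intro exI[of _ n] allI impI divide_right_mono)
      fix m assume "n \<le> m"
      then have "n \<le> r m" using seq_suble[OF r, of m] by simp
      then show "real_of_int (fst (?b (r m))) \<le> real_of_int (fst (\<rho> (r m)))" using lt[of "r m"] by simp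
    qed simp
    have "asymp_dir ?b u" "asymp_dir \<rho> v" using r u v unfolding asymp_dir_def by blast+
    then have au: "affine_between p q u" and av: "v < 1" "affine_between p v t"
      using rat_asymp_dir(3)[OF q(1) q0 q(3), of Plus "\<rho> 0" u] dir[of v] by simp_all
    have "v \<le> T"
    proof (rule ccontr)
      assume "\<not> v \<le> T"
      then have "v \<in> A" using av T affine_between_sym[of p v t] unfolding A_def by simp
      then show False using A_le \<open>\<not> v \<le> T\<close> by blast
    qed
    then have "affine_between p T q" using uv q by (intro affine_between_subset[OF au]) simp_all
    then show False using no_affine q by blast
  qed
  obtain c where c: "c \<le> 1" "T < c" "\<forall>s. T < s \<longrightarrow> s < c \<longrightarrow> (\<forall>i\<le>n. bpath \<beta> s Plus (\<rho> 0) i = bpath \<beta> T Plus (\<rho> 0) i)"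
    using bpath_stable_right[OF less_le_trans[OF t(1) T(1)] T1, of n "\<rho> 0"] by blast
  obtain q where q: "T < q" "q < c" "q \<in> \<rat>" using Rats_dense_in_real[OF c(2)] by auto
  have "bpath \<beta> q Plus (\<rho> 0) n = bpath \<beta> t Plus (\<rho> 0) n"
  proof -
    have "bpath \<beta> q Plus (\<rho> 0) n = bpath \<beta> T Plus (\<rho> 0) n" using c(3) q(1,2) by blast
    then show ?thesis by (simp add: bpath_def step)
  qed
  then show ?thesis using rat[of q n] q c by simp
qed

end

context busemann_realization
begin

interpretation R: busemann_realization "w \<circ> prod.swap" "reflect \<beta>" "\<lambda>t. p (1 - t)"
  by (rule reflected)

lemma optimal_path_lower:
  assumes t: "0 < t" "t < 1" and reg: "regular p \<beta>" and opt: "optimal_path w \<rho>"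
    and dir: "\<And>v. asymp_dir \<rho> v \<Longrightarrow> 0 < v \<and> v < 1 \<and> affine_between p v t"
  shows "fst (bpath \<beta> t Minus (\<rho> 0) n) \<le> fst (\<rho> n)"
proof -
  have "fst (prod.swap (\<rho> n)) \<le> fst (bpath (reflect \<beta>) (1 - t) Plus (prod.swap (\<rho> 0)) n)"
  proof (rule R.optimal_path_upper[of "1 - t" "\<lambda>n. prod.swap (\<rho> n)",
        OF _ _ regular_reflect[OF reg] optimal_path_swap[OF opt]])
    fix v assume "asymp_dir (\<lambda>n. prod.swap (\<rho> n)) v"
    then have "asymp_dir \<rho> (1 - v)"
      using asymp_dir_swap[OF lev_optimal_path[OF opt], of "1 - v"] by simp
    from dir[OF this] show "0 < v \<and> v < 1 \<and> affine_between (\<lambda>t. p (1 - t)) v (1 - t)"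
      unfolding affine_between_reflect by simp
  qed (use t in simp_all)
  then have "snd (\<rho> n) \<le> snd (bpath \<beta> t Minus (\<rho> 0) n)" by (simp add: bpath_reflect)
  moreover have "lev (\<rho> n) = lev (bpath \<beta> t Minus (\<rho> 0) n)"
    unfolding lev_bpath by (rule lev_optimal_path[OF opt])
  ultimately show ?thesis by (simp add: lev_def)
qed

theorem optimal_path_unique:
  assumes t: "0 < t" "t < 1" and reg: "regular p \<beta>" and opt: "optimal_path w \<rho>"
    and dir: "\<And>v. asymp_dir \<rho> v \<Longrightarrow> 0 < v \<and> v < 1 \<and> affine_between p v t"
    and step: "bstep \<beta> t Plus = bstep \<beta> t Minus"
  shows "\<rho> n = bpath \<beta> t Plus (\<rho> 0) n"
proof (rule site_eqI)
  show "lev (\<rho> n) = lev (bpath \<beta> t Plus (\<rho> 0) n)"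
    unfolding lev_bpath by (rule lev_optimal_path[OF opt])
  show "fst (\<rho> n) = fst (bpath \<beta> t Plus (\<rho> 0) n)"
    using optimal_path_upper[OF t reg opt dir, of n] optimal_path_lower[OF t reg opt dir, of n] step
    by (simp add: bpath_def)
qed

end

section \<open>Busemann measures\<close>

subsection \<open>Directions as real numbers\<close>

definition dir :: "real \<Rightarrow> real \<times> real" where
  "dir t = (t, 1 - t)"

lemma fst_dir [simp]: "fst (dir t) = t" and snd_dir [simp]: "snd (dir t) = 1 - t"
  by (simp_all add: dir_def)

lemma inj_dir [simp]: "dir s = dir t \<longleftrightarrow> s = t"
  by (simp add: dir_def)

lemma dir_fst: "fst v + snd v = 1 \<Longrightarrow> dir (fst v) = v"
  by (cases v) (simp add: dir_def)

lemma U_dir_eq: "U_dir = dir ` {0..1}"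
  by (force simp: U_dir_def dir_def)

lemma riU_eq: "riU = dir ` {0<..<1}"
  unfolding riU_def U_dir_eq by (force simp: dir_def)

lemma dir_in_riU [simp]: "dir t \<in> riU \<longleftrightarrow> 0 < t \<and> t < 1"
  by (auto simp: riU_eq)

lemma prec_dir [simp]: "dir s \<prec> dir t \<longleftrightarrow> s < t"
  by (simp add: prec_def dir_def)

lemma preceq_dir [simp]: "dir s \<preceq> dir t \<longleftrightarrow> s \<le> t"
  by (simp add: preceq_def dir_def)

lemma dir_intervals:
  assumes "0 \<le> a" "b \<le> 1"
  shows "dir_cc (dir a) (dir b) = dir ` {a..b}" "dir_oc (dir a) (dir b) = dir ` {a<..b}"
    "dir_co (dir a) (dir b) = dir ` {a..<b}"
  using assms unfolding dir_cc_def dir_oc_def dir_co_def U_dir_eq by (auto simp: image_iff)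

lemma dir_image_eq: "dir ` C = {v. fst v + snd v = 1} \<inter> fst -` C"
  by (force simp: dir_def)

lemma continuous_on_dir [continuous_intros]: "continuous_on A dir"
  unfolding dir_def by (intro continuous_intros)

lemma measurable_dir [measurable]: "dir \<in> borel_measurable borel"
  by (rule borel_measurable_continuous_onI[OF continuous_on_dir])

lemma dir_image_borel:
  assumes "C \<in> sets borel"
  shows "dir ` C \<in> sets borel"
proof -
  have "{v :: real \<times> real. fst v + snd v = 1} \<in> sets borel"
    by (intro borel_closed closed_Collect_eq continuous_intros)
  moreover have "fst -` C \<in> sets (borel :: (real \<times> real) measure)"
    using measurable_sets[of fst "borel :: (real \<times> real) measure" borel C] assms
    by (simp add: borel_measurable_continuous_onI continuous_on_fst)
  ultimately show ?thesis unfolding dir_image_eq by (rule sets.Int)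
qed

lemma sets_restrict_dir: "A \<in> sets (restrict_space borel (dir ` {a..b})) \<longleftrightarrow>
    (\<exists>C \<subseteq> {a..b}. C \<in> sets borel \<and> A = dir ` C)"
proof -
  have K: "dir ` {a..b} \<inter> space borel \<in> sets borel" using dir_image_borel[of "{a..b}"] by simp
  show ?thesis unfolding sets_restrict_space_iff[OF K]
  proof
    assume A: "A \<subseteq> dir ` {a..b} \<and> A \<in> sets borel"
    then have "dir -` A \<in> sets borel" using measurable_sets[OF measurable_dir, of A] by simp
    moreover have "dir -` A \<subseteq> {a..b}" using A by force
    moreover have "A = dir ` (dir -` A)" using A by blast
    ultimately show "\<exists>C \<subseteq> {a..b}. C \<in> sets borel \<and> A = dir ` C" by blast
  next
    assume "\<exists>C \<subseteq> {a..b}. C \<in> sets borel \<and> A = dir ` C"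
    then show "A \<subseteq> dir ` {a..b} \<and> A \<in> sets borel" using dir_image_borel by blast
  qed
qed

lemma dir_image_in_sets:
  "C \<subseteq> {a..b} \<Longrightarrow> C \<in> sets borel \<Longrightarrow> dir ` C \<in> sets (restrict_space borel (dir ` {a..b}))"
  unfolding sets_restrict_dir by blast

subsection \<open>Uniqueness\<close>

lemma signed_measure_empty: "signed_measure N \<nu> \<Longrightarrow> \<nu> {} = 0"
  by (simp add: signed_measure_def)

lemma signed_measure_sums:
  assumes "signed_measure N \<nu>" "\<And>i. A i \<in> sets N" "disjoint_family A"
  shows "(\<lambda>i. \<nu> (A i)) sums \<nu> (\<Union>i. A i)"
  using conjunct2[OF assms(1)[unfolded signed_measure_def], THEN spec, THEN mp, of A] assms(2,3)
  by (simp add: image_subset_iff)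

lemma signed_measure_additive:
  assumes "signed_measure N \<nu>" "A \<in> sets N" "B \<in> sets N" "A \<inter> B = {}"
  shows "\<nu> (A \<union> B) = \<nu> A + \<nu> B"
proof -
  define S where "S i = (if i = 0 then A else if i = 1 then B else {})" for i :: nat
  have "range S \<subseteq> sets N" "disjoint_family S"
    using assms by (auto simp: S_def disjoint_family_on_def)
  then have "(\<lambda>i. \<nu> (S i)) sums \<nu> (\<Union>i. S i)"
    using assms(1) unfolding signed_measure_def by blast
  moreover have "(\<Union>i. S i) = A \<union> B"
    unfolding S_def by (auto split: if_splits)
  moreover have "(\<lambda>i. \<nu> (S i)) sums (\<Sum>i\<in>{0,1}. \<nu> (S i))"
    by (rule sums_finite) (use assms(1) in \<open>auto simp: S_def signed_measure_def\<close>)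
  ultimately show ?thesis by (auto simp: S_def dest: sums_unique2)
qed

text \<open>The Dynkin argument runs over the lower rays intersected with \<open>{a..b}\<close>.\<close>

lemma signed_measure_zero_on_interval:
  fixes \<nu> :: "real set \<Rightarrow> real"
  assumes sm: "signed_measure (restrict_space borel {a..b}) \<nu>" and ab: "a < b"
    and oc: "\<And>s t. a \<le> s \<Longrightarrow> s < t \<Longrightarrow> t \<le> b \<Longrightarrow> \<nu> {s<..t} = 0"
    and co: "\<And>s t. a \<le> s \<Longrightarrow> s < t \<Longrightarrow> t \<le> b \<Longrightarrow> \<nu> {s..<t} = 0"
    and C: "C \<in> sets borel"
  shows "\<nu> (C \<inter> {a..b}) = 0"
proof -
  have inN: "A \<in> sets (restrict_space borel {a..b})" if "A \<in> sets borel" "A \<subseteq> {a..b}" for A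
    using that by (simp add: sets_restrict_space_iff)
  note add = signed_measure_additive[OF sm inN inN]
  have sums: "(\<lambda>i. \<nu> (A i)) sums \<nu> (\<Union>i. A i)"
    if "\<And>i. A i \<in> sets borel" "\<And>i. A i \<subseteq> {a..b}" "disjoint_family A" for A :: "nat \<Rightarrow> real set"
  proof -
    show ?thesis by (rule signed_measure_sums[OF sm inN[OF that(1,2)] that(3)])
  qed
  \<comment> \<open>An increasing sequence from a to b cuts the open interval into countably many
    half-open pieces. This isolates the possible atom at b, which lies in no interval of the form
    {s..<t} considered here.\<close>
  define u where "u n = b - (b - a) / real (Suc n)" for n
  have u0: "u 0 = a" by (simp add: u_def)
  have u_less: "u m < u n" if "m < n" for m n
    using that ab unfolding u_def by (intro diff_strict_left_mono divide_strict_left_mono) auto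
  have u_mono: "u m \<le> u n" if "m \<le> n" for m n
    using that u_less[of m n] by (cases "m = n") auto
  have u_lt: "u n < b" for n using ab by (simp add: u_def)
  have u_ge: "a \<le> u n" for n using u_mono[of 0 n] u0 by simp
  have "(\<lambda>n. b - (b - a) * inverse (real (Suc n))) \<longlonglongrightarrow> b - (b - a) * 0"
    by (rule tendsto_diff[OF tendsto_const tendsto_mult[OF tendsto_const LIMSEQ_inverse_real_of_nat]])
  then have lim: "u \<longlonglongrightarrow> b" by (simp add: u_def[abs_def] divide_inverse)
  define I where "I n = {u n<..u (Suc n)}" for n
  have disj: "disjoint_family I"
    unfolding disjoint_family_on_def
  proof (intro ballI impI)
    fix m n :: nat assume "m \<noteq> n"
    then have "Suc m \<le> n \<or> Suc n \<le> m" by linarith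
    then show "I m \<inter> I n = {}"
      using u_mono[of "Suc m" n] u_mono[of "Suc n" m] unfolding I_def by auto
  qed
  have Un: "(\<Union>n. I n) = {a<..<b}"
  proof (intro equalityI subsetI)
    fix x assume "x \<in> (\<Union>n. I n)"
    then obtain n where "u n < x" "x \<le> u (Suc n)" unfolding I_def by auto
    then show "x \<in> {a<..<b}" using u_ge[of n] u_lt[of "Suc n"] by simp
  next
    fix x assume x: "x \<in> {a<..<b}"
    have "\<forall>\<^sub>F n in sequentially. x < u n" by (rule order_tendstoD(1)[OF lim]) (use x in simp)
    then have ex: "\<exists>n. x \<le> u n" unfolding eventually_sequentially by (meson less_imp_le order_refl)
    define n where "n = (LEAST n. x \<le> u n)"
    have n: "x \<le> u n" unfolding n_def using ex by (rule LeastI_ex)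
    then obtain k where k: "n = Suc k" using u0 x by (cases n) auto
    have "\<not> x \<le> u k" using not_less_Least[of k "\<lambda>n. x \<le> u n"] k unfolding n_def by simp
    then show "x \<in> (\<Union>n. I n)" using n k unfolding I_def by (intro UN_I[of k]) simp_all
  qed
  have Isub: "I n \<subseteq> {a..b}" for n
  proof
    fix x assume "x \<in> I n"
    then have "u n < x" "x \<le> u (Suc n)" unfolding I_def by simp_all
    then show "x \<in> {a..b}" using u_ge[of n] u_lt[of "Suc n"] by simp
  qed
  have "(\<lambda>n. \<nu> (I n)) sums \<nu> (\<Union>n. I n)"
    by (rule sums[OF _ Isub disj]) (simp add: I_def)
  moreover have "\<nu> (I n) = 0" for n
    unfolding I_def by (rule oc[OF u_ge u_less[OF lessI] less_imp_le[OF u_lt]])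
  ultimately have "\<nu> {a<..<b} = 0" unfolding Un using sums_unique2[OF _ sums_zero] by simp
  moreover have "\<nu> {a<..b} = \<nu> {a<..<b} + \<nu> {b}"
  proof -
    have "{a<..b} = {a<..<b} \<union> {b}" using ab by auto
    moreover have "\<nu> ({a<..<b} \<union> {b}) = \<nu> {a<..<b} + \<nu> {b}" by (rule add) (use ab in auto)
    ultimately show ?thesis by (simp only:)
  qed
  ultimately have nb: "\<nu> {b} = 0" using oc[of a b] ab by simp
  have "{a..b} = {a..<b} \<union> {b}" using ab by auto
  moreover have "\<nu> ({a..<b} \<union> {b}) = \<nu> {a..<b} + \<nu> {b}" by (rule add) (use ab in auto)
  ultimately have tot: "\<nu> {a..b} = 0" using nb co[of a b] ab by simp
  have borel_eq: "sets borel = sigma_sets UNIV (range (lessThan :: real \<Rightarrow> real set))"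
    unfolding borel_Iio by simp
  have C': "C \<in> sigma_sets UNIV (range lessThan)" using C borel_eq by simp
  have stable: "Int_stable (range (lessThan :: real \<Rightarrow> real set))"
    unfolding Int_stable_def
  proof (intro ballI)
    fix A B :: "real set" assume "A \<in> range lessThan" "B \<in> range lessThan"
    then obtain x y where "A = {..<x}" "B = {..<y}" by blast
    then have "A \<inter> B = {..<min x y}" by auto
    then show "A \<inter> B \<in> range lessThan" by blast
  qed
  have G: "range (lessThan :: real \<Rightarrow> real set) \<subseteq> Pow UNIV" by simp
  show ?thesis
    using stable G C'
  proof (induction rule: sigma_sets_induct_disjoint)
    case (basic A)
    then obtain x where A: "A = {..<x}" by auto
    consider "x \<le> a" | "a < x" "x \<le> b" | "b < x" by linarith
    then show ?case
    proof cases
      case 1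
      then have "A \<inter> {a..b} = {}" unfolding A by auto
      then show ?thesis using sm unfolding signed_measure_def by simp
    next
      case 2
      then have "A \<inter> {a..b} = {a..<x}" unfolding A by auto
      then show ?thesis using co[of a x] 2 by simp
    next
      case 3
      then have "A \<inter> {a..b} = {a..b}" unfolding A by auto
      then show ?thesis using tot by simp
    qed
  next
    case empty
    then show ?case using sm unfolding signed_measure_def by simp
  next
    case (compl A)
    have A: "A \<in> sets borel" using compl(1) borel_eq by simp
    have split: "(A \<inter> {a..b}) \<union> ((UNIV - A) \<inter> {a..b}) = {a..b}" by blast
    have "\<nu> ((A \<inter> {a..b}) \<union> ((UNIV - A) \<inter> {a..b})) = \<nu> (A \<inter> {a..b}) + \<nu> ((UNIV - A) \<inter> {a..b})"
    proof (rule add)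
      show "A \<inter> {a..b} \<in> sets borel" "(UNIV - A) \<inter> {a..b} \<in> sets borel"
        using A by (auto intro!: sets.Int sets.Diff)
    qed blast+
    then show ?case unfolding split using compl(2) tot by linarith
  next
    case (union A)
    have A: "A i \<in> sets borel" for i using union(2) borel_eq by auto
    have "(\<lambda>i. \<nu> (A i \<inter> {a..b})) sums \<nu> (\<Union>i. A i \<inter> {a..b})"
    proof (rule sums)
      show "A i \<inter> {a..b} \<in> sets borel" for i using A[of i] by simp
      show "disjoint_family (\<lambda>i. A i \<inter> {a..b})" using union(1) unfolding disjoint_family_on_def by blast
    qed simp
    then have "(\<lambda>i. 0) sums \<nu> (\<Union>i. A i \<inter> {a..b})" by (simp only: union(3))
    then have "\<nu> (\<Union>i. A i \<inter> {a..b}) = 0" by (rule sums_unique2[OF _ sums_zero])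
    moreover have "(\<Union>i. A i) \<inter> {a..b} = (\<Union>i. A i \<inter> {a..b})" by blast
    ultimately show ?case by (simp only:)
  qed
qed

text \<open>The signed measure is pulled back along \<open>dir\<close> and restricted to the
  parameters from c to d; the smaller interval allows the vanishing to be used near a single
  direction.\<close>

lemma signed_measure_zero_on_arc:
  assumes sm: "signed_measure (restrict_space borel (dir ` {a..b})) \<nu>" and cd: "a \<le> c" "c < d" "d \<le> b"
    and oc: "\<And>s t. c \<le> s \<Longrightarrow> s < t \<Longrightarrow> t \<le> d \<Longrightarrow> \<nu> (dir ` {s<..t}) = 0"
    and co: "\<And>s t. c \<le> s \<Longrightarrow> s < t \<Longrightarrow> t \<le> d \<Longrightarrow> \<nu> (dir ` {s..<t}) = 0"
    and S: "S \<in> sets (restrict_space borel (dir ` {a..b}))" "S \<subseteq> dir ` {c..d}"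
  shows "\<nu> S = 0"
proof -
  obtain C where C: "C \<subseteq> {a..b}" "C \<in> sets borel" "S = dir ` C"
    using S(1) unfolding sets_restrict_dir by blast
  have "signed_measure (restrict_space borel {c..d}) (\<lambda>C. \<nu> (dir ` C))"
    unfolding signed_measure_def
  proof (intro conjI allI impI; (elim conjE)?)
    show "\<nu> (dir ` {}) = 0" using sm unfolding signed_measure_def by simp
    fix A :: "nat \<Rightarrow> real set"
    assume A: "range A \<subseteq> sets (restrict_space borel {c..d})" "disjoint_family A"
    have A': "A i \<in> sets borel" "A i \<subseteq> {a..b}" for i
    proof -
      have "A i \<in> sets (restrict_space borel {c..d})" using A by blast
      then show "A i \<in> sets borel" "A i \<subseteq> {a..b}" using cd by (auto simp: sets_restrict_space_iff)
    qed
    have "dir ` A i \<in> sets (restrict_space borel (dir ` {a..b}))" for i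
      using A' sets_restrict_dir by blast
    moreover have "disjoint_family (\<lambda>i. dir ` A i)"
      unfolding disjoint_family_on_def
    proof (intro ballI impI)
      fix i j :: nat assume "i \<noteq> j"
      then have "A i \<inter> A j = {}" using A(2) unfolding disjoint_family_on_def by blast
      then show "dir ` A i \<inter> dir ` A j = {}" by (auto simp: dir_def)
    qed
    ultimately have "(\<lambda>i. \<nu> (dir ` A i)) sums \<nu> (\<Union>i. dir ` A i)"
      by (rule signed_measure_sums[OF sm])
    then show "(\<lambda>i. \<nu> (dir ` A i)) sums \<nu> (dir ` (\<Union>i. A i))" by (simp add: image_UN)
  qed
  from signed_measure_zero_on_interval[OF this cd(2) oc co C(2)]
  have "\<nu> (dir ` (C \<inter> {c..d})) = 0" by simp
  moreover have "C \<inter> {c..d} = C" using S(2) C(3) by auto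
  ultimately show ?thesis using C(3) by simp
qed

subsection \<open>Existence\<close>

text \<open>The function f' records the left limits of the right-continuous f. In the application f
  is a \<open>Plus\<close> value and f' the corresponding \<open>Minus\<close> value, possibly after
  a change of sign.\<close>

definition increasing_pair :: "(real \<Rightarrow> real) \<Rightarrow> (real \<Rightarrow> real) \<Rightarrow> bool" where
  "increasing_pair f f' \<longleftrightarrow> (\<forall>s t. 0 < s \<longrightarrow> s \<le> t \<longrightarrow> t < 1 \<longrightarrow> f s \<le> f t) \<and>
     (\<forall>t. 0 < t \<longrightarrow> t < 1 \<longrightarrow> (f \<longlongrightarrow> f t) (at_right t) \<and> (f \<longlongrightarrow> f' t) (at_left t))"

lemma increasing_pair_add:
  assumes "increasing_pair f f'" "increasing_pair h h'"
  shows "increasing_pair (\<lambda>t. f t + h t) (\<lambda>t. f' t + h' t)"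
  using assms unfolding increasing_pair_def by (auto intro!: tendsto_add add_mono)

text \<open>This is the Stieltjes measure of f. Nothing is known about f outside the open unit
  interval, so it is first frozen outside a slightly larger compact interval.\<close>

lemma increasing_pair_measure:
  assumes f: "increasing_pair f f'" and ab: "0 < a" "a < b" "b < 1"
  obtains m where "sets m = sets borel" "emeasure m {a..b} < \<infinity>"
    "\<And>s t. a \<le> s \<Longrightarrow> s < t \<Longrightarrow> t \<le> b \<Longrightarrow>
       measure m {s<..t} = f t - f s \<and> measure m {s..<t} = f' t - f' s"
proof -
  define a' b' where "a' = a / 2" and "b' = (1 + b) / 2"
  have a'b': "0 < a'" "a' < a" "b < b'" "b' < 1" using ab by (auto simp: a'_def b'_def)
  define H where "H r = f (max a' (min b' r))" for r
  have Hf: "H r = f r" if "a' \<le> r" "r \<le> b'" for r using that by (simp add: H_def)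
  have mono: "H x \<le> H y" if "x \<le> y" for x y
  proof -
    have "0 < max a' (min b' x)" "max a' (min b' x) \<le> max a' (min b' y)" "max a' (min b' y) < 1"
      using a'b' ab that by auto
    then show ?thesis using f unfolding H_def increasing_pair_def by blast
  qed
  have rc: "continuous (at_right r) H" for r
    unfolding continuous_within
  proof (cases "r < a'")
    case True
    have "\<forall>\<^sub>F s in at_right r. H s = H r"
      by (rule eventually_at_rightI[OF _ True]) (use a'b' ab in \<open>simp add: H_def\<close>)
    then show "(H \<longlongrightarrow> H r) (at_right r)" by (rule tendsto_eventually)
  next
    case ge: False
    show "(H \<longlongrightarrow> H r) (at_right r)"
    proof (cases "r < b'")
      case True
      have "(f \<longlongrightarrow> f r) (at_right r)" using f ge True a'b' unfolding increasing_pair_def by force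
      moreover have "\<forall>\<^sub>F s in at_right r. f s = H s"
        by (rule eventually_at_rightI[OF _ True]) (use ge in \<open>simp add: Hf\<close>)
      ultimately show ?thesis using Hf[of r] ge True by (simp add: Lim_transform_eventually)
    next
      case False
      have "\<forall>\<^sub>F s in at_right r. H s = H r"
        by (rule eventually_at_rightI[of r "r + 1"]) (use False in \<open>simp_all add: H_def\<close>)
      then show ?thesis by (rule tendsto_eventually)
    qed
  qed
  define m where "m = interval_measure H"
  have Ioc: "emeasure m {s<..t} = H t - H s" if "s \<le> t" for s t
    unfolding m_def by (rule emeasure_interval_measure_Ioc[OF that]) (use mono rc in auto)
  have meas_Ioc: "measure m {s<..t} = H t - H s" if "s \<le> t" for s t
    unfolding measure_def Ioc[OF that] using mono[OF that] by simp
  have fin: "emeasure m A \<noteq> \<infinity>" if "A \<subseteq> {a'<..b'}" for A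
  proof -
    have "emeasure m A \<le> emeasure m {a'<..b'}" by (rule emeasure_mono[OF that]) (simp add: m_def)
    also have "\<dots> < \<infinity>" using Ioc[of a' b'] a'b' ab by simp
    finally show ?thesis by simp
  qed
  \<comment> \<open>The reference point a' lies strictly to the left of a, so that an interval
    containing its left end a is still a difference of two such open intervals.\<close>
  have Ioo: "measure m {a'<..<t} = f' t - f a'" if t: "a \<le> t" "t \<le> b" for t
  proof -
    define u where "u n = t - (t - a') / real (Suc n)" for n
    have t': "a' < t" "t < b'" "0 < t" "t < 1" using t a'b' ab by auto
    have sub: "{a'<..<t} \<subseteq> {a'<..b'}" using t' by auto
    have u_ge: "a' \<le> u n" for n
      using divide_left_mono[of 1 "real (Suc n)" "t - a'"] t' by (simp add: u_def)
    have u_lt: "u n < t" for n using t' by (simp add: u_def)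
    have "(\<lambda>n. t - (t - a') * inverse (real (Suc n))) \<longlonglongrightarrow> t - (t - a') * 0"
      by (rule tendsto_diff[OF tendsto_const tendsto_mult[OF tendsto_const LIMSEQ_inverse_real_of_nat]])
    then have lim: "u \<longlonglongrightarrow> t" by (simp add: u_def[abs_def] divide_inverse)
    have u_mono: "u i \<le> u j" if "i \<le> j" for i j
      unfolding u_def by (intro diff_left_mono divide_left_mono) (use that t' in auto)
    have inc: "incseq (\<lambda>n. {a'<..u n})"
    proof (rule incseq_SucI)
      show "{a'<..u n} \<subseteq> {a'<..u (Suc n)}" for n using u_mono[of n "Suc n"] by auto
    qed
    have Un: "(\<Union>n. {a'<..u n}) = {a'<..<t}"
    proof (intro equalityI subsetI)
      fix x assume "x \<in> (\<Union>n. {a'<..u n})"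
      then obtain n where "a' < x" "x \<le> u n" by auto
      then show "x \<in> {a'<..<t}" using u_lt[of n] by simp
    next
      fix x assume x: "x \<in> {a'<..<t}"
      have "\<forall>\<^sub>F n in sequentially. x < u n" by (rule order_tendstoD(1)[OF lim]) (use x in simp)
      then obtain n where "x < u n" unfolding eventually_sequentially by blast
      then show "x \<in> (\<Union>n. {a'<..u n})" using x by (intro UN_I[of n]) simp_all
    qed
    have "(\<lambda>n. measure m {a'<..u n}) \<longlonglongrightarrow> measure m (\<Union>n. {a'<..u n})"
      by (rule Lim_measure_incseq[OF _ inc]) (use fin[OF sub] Un in \<open>auto simp: m_def\<close>)
    then have l1: "(\<lambda>n. measure m {a'<..u n}) \<longlonglongrightarrow> measure m {a'<..<t}" unfolding Un .
    have "filterlim u (at_left t) sequentially"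
      unfolding filterlim_at by (use lim u_lt in \<open>auto simp: less_imp_neq\<close>)
    moreover have "(f \<longlongrightarrow> f' t) (at_left t)" using f t' unfolding increasing_pair_def by blast
    ultimately have l2: "(\<lambda>n. f (u n) - f a') \<longlonglongrightarrow> f' t - f a'"
      by (intro tendsto_diff tendsto_const) (rule filterlim_compose)
    have "measure m {a'<..u n} = f (u n) - f a'" for n
      using meas_Ioc[OF u_ge[of n]] Hf[of "u n"] Hf[of a'] u_ge[of n] u_lt[of n] t' by simp
    then show ?thesis using LIMSEQ_unique[OF l1] l2 by simp
  qed
  show thesis
  proof (rule that[of m])
    show "sets m = sets borel" by (simp add: m_def)
    have "{a..b} \<subseteq> {a'<..b'}" using a'b' by auto
    from fin[OF this] show "emeasure m {a..b} < \<infinity>" by (simp add: top.not_eq_extremum)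
    fix s t assume st: "a \<le> s" "s < t" "t \<le> b"
    have "measure m {s<..t} = f t - f s"
      using meas_Ioc[of s t] Hf[of s] Hf[of t] st a'b' by simp
    moreover have "measure m {s..<t} = f' t - f' s"
    proof -
      have "{s..<t} = {a'<..<t} - {a'<..<s}" using st a'b' by auto
      moreover have "{a'<..<t} \<subseteq> {a'<..b'}" using st a'b' by auto
      note fin[OF this]
      moreover have "measure m ({a'<..<t} - {a'<..<s}) = measure m {a'<..<t} - measure m {a'<..<s}"
        by (rule measure_Diff) (use st a'b' \<open>emeasure m {a'<..<t} \<noteq> \<infinity>\<close> in \<open>auto simp: m_def\<close>)
      ultimately show ?thesis using Ioo[of s] Ioo[of t] st by simp
    qed
    ultimately show "measure m {s<..t} = f t - f s \<and> measure m {s..<t} = f' t - f' s" ..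
  qed
qed

text \<open>A simultaneous Jordan decomposition of a right-continuous function F and of its left
  limits F'.\<close>

definition bv_pair :: "(real \<Rightarrow> real) \<Rightarrow> (real \<Rightarrow> real) \<Rightarrow> bool" where
  "bv_pair F F' \<longleftrightarrow> (\<exists>f f' h h'. increasing_pair f f' \<and> increasing_pair h h' \<and>
     (\<forall>t. 0 < t \<longrightarrow> t < 1 \<longrightarrow> F t = f t - h t \<and> F' t = f' t - h' t))"

lemma bv_pair_measure:
  assumes F: "bv_pair F F'" and ab: "0 < a" "a < b" "b < 1"
  obtains \<mu> where "signed_measure (restrict_space borel {a..b}) \<mu>"
    "\<And>s t. a \<le> s \<Longrightarrow> s < t \<Longrightarrow> t \<le> b \<Longrightarrow> \<mu> {s<..t} = F t - F s \<and> \<mu> {s..<t} = F' t - F' s"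
proof -
  obtain f f' h h' where f: "increasing_pair f f'" and h: "increasing_pair h h'"
    and F: "\<And>t. 0 < t \<Longrightarrow> t < 1 \<Longrightarrow> F t = f t - h t \<and> F' t = f' t - h' t"
    using F unfolding bv_pair_def by blast
  obtain m1 where m1: "sets m1 = sets borel" "emeasure m1 {a..b} < \<infinity>"
    and m1': "\<And>s t. a \<le> s \<Longrightarrow> s < t \<Longrightarrow> t \<le> b \<Longrightarrow>
       measure m1 {s<..t} = f t - f s \<and> measure m1 {s..<t} = f' t - f' s"
    by (rule increasing_pair_measure[OF f ab]) blast
  obtain m2 where m2: "sets m2 = sets borel" "emeasure m2 {a..b} < \<infinity>"
    and m2': "\<And>s t. a \<le> s \<Longrightarrow> s < t \<Longrightarrow> t \<le> b \<Longrightarrow>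
       measure m2 {s<..t} = h t - h s \<and> measure m2 {s..<t} = h' t - h' s"
    by (rule increasing_pair_measure[OF h ab]) blast
  have sums: "(\<lambda>i. measure m (A i)) sums measure m (\<Union>i. A i)"
    if m: "sets m = sets borel" "emeasure m {a..b} < \<infinity>"
      and A: "\<And>i. A i \<in> sets borel" "\<And>i. A i \<subseteq> {a..b}" "disjoint_family A"
    for m and A :: "nat \<Rightarrow> real set"
  proof (rule measure_UNION)
    show "range A \<subseteq> sets m" using A(1) m(1) by blast
    have "emeasure m (\<Union>i. A i) \<le> emeasure m {a..b}"
      by (rule emeasure_mono) (use A(2) m(1) in auto)
    then show "emeasure m (\<Union>i. A i) \<noteq> \<infinity>" using m(2) by (auto simp: top_unique)
  qed (rule A)
  show thesis
  proof (rule that[of "\<lambda>A. measure m1 A - measure m2 A"])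
    show "signed_measure (restrict_space borel {a..b}) (\<lambda>A. measure m1 A - measure m2 A)"
      unfolding signed_measure_def
    proof (intro conjI allI impI; (elim conjE)?)
      fix A :: "nat \<Rightarrow> real set"
      assume A: "range A \<subseteq> sets (restrict_space borel {a..b})" "disjoint_family A"
      have A': "A i \<in> sets borel" "A i \<subseteq> {a..b}" for i
      proof -
        have "A i \<in> sets (restrict_space borel {a..b})" using A by blast
        then show "A i \<in> sets borel" "A i \<subseteq> {a..b}" by (simp_all add: sets_restrict_space_iff)
      qed
      show "(\<lambda>i. measure m1 (A i) - measure m2 (A i)) sums (measure m1 (\<Union>i. A i) - measure m2 (\<Union>i. A i))"
        by (intro sums_diff sums m1 m2 A' A(2))
    qed simp
    fix s t assume st: "a \<le> s" "s < t" "t \<le> b"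
    have "F s = f s - h s \<and> F' s = f' s - h' s" "F t = f t - h t \<and> F' t = f' t - h' t"
      by (rule F; use st ab in simp)+
    then show "measure m1 {s<..t} - measure m2 {s<..t} = F t - F s \<and>
        measure m1 {s..<t} - measure m2 {s..<t} = F' t - F' s"
      using m1'[OF st] m2'[OF st] by simp
  qed
qed

lemma is_busemann_measure_arc:
  assumes ab: "0 < a" "b < 1"
  shows "is_busemann_measure bb x y (dir ` {a..b}) \<nu> \<longleftrightarrow>
     signed_measure (restrict_space borel (dir ` {a..b})) \<nu> \<and>
     \<nu> \<in> extensional (sets (restrict_space borel (dir ` {a..b}))) \<and>
     (\<forall>s t. a \<le> s \<longrightarrow> s < t \<longrightarrow> t \<le> b \<longrightarrow>
        \<nu> (dir ` {s<..t}) = bb (dir t) Plus x y - bb (dir s) Plus x y \<and>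
        \<nu> (dir ` {s..<t}) = bb (dir t) Minus x y - bb (dir s) Minus x y)"
proof -
  have "(\<forall>\<zeta>\<in>riU. \<forall>\<eta>\<in>riU. \<zeta> \<prec> \<eta> \<and> dir_cc \<zeta> \<eta> \<subseteq> dir ` {a..b} \<longrightarrow>
        \<nu> (dir_oc \<zeta> \<eta>) = bb \<eta> Plus x y - bb \<zeta> Plus x y \<and>
        \<nu> (dir_co \<zeta> \<eta>) = bb \<eta> Minus x y - bb \<zeta> Minus x y) \<longleftrightarrow>
     (\<forall>s t. 0 < s \<longrightarrow> s < 1 \<longrightarrow> 0 < t \<longrightarrow> t < 1 \<longrightarrow> s < t \<longrightarrow> a \<le> s \<longrightarrow> t \<le> b \<longrightarrow>
        \<nu> (dir ` {s<..t}) = bb (dir t) Plus x y - bb (dir s) Plus x y \<and>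
        \<nu> (dir ` {s..<t}) = bb (dir t) Minus x y - bb (dir s) Minus x y)"
  proof -
    have sub: "dir ` {s..t} \<subseteq> dir ` {a..b} \<longleftrightarrow> a \<le> s \<and> t \<le> b" if "s < t" for s t
      using that by (simp add: inj_image_subset_iff inj_def)
    show ?thesis unfolding riU_eq by (auto simp: dir_intervals sub)
  qed
  also have "\<dots> \<longleftrightarrow> (\<forall>s t. a \<le> s \<longrightarrow> s < t \<longrightarrow> t \<le> b \<longrightarrow>
        \<nu> (dir ` {s<..t}) = bb (dir t) Plus x y - bb (dir s) Plus x y \<and>
        \<nu> (dir ` {s..<t}) = bb (dir t) Minus x y - bb (dir s) Minus x y)"
  proof -
    have "(0 < s \<longrightarrow> s < 1 \<longrightarrow> 0 < t \<longrightarrow> t < 1 \<longrightarrow> s < t \<longrightarrow> a \<le> s \<longrightarrow> t \<le> b \<longrightarrow> Q) \<longleftrightarrow>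
        (a \<le> s \<longrightarrow> s < t \<longrightarrow> t \<le> b \<longrightarrow> Q)" for s t Q
      using ab by auto
    then show ?thesis by (simp only:)
  qed
  finally show ?thesis unfolding is_busemann_measure_def by blast
qed

lemma busemann_measure_exists:
  assumes bv: "bv_pair (\<lambda>t. bb (dir t) Plus x y) (\<lambda>t. bb (dir t) Minus x y)"
    and ab: "0 < a" "a < b" "b < 1"
  shows "\<exists>\<nu>. is_busemann_measure bb x y (dir ` {a..b}) \<nu>"
proof -
  obtain \<mu> where sm: "signed_measure (restrict_space borel {a..b}) \<mu>" and \<mu>:
    "\<And>s t. a \<le> s \<Longrightarrow> s < t \<Longrightarrow> t \<le> b \<Longrightarrow> \<mu> {s<..t} = bb (dir t) Plus x y - bb (dir s) Plus x y \<and>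
       \<mu> {s..<t} = bb (dir t) Minus x y - bb (dir s) Minus x y"
    by (rule bv_pair_measure[OF bv ab]) blast
  let ?N = "restrict_space borel (dir ` {a..b})"
  \<comment> \<open>Outside the measurable sets \<nu> takes the default value, as extensionality
    requires.\<close>
  define \<nu> where "\<nu> = restrict (\<lambda>A. \<mu> (dir -` A)) (sets ?N)"
  have \<nu>: "\<nu> (dir ` C) = \<mu> C" if "C \<in> sets borel" "C \<subseteq> {a..b}" for C
  proof -
    have "dir ` C \<in> sets ?N" using that sets_restrict_dir by blast
    moreover have "dir -` (dir ` C) = C" by auto
    ultimately show ?thesis by (simp add: \<nu>_def)
  qed
  have "signed_measure ?N \<nu>" unfolding signed_measure_def
  proof (intro conjI allI impI; (elim conjE)?)
    show "\<nu> {} = 0" using \<nu>[of "{}"] signed_measure_empty[OF sm] by simp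
    fix A :: "nat \<Rightarrow> (real \<times> real) set" assume A: "range A \<subseteq> sets ?N" "disjoint_family A"
    have "\<exists>C \<subseteq> {a..b}. C \<in> sets borel \<and> A i = dir ` C" for i
    proof -
      have "A i \<in> sets ?N" using A by blast
      then show ?thesis unfolding sets_restrict_dir .
    qed
    then obtain C where C: "\<And>i. C i \<subseteq> {a..b}" "\<And>i. C i \<in> sets borel" "\<And>i. A i = dir ` C i" by metis
    have dC: "disjoint_family C" unfolding disjoint_family_on_def
    proof (intro ballI impI)
      fix i j :: nat assume "i \<noteq> j"
      then have "A i \<inter> A j = {}" using A(2) unfolding disjoint_family_on_def by blast
      then show "C i \<inter> C j = {}" unfolding C(3) by blast
    qed
    have "(\<lambda>i. \<mu> (C i)) sums \<mu> (\<Union>i. C i)"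
      by (rule signed_measure_sums[OF sm _ dC]) (use C(1,2) in \<open>simp add: sets_restrict_space_iff\<close>)
    moreover have "\<mu> (C i) = \<nu> (A i)" for i using \<nu>[OF C(2,1)] C(3) by simp
    moreover have "\<mu> (\<Union>i. C i) = \<nu> (\<Union>i. A i)"
    proof -
      have "(\<Union>i. A i) = dir ` (\<Union>i. C i)" using C(3) by blast
      moreover have "\<nu> (dir ` (\<Union>i. C i)) = \<mu> (\<Union>i. C i)" by (rule \<nu>) (use C in auto)
      ultimately show ?thesis by (simp only:)
    qed
    ultimately show "(\<lambda>i. \<nu> (A i)) sums \<nu> (\<Union>i. A i)" by (simp only:)
  qed
  moreover have "\<nu> \<in> extensional (sets ?N)" by (simp add: \<nu>_def)
  moreover have "\<nu> (dir ` {s<..t}) = bb (dir t) Plus x y - bb (dir s) Plus x y \<and>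
        \<nu> (dir ` {s..<t}) = bb (dir t) Minus x y - bb (dir s) Minus x y"
    if "a \<le> s" "s < t" "t \<le> b" for s t
  proof -
    have "{s<..t} \<subseteq> {a..b}" "{s..<t} \<subseteq> {a..b}" using that by auto
    then show ?thesis using \<mu>[OF that] by (simp add: \<nu>)
  qed
  ultimately show ?thesis unfolding is_busemann_measure_arc[OF ab(1,3)] by blast
qed

lemma is_busemann_measure_unique:
  assumes ab: "0 < a" "a < b" "b < 1"
    and 1: "is_busemann_measure bb x y (dir ` {a..b}) \<nu>" and 2: "is_busemann_measure bb x y (dir ` {a..b}) \<nu>'"
  shows "\<nu> = \<nu>'"
proof
  fix A
  let ?N = "restrict_space borel (dir ` {a..b})"
  note 1 = 1[unfolded is_busemann_measure_arc[OF ab(1,3)]]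
  note 2 = 2[unfolded is_busemann_measure_arc[OF ab(1,3)]]
  have sm: "signed_measure ?N \<nu>" "signed_measure ?N \<nu>'" using 1 2 by blast+
  show "\<nu> A = \<nu>' A"
  proof (cases "A \<in> sets ?N")
    case True
    have "signed_measure ?N (\<lambda>A. \<nu> A - \<nu>' A)" unfolding signed_measure_def
    proof (intro conjI allI impI; (elim conjE)?)
      show "\<nu> {} - \<nu>' {} = 0" using sm[THEN signed_measure_empty] by simp
      fix A :: "nat \<Rightarrow> (real \<times> real) set" assume A: "range A \<subseteq> sets ?N" "disjoint_family A"
      then have "A i \<in> sets ?N" for i by blast
      then show "(\<lambda>i. \<nu> (A i) - \<nu>' (A i)) sums (\<nu> (\<Union>i. A i) - \<nu>' (\<Union>i. A i))"
        by (intro sums_diff sm[THEN signed_measure_sums] A(2))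
    qed
    then have "\<nu> A - \<nu>' A = 0"
    proof (rule signed_measure_zero_on_arc[OF _ order_refl ab(2) order_refl _ _ True])
      show "A \<subseteq> dir ` {a..b}" using True unfolding sets_restrict_dir by blast
      fix s t assume st: "a \<le> s" "s < t" "t \<le> b"
      show "\<nu> (dir ` {s<..t}) - \<nu>' (dir ` {s<..t}) = 0" "\<nu> (dir ` {s..<t}) - \<nu>' (dir ` {s..<t}) = 0"
        using 1 2 st by simp_all
    qed
    then show ?thesis by simp
  next
    case False
    then show ?thesis using 1 2 unfolding extensional_def by simp
  qed
qed

text \<open>Existence and uniqueness together give meaning to the definite description in
  \<open>busemann_measure\<close>.\<close>

lemma busemann_measure_arc:
  assumes bv: "bv_pair (\<lambda>t. bb (dir t) Plus x y) (\<lambda>t. bb (dir t) Minus x y)"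
    and ab: "0 < a" "a < b" "b < 1"
  shows "is_busemann_measure bb x y (dir ` {a..b}) (busemann_measure bb x y (dir ` {a..b}))"
proof -
  obtain \<nu> where \<nu>: "is_busemann_measure bb x y (dir ` {a..b}) \<nu>"
    using busemann_measure_exists[of bb x y a b, OF bv ab] by blast
  have "busemann_measure bb x y (dir ` {a..b}) = \<nu>"
    unfolding busemann_measure_def
    by (rule the_equality, rule \<nu>, rule is_busemann_measure_unique[OF ab _ \<nu>])
  then show ?thesis using \<nu> by simp
qed

subsection \<open>Supports\<close>

text \<open>A measurable part S is a block of the partition {S, A - S}, so vanishing total variation
  annihilates it.\<close>

lemma total_variation_eq_0_iff:
  assumes A: "A \<in> sets N"
  shows "total_variation N \<nu> A = 0 \<longleftrightarrow> (\<forall>S\<in>sets N. S \<subseteq> A \<longrightarrow> \<nu> S = 0)"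
proof (intro iffI ballI impI)
  fix S assume tv: "total_variation N \<nu> A = 0" and S: "S \<in> sets N" "S \<subseteq> A"
  define P where "P = {S, A - S}"
  have "finite P \<and> P \<subseteq> sets N \<and> disjoint P \<and> \<Union>P = A"
    using S A unfolding P_def disjoint_def by auto
  then have "(\<Sum>S\<in>P. ennreal \<bar>\<nu> S\<bar>) \<le> total_variation N \<nu> A"
    unfolding total_variation_def by (intro SUP_upper) simp
  then have "(\<Sum>S\<in>P. ennreal \<bar>\<nu> S\<bar>) = 0" using tv by simp
  moreover have "finite P" "S \<in> P" unfolding P_def by simp_all
  ultimately have "ennreal \<bar>\<nu> S\<bar> = 0"
    using sum_eq_0_iff[of P "\<lambda>S. ennreal \<bar>\<nu> S\<bar>"] by blast
  then show "\<nu> S = 0" by simp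
next
  assume *: "\<forall>S\<in>sets N. S \<subseteq> A \<longrightarrow> \<nu> S = 0"
  have "(\<Sum>S\<in>P. ennreal \<bar>\<nu> S\<bar>) = 0" if "P \<subseteq> sets N" "\<Union>P = A" for P
  proof (rule sum.neutral, intro ballI)
    fix S assume "S \<in> P"
    then have "S \<in> sets N" "S \<subseteq> A" using that by blast+
    then show "ennreal \<bar>\<nu> S\<bar> = 0" using * by simp
  qed
  then have "total_variation N \<nu> A \<le> 0"
    unfolding total_variation_def by (intro SUP_least) (simp del: le_zero_eq)
  then show "total_variation N \<nu> A = 0" by simp
qed

lemma locally_constI:
  assumes "0 \<le> c" "c < t" "t < d" "d \<le> 1" "\<And>s \<sigma>. c < s \<Longrightarrow> s < d \<Longrightarrow> \<beta> s \<sigma> x y = k"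
  shows "locally_const \<beta> t x y"
  unfolding locally_const_def left_const_def right_const_def
proof (intro conjI)
  have t: "\<beta> t \<sigma> x y = k" for \<sigma> by (rule assms(5)[OF assms(2,3)])
  show "\<exists>c\<ge>0. c < t \<and> (\<forall>s \<sigma>. c < s \<longrightarrow> s < t \<longrightarrow> \<beta> s \<sigma> x y = \<beta> t Minus x y)"
    by (intro exI[of _ c]) (use assms t in auto)
  show "\<exists>c\<le>1. t < c \<and> (\<forall>s \<sigma>. t < s \<longrightarrow> s < c \<longrightarrow> \<beta> s \<sigma> x y = \<beta> t Plus x y)"
    by (intro exI[of _ d]) (use assms t in auto)
  show "\<beta> t Plus x y = \<beta> t Minus x y" by (simp only: t)
qed

lemma locally_constE:
  assumes "locally_const \<beta> t x y"
  obtains c d where "0 \<le> c" "c < t" "t < d" "d \<le> 1"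
    "\<forall>s \<sigma>. c < s \<longrightarrow> s < d \<longrightarrow> \<beta> s \<sigma> x y = \<beta> t Plus x y"
proof -
  obtain c where c: "0 \<le> c" "c < t" "\<forall>s \<sigma>. c < s \<longrightarrow> s < t \<longrightarrow> \<beta> s \<sigma> x y = \<beta> t Minus x y"
    using assms unfolding locally_const_def left_const_def by blast
  obtain d where d: "d \<le> 1" "t < d" "\<forall>s \<sigma>. t < s \<longrightarrow> s < d \<longrightarrow> \<beta> s \<sigma> x y = \<beta> t Plus x y"
    using assms unfolding locally_const_def right_const_def by blast
  have pm: "\<beta> t \<sigma> x y = \<beta> t Plus x y" for \<sigma>
    using assms unfolding locally_const_def by (cases \<sigma>) simp_all
  have "\<beta> s \<sigma> x y = \<beta> t Plus x y" if "c < s" "s < d" for s \<sigma>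
  proof (cases s t rule: linorder_cases)
    case less
    then show ?thesis using c(3) that pm[of Minus] by simp
  next
    case equal
    then show ?thesis using pm by simp
  next
    case greater
    then show ?thesis using d(3) that by simp
  qed
  then show thesis using that[OF c(1,2) d(2,1)] by blast
qed

lemma bv_pair_limits:
  assumes bv: "bv_pair F F'" and t: "0 < t" "t < 1"
  shows "(F \<longlongrightarrow> F t) (at_right t)" "(F \<longlongrightarrow> F' t) (at_left t)"
proof -
  obtain f f' h h' where f: "increasing_pair f f'" and h: "increasing_pair h h'"
    and F: "\<And>t. 0 < t \<Longrightarrow> t < 1 \<Longrightarrow> F t = f t - h t \<and> F' t = f' t - h' t"
    using bv unfolding bv_pair_def by blast
  have "((\<lambda>s. f s - h s) \<longlongrightarrow> f t - h t) (at_right t)"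
    using f h t unfolding increasing_pair_def by (intro tendsto_diff) blast+
  moreover have "\<forall>\<^sub>F s in at_right t. f s - h s = F s"
    by (rule eventually_at_rightI[OF _ t(2)]) (use F t in simp)
  ultimately show "(F \<longlongrightarrow> F t) (at_right t)"
    using F[OF t] by (simp add: Lim_transform_eventually)
  have "((\<lambda>s. f s - h s) \<longlongrightarrow> f' t - h' t) (at_left t)"
    using f h t unfolding increasing_pair_def by (intro tendsto_diff) blast+
  moreover have "\<forall>\<^sub>F s in at_left t. f s - h s = F s"
    by (rule eventually_at_leftI[OF _ t(1)]) (use F t in simp)
  ultimately show "(F \<longlongrightarrow> F' t) (at_left t)"
    using F[OF t] by (simp add: Lim_transform_eventually)
qed

lemma open_dir_vimage:
  assumes "open U" "dir t \<in> U"
  obtains e where "e > 0" "\<And>s. \<bar>s - t\<bar> < e \<Longrightarrow> dir s \<in> U"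
proof -
  have "open (dir -` U)" by (rule open_vimage[OF assms(1) continuous_on_dir])
  then obtain e where "e > 0" "ball t e \<subseteq> dir -` U" using assms(2) open_contains_ball by blast
  then show thesis by (intro that[of e]) (auto simp: subset_iff dist_real_def abs_minus_commute)
qed

text \<open>Where the Busemann function is constant, half-open intervals have mass zero, hence so
  has every measurable set by the uniqueness argument. Conversely, absence of mass near t makes each
  of the two one-sided versions constant there.\<close>

theorem busemann_support_iff:
  assumes bv: "bv_pair (\<lambda>t. bb (dir t) Plus x y) (\<lambda>t. bb (dir t) Minus x y)" and t: "0 < t" "t < 1"
  shows "dir t \<in> busemann_support bb x y \<longleftrightarrow> \<not> locally_const (\<lambda>t. bb (dir t)) t x y"
proof
  assume "dir t \<in> busemann_support bb x y"
  then obtain \<zeta> \<eta> where *: "\<zeta> \<in> riU" "\<eta> \<in> riU" "prec \<zeta> \<eta>"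
      "dir t \<in> signed_support (dir_cc \<zeta> \<eta>) (busemann_measure bb x y (dir_cc \<zeta> \<eta>))"
    unfolding busemann_support_def by blast
  obtain a b where \<zeta>: "\<zeta> = dir a" "0 < a" "a < 1" and \<eta>: "\<eta> = dir b" "0 < b" "b < 1"
    using *(1,2) unfolding riU_eq by auto
  then have ab: "0 < a" "a < b" "b < 1" using *(3) by simp_all
  then have supp: "dir t \<in> signed_support (dir ` {a..b}) (busemann_measure bb x y (dir ` {a..b}))"
    using *(4) unfolding \<zeta>(1) \<eta>(1) by (simp add: dir_intervals)
  let ?K = "dir ` {a..b}" and ?N = "restrict_space borel (dir ` {a..b})"
  let ?\<nu> = "busemann_measure bb x y (dir ` {a..b})"
  note \<nu> = busemann_measure_arc[of bb x y a b, OF bv ab, unfolded is_busemann_measure_arc[OF ab(1,3)]]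
  show "\<not> locally_const (\<lambda>t. bb (dir t)) t x y"
  proof
    assume "locally_const (\<lambda>t. bb (dir t)) t x y"
    then obtain c d where cd: "0 \<le> c" "c < t" "t < d" "d \<le> 1"
      and const: "\<forall>s \<sigma>. c < s \<longrightarrow> s < d \<longrightarrow> bb (dir s) \<sigma> x y = bb (dir t) Plus x y"
      by (rule locally_constE)
    \<comment> \<open>Midpoints, so that the closed interval from lo to hi still lies where the
      Busemann function is constant.\<close>
    define lo hi where "lo = (c + t) / 2" and "hi = (t + d) / 2"
    have lohi: "c < lo" "lo < t" "t < hi" "hi < d" using cd by (auto simp: lo_def hi_def)
    define F where "F = ?K \<inter> {v. fst v \<le> lo \<or> hi \<le> fst v}"
    have "closed ?K"
      by (intro compact_imp_closed compact_continuous_image continuous_on_dir) simp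
    then have clF: "closed F" unfolding F_def
      by (intro closed_Int closed_Collect_disj closed_Collect_le continuous_intros)
    have FK: "F \<subseteq> ?K" unfolding F_def by blast
    have K_diff: "?K - F = dir ` ({a..b} \<inter> {lo<..<hi})"
    proof
      show "?K - F \<subseteq> dir ` ({a..b} \<inter> {lo<..<hi})"
      proof
        fix v assume v: "v \<in> ?K - F"
        then obtain r where r: "v = dir r" "a \<le> r" "r \<le> b" by auto
        then have "lo < r" "r < hi" using v unfolding F_def by simp_all
        then show "v \<in> dir ` ({a..b} \<inter> {lo<..<hi})" using r by simp
      qed
      show "dir ` ({a..b} \<inter> {lo<..<hi}) \<subseteq> ?K - F" unfolding F_def by auto
    qed
    have KF: "?K - F \<in> sets ?N" unfolding K_diff by (rule dir_image_in_sets) simp_all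
    have "\<forall>S\<in>sets ?N. S \<subseteq> ?K - F \<longrightarrow> ?\<nu> S = 0"
    proof (intro ballI impI)
      fix S assume S: "S \<in> sets ?N" "S \<subseteq> ?K - F"
      show "?\<nu> S = 0"
      proof (cases "max a lo < min b hi")
        case True
        show ?thesis
        proof (rule signed_measure_zero_on_arc[OF conjunct1[OF \<nu>] _ True _ _ _ S(1)])
          have "S \<subseteq> dir ` ({a..b} \<inter> {lo<..<hi})" using S(2) unfolding K_diff .
          also have "\<dots> \<subseteq> dir ` {max a lo..min b hi}" by (rule image_mono) auto
          finally show "S \<subseteq> dir ` {max a lo..min b hi}" .
          fix r u assume ru: "max a lo \<le> r" "r < u" "u \<le> min b hi"
          have "c < r" "r < d" "c < u" "u < d" using ru lohi by auto
          then have "bb (dir r) \<sigma> x y = bb (dir t) Plus x y" "bb (dir u) \<sigma> x y = bb (dir t) Plus x y" for \<sigma>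
            using const by blast+
          then show "?\<nu> (dir ` {r<..u}) = 0" "?\<nu> (dir ` {r..<u}) = 0"
            using \<nu>[THEN conjunct2, THEN conjunct2, THEN spec[of _ r], THEN spec[of _ u]] ru by simp_all
        qed simp_all
      next
        case False
        have "S = {}"
        proof (rule ccontr)
          assume "S \<noteq> {}"
          then obtain v where "v \<in> S" by blast
          then have "v \<in> dir ` ({a..b} \<inter> {lo<..<hi})" using S(2) unfolding K_diff by blast
          then obtain r where "a \<le> r" "r \<le> b" "lo < r" "r < hi" by auto
          then show False using False ab by linarith
        qed
        then show ?thesis using signed_measure_empty[OF conjunct1[OF \<nu>]] by simp
      qed
    qed
    then have "total_variation ?N ?\<nu> (?K - F) = 0" unfolding total_variation_eq_0_iff[OF KF] .
    then have "signed_support ?K ?\<nu> \<subseteq> F" unfolding signed_support_def using clF FK by blast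
    then have "dir t \<in> F" using supp by blast
    then show False using lohi unfolding F_def by simp
  qed
next
  assume nlc: "\<not> locally_const (\<lambda>t. bb (dir t)) t x y"
  show "dir t \<in> busemann_support bb x y"
  proof (rule ccontr)
    assume ns: "dir t \<notin> busemann_support bb x y"
    define a b where "a = t / 2" and "b = (1 + t) / 2"
    have ab: "0 < a" "a < b" "b < 1" and atb: "a < t" "t < b" using t by (auto simp: a_def b_def)
    let ?K = "dir ` {a..b}" and ?N = "restrict_space borel (dir ` {a..b})"
    let ?\<nu> = "busemann_measure bb x y (dir ` {a..b})"
    note \<nu> = busemann_measure_arc[of bb x y a b, OF bv ab, unfolded is_busemann_measure_arc[OF ab(1,3)]]
    have "signed_support ?K ?\<nu> \<subseteq> busemann_support bb x y"
      unfolding busemann_support_def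
      using ab by (intro Union_upper CollectI exI[of _ "dir a"] exI[of _ "dir b"]) (simp add: dir_intervals)
    then have "dir t \<notin> signed_support ?K ?\<nu>" using ns by blast
    then obtain F where F: "closed F" "F \<subseteq> ?K" "total_variation ?N ?\<nu> (?K - F) = 0" "dir t \<notin> F"
      unfolding signed_support_def by blast
    have "?K \<in> sets ?N" by (rule dir_image_in_sets) simp_all
    moreover have "F \<in> sets ?N"
      using F(1,2) dir_image_borel[of "{a..b}"] by (simp add: sets_restrict_space_iff borel_closed)
    ultimately have KF: "?K - F \<in> sets ?N" by (rule sets.Diff)
    have zero: "?\<nu> S = 0" if "S \<in> sets ?N" "S \<subseteq> ?K - F" for S
      using F(3) that unfolding total_variation_eq_0_iff[OF KF] by blast
    obtain e where e: "e > 0" "\<And>s. \<bar>s - t\<bar> < e \<Longrightarrow> dir s \<in> - F"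
      by (rule open_dir_vimage[of "- F" t]) (use F in auto)
    define c d where "c = max a (t - e)" and "d = min b (t + e)"
    have cd: "0 \<le> c" "c < t" "t < d" "d \<le> 1" "a \<le> c" "d \<le> b"
      using atb ab e(1) by (auto simp: c_def d_def)
    have step: "bb (dir s) \<sigma> x y = bb (dir u) \<sigma> x y" if su: "c < s" "s < u" "u < d" for s u \<sigma>
    proof -
      have nF: "dir r \<notin> F" if "s \<le> r" "r \<le> u" for r
      proof -
        have "\<bar>r - t\<bar> < e" using su that unfolding c_def d_def by auto
        then show ?thesis using e(2) by blast
      qed
      have ivl: "{s<..u} \<subseteq> {a..b}" "{s..<u} \<subseteq> {a..b}" using su cd by auto
      have "dir ` {s<..u} \<in> sets ?N" "dir ` {s..<u} \<in> sets ?N"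
        by (rule dir_image_in_sets[OF ivl(1)], simp, rule dir_image_in_sets[OF ivl(2)], simp)
      moreover have "dir ` {s<..u} \<subseteq> ?K - F" "dir ` {s..<u} \<subseteq> ?K - F"
      proof -
        show "dir ` {s<..u} \<subseteq> ?K - F"
        proof (rule image_subsetI)
          fix r assume r: "r \<in> {s<..u}"
          then have "dir r \<in> ?K" using ivl(1) by blast
          moreover have "dir r \<notin> F" by (rule nF) (use r in simp_all)
          ultimately show "dir r \<in> ?K - F" by blast
        qed
        show "dir ` {s..<u} \<subseteq> ?K - F"
        proof (rule image_subsetI)
          fix r assume r: "r \<in> {s..<u}"
          then have "dir r \<in> ?K" using ivl(2) by blast
          moreover have "dir r \<notin> F" by (rule nF) (use r in simp_all)
          ultimately show "dir r \<in> ?K - F" by blast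
        qed
      qed
      ultimately have "?\<nu> (dir ` {s<..u}) = 0" "?\<nu> (dir ` {s..<u}) = 0" using zero by blast+
      moreover have "a \<le> s" "u \<le> b" using su cd by auto
      ultimately show ?thesis
        using \<nu>[THEN conjunct2, THEN conjunct2, THEN spec[of _ s], THEN spec[of _ u]] su(2)
        by (cases \<sigma>) simp_all
    qed
    have const: "bb (dir s) \<sigma> x y = bb (dir t) \<sigma> x y" if "c < s" "s < d" for s \<sigma>
    proof (cases s t rule: linorder_cases)
      case less
      then show ?thesis by (rule step[OF that(1) _ cd(3)])
    next
      case greater
      then show ?thesis by (rule step[OF cd(2) _ that(2), symmetric])
    qed simp
    have "\<forall>\<^sub>F s in at_left t. bb (dir s) Plus x y = bb (dir t) Plus x y"
      by (rule eventually_at_leftI[OF _ cd(2)]) (rule const, use cd in auto)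
    then have "((\<lambda>s. bb (dir s) Plus x y) \<longlongrightarrow> bb (dir t) Plus x y) (at_left t)"
      by (rule tendsto_eventually)
    \<comment> \<open>So far each sign is constant separately. The left limit of the
      \<open>Plus\<close> values is the \<open>Minus\<close> value at t, which identifies the two
      constants.\<close>
    then have pm: "bb (dir t) Plus x y = bb (dir t) Minus x y"
      by (rule tendsto_unique[OF trivial_limit_at_left_real _ bv_pair_limits(2)[OF bv t]])
    have "bb (dir s) \<sigma> x y = bb (dir t) Plus x y" if "c < s" "s < d" for s \<sigma>
      using const[OF that, of \<sigma>] pm by (cases \<sigma>) simp_all
    then have "locally_const (\<lambda>t. bb (dir t)) t x y" by (rule locally_constI[OF cd(1-4)])
    then show False using nlc by blast
  qed
qed

section \<open>Isolated support points and one-sided constancy\<close>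

lemma locally_const_imp_const_on_interval:
  assumes lc: "\<And>s. c < s \<Longrightarrow> s < d \<Longrightarrow> locally_const \<beta> s x y"
    and s: "c < s" "s < d" and s': "c < s'" "s' < d"
  shows "\<beta> s \<sigma> x y = \<beta> s' \<tau> x y"
proof -
  \<comment> \<open>Local constancy is turned into constancy on the whole interval through a
    vanishing derivative.\<close>
  have "DERIV (\<lambda>s. \<beta> s Plus x y) r :> 0" if r: "c < r" "r < d" for r
  proof -
    obtain u v where uv: "0 \<le> u" "u < r" "r < v" "v \<le> 1"
        "\<forall>s \<sigma>. u < s \<longrightarrow> s < v \<longrightarrow> \<beta> s \<sigma> x y = \<beta> r Plus x y"
      by (rule locally_constE[OF lc[OF r]])
    show ?thesis
    proof (rule has_field_derivative_transform_within_open)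
      show "DERIV (\<lambda>s. \<beta> r Plus x y) r :> 0" by (rule DERIV_const)
      show "\<beta> r Plus x y = \<beta> s Plus x y" if "s \<in> {u<..<v}" for s
        using uv(5) that by (metis greaterThanLessThan_iff)
    qed (use uv in simp_all)
  qed
  moreover have "c < d" using s by simp
  ultimately have "\<beta> s Plus x y = \<beta> s' Plus x y"
    by (intro DERIV_isconst3[of c d s s' "\<lambda>s. \<beta> s Plus x y"]) (use s s' in simp_all)
  moreover have "\<beta> s \<sigma> x y = \<beta> s Plus x y"
    using lc[OF s] unfolding locally_const_def by (cases \<sigma>) simp_all
  moreover have "\<beta> s' \<tau> x y = \<beta> s' Plus x y"
    using lc[OF s'] unfolding locally_const_def by (cases \<tau>) simp_all
  ultimately show ?thesis by simp
qed

text \<open>An isolated support point has a punctured neighbourhood free of the support, with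
  constant values on either side; the one-sided limits identify these constants with the
  \<open>Minus\<close> and \<open>Plus\<close> values at t.\<close>

theorem isolated_support_imp_one_sided_const:
  assumes bv: "bv_pair (\<lambda>t. bb (dir t) Plus x y) (\<lambda>t. bb (dir t) Minus x y)" and t: "0 < t" "t < 1"
    and iso: "\<And>v. v \<in> busemann_support bb x y \<Longrightarrow> v isolated_in busemann_support bb x y"
  shows "left_const (\<lambda>t. bb (dir t)) t x y \<and> right_const (\<lambda>t. bb (dir t)) t x y"
proof (cases "dir t \<in> busemann_support bb x y")
  case False
  then show ?thesis using busemann_support_iff[of bb x y t, OF bv t] unfolding locally_const_def by blast
next
  case True
  let ?\<beta> = "\<lambda>t. bb (dir t)"
  obtain U where U: "open U" "U \<inter> busemann_support bb x y = {dir t}"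
    using iso[OF True] unfolding isolated_in_def by blast
  then have tU: "dir t \<in> U" by blast
  obtain e where e: "e > 0" "\<And>s. \<bar>s - t\<bar> < e \<Longrightarrow> dir s \<in> U"
    by (rule open_dir_vimage[OF U(1) tU]) blast
  define c d where "c = max 0 (t - e)" and "d = min 1 (t + e)"
  have cd: "0 \<le> c" "c < t" "t < d" "d \<le> 1" using t e(1) by (auto simp: c_def d_def)
  have lc: "locally_const ?\<beta> s x y" if "c < s" "s < d" "s \<noteq> t" for s
  proof -
    have s: "0 < s" "s < 1" and "\<bar>s - t\<bar> < e" using that unfolding c_def d_def by auto
    then have "dir s \<in> U" using e(2) by blast
    then have "dir s \<notin> busemann_support bb x y" using U(2) that(3) by (metis IntI inj_dir singletonD)
    then show ?thesis using busemann_support_iff[of bb x y s, OF bv s] by blast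
  qed
  have "?\<beta> s \<sigma> x y = ?\<beta> t Minus x y" if s: "c < s" "s < t" for s \<sigma>
  proof -
    have "?\<beta> r Plus x y = ?\<beta> s \<sigma> x y" if "c < r" "r < t" for r
      by (rule locally_const_imp_const_on_interval[of c t]) (rule lc, use that s cd in simp_all)
    then have "\<forall>\<^sub>F r in at_left t. ?\<beta> r Plus x y = ?\<beta> s \<sigma> x y"
      by (intro eventually_at_leftI[OF _ cd(2)]) (simp only: greaterThanLessThan_iff)
    then have "((\<lambda>r. ?\<beta> r Plus x y) \<longlongrightarrow> ?\<beta> s \<sigma> x y) (at_left t)"
      by (rule tendsto_eventually)
    then show ?thesis
      by (rule tendsto_unique[OF trivial_limit_at_left_real _ bv_pair_limits(2)[OF bv t]])
  qed
  then have "left_const ?\<beta> t x y" unfolding left_const_def using cd by blast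
  moreover have "?\<beta> s \<sigma> x y = ?\<beta> t Plus x y" if s: "t < s" "s < d" for s \<sigma>
  proof -
    have "?\<beta> r Plus x y = ?\<beta> s \<sigma> x y" if "t < r" "r < d" for r
      by (rule locally_const_imp_const_on_interval[of t d]) (rule lc, use that s cd in simp_all)
    then have "\<forall>\<^sub>F r in at_right t. ?\<beta> r Plus x y = ?\<beta> s \<sigma> x y"
      by (intro eventually_at_rightI[OF _ cd(3)]) (simp only: greaterThanLessThan_iff)
    then have "((\<lambda>r. ?\<beta> r Plus x y) \<longlongrightarrow> ?\<beta> s \<sigma> x y) (at_right t)"
      by (rule tendsto_eventually)
    then show ?thesis
      by (rule tendsto_unique[OF trivial_limit_at_right_real _ bv_pair_limits(1)[OF bv t]])
  qed
  then have "right_const ?\<beta> t x y" unfolding right_const_def using cd by blast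
  ultimately show ?thesis ..
qed

section \<open>Coalescence in a fixed direction\<close>

subsection \<open>Planar combinatorics\<close>

definition coalesces :: "(site \<Rightarrow> site) \<Rightarrow> site \<Rightarrow> site \<Rightarrow> bool" where
  "coalesces f x y \<longleftrightarrow> (\<exists>m n. (f ^^ m) x = (f ^^ n) y)"

lemma coalesces_sym: "coalesces f x y \<Longrightarrow> coalesces f y x"
  unfolding coalesces_def by metis

lemma coalesces_trans:
  assumes "coalesces f x y" "coalesces f y z"
  shows "coalesces f x z"
proof -
  obtain m n where 1: "(f ^^ m) x = (f ^^ n) y" using assms(1) unfolding coalesces_def by blast
  obtain k l where 2: "(f ^^ k) y = (f ^^ l) z" using assms(2) unfolding coalesces_def by blast
  have "(f ^^ (k + m)) x = (f ^^ (k + n)) y" by (simp add: funpow_add 1)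
  also have "\<dots> = (f ^^ (n + k)) y" by (simp only: add.commute)
  also have "\<dots> = (f ^^ (n + l)) z" by (simp add: funpow_add 2)
  finally show ?thesis unfolding coalesces_def by blast
qed

lemma coalesces_iterate: "coalesces f x ((f ^^ n) x)"
  unfolding coalesces_def by (intro exI[of _ n] exI[of _ 0]) simp

text \<open>Planarity: a path started between two paths that merge is squeezed between them.\<close>

lemma coalesces_between:
  assumes f: "up_right_step f" and lev: "lev x = lev y" "lev y = lev z"
    and le: "fst x \<le> fst y" "fst y \<le> fst z" and c: "coalesces f x z"
  shows "coalesces f x y"
proof -
  obtain m n where mn: "(f ^^ m) x = (f ^^ n) z" using c unfolding coalesces_def by blast
  have "lev x + int m = lev z + int n"
    using arg_cong[OF mn, of lev] by (simp add: lev_iterate[OF f])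
  then have m: "n = m" using lev by simp
  have "fst ((f ^^ m) x) \<le> fst ((f ^^ m) y)" by (rule iterate_mono[OF f f _ lev(1) le(1)])
  moreover have "fst ((f ^^ m) y) \<le> fst ((f ^^ m) z)" by (rule iterate_mono[OF f f _ lev(2) le(2)])
  ultimately have "fst ((f ^^ m) x) = fst ((f ^^ m) y)" using mn m by simp
  then have "(f ^^ m) x = (f ^^ m) y" by (intro site_eqI) (simp_all add: lev_iterate[OF f] lev)
  then show ?thesis unfolding coalesces_def by blast
qed

definition diag :: "int \<Rightarrow> site" where
  "diag i = (i, - i)"

lemma lev_diag [simp]: "lev (diag i) = 0" and fst_diag [simp]: "fst (diag i) = i"
  and snd_diag [simp]: "snd (diag i) = - i"
  by (simp_all add: diag_def)

text \<open>At \<open>z\<close> the sites \<open>z + diag i\<close>, \<open>k < i \<le> l\<close>, are separated from both neighbouring blocks of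
  their antidiagonal and have no ancestors \<open>N\<close> levels below.\<close>

definition barren_gap :: "nat \<Rightarrow> int \<Rightarrow> int \<Rightarrow> (site \<Rightarrow> site) \<Rightarrow> site \<Rightarrow> bool" where
  "barren_gap N k l f z \<longleftrightarrow>
     \<not> coalesces f (z + diag k) (z + diag (k + 1)) \<and> \<not> coalesces f (z + diag l) (z + diag (l + 1)) \<and>
     (\<forall>x. lev x = lev z - int N \<longrightarrow> (\<forall>i\<in>{k+1..l}. (f ^^ N) x \<noteq> z + diag i))"

text \<open>A path from outside the block that merged with the one from its first site would squeeze
  the separated pair at that end of the block, which \<open>coalesces_between\<close> turns into a
  contradiction.\<close>

lemma barren_gap_avoid:
  assumes f: "up_right_step f" and kl: "k < l" and z: "barren_gap N k l f z"
    and y: "lev y = lev z" "\<And>i. i \<in> {k+1..l} \<Longrightarrow> y \<noteq> z + diag i"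
  shows "\<not> coalesces f y (z + diag (k + 1))"
proof
  assume c: "coalesces f y (z + diag (k + 1))"
  define i where "i = fst y - fst z"
  have yi: "y = z + diag i" by (rule site_eqI) (simp_all add: i_def y(1) lev_add)
  then have "i \<notin> {k+1..l}" using y(2) by blast
  then consider "i \<le> k" | "l + 1 \<le> i" by force
  then show False
  proof cases
    case 1
    have "coalesces f y (z + diag k)"
      by (rule coalesces_between[OF f _ _ _ _ c]) (use 1 in \<open>simp_all add: yi lev_add\<close>)
    then have "coalesces f (z + diag k) (z + diag (k + 1))"
      by (rule coalesces_trans[OF coalesces_sym c])
    then show False using z unfolding barren_gap_def by blast
  next
    case 2
    note c = coalesces_sym[OF c]
    have "coalesces f (z + diag (k + 1)) (z + diag l)"
      by (rule coalesces_between[OF f _ _ _ _ c]) (use 2 kl in \<open>simp_all add: yi lev_add\<close>)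
    moreover have "coalesces f (z + diag (k + 1)) (z + diag (l + 1))"
      by (rule coalesces_between[OF f _ _ _ _ c]) (use 2 kl in \<open>simp_all add: yi lev_add\<close>)
    ultimately have "coalesces f (z + diag l) (z + diag (l + 1))"
      by (rule coalesces_trans[OF coalesces_sym])
    then show False using z unfolding barren_gap_def by blast
  qed
qed

text \<open>With a large enough spacing L, blocks on the same antidiagonal are disjoint, and box
  sites on different antidiagonals are at least L levels apart.\<close>

definition lattice_box :: "nat \<Rightarrow> nat \<Rightarrow> site set" where
  "lattice_box L n = (\<lambda>(i, j). (int L * int i, int L * int j)) ` ({..<n} \<times> {..<n})"

lemma card_lattice_box: "0 < L \<Longrightarrow> card (lattice_box L n) = n * n"
  unfolding lattice_box_def by (subst card_image) (auto simp: inj_on_def)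

lemma finite_lattice_box [simp]: "finite (lattice_box L n)"
  unfolding lattice_box_def by simp

lemma lattice_box_bounds:
  assumes "z \<in> lattice_box L n"
  shows "0 \<le> fst z" "0 \<le> snd z" "lev z \<le> 2 * int n * int L"
proof -
  obtain i j where z: "z = (int L * int i, int L * int j)" "i < n" "j < n"
    using assms unfolding lattice_box_def by auto
  show "0 \<le> fst z" "0 \<le> snd z" using z by simp_all
  have "int L * int i \<le> int L * int n" "int L * int j \<le> int L * int n"
    using z by (simp_all add: mult_left_mono)
  then show "lev z \<le> 2 * int n * int L" using z by (simp add: algebra_simps)
qed

text \<open>The path from the lower block cannot enter the block at z: on the same level the blocks
  are disjoint, and from a lower level it would provide an ancestor N levels below, which
  \<open>barren_gap\<close> forbids. So \<open>barren_gap_avoid\<close> applies.\<close>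

lemma barren_gaps_separated:
  assumes f: "up_right_step f" and kl: "k < l" and L: "N \<le> L" "l - k \<le> int L" "0 < L"
    and z: "z \<in> lattice_box L n" "barren_gap N k l f z" and z': "z' \<in> lattice_box L n" "z' \<noteq> z"
    and lev: "lev z' \<le> lev z"
  shows "\<not> coalesces f (z' + diag (k + 1)) (z + diag (k + 1))"
proof -
  let ?m = "z' + diag (k + 1)"
  obtain i j where zij: "z = (int L * int i, int L * int j)" using z(1) unfolding lattice_box_def by auto
  obtain i' j' where zij': "z' = (int L * int i', int L * int j')" using z'(1) unfolding lattice_box_def by auto
  define d where "d = nat (lev z - lev z')"
  let ?y = "(f ^^ d) ?m"
  have lev_y: "lev ?y = lev z" using lev by (simp add: lev_iterate[OF f] lev_add d_def)
  have "?y \<noteq> z + diag a" if a: "a \<in> {k+1..l}" for a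
  proof (cases "lev z' = lev z")
    case True
    then have d: "d = 0" by (simp add: d_def)
    have "int L * (int i' + int j') = int L * (int i + int j)"
      using True zij zij' by (simp add: algebra_simps)
    then have ij: "int i' + int j' = int i + int j" using L(3) by simp
    then have ne: "int i' \<noteq> int i" using z'(2) zij zij' by auto
    have "fst ?m \<noteq> fst (z + diag a)"
    proof
      assume "fst ?m = fst (z + diag a)"
      then have eq: "int L * (int i' - int i) = a - (k + 1)" by (simp add: zij zij' algebra_simps)
      show False
      proof (cases "int i < int i'")
        case True
        then have "int L * 1 \<le> int L * (int i' - int i)" by (intro mult_left_mono) simp_all
        then show False using eq a L(2) by simp
      next
        case False
        then have "int L * 1 \<le> int L * (int i - int i')" using ne by (intro mult_left_mono) simp_all
        then show False using eq a L(3) by (simp add: algebra_simps)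
      qed
    qed
    then show ?thesis unfolding d funpow_0 by metis
  next
    case False
    have "int L * ((int i + int j) - (int i' + int j')) = lev z - lev z'"
      by (simp add: zij zij' algebra_simps)
    moreover have "0 < lev z - lev z'" using lev False by simp
    ultimately have "0 < (int i + int j) - (int i' + int j')" by (metis L(3) of_nat_0_less_iff zero_less_mult_pos)
    then have "int L * 1 \<le> int L * ((int i + int j) - (int i' + int j'))" by (intro mult_left_mono) simp_all
    also have "\<dots> = lev z - lev z'" by (simp add: zij zij' algebra_simps)
    finally have dN: "N \<le> d" using L(1) unfolding d_def by simp
    have "lev ((f ^^ (d - N)) ?m) = lev z - int N"
      using dN lev by (simp add: lev_iterate[OF f] lev_add d_def of_nat_diff)
    then have ne: "(f ^^ N) ((f ^^ (d - N)) ?m) \<noteq> z + diag a"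
      using z(2) a unfolding barren_gap_def by blast
    have eq: "(f ^^ N) ((f ^^ (d - N)) ?m) = ?y"
      using dN funpow_add[of N "d - N" f] by (metis comp_apply le_add_diff_inverse)
    show ?thesis using ne unfolding eq .
  qed
  then have "\<not> coalesces f ?y (z + diag (k + 1))"
    by (rule barren_gap_avoid[OF f kl z(2) lev_y])
  then show ?thesis using coalesces_trans[OF coalesces_sym[OF coalesces_iterate]] by blast
qed

lemma card_barren_gaps:
  assumes f: "up_right_step f" and kl: "k < l" and L: "N \<le> L" "l - k \<le> int L" "0 < L"
  shows "card {z \<in> lattice_box L n. barren_gap N k l f z} \<le> 2 * n * L + 1"
proof -
  define S where "S = {z \<in> lattice_box L n. barren_gap N k l f z}"
  \<comment> \<open>No site of the box has a level above H, so all representatives can be followed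
    to this antidiagonal. Coordinates only grow along paths, which leaves H + 1 possible exit
    sites.\<close>
  define H where "H = 2 * int n * int L"
  define F where "F z = (f ^^ nat (H - lev z)) (z + diag (k + 1))" for z
  have lev_F: "lev (F z) = H" if "z \<in> S" for z
    using lattice_box_bounds(3)[of z L n] that by (simp add: F_def S_def H_def lev_iterate[OF f] lev_add)
  have "inj_on (\<lambda>z. fst (F z)) S"
  proof (rule inj_onI, rule ccontr)
    fix z z' assume *: "z \<in> S" "z' \<in> S" "fst (F z) = fst (F z')" "z \<noteq> z'"
    have eq: "F z = F z'" by (rule site_eqI) (use * lev_F in simp_all)
    then have c: "coalesces f (z + diag (k + 1)) (z' + diag (k + 1))"
      unfolding coalesces_def F_def by blast
    show False
    proof (cases "lev z' \<le> lev z")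
      case True
      show False
        using barren_gaps_separated[OF f kl L _ _ _ _ True] * coalesces_sym[OF c] unfolding S_def by blast
    next
      case False
      then have "lev z \<le> lev z'" by simp
      from barren_gaps_separated[OF f kl L _ _ _ _ this] show False using * c unfolding S_def by blast
    qed
  qed
  moreover have "(\<lambda>z. fst (F z)) ` S \<subseteq> {k + 1..k + 1 + H}"
  proof (intro image_subsetI)
    fix z assume z: "z \<in> S"
    then have zb: "0 \<le> fst z" "0 \<le> snd z" using lattice_box_bounds unfolding S_def by blast+
    have "fst (z + diag (k + 1)) \<le> fst (F z)"
      using fst_iterate_bounds[OF f] unfolding F_def by blast
    moreover have "snd (z + diag (k + 1)) \<le> snd (F z)"
      using snd_iterate_bounds[OF f] unfolding F_def by blast
    ultimately show "fst (F z) \<in> {k + 1..k + 1 + H}"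
      using lev_F[OF z] zb by (simp add: lev_def)
  qed
  ultimately have "card S \<le> card {k + 1..k + 1 + H}" by (rule card_inj_on_le) simp
  also have "\<dots> = 2 * n * L + 1" unfolding H_def by (simp add: nat_add_distrib nat_mult_distrib)
  finally show ?thesis unfolding S_def .
qed

subsection \<open>Blocking a gap by the weights below it\<close>

context busemann_cocycle
begin

lemma leg_weight:
  assumes t: "0 < t" "t < 1" and u: "u = e1 \<or> u = e2"
    and A: "\<And>j. j < n \<Longrightarrow> A \<le> w (x + (int j * fst u, int j * snd u))"
  shows "real n * A \<le> \<beta> t \<sigma> x (x + (int n * fst u, int n * snd u))"
  using A
proof (induction n)
  case 0
  have "x + (int 0 * fst u, int 0 * snd u) = x" by (simp add: prod_eq_iff)
  then show ?case using beta_refl[OF t] by simp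
next
  case (Suc n)
  let ?y = "x + (int n * fst u, int n * snd u)" and ?z = "x + (int (Suc n) * fst u, int (Suc n) * snd u)"
  have "real n * A \<le> \<beta> t \<sigma> x ?y" by (rule Suc.IH, rule Suc.prems) simp
  moreover have "A \<le> w ?y" by (rule Suc.prems) simp
  moreover have "w ?y \<le> \<beta> t \<sigma> ?y ?z"
    by (rule weight_le_step[OF t]) (use u in \<open>auto simp: prod_eq_iff algebra_simps\<close>)
  moreover have "\<beta> t \<sigma> x ?y + \<beta> t \<sigma> ?y ?z = \<beta> t \<sigma> x ?z" by (rule cocycle[OF t])
  ultimately have "real n * A + A \<le> \<beta> t \<sigma> x ?z" by linarith
  then show ?case by (simp add: algebra_simps)
qed

text \<open>Any path from far below into the gap collects only low weights, whereas a detour along the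
  row of \<open>diag k\<close> or the column of \<open>diag (l + 1)\<close> collects many high ones.\<close>

lemma gap_blocked:
  assumes t: "0 < t" "t < 1" and kl: "k < l" and \<epsilon>: "0 < \<epsilon>"
    and low: "\<And>x. - int N \<le> lev x \<Longrightarrow> lev x < 0 \<Longrightarrow> fst x \<le> l \<Longrightarrow> snd x < - k \<Longrightarrow> \<alpha> - \<epsilon> \<le> w x \<and> w x \<le> \<alpha>"
    and row: "\<And>m. 1 \<le> m \<Longrightarrow> m \<le> int N \<Longrightarrow> \<alpha> + 2 * \<epsilon> \<le> w (k - m, - k)"
    and col: "\<And>m. 1 \<le> m \<Longrightarrow> m \<le> int N \<Longrightarrow> \<alpha> + 2 * \<epsilon> \<le> w (l + 1, - (l + 1) - m)"
    and R0: "0 \<le> R" and R: "\<And>i. i \<in> {k+1..l} \<Longrightarrow> \<beta> t \<sigma> (diag i) (diag k) \<le> R \<and> \<beta> t \<sigma> (diag i) (diag (l + 1)) \<le> R"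
    and N: "3 * real_of_int (l + 1 - k) + 2 * R / \<epsilon> < real N"
    and x: "lev x = - int N" and i: "i \<in> {k+1..l}"
  shows "bpath \<beta> t \<sigma> x N \<noteq> diag i"
proof
  assume hit: "bpath \<beta> t \<sigma> x N = diag i"
  have bx: "fst x \<le> fst (bpath \<beta> t \<sigma> x j)" "snd x \<le> snd (bpath \<beta> t \<sigma> x j)" for j
    unfolding bpath_def using fst_iterate_bounds[OF up_right_bstep] snd_iterate_bounds[OF up_right_bstep] by blast+
  have bi: "fst (bpath \<beta> t \<sigma> x j) \<le> i" "snd (bpath \<beta> t \<sigma> x j) \<le> - i" if "j \<le> N" for j
  proof -
    have e: "bpath \<beta> t \<sigma> x N = (bstep \<beta> t \<sigma> ^^ (N - j)) (bpath \<beta> t \<sigma> x j)"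
      using bpath_add[of \<beta> t \<sigma> x j "N - j"] that by (simp add: bpath_def)
    have "fst v \<le> fst ((bstep \<beta> t \<sigma> ^^ n) v)" "snd v \<le> snd ((bstep \<beta> t \<sigma> ^^ n) v)" for n v
      using fst_iterate_bounds[OF up_right_bstep] snd_iterate_bounds[OF up_right_bstep] by blast+
    from this[where v = "bpath \<beta> t \<sigma> x j" and n = "N - j"]
    show "fst (bpath \<beta> t \<sigma> x j) \<le> i" "snd (bpath \<beta> t \<sigma> x j) \<le> - i"
      unfolding e[symmetric] hit by simp_all
  qed
  have xi: "fst x \<le> i" "snd x \<le> - i" using bi[of 0] by simp_all
  have "w (bpath \<beta> t \<sigma> x j) \<le> \<alpha>" if "j < N" for j
    using low[of "bpath \<beta> t \<sigma> x j"] bi[of j] that i by (simp add: lev_bpath x)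
  then have "(\<Sum>j<N. w (bpath \<beta> t \<sigma> x j)) \<le> real N * \<alpha>"
    using sum_bounded_above[of "{..<N}" "\<lambda>j. w (bpath \<beta> t \<sigma> x j)" \<alpha>] by simp
  then have top: "\<beta> t \<sigma> x (diag i) \<le> real N * \<alpha>"
    using bpath_weights[OF t, of \<sigma> x N] hit by simp
  \<comment> \<open>n1 and n2 are the signed lengths of the high-weight legs of two candidate
    detours, along the row of \<open>diag k\<close> and along the column of
    \<open>diag (l + 1)\<close>; together they fall short of N only by D.\<close>
  define D n1 n2 where "D = l + 1 - k" and "n1 = k - fst x" and "n2 = - (l + 1) - snd x"
  have sum: "n1 + n2 + D = int N" using x by (simp add: D_def n1_def n2_def lev_def)
  have D: "0 < D" using kl by (simp add: D_def)
  have N\<epsilon>: "3 * \<epsilon> * real_of_int D + 2 * R < \<epsilon> * real N"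
  proof -
    have "\<epsilon> * (3 * real_of_int D + 2 * R / \<epsilon>) < \<epsilon> * real N"
      by (rule mult_strict_left_mono) (use N \<epsilon> in \<open>simp_all add: D_def\<close>)
    then show ?thesis using \<epsilon> by (simp add: algebra_simps)
  qed
  have "3 * real_of_int D < real N"
  proof -
    have "0 \<le> 2 * R / \<epsilon>" using R0 \<epsilon> by simp
    then show ?thesis using N by (simp add: D_def)
  qed
  then have DN: "3 * D < int N" by linarith
  \<comment> \<open>A detour with p low and q high sites collects at least
    \<open>real N * \<alpha>\<close> plus \<epsilon> (2 q - p). From p \<le> q + D and p + q = N the
    excess is at least \<epsilon> (N - 3 D) / 2, which is more than R by the choice of N.\<close>
  have balance: False
    if W: "real p * (\<alpha> - \<epsilon>) + real q * (\<alpha> + 2 * \<epsilon>) \<le> real N * \<alpha> + R" and pq: "p + q = N" "int p \<le> int q + D"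
    for p q
  proof -
    have "real N * \<alpha> = real p * \<alpha> + real q * \<alpha>" using pq(1) by (simp flip: distrib_right of_nat_add)
    then have 1: "2 * (\<epsilon> * real q) - \<epsilon> * real p \<le> R" using W by (simp add: algebra_simps)
    have "real p \<le> real q + real_of_int D" using pq(2) by linarith
    then have 2: "\<epsilon> * real p \<le> \<epsilon> * (real q + real_of_int D)" using \<epsilon> by (intro mult_left_mono) simp_all
    have 3: "\<epsilon> * real N = \<epsilon> * real p + \<epsilon> * real q" using pq(1) by (simp flip: distrib_left of_nat_add)
    have 4: "\<epsilon> * (real q + real_of_int D) = \<epsilon> * real q + \<epsilon> * real_of_int D" by (rule distrib_left)
    show False using 1 2 3 4 N\<epsilon> by linarith
  qed
  have detour: "\<beta> t \<sigma> x (diag a) \<le> real N * \<alpha> + R" if "a = k \<or> a = l + 1" for a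
  proof -
    have "\<beta> t \<sigma> x (diag i) + \<beta> t \<sigma> (diag i) (diag a) = \<beta> t \<sigma> x (diag a)" by (rule cocycle[OF t])
    moreover have "\<beta> t \<sigma> (diag i) (diag a) \<le> R" using R[OF i] that by auto
    ultimately show ?thesis using top by linarith
  qed
  have ik: "k + 1 \<le> i" "i \<le> l" using i by simp_all
  show False
  \<comment> \<open>The detour with the longer high leg is taken; this is what yields p \<le> q +
    D.\<close>
  proof (cases "n2 \<le> n1")
    case True
    define p q where "p = nat (- k - snd x)" and "q = nat n1"
    have pq: "int p = - k - snd x" "int q = n1"
      using xi ik True sum DN D by (auto simp: p_def q_def)
    have pqN: "p + q = N" using pq x by (simp add: n1_def lev_def)
    let ?y = "x + (int p * fst (e2 :: site), int p * snd (e2 :: site))"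
    have y: "?y = (fst x, - k)" by (simp add: prod_eq_iff pq)
    have z: "?y + (int q * fst (e1 :: site), int q * snd (e1 :: site)) = diag k"
      unfolding y by (simp add: prod_eq_iff pq n1_def)
    have 1: "real p * (\<alpha> - \<epsilon>) \<le> \<beta> t \<sigma> x ?y"
    proof (rule leg_weight[OF t])
      fix j assume j: "j < p"
      show "\<alpha> - \<epsilon> \<le> w (x + (int j * fst (e2 :: site), int j * snd (e2 :: site)))"
        by (rule low[THEN conjunct1]) (use j xi ik pqN pq x in \<open>simp_all add: lev_add\<close>)
    qed simp
    have 2: "real q * (\<alpha> + 2 * \<epsilon>) \<le> \<beta> t \<sigma> ?y (?y + (int q * fst (e1 :: site), int q * snd (e1 :: site)))"
    proof (rule leg_weight[OF t])
      fix j assume j: "j < q"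
      have "?y + (int j * fst (e1 :: site), int j * snd (e1 :: site)) = (k - (int q - int j), - k)"
        unfolding y by (simp add: prod_eq_iff pq n1_def)
      moreover have "\<alpha> + 2 * \<epsilon> \<le> w (k - (int q - int j), - k)"
        by (rule row) (use j pqN in simp_all)
      ultimately show "\<alpha> + 2 * \<epsilon> \<le> w (?y + (int j * fst (e1 :: site), int j * snd (e1 :: site)))"
        by (simp only:)
    qed simp
    have "\<beta> t \<sigma> x ?y + \<beta> t \<sigma> ?y (diag k) = \<beta> t \<sigma> x (diag k)" by (rule cocycle[OF t])
    then have "real p * (\<alpha> - \<epsilon>) + real q * (\<alpha> + 2 * \<epsilon>) \<le> real N * \<alpha> + R"
      using 1 2[unfolded z] detour[of k] by simp
    moreover have "int p \<le> int q + D" using True pq sum by (simp add: n1_def n2_def D_def)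
    ultimately show False using balance pqN by blast
  next
    case False
    define p q where "p = nat (l + 1 - fst x)" and "q = nat n2"
    have pq: "int p = l + 1 - fst x" "int q = n2"
      using xi ik False sum DN D by (auto simp: p_def q_def)
    have pqN: "p + q = N" using pq x by (simp add: n2_def lev_def)
    let ?y = "x + (int p * fst (e1 :: site), int p * snd (e1 :: site))"
    have y: "?y = (l + 1, snd x)" by (simp add: prod_eq_iff pq)
    have z: "?y + (int q * fst (e2 :: site), int q * snd (e2 :: site)) = diag (l + 1)"
      unfolding y by (simp add: prod_eq_iff pq n2_def)
    have 1: "real p * (\<alpha> - \<epsilon>) \<le> \<beta> t \<sigma> x ?y"
    proof (rule leg_weight[OF t])
      fix j assume j: "j < p"
      show "\<alpha> - \<epsilon> \<le> w (x + (int j * fst (e1 :: site), int j * snd (e1 :: site)))"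
        by (rule low[THEN conjunct1]) (use j xi ik pqN pq x in \<open>simp_all add: lev_add\<close>)
    qed simp
    have 2: "real q * (\<alpha> + 2 * \<epsilon>) \<le> \<beta> t \<sigma> ?y (?y + (int q * fst (e2 :: site), int q * snd (e2 :: site)))"
    proof (rule leg_weight[OF t])
      fix j assume j: "j < q"
      have "?y + (int j * fst (e2 :: site), int j * snd (e2 :: site)) = (l + 1, - (l + 1) - (int q - int j))"
        unfolding y by (simp add: prod_eq_iff pq n2_def)
      moreover have "\<alpha> + 2 * \<epsilon> \<le> w (l + 1, - (l + 1) - (int q - int j))"
        by (rule col) (use j pqN in simp_all)
      ultimately show "\<alpha> + 2 * \<epsilon> \<le> w (?y + (int j * fst (e2 :: site), int j * snd (e2 :: site)))"
        by (simp only:)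
    qed simp
    have "\<beta> t \<sigma> x ?y + \<beta> t \<sigma> ?y (diag (l + 1)) = \<beta> t \<sigma> x (diag (l + 1))" by (rule cocycle[OF t])
    then have "real p * (\<alpha> - \<epsilon>) + real q * (\<alpha> + 2 * \<epsilon>) \<le> real N * \<alpha> + R"
      using 1 2[unfolded z] detour[of "l + 1"] by simp
    moreover have "int p \<le> int q + D" using False pq sum by (simp add: n1_def n2_def D_def)
    ultimately show False using balance pqN by blast
  qed
qed

end

subsection \<open>Measurability of the step field\<close>

lemma countable_eq_in_sets:
  fixes g h :: "'a \<Rightarrow> 'b::countable"
  assumes "g \<in> measurable N (count_space UNIV)" "h \<in> measurable N (count_space UNIV)"
  shows "{\<omega> \<in> space N. g \<omega> = h \<omega>} \<in> sets N"
proof -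
  have "{\<omega> \<in> space N. g \<omega> = h \<omega>} = (\<Union>z. (g -` {z} \<inter> space N) \<inter> (h -` {z} \<inter> space N))" by auto
  also have "\<dots> \<in> sets N"
    using measurable_sets[OF assms(1)] measurable_sets[OF assms(2)]
    by (intro sets.countable_UN' sets.Int) auto
  finally show ?thesis .
qed

lemma measurable_bstep:
  assumes "(\<lambda>\<omega>. \<beta> \<omega> t \<sigma> z (z + e1)) \<in> borel_measurable N" "(\<lambda>\<omega>. \<beta> \<omega> t \<sigma> z (z + e2)) \<in> borel_measurable N"
  shows "(\<lambda>\<omega>. bstep (\<beta> \<omega>) t \<sigma> z) \<in> measurable N (count_space UNIV)"
proof -
  note [measurable] = assms
  show ?thesis unfolding bstep_def tilt_def by measurable
qed

text \<open>Only steps at levels at least m are asked to be measurable, so that the lemma also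
  applies to the \<sigma>-algebra generated by increments at nonnegative levels.\<close>

lemma measurable_iterate:
  assumes f: "\<And>z. m \<le> lev z \<Longrightarrow> (\<lambda>\<omega>. f \<omega> z) \<in> measurable N (count_space UNIV)"
    and up: "\<And>\<omega>. up_right_step (f \<omega>)" and x: "m \<le> lev x"
  shows "(\<lambda>\<omega>. (f \<omega> ^^ n) x) \<in> measurable N (count_space UNIV)"
proof (induction n)
  case (Suc n)
  \<comment> \<open>Below level m the step is replaced by a map constant in the outcome, to obtain a
    family that is measurable at every site.\<close>
  define F where "F z = (\<lambda>\<omega>. if m \<le> lev z then f \<omega> z else z)" for z
  have "F z \<in> measurable N (count_space UNIV)" for z
    using f[of z] by (cases "m \<le> lev z") (simp_all add: F_def)
  then have "(\<lambda>\<omega>. F ((f \<omega> ^^ n) x) \<omega>) \<in> measurable N (count_space UNIV)"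
    by (rule measurable_compose_countable[OF _ Suc])
  moreover have "F ((f \<omega> ^^ n) x) \<omega> = (f \<omega> ^^ Suc n) x" for \<omega>
    using x by (simp add: F_def lev_iterate[OF up])
  ultimately show ?case by (simp only:)
qed simp

lemma coalesces_in_sets:
  assumes f: "\<And>z. m \<le> lev z \<Longrightarrow> (\<lambda>\<omega>. f \<omega> z) \<in> measurable N (count_space UNIV)"
    and up: "\<And>\<omega>. up_right_step (f \<omega>)" and x: "m \<le> lev x" and y: "m \<le> lev y"
  shows "{\<omega> \<in> space N. coalesces (f \<omega>) x y} \<in> sets N"
proof -
  have "{\<omega> \<in> space N. coalesces (f \<omega>) x y} = (\<Union>i j. {\<omega> \<in> space N. (f \<omega> ^^ i) x = (f \<omega> ^^ j) y})"
    unfolding coalesces_def by auto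
  also have "\<dots> \<in> sets N"
  proof -
    have "{\<omega> \<in> space N. (f \<omega> ^^ i) x = (f \<omega> ^^ j) y} \<in> sets N" for i j
      by (intro countable_eq_in_sets measurable_iterate[where m = m and f = f, OF f up] x y)
    then show ?thesis by (intro sets.countable_UN image_subsetI)
  qed
  finally show ?thesis .
qed

lemma not_coalesces_in_sets:
  assumes "\<And>z. m \<le> lev z \<Longrightarrow> (\<lambda>\<omega>. f \<omega> z) \<in> measurable N (count_space UNIV)"
    and "\<And>\<omega>. up_right_step (f \<omega>)" and "m \<le> lev x" and "m \<le> lev y"
  shows "{\<omega> \<in> space N. \<not> coalesces (f \<omega>) x y} \<in> sets N"
proof -
  have "{\<omega> \<in> space N. \<not> coalesces (f \<omega>) x y} = space N - {\<omega> \<in> space N. coalesces (f \<omega>) x y}" by auto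
  also have "\<dots> \<in> sets N" by (intro sets.Diff sets.top coalesces_in_sets[where m = m] assms)
  finally show ?thesis .
qed

lemma barren_gap_in_sets:
  assumes f: "\<And>z. (\<lambda>\<omega>. f \<omega> z) \<in> measurable N (count_space UNIV)" and up: "\<And>\<omega>. up_right_step (f \<omega>)"
  shows "{\<omega> \<in> space N. barren_gap n k l (f \<omega>) z} \<in> sets N"
proof -
  have nc: "{\<omega> \<in> space N. \<not> coalesces (f \<omega>) x y} \<in> sets N" for x y
    by (rule not_coalesces_in_sets[where m = "min (lev x) (lev y)"]) (simp_all add: f up)
  have hit: "{\<omega> \<in> space N. (f \<omega> ^^ n) x = v} \<in> sets N" for x v
    by (intro countable_eq_in_sets measurable_iterate[where m = "lev x" and f = f] f up) simp_all
  have "{\<omega> \<in> space N. barren_gap n k l (f \<omega>) z} =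
      ({\<omega> \<in> space N. \<not> coalesces (f \<omega>) (z + diag k) (z + diag (k + 1))} \<inter>
       {\<omega> \<in> space N. \<not> coalesces (f \<omega>) (z + diag l) (z + diag (l + 1))}) -
      (\<Union>x\<in>{x. lev x = lev z - int n}. \<Union>i\<in>{k+1..l}. {\<omega> \<in> space N. (f \<omega> ^^ n) x = z + diag i})"
    unfolding barren_gap_def by blast
  also have "\<dots> \<in> sets N"
    by (intro sets.Diff sets.Int nc sets.countable_UN') (auto intro: hit)
  finally show ?thesis .
qed

subsection \<open>Stationarity\<close>

lemma iterate_shift:
  fixes f g :: "site \<Rightarrow> site"
  assumes "\<And>x. f (x + z) = g x + z"
  shows "(f ^^ n) (x + z) = (g ^^ n) x + z"
  by (induction n) (simp_all add: assms)

lemma coalesces_shift: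
  fixes f g :: "site \<Rightarrow> site"
  assumes "\<And>x. f (x + z) = g x + z"
  shows "coalesces f (x + z) (y + z) \<longleftrightarrow> coalesces g x y"
  unfolding coalesces_def iterate_shift[of f z g, OF assms] by simp

lemma barren_gap_shift:
  fixes f g :: "site \<Rightarrow> site"
  assumes fg: "\<And>x. f (x + z) = g x + z"
  shows "barren_gap N k l f z \<longleftrightarrow> barren_gap N k l g 0"
proof -
  have 1: "coalesces f (z + diag i) (z + diag j) \<longleftrightarrow> coalesces g (0 + diag i) (0 + diag j)" for i j
    using coalesces_shift[of f z g "diag i" "diag j", OF fg] by (simp add: add.commute)
  have 2: "(\<forall>x. lev x = lev z - int N \<longrightarrow> (\<forall>i\<in>{k+1..l}. (f ^^ N) x \<noteq> z + diag i)) \<longleftrightarrow>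
      (\<forall>x. lev x = lev 0 - int N \<longrightarrow> (\<forall>i\<in>{k+1..l}. (g ^^ N) x \<noteq> 0 + diag i))" (is "?L \<longleftrightarrow> ?R")
  proof
    assume L: ?L
    show ?R
    proof (intro allI impI ballI)
      fix x i assume x: "lev x = lev 0 - int N" and i: "i \<in> {k+1..l}"
      have "lev (x + z) = lev z - int N" using x by (simp add: lev_add) (simp add: lev_def)
      then have "(f ^^ N) (x + z) \<noteq> z + diag i" using L i by blast
      then show "(g ^^ N) x \<noteq> 0 + diag i"
        unfolding iterate_shift[of f z g, OF fg] by (auto simp: add.commute)
    qed
  next
    assume R: ?R
    show ?L
    proof (intro allI impI ballI)
      fix x i assume x: "lev x = lev z - int N" and i: "i \<in> {k+1..l}"
      have "lev (x - z) = lev 0 - int N" using x by (simp add: lev_def)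
      then have "(g ^^ N) (x - z) \<noteq> 0 + diag i" using R i by blast
      moreover have "(f ^^ N) x = (g ^^ N) (x - z) + z"
        using iterate_shift[of f z g N "x - z", OF fg] by simp
      ultimately show "(f ^^ N) x \<noteq> z + diag i" by (auto simp: add.commute)
    qed
  qed
  show ?thesis unfolding barren_gap_def 1 2 ..
qed

context busemann_process
begin

abbreviation real_B :: "'a \<Rightarrow> realization" where
  "real_B \<omega> \<equiv> \<lambda>t. B \<omega> (dir t)"

lemma space_M: "space M = UNIV"
  using sets_eq_imp_space_eq[OF sets_borel] by simp

lemma AE_B1: "AE \<omega> in M.
    (\<forall>\<xi>\<in>riU. \<forall>\<sigma> x y z. B \<omega> \<xi> \<sigma> (x + z) (y + z) = B (T z \<omega>) \<xi> \<sigma> x y \<and>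
          B \<omega> \<xi> \<sigma> x y + B \<omega> \<xi> \<sigma> y z = B \<omega> \<xi> \<sigma> x z) \<and>
    (\<forall>\<xi>\<in>riU. \<forall>\<sigma> x. min (B \<omega> \<xi> \<sigma> x (x + e1)) (B \<omega> \<xi> \<sigma> x (x + e2)) = wt \<omega> x) \<and>
    (\<forall>\<xi>\<in>riU. \<forall>\<xi>'\<in>riU. \<forall>x. prec \<xi> \<xi>' \<longrightarrow>
          B \<omega> \<xi> Minus x (x + e1) \<ge> B \<omega> \<xi> Plus x (x + e1) \<and>
          B \<omega> \<xi> Plus x (x + e1) \<ge> B \<omega> \<xi>' Minus x (x + e1) \<and>
          B \<omega> \<xi>' Minus x (x + e1) \<ge> B \<omega> \<xi>' Plus x (x + e1) \<and>
          B \<omega> \<xi> Minus x (x + e2) \<le> B \<omega> \<xi> Plus x (x + e2) \<and>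
          B \<omega> \<xi> Plus x (x + e2) \<le> B \<omega> \<xi>' Minus x (x + e2) \<and>
          B \<omega> \<xi>' Minus x (x + e2) \<le> B \<omega> \<xi>' Plus x (x + e2)) \<and>
    (\<forall>\<xi>\<in>riU. \<forall>\<sigma> x y.
          ((\<lambda>\<zeta>. B \<omega> \<zeta> \<sigma> x y) \<longlongrightarrow> B \<omega> \<xi> Minus x y) (from_left \<xi>) \<and>
          ((\<lambda>\<zeta>. B \<omega> \<zeta> \<sigma> x y) \<longlongrightarrow> B \<omega> \<xi> Plus x y) (from_right \<xi>)) \<and>
    (\<forall>\<sigma> x. filterlim (\<lambda>\<xi>. B \<omega> \<xi> \<sigma> x (x + e1)) at_top (at e2 within riU) \<and>
          filterlim (\<lambda>\<xi>. B \<omega> \<xi> \<sigma> x (x + e2)) at_top (at e1 within riU))"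
proof -
  from B1 obtain E where E: "E \<in> sets M" "prob E = 1" and facts: "\<forall>\<omega>\<in>E.
       (\<forall>\<xi>\<in>riU. \<forall>\<sigma> x y z. B \<omega> \<xi> \<sigma> (x + z) (y + z) = B (T z \<omega>) \<xi> \<sigma> x y \<and>
          B \<omega> \<xi> \<sigma> x y + B \<omega> \<xi> \<sigma> y z = B \<omega> \<xi> \<sigma> x z) \<and>
       (\<forall>\<xi>\<in>riU. \<forall>\<sigma> x. min (B \<omega> \<xi> \<sigma> x (x + e1)) (B \<omega> \<xi> \<sigma> x (x + e2)) = wt \<omega> x) \<and>
       (\<forall>\<xi>\<in>riU. \<forall>\<xi>'\<in>riU. \<forall>x. prec \<xi> \<xi>' \<longrightarrow>
          B \<omega> \<xi> Minus x (x + e1) \<ge> B \<omega> \<xi> Plus x (x + e1) \<and>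
          B \<omega> \<xi> Plus x (x + e1) \<ge> B \<omega> \<xi>' Minus x (x + e1) \<and>
          B \<omega> \<xi>' Minus x (x + e1) \<ge> B \<omega> \<xi>' Plus x (x + e1) \<and>
          B \<omega> \<xi> Minus x (x + e2) \<le> B \<omega> \<xi> Plus x (x + e2) \<and>
          B \<omega> \<xi> Plus x (x + e2) \<le> B \<omega> \<xi>' Minus x (x + e2) \<and>
          B \<omega> \<xi>' Minus x (x + e2) \<le> B \<omega> \<xi>' Plus x (x + e2)) \<and>
       (\<forall>\<xi>\<in>riU. \<forall>\<sigma> x y.
          ((\<lambda>\<zeta>. B \<omega> \<zeta> \<sigma> x y) \<longlongrightarrow> B \<omega> \<xi> Minus x y) (from_left \<xi>) \<and>
          ((\<lambda>\<zeta>. B \<omega> \<zeta> \<sigma> x y) \<longlongrightarrow> B \<omega> \<xi> Plus x y) (from_right \<xi>)) \<and>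
       (\<forall>\<sigma> x. filterlim (\<lambda>\<xi>. B \<omega> \<xi> \<sigma> x (x + e1)) at_top (at e2 within riU) \<and>
          filterlim (\<lambda>\<xi>. B \<omega> \<xi> \<sigma> x (x + e2)) at_top (at e1 within riU))"
    by (elim bexE conjE) (rule that; assumption)
  have "AE \<omega> in M. \<omega> \<in> E" using AE_in_set_eq_1[OF E(1)] E(2) by simp
  then show ?thesis by (rule AE_mp) (intro AE_I2 impI bspec[OF facts])
qed

lemma AE_shift:
  "AE \<omega> in M. \<forall>t \<sigma> x y z. 0 < t \<and> t < 1 \<longrightarrow> real_B \<omega> t \<sigma> (x + z) (y + z) = real_B (T z \<omega>) t \<sigma> x y"
  using AE_B1
proof eventually_elim
  case (elim \<omega>)
  note shift = elim[THEN conjunct1]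
  show ?case
  proof (intro allI impI)
    fix t \<sigma> x y z assume "0 < t \<and> t < (1 :: real)"
    then have "dir t \<in> riU" by simp
    from bspec[OF shift this] show "real_B \<omega> t \<sigma> (x + z) (y + z) = real_B (T z \<omega>) t \<sigma> x y" by blast
  qed
qed

lemma AE_cocycle: "AE \<omega> in M. busemann_cocycle (wt \<omega>) (real_B \<omega>)"
  using AE_B1
proof eventually_elim
  case (elim \<omega>)
  note coc = elim[THEN conjunct1] and rec = elim[THEN conjunct2, THEN conjunct1]
  show ?case
  proof
    fix t :: real and \<sigma> x y z assume "0 < t" "t < 1"
    then have d: "dir t \<in> riU" by simp
    show "real_B \<omega> t \<sigma> x y + real_B \<omega> t \<sigma> y z = real_B \<omega> t \<sigma> x z" using bspec[OF coc d] by blast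
    show "min (real_B \<omega> t \<sigma> x (x + e1)) (real_B \<omega> t \<sigma> x (x + e2)) = wt \<omega> x" using bspec[OF rec d] by blast
  qed
qed

text \<open>For a fixed direction, measurability is read off from the integrability in (B2).\<close>

lemma measurable_B: "0 < t \<Longrightarrow> t < 1 \<Longrightarrow> (\<lambda>\<omega>. real_B \<omega> t \<sigma> x y) \<in> borel_measurable M"
  using B2_integrable[of "dir t"] by simp

lemma measurable_field:
  "0 < t \<Longrightarrow> t < 1 \<Longrightarrow> (\<lambda>\<omega>. bstep (real_B \<omega>) t \<sigma> z) \<in> measurable M (count_space UNIV)"
  by (intro measurable_bstep[where \<beta> = real_B] measurable_B)

lemma prob_shift:
  assumes "A \<in> sets M"
  shows "prob (T z -` A \<inter> space M) = prob A" "T z -` A \<inter> space M \<in> sets M"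
  using measure_distr[OF T_measurable assms, of z] T_preserving[of z] measurable_sets[OF T_measurable assms]
  by simp_all

lemma AE_field_shift:
  assumes t: "0 < t" "t < 1"
  shows "AE \<omega> in M. \<forall>x z. bstep (real_B \<omega>) t \<sigma> (x + z) = bstep (real_B (T z \<omega>)) t \<sigma> x + z"
  using AE_shift
proof eventually_elim
  case (elim \<omega>)
  have "tilt (real_B \<omega>) t \<sigma> (x + z) = tilt (real_B (T z \<omega>)) t \<sigma> x" for x z
  proof -
    have "real_B \<omega> t \<sigma> (x + z) (y + z) = real_B (T z \<omega>) t \<sigma> x y" for y
      using elim[THEN spec[of _ t]] t by blast
    from this[of "x + e1"] this[of "x + e2"] show ?thesis
      by (simp add: tilt_def add.assoc add.commute[of _ z])
  qed
  note tilt = this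
  show ?case
  proof (intro allI)
    fix x z
    show "bstep (real_B \<omega>) t \<sigma> (x + z) = bstep (real_B (T z \<omega>)) t \<sigma> x + z"
      unfolding bstep_def tilt by (auto simp: add_ac simp del: split_paired_All split_paired_Ex)
  qed
qed

subsection \<open>Typical weights\<close>

lemma measurable_wt: "(\<lambda>\<omega>. wt \<omega> x) \<in> borel_measurable M"
  using wt_indep unfolding indep_vars_def by blast

lemma prob_wt_eq:
  assumes "A \<in> sets borel"
  shows "prob {\<omega> \<in> space M. wt \<omega> x \<in> A} = prob {\<omega> \<in> space M. wt \<omega> 0 \<in> A}"
proof -
  have "prob {\<omega> \<in> space M. wt \<omega> x \<in> A} = measure (distr M borel (\<lambda>\<omega>. wt \<omega> x)) A" for x
    using measure_distr[OF measurable_wt assms, of x] by (simp add: vimage_def Int_def conj_commute)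
  then show ?thesis using wt_ident[of x] by simp
qed

text \<open>Continuity of the distribution function provides points a < b with values 1/3 and 2/3.
  Intervals of length \<epsilon> = (b - a) / 2 going down from a cover the lower tail, so one of
  them has positive probability; its upper end \<alpha> satisfies \<alpha> + 2 \<epsilon> \<le> b,
  and the weights above b have positive probability too.\<close>

lemma two_weight_levels:
  obtains \<alpha> \<epsilon> where "0 < \<epsilon>" "0 < prob {\<omega> \<in> space M. wt \<omega> 0 \<in> {\<alpha> - \<epsilon>..\<alpha>}}"
    "0 < prob {\<omega> \<in> space M. wt \<omega> 0 \<in> {\<alpha> + 2 * \<epsilon>..}}"
proof -
  let ?D = "distr M borel (\<lambda>\<omega>. wt \<omega> 0)"
  interpret D: real_distribution ?D by (rule real_distribution_distr[OF measurable_wt])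
  let ?F = "cdf ?D"
  have cont: "isCont ?F x" for x
    using wt_continuous by (simp add: continuous_on_eq_continuous_at)
  have "\<forall>\<^sub>F x in at_bot. ?F x < 1/3" by (rule order_tendstoD(2)[OF D.cdf_lim_at_bot]) simp
  then obtain x0 where x0: "?F x0 < 1/3" unfolding eventually_at_bot_linorder by blast
  have "\<forall>\<^sub>F x in at_top. 2/3 < ?F x" by (rule order_tendstoD(1)[OF D.cdf_lim_at_top_prob]) simp
  then obtain x1 where x1: "2/3 < ?F x1" unfolding eventually_at_top_linorder by blast
  have x01: "x0 \<le> x1" using D.cdf_nondecreasing[of x1 x0] x0 x1 by linarith
  obtain a where a: "?F a = 1/3" using IVT[of ?F x0 "1/3" x1] x0 x1 x01 cont by auto
  obtain b where b: "?F b = 2/3" using IVT[of ?F x0 "2/3" x1] x0 x1 x01 cont by auto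
  have ab: "a < b" using D.cdf_nondecreasing[of b a] a b by linarith
  have cdf_eq: "?F x = prob {\<omega> \<in> space M. wt \<omega> 0 \<le> x}" for x
    unfolding cdf_def using measure_distr[OF measurable_wt, of "{..x}" 0]
    by (simp add: vimage_def Int_def conj_commute)
  note [measurable] = measurable_wt
  have up: "0 < prob {\<omega> \<in> space M. b < wt \<omega> 0}"
  proof -
    have "{\<omega> \<in> space M. b < wt \<omega> 0} = space M - {\<omega> \<in> space M. wt \<omega> 0 \<le> b}" by auto
    then have "prob {\<omega> \<in> space M. b < wt \<omega> 0} = 1 - 2/3"
      using prob_compl[of "{\<omega> \<in> space M. wt \<omega> 0 \<le> b}"] b cdf_eq[of b] by simp
    then show ?thesis by simp
  qed
  define \<epsilon> where "\<epsilon> = (b - a) / 2"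
  have \<epsilon>: "0 < \<epsilon>" using ab by (simp add: \<epsilon>_def)
  define \<alpha> where "\<alpha> j = a - real j * \<epsilon>" for j :: nat
  have "\<exists>j. 0 < prob {\<omega> \<in> space M. wt \<omega> 0 \<in> {\<alpha> j - \<epsilon>..\<alpha> j}}"
  proof (rule ccontr)
    assume "\<not> ?thesis"
    then have z: "prob {\<omega> \<in> space M. wt \<omega> 0 \<in> {\<alpha> j - \<epsilon>..\<alpha> j}} = 0" for j
      by (metis linorder_neqE_linordered_idom measure_nonneg not_less)
    have "AE \<omega> in M. wt \<omega> 0 \<notin> {\<alpha> j - \<epsilon>..\<alpha> j}" for j
      using prob_eq_0[of "{\<omega> \<in> space M. wt \<omega> 0 \<in> {\<alpha> j - \<epsilon>..\<alpha> j}}"] z[of j] by simp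
    then have "AE \<omega> in M. \<forall>j. wt \<omega> 0 \<notin> {\<alpha> j - \<epsilon>..\<alpha> j}" by (simp add: AE_all_countable)
    then have "AE \<omega> in M. \<not> wt \<omega> 0 \<le> a"
    proof eventually_elim
      case (elim \<omega>)
      show ?case
      proof
        assume le: "wt \<omega> 0 \<le> a"
        define j where "j = nat \<lfloor>(a - wt \<omega> 0) / \<epsilon>\<rfloor>"
        have "0 \<le> (a - wt \<omega> 0) / \<epsilon>" using le \<epsilon> by simp
        then have "real j \<le> (a - wt \<omega> 0) / \<epsilon>" "(a - wt \<omega> 0) / \<epsilon> < real j + 1"
          unfolding j_def by linarith+
        then have "real j * \<epsilon> \<le> a - wt \<omega> 0" "a - wt \<omega> 0 < (real j + 1) * \<epsilon>"
          using \<epsilon> by (simp_all add: pos_le_divide_eq pos_divide_less_eq)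
        then have "wt \<omega> 0 \<in> {\<alpha> j - \<epsilon>..\<alpha> j}" by (simp add: \<alpha>_def algebra_simps)
        then show False using elim by blast
      qed
    qed
    then have "prob {\<omega> \<in> space M. wt \<omega> 0 \<le> a} = 0"
      using prob_eq_0[of "{\<omega> \<in> space M. wt \<omega> 0 \<le> a}"] by simp
    then show False using a cdf_eq[of a] by simp
  qed
  then obtain j where j: "0 < prob {\<omega> \<in> space M. wt \<omega> 0 \<in> {\<alpha> j - \<epsilon>..\<alpha> j}}" by blast
  have "\<alpha> j + 2 * \<epsilon> \<le> b"
  proof -
    have "0 \<le> real j * \<epsilon>" using \<epsilon> by simp
    moreover have "a + 2 * \<epsilon> = b" by (simp add: \<epsilon>_def field_simps)
    ultimately show ?thesis unfolding \<alpha>_def by linarith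
  qed
  then have "prob {\<omega> \<in> space M. b < wt \<omega> 0} \<le> prob {\<omega> \<in> space M. wt \<omega> 0 \<in> {\<alpha> j + 2 * \<epsilon>..}}"
    by (intro finite_measure_mono) auto
  then show thesis using that[OF \<epsilon> j] up by linarith
qed

subsection \<open>Non-coalescence is impossible\<close>

lemma expectation_sum_indicator:
  assumes "finite I" "\<And>i. i \<in> I \<Longrightarrow> A i \<in> sets M"
  shows "integrable M (\<lambda>\<omega>. \<Sum>i\<in>I. indicator (A i) \<omega> :: real)"
    and "expectation (\<lambda>\<omega>. \<Sum>i\<in>I. indicator (A i) \<omega> :: real) = (\<Sum>i\<in>I. prob (A i))"
proof -
  have int: "integrable M (\<lambda>\<omega>. indicator (A i) \<omega> :: real)" if "i \<in> I" for i
    by (rule integrable_real_indicator) (use assms(2)[OF that] in \<open>simp_all add: less_top[symmetric]\<close>)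
  then show "integrable M (\<lambda>\<omega>. \<Sum>i\<in>I. indicator (A i) \<omega> :: real)"
    by (rule Bochner_Integration.integrable_sum)
  have "expectation (\<lambda>\<omega>. \<Sum>i\<in>I. indicator (A i) \<omega> :: real) = (\<Sum>i\<in>I. expectation (\<lambda>\<omega>. indicator (A i) \<omega>))"
    by (rule Bochner_Integration.integral_sum[OF int])
  also have "\<dots> = (\<Sum>i\<in>I. prob (A i))"
    using assms(2) by (intro sum.cong) (simp_all add: sets.Int_space_eq1)
  finally show "expectation (\<lambda>\<omega>. \<Sum>i\<in>I. indicator (A i) \<omega> :: real) = (\<Sum>i\<in>I. prob (A i))" .
qed

text \<open>If all pairwise intersections were null, at most one of the events could occur almost
  surely, so n of them would have total probability n q \<le> 1 for every n.\<close>

lemma exists_two_of_many: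
  fixes A :: "nat \<Rightarrow> 'a set"
  assumes A: "\<And>k. A k \<in> sets M" and p: "\<And>k. prob (A k) = q" and q: "0 < q"
  obtains k l where "k < l" "0 < prob (A k \<inter> A l)"
proof -
  note found = that
  obtain n :: nat where n: "1 < real n * q"
    using reals_Archimedean3[OF q] by blast
  show thesis
  proof (rule ccontr)
    assume no: "\<not> thesis"
    have null: "AE \<omega> in M. \<omega> \<notin> A k \<inter> A l" if "k < l" for k l
    proof -
      have "\<not> 0 < prob (A k \<inter> A l)" using no found[OF that] by blast
      then have "prob (A k \<inter> A l) = 0" by (simp add: zero_less_measure_iff)
      then show ?thesis using prob_eq_0[of "A k \<inter> A l"] A by simp
    qed
    have "AE \<omega> in M. \<forall>k l. k < l \<longrightarrow> \<omega> \<notin> A k \<inter> A l"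
      using null by (simp add: AE_all_countable)
    then have "AE \<omega> in M. (\<Sum>k<n. indicator (A k) \<omega> :: real) \<le> 1"
    proof eventually_elim
      case (elim \<omega>)
      have fin: "finite {k \<in> {..<n}. \<omega> \<in> A k}" by simp
      have "a = b" if "a \<in> {k \<in> {..<n}. \<omega> \<in> A k}" "b \<in> {k \<in> {..<n}. \<omega> \<in> A k}" for a b
        using elim[THEN spec[of _ a], THEN spec[of _ b]] elim[THEN spec[of _ b], THEN spec[of _ a]] that
        by (cases a b rule: linorder_cases) auto
      then have "card {k \<in> {..<n}. \<omega> \<in> A k} \<le> Suc 0"
        unfolding card_le_Suc0_iff_eq[OF fin] by blast
      moreover have "(\<Sum>k<n. indicator (A k) \<omega> :: real) = real (card {k \<in> {..<n}. \<omega> \<in> A k})"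
        by (simp add: indicator_def sum.If_cases Int_def)
      ultimately show ?case by simp
    qed
    then have "expectation (\<lambda>\<omega>. \<Sum>k<n. indicator (A k) \<omega> :: real) \<le> expectation (\<lambda>\<omega>. 1)"
      by (intro integral_mono_AE expectation_sum_indicator(1)) (use A in simp_all)
    then have "real n * q \<le> 1"
      using expectation_sum_indicator(2)[of "{..<n}" A] A by (simp add: p prob_space)
    then show False using n by simp
  qed
qed

text \<open>Occurrences of a barren gap on a lattice give distinct exit sites at a high level, so their
  expected number in a box grows at most linearly in the side length.\<close>

lemma barren_gap_null:
  assumes t: "0 < t" "t < 1" and kl: "k < l"
  shows "prob {\<omega> \<in> space M. barren_gap N k l (bstep (real_B \<omega>) t \<sigma>) 0} = 0"
proof (rule ccontr)
  let ?f = "\<lambda>\<omega>. bstep (real_B \<omega>) t \<sigma>"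
  define G where "G = {\<omega> \<in> space M. barren_gap N k l (?f \<omega>) 0}"
  assume "prob {\<omega> \<in> space M. barren_gap N k l (?f \<omega>) 0} \<noteq> 0"
  then have pos: "0 < prob G" unfolding G_def by (simp add: zero_less_measure_iff)
  have G: "G \<in> sets M"
    unfolding G_def by (intro barren_gap_in_sets measurable_field t up_right_bstep)
  \<comment> \<open>The spacing must be at least the depth N, and at least the width of a
    gap.\<close>
  define L where "L = N + nat (l - k)"
  have L: "N \<le> L" "l - k \<le> int L" "0 < L" using kl by (auto simp: L_def)
  have bound: "real (n * n) * prob G \<le> real (2 * n * L + 1)" for n
  proof -
    let ?A = "\<lambda>z. T z -` G \<inter> space M"
    have A: "?A z \<in> sets M" "prob (?A z) = prob G" for z
      using prob_shift[OF G] by blast+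
    have "AE \<omega> in M. (\<Sum>z\<in>lattice_box L n. indicator (?A z) \<omega> :: real) \<le> real (2 * n * L + 1)"
      using AE_field_shift[OF t, of \<sigma>]
    proof eventually_elim
      case (elim \<omega>)
      have shift: "?f \<omega> (x + z) = ?f (T z \<omega>) x + z" for x z using elim by blast
      have "\<omega> \<in> ?A z \<longleftrightarrow> barren_gap N k l (?f \<omega>) z" for z
        unfolding G_def using barren_gap_shift[of "?f \<omega>" z "?f (T z \<omega>)" N k l, OF shift]
        by (simp add: space_M)
      then have "(\<Sum>z\<in>lattice_box L n. indicator (?A z) \<omega> :: real) =
          real (card {z \<in> lattice_box L n. barren_gap N k l (?f \<omega>) z})"
        by (simp only: indicator_def) (simp add: sum.If_cases Int_def)
      also have "\<dots> \<le> real (2 * n * L + 1)"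
        using card_barren_gaps[OF up_right_bstep kl L, of n] of_nat_le_iff by blast
      finally show ?case .
    qed
    then have "expectation (\<lambda>\<omega>. \<Sum>z\<in>lattice_box L n. indicator (?A z) \<omega> :: real) \<le> expectation (\<lambda>\<omega>. real (2 * n * L + 1))"
      by (intro integral_mono_AE expectation_sum_indicator(1)) (use A in simp_all)
    moreover have "expectation (\<lambda>\<omega>. \<Sum>z\<in>lattice_box L n. indicator (?A z) \<omega> :: real) = real (n * n) * prob G"
    proof -
      have "expectation (\<lambda>\<omega>. \<Sum>z\<in>lattice_box L n. indicator (?A z) \<omega> :: real) = (\<Sum>z\<in>lattice_box L n. prob (?A z))"
        by (rule expectation_sum_indicator(2)) (simp_all add: A(1))
      then show ?thesis using A(2) L(3) by (simp add: card_lattice_box)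
    qed
    ultimately show ?thesis by (simp add: prob_space)
  qed
  \<comment> \<open>For this n the expected number n n \<open>prob G\<close> exceeds 2 n L + 1,
    since the latter is at most n (2 L + 1).\<close>
  obtain n :: nat where n: "real (2 * L + 1) < real n * prob G"
    using reals_Archimedean3[OF pos] by blast
  then have n0: "0 < n" by (cases n) simp_all
  have "real n * real (2 * L + 1) < real n * (real n * prob G)"
    using n n0 by (intro mult_strict_left_mono) simp_all
  also have "\<dots> = real (n * n) * prob G" by simp
  also have "\<dots> \<le> real (2 * n * L + 1)" by (rule bound)
  also have "\<dots> \<le> real n * real (2 * L + 1)" using n0 by (simp add: algebra_simps)
  finally show False by simp
qed

lemma noncoalescence_null:
  assumes t: "0 < t" "t < 1"
  shows "AE \<omega> in M. coalesces (bstep (real_B \<omega>) t \<sigma>) (diag 0) (diag 1)"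
proof (rule ccontr)
  let ?f = "\<lambda>\<omega>. bstep (real_B \<omega>) t \<sigma>"
  assume neg: "\<not> ?thesis"
  define A where "A k = {\<omega> \<in> space M. \<not> coalesces (?f \<omega>) (diag k) (diag (k + 1))}" for k
  \<comment> \<open>Stated for an arbitrary \<sigma>-algebra, because measurability is needed in M
    and also in the \<sigma>-algebra U of the increments at nonnegative levels.\<close>
  have A_N: "{\<omega> \<in> space N. \<not> coalesces (?f \<omega>) (diag k) (diag (k + 1))} \<in> sets N"
    if "\<And>z. 0 \<le> lev z \<Longrightarrow> (\<lambda>\<omega>. ?f \<omega> z) \<in> measurable N (count_space UNIV)" for N :: "'a measure" and k
    by (rule not_coalesces_in_sets[where m = 0 and f = ?f, OF that up_right_bstep]) simp_all
  have A: "A k \<in> sets M" for k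
    unfolding A_def by (rule A_N) (rule measurable_field[OF t])
  have pA: "prob (A k) = prob (A 0)" for k
  proof -
    have "AE \<omega> in M. \<omega> \<in> A k \<longleftrightarrow> \<omega> \<in> T (diag k) -` A 0 \<inter> space M"
      using AE_field_shift[OF t, of \<sigma>]
    proof eventually_elim
      case (elim \<omega>)
      have shift: "?f \<omega> (x + diag k) = ?f (T (diag k) \<omega>) x + diag k" for x using elim by blast
      have "diag 0 + diag k = diag k" "diag 1 + diag k = diag (k + 1)" by (simp_all add: diag_def)
      then show ?case unfolding A_def
        using coalesces_shift[of "?f \<omega>" "diag k" "?f (T (diag k) \<omega>)" "diag 0" "diag 1", OF shift]
        by (simp add: space_M)
    qed
    then have "prob (A k) = prob (T (diag k) -` A 0 \<inter> space M)"
      by (rule measure_eq_AE[OF _ A prob_shift(2)[OF A]])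
    then show ?thesis using prob_shift(1)[OF A] by simp
  qed
  have "prob (A 0) \<noteq> 0"
  proof
    assume "prob (A 0) = 0"
    then have "AE \<omega> in M. \<omega> \<notin> A 0" using prob_eq_0[OF A] by simp
    then have "AE \<omega> in M. coalesces (?f \<omega>) (diag 0) (diag 1)"
      unfolding A_def by eventually_elim (simp add: space_M)
    then show False using neg by blast
  qed
  then have "0 < prob (A 0)" by (simp add: zero_less_measure_iff)
  \<comment> \<open>By stationarity all separations have the same positive probability, so two of
    them occur together and bound a block of finite width.\<close>
  then obtain k' l' :: nat where kl': "k' < l'" "0 < prob (A (int k') \<inter> A (int l'))"
    using exists_two_of_many[of "\<lambda>k. A (int k)" "prob (A 0)", OF A pA] by blast
  define k l where "k = int k'" and "l = int l'"
  have kl: "k < l" and pkl: "0 < prob (A k \<inter> A l)" using kl' by (simp_all add: k_def l_def)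
  \<comment> \<open>\<open>\<beta> (diag i) (diag a)\<close> expressed through increments from level 0 upwards, as required by B4\<close>
  define inc where "inc \<omega> i a = real_B \<omega> t \<sigma> (diag i) (max i a, - min i a)
      - real_B \<omega> t \<sigma> (diag a) (max i a, - min i a)" for \<omega> i a
  \<comment> \<open>R caps the Busemann increments from the block to the two sites next to it. It
    has to be fixed first, since the depth N of the prescribed weights depends on it.\<close>
  define C where "C R = {\<omega> \<in> space M. \<forall>i\<in>{k+1..l}. inc \<omega> i k \<le> real R \<and> inc \<omega> i (l + 1) \<le> real R}" for R :: nat
  \<comment> \<open>The set I of (B4) is taken to be the half-plane of nonnegative levels; every
    site of negative level then belongs to K.\<close>
  define J where "J = {(x, y, \<xi>, \<sigma>' :: sign). x \<in> {x. 0 \<le> lev x} \<and> x \<le> y \<and> \<xi> \<in> riU}"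
  define K where "K = {x. \<forall>z\<in>{x. 0 \<le> lev x}. \<not> z \<le> x}"
  define U where "U = vimage_algebra (space M)
      (\<lambda>\<omega>. \<lambda>(x, y, \<xi>, \<sigma>)\<in>J. (wt \<omega> x, B \<omega> \<xi> \<sigma> x y)) (PiM J (\<lambda>_. borel :: (real \<times> real) measure))"
  define V where "V = vimage_algebra (space M) (\<lambda>\<omega>. \<lambda>x\<in>K. wt \<omega> x) (PiM K (\<lambda>_. borel :: real measure))"
  have indep: "indep_set (sets U) (sets V)"
    unfolding U_def V_def by (rule B4[OF J_def K_def])
  have space_U: "space U = space M" and space_V: "space V = space M" by (simp_all add: U_def V_def)
  have U_B: "(\<lambda>\<omega>. real_B \<omega> t \<sigma> x y) \<in> borel_measurable U" if "0 \<le> lev x" "x \<le> y" for x y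
  proof -
    have mem: "(x, y, dir t, \<sigma>) \<in> J" using that t by (simp add: J_def)
    have "(\<lambda>\<omega>. \<lambda>(x, y, \<xi>, \<sigma>)\<in>J. (wt \<omega> x, B \<omega> \<xi> \<sigma> x y)) \<in> measurable U (PiM J (\<lambda>_. borel))"
      unfolding U_def by (rule measurable_vimage_algebra1) (auto simp: space_PiM)
    from measurable_compose[OF this measurable_component_singleton[OF mem]]
    have "(\<lambda>\<omega>. (wt \<omega> x, B \<omega> (dir t) \<sigma> x y)) \<in> borel_measurable U" using mem by simp
    from measurable_compose[OF this borel_measurable_continuous_onI[OF continuous_on_snd[OF continuous_on_id]]]
    show ?thesis by simp
  qed
  have V_wt: "(\<lambda>\<omega>. wt \<omega> x) \<in> borel_measurable V" if "lev x < 0" for x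
  proof -
    have mem: "x \<in> K" using that by (auto simp: K_def lev_def less_eq_prod_def)
    have "(\<lambda>\<omega>. \<lambda>x\<in>K. wt \<omega> x) \<in> measurable V (PiM K (\<lambda>_. borel))"
      unfolding V_def by (rule measurable_vimage_algebra1) (auto simp: space_PiM)
    from measurable_compose[OF this measurable_component_singleton[OF mem]]
    show ?thesis using mem by simp
  qed
  have U_field: "(\<lambda>\<omega>. ?f \<omega> z) \<in> measurable U (count_space UNIV)" if "0 \<le> lev z" for z
    by (intro measurable_bstep[where \<beta> = real_B] U_B that) (simp_all add: less_eq_prod_def)
  have A_U: "A k \<in> sets U" for k
    using A_N[of U k, OF U_field] unfolding A_def space_U .
  have C_N: "{\<omega> \<in> space N. \<forall>i\<in>{k+1..l}. inc \<omega> i k \<le> real R \<and> inc \<omega> i (l + 1) \<le> real R} \<in> sets N"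
    if B: "\<And>x y. 0 \<le> lev x \<Longrightarrow> x \<le> y \<Longrightarrow> (\<lambda>\<omega>. real_B \<omega> t \<sigma> x y) \<in> borel_measurable N"
    for N :: "'a measure" and R
  proof -
    have [measurable]: "(\<lambda>\<omega>. inc \<omega> i a) \<in> borel_measurable N" for i a
      unfolding inc_def by (intro borel_measurable_diff B) (simp_all add: less_eq_prod_def)
    show ?thesis by measurable
  qed
  have C_U: "C R \<in> sets U" for R unfolding C_def space_U[symmetric] by (rule C_N[OF U_B])
  have C_M: "C R \<in> sets M" for R unfolding C_def by (rule C_N) (rule measurable_B[OF t])
  have "\<exists>R. 0 < prob (A k \<inter> A l \<inter> C R)"
  proof (rule ccontr)
    assume "\<not> ?thesis"
    then have "prob (A k \<inter> A l \<inter> C R) = 0" for R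
      by (simp add: zero_less_measure_iff)
    then have "AE \<omega> in M. \<omega> \<notin> A k \<inter> A l \<inter> C R" for R
      using prob_eq_0[of "A k \<inter> A l \<inter> C R"] A C_M by simp
    then have "AE \<omega> in M. \<forall>R. \<omega> \<notin> A k \<inter> A l \<inter> C R" by (intro AE_all_countable[THEN iffD2] allI)
    then have "AE \<omega> in M. \<omega> \<notin> A k \<inter> A l"
      using AE_space
    proof eventually_elim
      case (elim \<omega>)
      obtain R :: nat where R: "Max ((\<lambda>i. max (inc \<omega> i k) (inc \<omega> i (l + 1))) ` {k+1..l}) \<le> real R"
        using real_arch_simple by blast
      have "inc \<omega> i k \<le> real R \<and> inc \<omega> i (l + 1) \<le> real R" if "i \<in> {k+1..l}" for i
      proof -
        have "max (inc \<omega> i k) (inc \<omega> i (l + 1)) \<le> Max ((\<lambda>i. max (inc \<omega> i k) (inc \<omega> i (l + 1))) ` {k+1..l})"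
          by (intro Max_ge finite_imageI imageI that) simp
        then show ?thesis using R by simp
      qed
      then have "\<omega> \<in> C R" unfolding C_def using elim(2) by blast
      then show ?case using elim(1) by blast
    qed
    then have "prob (A k \<inter> A l) = 0" using prob_eq_0[of "A k \<inter> A l"] A by simp
    then show False using pkl by simp
  qed
  then obtain R where R: "0 < prob (A k \<inter> A l \<inter> C R)" by blast
  obtain \<alpha> \<epsilon> where \<epsilon>: "0 < \<epsilon>" and p1: "0 < prob {\<omega> \<in> space M. wt \<omega> 0 \<in> {\<alpha> - \<epsilon>..\<alpha>}}"
    and p2: "0 < prob {\<omega> \<in> space M. wt \<omega> 0 \<in> {\<alpha> + 2 * \<epsilon>..}}"
    by (rule two_weight_levels)
  obtain N :: nat where N: "3 * real_of_int (l + 1 - k) + 2 * real R / \<epsilon> < real N"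
    using reals_Archimedean2 by blast
  have N1: "1 \<le> int N"
  proof -
    have "0 < 3 * real_of_int (l + 1 - k)" "0 \<le> 2 * real R / \<epsilon>" using \<epsilon> kl by simp_all
    from less_trans[OF add_pos_nonneg[OF this] N] have "0 < real N" .
    then show ?thesis by simp
  qed
  \<comment> \<open>S is the finite region below the gap down to depth N, together with the row of
    \<open>diag k\<close> and the column of \<open>diag (l + 1)\<close>. \<open>X\<close> puts high
    weights on these two lines and low weights elsewhere, matching
    \<open>gap_blocked\<close>.\<close>
  define S where "S = {x. - int N \<le> lev x \<and> lev x < 0 \<and> fst x \<le> l + 1 \<and> snd x \<le> - k}"
  define X where "X x = (if fst x \<le> l \<and> snd x < - k then {\<alpha> - \<epsilon>..\<alpha>} else {\<alpha> + 2 * \<epsilon>..})" for x :: site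
  define W where "W = {\<omega> \<in> space M. \<forall>x\<in>S. wt \<omega> x \<in> X x}"
  have "S \<subseteq> {k - int N..l + 1} \<times> {- int N - (l + 1)..- k}"
    by (auto simp: S_def)
  then have finS: "finite S" by (rule finite_subset) simp
  have neS: "S \<noteq> {}"
  proof -
    have "(k - 1, - k) \<in> S" using N1 kl by (simp add: S_def)
    then show ?thesis by blast
  qed
  have X: "X x \<in> sets borel" for x by (simp add: X_def)
  have W_V: "W \<in> sets V"
  proof -
    have "W = (\<Inter>x\<in>S. (\<lambda>\<omega>. wt \<omega> x) -` X x \<inter> space V)" unfolding W_def space_V using neS by blast
    also have "\<dots> \<in> sets V"
      by (intro sets.finite_INT finS neS measurable_sets[OF V_wt X]) (simp add: S_def)
    finally show ?thesis .
  qed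
  have pW: "0 < prob W"
  proof -
    have "W = (\<Inter>x\<in>S. (\<lambda>\<omega>. wt \<omega> x) -` X x \<inter> space M)" unfolding W_def using neS by blast
    then have "prob W = (\<Prod>x\<in>S. prob ((\<lambda>\<omega>. wt \<omega> x) -` X x \<inter> space M))"
      using indep_varsD[OF wt_indep neS finS subset_UNIV X] by simp
    moreover have "0 < prob ((\<lambda>\<omega>. wt \<omega> x) -` X x \<inter> space M)" for x
    proof -
      have "(\<lambda>\<omega>. wt \<omega> x) -` X x \<inter> space M = {\<omega> \<in> space M. wt \<omega> x \<in> X x}" by blast
      moreover have "0 < prob {\<omega> \<in> space M. wt \<omega> 0 \<in> X x}" using p1 p2 by (simp add: X_def)
      ultimately show ?thesis unfolding prob_wt_eq[OF X[of x], of x, symmetric] by (simp only:)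
    qed
    ultimately show ?thesis by (simp add: prod_pos)
  qed
  \<comment> \<open>The separations and the bound R are decided at levels at least 0, the weights in
    W strictly below; hence independence by (B4).\<close>
  have "prob (A k \<inter> A l \<inter> C R \<inter> W) = prob (A k \<inter> A l \<inter> C R) * prob W"
    by (rule indep_setD[OF indep _ W_V]) (intro sets.Int A_U C_U)
  then have pos: "0 < prob (A k \<inter> A l \<inter> C R \<inter> W)" using R pW by simp
  have "AE \<omega> in M. \<omega> \<in> A k \<inter> A l \<inter> C R \<inter> W \<longrightarrow> \<omega> \<in> {\<omega> \<in> space M. barren_gap N k l (?f \<omega>) 0}"
    using AE_cocycle
  proof eventually_elim
    case (elim \<omega>)
    interpret busemann_cocycle "wt \<omega>" "real_B \<omega>" by (rule elim)
    show ?case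
    proof (intro impI)
      assume \<omega>: "\<omega> \<in> A k \<inter> A l \<inter> C R \<inter> W"
      have inc: "real_B \<omega> t \<sigma> (diag i) (diag a) = inc \<omega> i a" for i a
      proof -
        let ?m = "(max i a, - min i a)"
        have "real_B \<omega> t \<sigma> (diag i) (diag a) + real_B \<omega> t \<sigma> (diag a) ?m = real_B \<omega> t \<sigma> (diag i) ?m"
          by (rule cocycle[OF t])
        then show ?thesis unfolding inc_def by linarith
      qed
      have wX: "wt \<omega> x \<in> X x" if "x \<in> S" for x using \<omega> that unfolding W_def by blast
      have "(?f \<omega> ^^ N) x \<noteq> diag i" if x: "lev x = - int N" and i: "i \<in> {k+1..l}" for x i
        unfolding bpath_def[symmetric]
      proof (rule gap_blocked[OF t kl \<epsilon>, where R = "real R" and \<alpha> = \<alpha>])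
        show "\<alpha> - \<epsilon> \<le> wt \<omega> x \<and> wt \<omega> x \<le> \<alpha>"
          if "- int N \<le> lev x" "lev x < 0" "fst x \<le> l" "snd x < - k" for x
          using wX[of x] that by (simp add: S_def X_def)
        show "\<alpha> + 2 * \<epsilon> \<le> wt \<omega> (k - m, - k)" if "1 \<le> m" "m \<le> int N" for m
          using wX[of "(k - m, - k)"] that kl by (simp add: S_def X_def)
        show "\<alpha> + 2 * \<epsilon> \<le> wt \<omega> (l + 1, - (l + 1) - m)" if "1 \<le> m" "m \<le> int N" for m
          using wX[of "(l + 1, - (l + 1) - m)"] that kl by (simp add: S_def X_def)
        show "real_B \<omega> t \<sigma> (diag i) (diag k) \<le> real R \<and> real_B \<omega> t \<sigma> (diag i) (diag (l + 1)) \<le> real R"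
          if "i \<in> {k+1..l}" for i
          using \<omega> that unfolding inc C_def by blast
      qed (use N x i in simp_all)
      then have "barren_gap N k l (?f \<omega>) 0"
        using \<omega> unfolding barren_gap_def A_def by (simp add: lev_def)
      then show "\<omega> \<in> {\<omega> \<in> space M. barren_gap N k l (?f \<omega>) 0}" by (simp add: space_M)
    qed
  qed
  then have "prob (A k \<inter> A l \<inter> C R \<inter> W) \<le> prob {\<omega> \<in> space M. barren_gap N k l (?f \<omega>) 0}"
    by (rule finite_measure_mono_AE) (intro barren_gap_in_sets measurable_field t up_right_bstep)
  then show False using pos barren_gap_null[OF t kl, of N \<sigma>] by simp
qed

text \<open>By stationarity all neighbours on antidiagonals coalesce simultaneously; transitivity
  along an antidiagonal and advancing the lower starting point then cover all pairs.\<close>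

theorem AE_coalescence:
  assumes t: "0 < t" "t < 1"
  shows "AE \<omega> in M. \<forall>x y. \<exists>m n. bpath (real_B \<omega>) t \<sigma> x m = bpath (real_B \<omega>) t \<sigma> y n"
proof -
  let ?f = "\<lambda>\<omega>. bstep (real_B \<omega>) t \<sigma>"
  define E where "E = {\<omega> \<in> space M. coalesces (?f \<omega>) (diag 0) (diag 1)}"
  have E: "E \<in> sets M" unfolding E_def
    by (rule coalesces_in_sets[where m = 0 and f = ?f, OF measurable_field[OF t] up_right_bstep]) simp_all
  have "prob E = 1" using AE_in_set_eq_1[OF E] noncoalescence_null[OF t, of \<sigma>] by (simp add: E_def space_M)
  then have "AE \<omega> in M. \<omega> \<in> T z -` E \<inter> space M" for z
    using AE_in_set_eq_1[OF prob_shift(2)[OF E]] prob_shift(1)[OF E] by simp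
  then have "AE \<omega> in M. \<forall>z. \<omega> \<in> T z -` E \<inter> space M" by (simp only: AE_all_countable) simp
  then show ?thesis
    using AE_field_shift[OF t, of \<sigma>]
  proof eventually_elim
    case (elim \<omega>)
    let ?g = "?f \<omega>"
    have nb: "coalesces ?g z (z + diag 1)" for z
    proof -
      have shift: "?g (x + z) = ?f (T z \<omega>) x + z" for x using elim(2) by blast
      have "coalesces (?f (T z \<omega>)) (diag 0) (diag 1)" using elim(1) unfolding E_def by blast
      then have "coalesces ?g (diag 0 + z) (diag 1 + z)"
        using coalesces_shift[of ?g z "?f (T z \<omega>)" "diag 0" "diag 1", OF shift] by simp
      moreover have "diag 0 + z = z" by (simp add: prod_eq_iff)
      ultimately show ?thesis by (simp add: add.commute)
    qed
    have row: "coalesces ?g z (z + diag (int n))" for z n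
    proof (induction n)
      case 0
      have "z + diag (int 0) = z" by (simp add: prod_eq_iff)
      then show ?case unfolding coalesces_def by metis
    next
      case (Suc n)
      have eq: "z + diag (int n) + diag 1 = z + diag (int (Suc n))" by (simp add: prod_eq_iff)
      show ?case using coalesces_trans[OF Suc nb[of "z + diag (int n)"]] unfolding eq .
    qed
    have same: "\<exists>n. bpath (real_B \<omega>) t \<sigma> x n = bpath (real_B \<omega>) t \<sigma> y n" if xy: "lev x = lev y" "fst y \<le> fst x" for x y
    proof -
      have "x = y + diag (int (nat (fst x - fst y)))"
        by (rule site_eqI) (use xy in \<open>simp_all add: lev_add\<close>)
      then have "coalesces ?g y x" using row by metis
      then obtain m n where mn: "(?g ^^ m) y = (?g ^^ n) x" unfolding coalesces_def by blast
      have "lev ((?g ^^ m) y) = lev y + int m" "lev ((?g ^^ n) x) = lev x + int n"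
        by (rule lev_iterate[OF up_right_bstep])+
      then have "m = n" using mn xy by simp
      then show ?thesis using mn unfolding bpath_def by metis
    qed
    show ?case using coalesce_if_same_level[of "real_B \<omega>" t \<sigma>, OF same] by blast
  qed
qed

end

section \<open>The shape function along the direction simplex\<close>

text \<open>The sign sits in the increment and in the divisor, so for \<open>Minus\<close> this is
  the ordinary left derivative and not its negative.\<close>

definition side_deriv :: "(real \<Rightarrow> real) \<Rightarrow> real \<Rightarrow> sign \<Rightarrow> real \<Rightarrow> bool" where
  "side_deriv p t \<sigma> d \<longleftrightarrow>
     ((\<lambda>h. (p (t + sign_val \<sigma> * h) - p t) / (sign_val \<sigma> * h)) \<longlongrightarrow> d) (at_right 0)"

lemma side_deriv_unique: "side_deriv p t \<sigma> d \<Longrightarrow> side_deriv p t \<sigma> d' \<Longrightarrow> d = d'"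
  unfolding side_deriv_def by (rule tendsto_unique[OF trivial_limit_at_right_real])

lemma sign_val_square [simp]: "sign_val \<sigma> * sign_val \<sigma> = 1" "sign_val \<sigma> \<noteq> 0" "\<bar>sign_val \<sigma>\<bar> = 1"
  by (cases \<sigma>; simp)+

lemma side_deriv_affine:
  assumes a: "\<And>r. r \<in> {min s t..max s t} \<Longrightarrow> p r = a + c * r" and s: "s \<noteq> t" and \<sigma>: "0 < sign_val \<sigma> * (s - t)"
  shows "side_deriv p t \<sigma> c"
proof -
  have "\<forall>\<^sub>F h in at_right 0. (p (t + sign_val \<sigma> * h) - p t) / (sign_val \<sigma> * h) = c"
  proof (rule eventually_at_rightI)
    fix h assume h: "h \<in> {0<..<\<bar>s - t\<bar>}"
    have "t + sign_val \<sigma> * h \<in> {min s t..max s t}" using \<sigma> h by (cases \<sigma>) auto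
    then have "p (t + sign_val \<sigma> * h) - p t = c * (sign_val \<sigma> * h)"
      using a[of "t + sign_val \<sigma> * h"] a[of t] by (simp add: algebra_simps)
    then show "(p (t + sign_val \<sigma> * h) - p t) / (sign_val \<sigma> * h) = c" using h by simp
  qed (use s in simp)
  then show ?thesis unfolding side_deriv_def by (rule tendsto_eventually)
qed

lemma side_deriv_differentiable:
  assumes "(p has_field_derivative D) (at t)"
  shows "side_deriv p t \<sigma> D"
proof -
  have "((\<lambda>h. (p (t + h) - p t) / h) \<longlongrightarrow> D) (at 0)"
    using assms unfolding DERIV_def .
  moreover have "filterlim (\<lambda>h. sign_val \<sigma> * h) (at 0) (at_right 0)"
    unfolding filterlim_at
    by (auto intro!: tendsto_eq_intros eventually_at_rightI[of 0 1])
  ultimately show ?thesis unfolding side_deriv_def by (rule filterlim_compose)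
qed

text \<open>Three-point concavity in product form avoids division and includes coinciding
  points.\<close>

locale concave_profile =
  fixes p :: "real \<Rightarrow> real"
  assumes concave: "\<And>r s u. 0 \<le> r \<Longrightarrow> r \<le> s \<Longrightarrow> s \<le> u \<Longrightarrow> u \<le> 1 \<Longrightarrow>
    (u - s) * p r + (s - r) * p u \<le> (u - r) * p s"
begin

lemma slope_left_ge:
  assumes "0 \<le> r" "r < s" "s < u" "u \<le> 1"
  shows "(p u - p s) / (u - s) \<le> (p s - p r) / (s - r)"
proof -
  have "(u - s) * p r + (s - r) * p u \<le> (u - r) * p s" by (rule concave) (use assms in auto)
  then have "(p u - p s) * (s - r) \<le> (p s - p r) * (u - s)" by (simp add: algebra_simps)
  then show ?thesis using assms by (simp add: pos_divide_le_eq pos_le_divide_eq)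
qed

lemma right_slope_antimono:
  assumes "0 \<le> t" "0 < h" "h \<le> h'" "t + h' \<le> 1"
  shows "(p (t + h') - p t) / h' \<le> (p (t + h) - p t) / h"
proof -
  have "(t + h' - (t + h)) * p t + (t + h - t) * p (t + h') \<le> (t + h' - t) * p (t + h)"
    by (rule concave) (use assms in auto)
  then have "(p (t + h') - p t) * h \<le> (p (t + h) - p t) * h'" by (simp add: algebra_simps)
  then show ?thesis using assms by (simp add: field_simps)
qed

text \<open>Right difference quotients increase as the step shrinks and are bounded by left
  quotients, so their supremum is the right derivative. Its comparison with the quotients on both
  sides gives the supporting line.\<close>

lemma right_side_deriv:
  assumes t: "0 < t" "t < 1"
  obtains d where "side_deriv p t Plus d" "\<And>r. 0 \<le> r \<Longrightarrow> r \<le> 1 \<Longrightarrow> p r \<le> p t + d * (r - t)"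
proof -
  define q where "q h = (p (t + h) - p t) / h" for h
  define A where "A = q ` {0<..1 - t}"
  define d where "d = Sup A"
  have ne: "A \<noteq> {}" using t by (simp add: A_def)
  have up: "q h \<le> (p t - p r) / (t - r)" if "0 \<le> r" "r < t" "h \<in> {0<..1 - t}" for h r
    using slope_left_ge[of r t "t + h"] that unfolding q_def by simp
  have bdd: "bdd_above A" unfolding A_def
  proof (rule bdd_aboveI2)
    show "q h \<le> (p t - p 0) / (t - 0)" if "h \<in> {0<..1 - t}" for h
      by (rule up[OF order_refl t(1) that])
  qed
  have q_le: "q h \<le> d" if "h \<in> {0<..1 - t}" for h
    unfolding d_def using bdd that by (intro cSup_upper) (simp_all add: A_def)
  have "(q \<longlongrightarrow> d) (at_right 0)"
  proof (rule order_tendstoI)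
    fix a assume "a < d"
    then obtain h0 where h0: "h0 \<in> {0<..1 - t}" "a < q h0"
      using less_cSupD[OF ne, of a] unfolding d_def A_def by auto
    show "\<forall>\<^sub>F h in at_right 0. a < q h"
    proof (rule eventually_at_rightI)
      fix h assume "h \<in> {0<..<h0}"
      then have "q h0 \<le> q h" unfolding q_def using h0 t by (intro right_slope_antimono) auto
      then show "a < q h" using h0 by simp
    qed (use h0 in simp)
  next
    fix a assume a: "d < a"
    show "\<forall>\<^sub>F h in at_right 0. q h < a"
    proof (rule eventually_at_rightI)
      fix h assume "h \<in> {0<..<1 - t}"
      then show "q h < a" using q_le[of h] a by simp
    qed (use t in simp)
  qed
  then have sd: "side_deriv p t Plus d" unfolding side_deriv_def q_def by simp
  have "p r \<le> p t + d * (r - t)" if r: "0 \<le> r" "r \<le> 1" for r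
  proof (cases r t rule: linorder_cases)
    case less
    have "d \<le> (p t - p r) / (t - r)" unfolding d_def
      by (rule cSup_least[OF ne]) (use up[OF r(1) less] in \<open>auto simp: A_def\<close>)
    then have "d * (t - r) \<le> p t - p r" using less by (simp add: le_divide_eq)
    then show ?thesis by (simp add: algebra_simps)
  next
    case greater
    have "q (r - t) \<le> d" by (rule q_le) (use greater r in simp)
    then have "p r - p t \<le> d * (r - t)" using greater by (simp add: q_def divide_le_eq)
    then show ?thesis by simp
  qed simp
  then show thesis using that sd by blast
qed

end

lemma concave_profile_reflect: "concave_profile p \<Longrightarrow> concave_profile (\<lambda>t. p (1 - t))"
proof
  assume "concave_profile p"
  then interpret concave_profile p .
  fix r s u :: real assume "0 \<le> r" "r \<le> s" "s \<le> u" "u \<le> 1"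
  then have "(1 - r - (1 - s)) * p (1 - u) + (1 - s - (1 - u)) * p (1 - r) \<le> (1 - r - (1 - u)) * p (1 - s)"
    by (intro concave) auto
  then show "(u - s) * p (1 - r) + (s - r) * p (1 - u) \<le> (u - r) * p (1 - s)"
    by (simp add: algebra_simps)
qed

context concave_profile
begin

lemma side_deriv_exists:
  assumes t: "0 < t" "t < 1"
  obtains d where "side_deriv p t \<sigma> d" "\<And>r. 0 \<le> r \<Longrightarrow> r \<le> 1 \<Longrightarrow> p r \<le> p t + d * (r - t)"
proof (cases \<sigma>)
  case Plus
  then show thesis using right_side_deriv[OF t] that by metis
next
  case Minus
  interpret R: concave_profile "\<lambda>t. p (1 - t)" by (rule concave_profile_reflect) unfold_locales
  have t': "0 < 1 - t" "1 - t < 1" using t by auto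
  obtain d where d: "side_deriv (\<lambda>t. p (1 - t)) (1 - t) Plus d"
    and tan: "\<And>r. 0 \<le> r \<Longrightarrow> r \<le> 1 \<Longrightarrow> p (1 - r) \<le> p (1 - (1 - t)) + d * (r - (1 - t))"
    using R.right_side_deriv[OF t'] by blast
  have "((\<lambda>h. - ((p (1 - (1 - t + 1 * h)) - p (1 - (1 - t))) / (1 * h))) \<longlongrightarrow> - d) (at_right 0)"
    using d unfolding side_deriv_def by (intro tendsto_minus) simp
  then have "side_deriv p t \<sigma> (- d)" unfolding side_deriv_def Minus by simp
  moreover have "p r \<le> p t + (- d) * (r - t)" if "0 \<le> r" "r \<le> 1" for r
    using tan[of "1 - r"] that by (simp add: algebra_simps)
  ultimately show thesis using that by blast
qed

text \<open>Concavity keeps p above its chord and the supporting line keeps it below; touching at s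
  makes chord and line coincide.\<close>

lemma touching_imp_affine:
  assumes s: "0 \<le> s" "s \<le> 1" and t: "0 \<le> t" "t \<le> 1"
    and tan: "\<And>r. 0 \<le> r \<Longrightarrow> r \<le> 1 \<Longrightarrow> p r \<le> p t + d * (r - t)" and touch: "p s = p t + d * (s - t)"
  shows "affine_between p s t"
proof -
  have "p r = p t + d * (r - t)" if r: "r \<in> {min s t..max s t}" for r
  proof (cases "s = t")
    case False
    define lo hi where "lo = min s t" and "hi = max s t"
    have *: "lo \<le> r" "r \<le> hi" "0 \<le> lo" "hi \<le> 1" "lo < hi" using r s t False by (auto simp: lo_def hi_def)
    have val: "p lo = p t + d * (lo - t)" "p hi = p t + d * (hi - t)"
      using touch by (auto simp: lo_def hi_def min_def max_def)
    have "(hi - r) * p lo + (r - lo) * p hi \<le> (hi - lo) * p r" by (rule concave) (use * in auto)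
    moreover have "(hi - r) * p lo + (r - lo) * p hi = (hi - lo) * (p t + d * (r - t))"
      unfolding val by (simp add: algebra_simps)
    ultimately have "p t + d * (r - t) \<le> p r" using * by simp
    moreover have "p r \<le> p t + d * (r - t)" by (rule tan) (use * in auto)
    ultimately show ?thesis by simp
  qed (use r in simp)
  then have "\<forall>r\<in>{min s t..max s t}. p r = (p t - d * t) + d * r" by (simp add: algebra_simps)
  then show ?thesis unfolding affine_between_def by blast
qed

text \<open>Continuity of \<open>p\<close> at the limit point is not available when it is an end point of
  the simplex; concavity between \<open>t\<close> and the approximating points replaces it.\<close>

lemma asymptotic_touching_imp_affine:
  assumes t: "0 < t" "t < 1" and tan: "\<And>r. 0 \<le> r \<Longrightarrow> r \<le> 1 \<Longrightarrow> p r \<le> p t + d * (r - t)"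
    and s: "\<And>n. 0 \<le> s n \<and> s n \<le> 1" "s \<longlonglongrightarrow> u" and gap: "(\<lambda>n. p t + d * (s n - t) - p (s n)) \<longlonglongrightarrow> 0"
    and r: "min t u < r" "r < max t u"
  shows "affine_between p t r"
proof -
  have u: "0 \<le> u" "u \<le> 1"
    using LIMSEQ_le_const[OF s(2), of 0] LIMSEQ_le_const2[OF s(2), of 1] s(1) by blast+
  have r01: "0 \<le> r" "r \<le> 1" using r u t by auto
  let ?f = "\<lambda>x. p t + d * (x - t) - p x"
  have f0: "0 \<le> ?f x" if "0 \<le> x" "x \<le> 1" for x using tan[OF that] by simp
  \<comment> \<open>The distance to the supporting line is convex, nonnegative and zero at t, so it
    grows away from t; smallness at the points \<open>s n\<close> thus carries over to r.\<close>
  have key: "?f r \<le> ?f x" if x: "0 \<le> x" "x \<le> 1" "min t x < r" "r < max t x" for x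
  proof -
    define lo hi where "lo = min t x" and "hi = max t x"
    have *: "lo < r" "r < hi" "0 \<le> lo" "hi \<le> 1" using x t by (auto simp: lo_def hi_def)
    have "(hi - r) * p lo + (r - lo) * p hi \<le> (hi - lo) * p r" by (rule concave) (use * in auto)
    then have le: "(hi - lo) * ?f r \<le> (hi - r) * ?f lo + (r - lo) * ?f hi" by (simp add: algebra_simps)
    have "?f lo \<le> ?f x" "?f hi \<le> ?f x"
      using f0[OF x(1,2)] by (auto simp: lo_def hi_def min_def max_def)
    then have "(hi - r) * ?f lo + (r - lo) * ?f hi \<le> (hi - r) * ?f x + (r - lo) * ?f x"
      using * by (intro add_mono mult_left_mono) auto
    also have "\<dots> = (hi - lo) * ?f x" by (simp add: algebra_simps)
    finally have "(hi - lo) * ?f r \<le> (hi - lo) * ?f x" using le by linarith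
    then show ?thesis using * by (simp only: mult_le_cancel_left)
  qed
  have "\<forall>\<^sub>F n in sequentially. min t (s n) < r \<and> r < max t (s n)"
  proof (cases "u < r")
    case True
    then have "r < t" using r by auto
    have "\<forall>\<^sub>F n in sequentially. s n < r" by (rule order_tendstoD(2)[OF s(2) True])
    then show ?thesis by eventually_elim (use \<open>r < t\<close> in auto)
  next
    case False
    then have "r < u" "t < r" using r by auto
    have "\<forall>\<^sub>F n in sequentially. r < s n" by (rule order_tendstoD(1)[OF s(2) \<open>r < u\<close>])
    then show ?thesis by eventually_elim (use \<open>t < r\<close> in auto)
  qed
  then have "\<forall>\<^sub>F n in sequentially. ?f r \<le> ?f (s n)"
    by eventually_elim (intro key, use s(1) in auto)
  then have "?f r \<le> 0" by (rule tendsto_le[OF trivial_limit_sequentially gap tendsto_const])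
  then have "p r = p t + d * (r - t)" using f0[OF r01] by simp
  then have "affine_between p r t"
    by (intro touching_imp_affine[OF r01 _ _ tan]) (use t in auto)
  then show ?thesis by (simp only: affine_between_sym)
qed

lemma continuous: "continuous_on {0<..<1} p"
proof -
  have "convex_on {0<..<1} (\<lambda>x. - p x)"
  proof (rule convex_onI)
    fix \<theta> x y :: real assume \<theta>: "0 < \<theta>" "\<theta> < 1" and xy: "x \<in> {0<..<1}" "y \<in> {0<..<1}"
    have le: "(1 - \<theta>) * p x + \<theta> * p y \<le> p ((1 - \<theta>) * x + \<theta> * y)"
      if \<theta>: "0 < \<theta>" "\<theta> < 1" and xy: "x < y" "0 < x" "y < 1" for x y \<theta> :: real
    proof -
      let ?z = "(1 - \<theta>) * x + \<theta> * y"
      have z: "?z - x = \<theta> * (y - x)" "y - ?z = (1 - \<theta>) * (y - x)" by (simp_all add: algebra_simps)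
      have zb: "x \<le> ?z" "?z \<le> y"
        using mult_nonneg_nonneg[of \<theta> "y - x"] mult_nonneg_nonneg[of "1 - \<theta>" "y - x"] \<theta> xy z by linarith+
      have "(y - ?z) * p x + (?z - x) * p y \<le> (y - x) * p ?z"
        by (rule concave) (use xy zb in auto)
      then have "(y - x) * ((1 - \<theta>) * p x + \<theta> * p y) \<le> (y - x) * p ?z"
        unfolding z by (simp add: algebra_simps)
      then show ?thesis using xy by simp
    qed
    show "- p ((1 - \<theta>) *\<^sub>R x + \<theta> *\<^sub>R y) \<le> (1 - \<theta>) * - p x + \<theta> * - p y"
    proof (cases x y rule: linorder_cases)
      case less
      then show ?thesis using le[of \<theta> x y] \<theta> xy by simp
    next
      case greater
      then show ?thesis using le[of "1 - \<theta>" y x] \<theta> xy by (simp add: add.commute)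
    next
      case equal
      then show ?thesis by (simp add: algebra_simps)
    qed
  qed simp
  then have "continuous_on {0<..<1} (\<lambda>x. - p x)" by (intro convex_on_continuous) auto
  then show ?thesis using continuous_on_minus by fastforce
qed

end

subsection \<open>Gradients\<close>

text \<open>By homogeneity a displacement along a coordinate axis can be rescaled back to the
  simplex; the product rule then expresses both coordinates of the gradient through a single
  one-sided derivative of p.\<close>

lemma grad_dir_eq:
  assumes t: "0 < t" "t < 1" and p: "\<And>r. p r = g (dir r)" and cont: "isCont p t"
    and hom: "\<And>c v. 0 \<le> c \<Longrightarrow> 0 \<le> v \<Longrightarrow> g (c *\<^sub>R v) = c * g v"
    and d: "side_deriv p t \<sigma> d"
  shows "grad g (dir t) \<sigma> = (p t + (1 - t) * d, p t - t * d)"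
proof -
  let ?s = "sign_val \<sigma>"
  have s2: "?s * ?s = 1" by simp
  have quot: "((\<lambda>\<epsilon>. p (t + ?s * k \<epsilon>) + e * ((p (t + ?s * k \<epsilon>) - p t) / (?s * k \<epsilon>)) * (k \<epsilon> / \<epsilon>)) \<longlongrightarrow> p t + e * d * m) (at_right 0)"
    if k: "(k \<longlongrightarrow> 0) (at_right 0)" "\<forall>\<^sub>F \<epsilon> in at_right 0. 0 < k \<epsilon>" "((\<lambda>\<epsilon>. k \<epsilon> / \<epsilon>) \<longlongrightarrow> m) (at_right 0)"
    for k :: "real \<Rightarrow> real" and m e
  proof -
    have kr: "filterlim k (at_right 0) (at_right 0)" unfolding filterlim_at
      using k(1) eventually_mono[OF k(2), of "\<lambda>x. k x \<in> {0<..} \<and> k x \<noteq> 0"] by simp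
    have "((\<lambda>\<epsilon>. t + ?s * k \<epsilon>) \<longlongrightarrow> t + ?s * 0) (at_right 0)" by (intro tendsto_intros k)
    then have "((\<lambda>\<epsilon>. p (t + ?s * k \<epsilon>)) \<longlongrightarrow> p t) (at_right 0)"
      using isCont_tendsto_compose[OF cont] by simp
    moreover have "((\<lambda>\<epsilon>. (p (t + ?s * k \<epsilon>) - p t) / (?s * k \<epsilon>)) \<longlongrightarrow> d) (at_right 0)"
      by (rule filterlim_compose[OF d[unfolded side_deriv_def] kr])
    ultimately show ?thesis by (intro tendsto_add tendsto_mult tendsto_const k(3))
  qed
  have small: "\<forall>\<^sub>F \<epsilon> in at_right (0::real). 0 < \<epsilon> \<and> \<epsilon> < 1 - t \<and> \<epsilon> < t"
    by (rule eventually_at_rightI[of 0 "min t (1 - t)"]) (use t in auto)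
  have 1: "Lim (at_right 0) (\<lambda>\<epsilon>. (g (dir t + (?s * \<epsilon>) *\<^sub>R e1) - g (dir t)) / (?s * \<epsilon>)) = p t + (1 - t) * d"
  proof (rule tendsto_Lim)
    \<comment> \<open>k is the displacement on the simplex after rescaling: \<open>(t + ?s *
      \<epsilon>) / (1 + ?s * \<epsilon>) = t + ?s * k \<epsilon>\<close>, and its ratio to
      \<epsilon> tends to 1 - t.\<close>
    define k where "k \<epsilon> = \<epsilon> * (1 - t) / (1 + ?s * \<epsilon>)" for \<epsilon>
    have kl: "(k \<longlongrightarrow> 0 * (1 - t) / (1 + ?s * 0)) (at_right 0)"
      unfolding k_def by (intro tendsto_intros) simp
    have kp: "\<forall>\<^sub>F \<epsilon> in at_right 0. 0 < k \<epsilon>"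
      using small by eventually_elim (cases \<sigma>; use t in \<open>auto simp: k_def\<close>)
    have "((\<lambda>\<epsilon>. (1 - t) / (1 + ?s * \<epsilon>)) \<longlongrightarrow> (1 - t) / (1 + ?s * 0)) (at_right 0)"
      by (intro tendsto_intros) simp
    moreover have "\<forall>\<^sub>F \<epsilon> in at_right 0. (1 - t) / (1 + ?s * \<epsilon>) = k \<epsilon> / \<epsilon>"
      using small by eventually_elim (simp add: k_def)
    ultimately have km: "((\<lambda>\<epsilon>. k \<epsilon> / \<epsilon>) \<longlongrightarrow> 1 - t) (at_right 0)"
      by (simp add: Lim_transform_eventually)
    have lim: "((\<lambda>\<epsilon>. p (t + ?s * k \<epsilon>) + 1 * ((p (t + ?s * k \<epsilon>) - p t) / (?s * k \<epsilon>)) * (k \<epsilon> / \<epsilon>))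
        \<longlongrightarrow> p t + 1 * d * (1 - t)) (at_right 0)"
      by (rule quot[OF _ kp km]) (use kl in simp)
    have "\<forall>\<^sub>F \<epsilon> in at_right 0. p (t + ?s * k \<epsilon>) + 1 * ((p (t + ?s * k \<epsilon>) - p t) / (?s * k \<epsilon>)) * (k \<epsilon> / \<epsilon>)
        = (g (dir t + (?s * \<epsilon>) *\<^sub>R e1) - g (dir t)) / (?s * \<epsilon>)"
      using small kp
    proof eventually_elim
      case (elim \<epsilon>)
      let ?c = "1 + ?s * \<epsilon>"
      have c: "0 < ?c" using elim t by (cases \<sigma>) auto
      have arg: "t + ?s * k \<epsilon> = (t + ?s * \<epsilon>) / ?c"
        using c by (simp add: k_def field_simps)
      have "dir t + (?s * \<epsilon>) *\<^sub>R e1 = ?c *\<^sub>R dir (t + ?s * k \<epsilon>)"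
        unfolding arg using c by (simp add: dir_def field_simps)
      moreover have "0 \<le> dir (t + ?s * k \<epsilon>)"
        unfolding arg using c elim t by (cases \<sigma>) (auto simp: dir_def less_eq_prod_def field_simps)
      ultimately have "g (dir t + (?s * \<epsilon>) *\<^sub>R e1) = ?c * p (t + ?s * k \<epsilon>)"
        using hom[of ?c "dir (t + ?s * k \<epsilon>)"] c p by simp
      moreover have "1 * ((P - p t) / (?s * k \<epsilon>)) * (k \<epsilon> / \<epsilon>) = (P - p t) / (?s * \<epsilon>)" for P
        using elim by simp
      moreover have "P + (P - p t) / (?s * \<epsilon>) = (?c * P - p t) / (?s * \<epsilon>)" for P
        using elim by (simp add: field_simps)
      ultimately show ?case using p[of t] by simp
    qed
    from Lim_transform_eventually[OF lim this]
    show "((\<lambda>\<epsilon>. (g (dir t + (?s * \<epsilon>) *\<^sub>R e1) - g (dir t)) / (?s * \<epsilon>)) \<longlongrightarrow> p t + (1 - t) * d) (at_right 0)"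
      by (simp add: mult.commute)
  qed simp
  have 2: "Lim (at_right 0) (\<lambda>\<epsilon>. (g (dir t - (?s * \<epsilon>) *\<^sub>R e2) - g (dir t)) / (- (?s * \<epsilon>))) = p t - t * d"
  proof (rule tendsto_Lim)
    \<comment> \<open>Lowering the second coordinate and rescaling raises the first:
      \<open>t / (1 - ?s * \<epsilon>) = t + ?s * k \<epsilon>\<close>. So the derivative from the
      same side occurs, now with a ratio of k to \<epsilon> tending to t.\<close>
    define k where "k \<epsilon> = \<epsilon> * t / (1 - ?s * \<epsilon>)" for \<epsilon>
    have kl: "(k \<longlongrightarrow> 0 * t / (1 - ?s * 0)) (at_right 0)"
      unfolding k_def by (intro tendsto_intros) simp
    have kp: "\<forall>\<^sub>F \<epsilon> in at_right 0. 0 < k \<epsilon>"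
      using small by eventually_elim (cases \<sigma>; use t in \<open>auto simp: k_def\<close>)
    have "((\<lambda>\<epsilon>. t / (1 - ?s * \<epsilon>)) \<longlongrightarrow> t / (1 - ?s * 0)) (at_right 0)"
      by (intro tendsto_intros) simp
    moreover have "\<forall>\<^sub>F \<epsilon> in at_right 0. t / (1 - ?s * \<epsilon>) = k \<epsilon> / \<epsilon>"
      using small by eventually_elim (simp add: k_def)
    ultimately have km: "((\<lambda>\<epsilon>. k \<epsilon> / \<epsilon>) \<longlongrightarrow> t) (at_right 0)"
      by (simp add: Lim_transform_eventually)
    have lim: "((\<lambda>\<epsilon>. p (t + ?s * k \<epsilon>) + (- 1) * ((p (t + ?s * k \<epsilon>) - p t) / (?s * k \<epsilon>)) * (k \<epsilon> / \<epsilon>))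
        \<longlongrightarrow> p t + (- 1) * d * t) (at_right 0)"
      by (rule quot[OF _ kp km]) (use kl in simp)
    have "\<forall>\<^sub>F \<epsilon> in at_right 0. p (t + ?s * k \<epsilon>) + (- 1) * ((p (t + ?s * k \<epsilon>) - p t) / (?s * k \<epsilon>)) * (k \<epsilon> / \<epsilon>)
        = (g (dir t - (?s * \<epsilon>) *\<^sub>R e2) - g (dir t)) / (- (?s * \<epsilon>))"
      using small kp
    proof eventually_elim
      case (elim \<epsilon>)
      let ?c = "1 - ?s * \<epsilon>"
      have c: "0 < ?c" using elim t by (cases \<sigma>) auto
      have arg: "t + ?s * k \<epsilon> = t / ?c"
        using c by (simp add: k_def field_simps)
      have "dir t - (?s * \<epsilon>) *\<^sub>R e2 = ?c *\<^sub>R dir (t + ?s * k \<epsilon>)"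
        unfolding arg using c by (simp add: dir_def field_simps)
      moreover have "0 \<le> dir (t + ?s * k \<epsilon>)"
        unfolding arg using c elim t by (cases \<sigma>) (auto simp: dir_def less_eq_prod_def field_simps)
      ultimately have "g (dir t - (?s * \<epsilon>) *\<^sub>R e2) = ?c * p (t + ?s * k \<epsilon>)"
        using hom[of ?c "dir (t + ?s * k \<epsilon>)"] c p by simp
      moreover have "(- 1) * ((P - p t) / (?s * k \<epsilon>)) * (k \<epsilon> / \<epsilon>) = - ((P - p t) / (?s * \<epsilon>))" for P
        using elim by (simp add: minus_divide_left)
      moreover have "P + - ((P - p t) / (?s * \<epsilon>)) = (?c * P - p t) / (- (?s * \<epsilon>))" for P
        using elim by (simp add: field_simps)
      ultimately show ?case using p[of t] by simp
    qed
    from Lim_transform_eventually[OF lim this]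
    show "((\<lambda>\<epsilon>. (g (dir t - (?s * \<epsilon>) *\<^sub>R e2) - g (dir t)) / (- (?s * \<epsilon>))) \<longlongrightarrow> p t - t * d) (at_right 0)"
      by (simp add: mult.commute)
  qed simp
  show ?thesis unfolding grad_def 1 2 ..
qed

section \<open>Finite and semi-infinite geodesics\<close>

lemma path_weight_nat:
  "path_weight w \<pi> k m = (\<Sum>i<nat (m - k). w (\<pi> (k + int i)))"
  unfolding path_weight_def
  by (rule sum.reindex_bij_witness[of _ "\<lambda>i. k + int i" "\<lambda>j. nat (j - k)"]) auto

lemma diff_unit_iff: "a - b \<in> {e1, e2} \<longleftrightarrow> a = b + e1 \<or> a = b + (e2 :: site)"
  by (auto simp: algebra_simps)

lemma up_right_path_site:
  assumes \<pi>: "up_right_path x y \<pi>" and i: "lev x \<le> i" "i \<le> lev y"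
  shows "lev (\<pi> i) = i \<and> fst x \<le> fst (\<pi> i) \<and> fst (\<pi> i) \<le> fst x + (i - lev x)"
  using i
proof (induction i rule: int_ge_induct)
  case base
  then show ?case using \<pi> unfolding up_right_path_def by simp
next
  case (step i)
  then have "\<pi> (i + 1) - \<pi> i \<in> {e1, e2}" using \<pi> unfolding up_right_path_def by simp
  then have "\<pi> (i + 1) = \<pi> i + e1 \<or> \<pi> (i + 1) = \<pi> i + e2" unfolding diff_unit_iff .
  moreover have "lev (\<pi> i) = i \<and> fst x \<le> fst (\<pi> i) \<and> fst (\<pi> i) \<le> fst x + (i - lev x)"
    using step by simp
  ultimately show ?case by (auto simp: lev_add)
qed

text \<open>Paths are functions on all integers, so there are infinitely many of them; the weight
  depends only on finitely many values in a finite set of sites.\<close>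

lemma finite_path_weights: "finite {path_weight w \<pi> (lev x) (lev y) |\<pi>. up_right_path x y \<pi>}"
proof -
  define S where "S = (\<lambda>(a, i). (a, i - a)) ` ({fst x..fst x + (lev y - lev x)} \<times> {lev x..lev y})"
  let ?I = "{lev x..<lev y}"
  have "{path_weight w \<pi> (lev x) (lev y) |\<pi>. up_right_path x y \<pi>} \<subseteq>
      (\<lambda>f. \<Sum>i\<in>?I. w (f i)) ` (PiE ?I (\<lambda>_. S))"
  proof
    fix v assume "v \<in> {path_weight w \<pi> (lev x) (lev y) |\<pi>. up_right_path x y \<pi>}"
    then obtain \<pi> where v: "v = path_weight w \<pi> (lev x) (lev y)" and \<pi>: "up_right_path x y \<pi>" by blast
    have "\<pi> i \<in> S" if i: "i \<in> ?I" for i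
    proof -
      have *: "lev (\<pi> i) = i \<and> fst x \<le> fst (\<pi> i) \<and> fst (\<pi> i) \<le> fst x + (i - lev x)"
        by (rule up_right_path_site[OF \<pi>]) (use i in simp_all)
      then have "\<pi> i = (\<lambda>(a, i). (a, i - a)) (fst (\<pi> i), i)" by (auto simp: lev_def prod_eq_iff)
      moreover have "(fst (\<pi> i), i) \<in> {fst x..fst x + (lev y - lev x)} \<times> {lev x..lev y}"
        using * i by auto
      ultimately show ?thesis unfolding S_def by (rule image_eqI)
    qed
    then have mem: "restrict \<pi> ?I \<in> PiE ?I (\<lambda>_. S)" by (simp add: PiE_def Pi_def)
    show "v \<in> (\<lambda>f. \<Sum>i\<in>?I. w (f i)) ` (PiE ?I (\<lambda>_. S))"
      by (rule image_eqI[OF _ mem]) (simp add: v path_weight_def)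
  qed
  moreover have "finite (PiE ?I (\<lambda>_. S))" by (intro finite_PiE) (simp_all add: S_def)
  ultimately show ?thesis using finite_surj by blast
qed

lemma geodesic_iff:
  "geodesic w x y \<pi> \<longleftrightarrow> up_right_path x y \<pi> \<and>
     (\<forall>\<pi>'. up_right_path x y \<pi>' \<longrightarrow> path_weight w \<pi>' (lev x) (lev y) \<le> path_weight w \<pi> (lev x) (lev y))"
proof
  assume "geodesic w x y \<pi>"
  then have "up_right_path x y \<pi>" "path_weight w \<pi> (lev x) (lev y) =
      Max {path_weight w \<pi> (lev x) (lev y) |\<pi>. up_right_path x y \<pi>}"
    unfolding geodesic_def LPT_def by auto
  then show "up_right_path x y \<pi> \<and>
     (\<forall>\<pi>'. up_right_path x y \<pi>' \<longrightarrow> path_weight w \<pi>' (lev x) (lev y) \<le> path_weight w \<pi> (lev x) (lev y))"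
    using Max_ge[OF finite_path_weights[of w x y]] by auto
next
  assume *: "up_right_path x y \<pi> \<and>
     (\<forall>\<pi>'. up_right_path x y \<pi>' \<longrightarrow> path_weight w \<pi>' (lev x) (lev y) \<le> path_weight w \<pi> (lev x) (lev y))"
  have "Max {path_weight w \<pi> (lev x) (lev y) |\<pi>. up_right_path x y \<pi>} = path_weight w \<pi> (lev x) (lev y)"
    by (rule Max_eqI[OF finite_path_weights]) (use * in auto)
  then show "geodesic w x y \<pi>" unfolding geodesic_def LPT_def using * by simp
qed

lemma semi_inf_path_step:
  "semi_inf_path x \<pi> \<Longrightarrow> lev x \<le> i \<Longrightarrow> \<pi> (i + 1) = \<pi> i + e1 \<or> \<pi> (i + 1) = \<pi> i + e2"
  unfolding semi_inf_path_def diff_unit_iff by blast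

lemma lev_semi_inf_path:
  assumes \<pi>: "semi_inf_path x \<pi>" and i: "lev x \<le> i"
  shows "lev (\<pi> i) = i"
  using i
proof (induction i rule: int_ge_induct)
  case base
  then show ?case using \<pi> unfolding semi_inf_path_def by simp
next
  case (step i)
  then show ?case using semi_inf_path_step[OF \<pi>, of i] by (auto simp: lev_add)
qed

lemma semi_inf_geodesic_optimal:
  assumes geo: "semi_inf_geodesic w x \<pi>"
  shows "optimal_path w (\<lambda>n. \<pi> (lev x + int n))"
proof -
  have \<pi>: "semi_inf_path x \<pi>" using geo unfolding semi_inf_geodesic_def by blast
  show ?thesis unfolding optimal_path_def
  proof (intro conjI allI impI)
    fix i
    show "\<pi> (lev x + int (Suc i)) = \<pi> (lev x + int i) + e1 \<or> \<pi> (lev x + int (Suc i)) = \<pi> (lev x + int i) + e2"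
      using semi_inf_path_step[OF \<pi>, of "lev x + int i"] by (simp add: add_ac)
  next
    fix n and \<rho>' :: "nat \<Rightarrow> site"
    assume path: "\<forall>i<n. \<rho>' (Suc i) = \<rho>' i + e1 \<or> \<rho>' (Suc i) = \<rho>' i + e2"
      and ends: "\<rho>' 0 = \<pi> (lev x + int 0)" "\<rho>' n = \<pi> (lev x + int n)"
    let ?u = "\<pi> (lev x)" and ?v = "\<pi> (lev x + int n)"
    have lev_u: "lev ?u = lev x" and lev_v: "lev ?v = lev x + int n"
      by (rule lev_semi_inf_path[OF \<pi>], simp)+
    have "geodesic w ?u ?v \<pi>" using geo unfolding semi_inf_geodesic_def by simp
    then have up: "up_right_path ?u ?v \<pi>"
      and max: "\<And>\<pi>'. up_right_path ?u ?v \<pi>' \<Longrightarrow>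
        path_weight w \<pi>' (lev ?u) (lev ?v) \<le> path_weight w \<pi> (lev ?u) (lev ?v)"
      unfolding geodesic_iff by blast+
    define \<pi>' where "\<pi>' j = \<rho>' (nat (j - lev x))" for j
    have "up_right_path ?u ?v \<pi>'" unfolding up_right_path_def
    proof (intro conjI ballI)
      show "?u \<le> ?v" using up unfolding up_right_path_def by blast
      show "\<pi>' (lev ?u) = ?u" "\<pi>' (lev ?v) = ?v"
        unfolding lev_u lev_v using ends by (simp_all add: \<pi>'_def)
      fix i assume i: "i \<in> {lev ?u..<lev ?v}"
      then have "nat (i + 1 - lev x) = Suc (nat (i - lev x))" "nat (i - lev x) < n"
        unfolding lev_u lev_v by auto
      then show "\<pi>' (i + 1) - \<pi>' i \<in> {e1, e2}"
        unfolding diff_unit_iff \<pi>'_def using path by simp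
    qed
    from max[OF this] show "(\<Sum>i<n. w (\<rho>' i)) \<le> (\<Sum>i<n. w (\<pi> (lev x + int i)))"
      unfolding path_weight_nat lev_u lev_v by (simp add: \<pi>'_def)
  qed
qed

definition level_path :: "realization \<Rightarrow> real \<Rightarrow> sign \<Rightarrow> site \<Rightarrow> int \<Rightarrow> site" where
  "level_path \<beta> t \<sigma> x = restrict (\<lambda>k. bpath \<beta> t \<sigma> x (nat (k - lev x))) {lev x..}"

lemma busemann_geodesic_eq: "busemann_geodesic b x (dir t) \<sigma> = level_path (\<lambda>t. b (dir t)) t \<sigma> x"
proof -
  have "busemann_step b (dir t) \<sigma> = bstep (\<lambda>t. b (dir t)) t \<sigma>"
    by (rule ext, cases \<sigma>) (auto simp: busemann_step_def bstep_def tilt_def)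
  then show ?thesis unfolding busemann_geodesic_def level_path_def bpath_def by simp
qed

lemma level_path_nat: "level_path \<beta> t \<sigma> x (lev x + int n) = bpath \<beta> t \<sigma> x n"
  by (simp add: level_path_def)

lemma level_path_eq_iff:
  "level_path \<beta> t \<sigma> x = level_path \<beta> t \<tau> x \<longleftrightarrow> (\<forall>n. bpath \<beta> t \<sigma> x n = bpath \<beta> t \<tau> x n)"
proof
  assume eq: "level_path \<beta> t \<sigma> x = level_path \<beta> t \<tau> x"
  show "\<forall>n. bpath \<beta> t \<sigma> x n = bpath \<beta> t \<tau> x n"
    by (intro allI) (simp only: eq flip: level_path_nat)
qed (simp add: level_path_def)

lemma semi_inf_path_level_path: "semi_inf_path x (level_path \<beta> t \<sigma> x)"
  unfolding semi_inf_path_def diff_unit_iff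
proof (intro conjI allI impI)
  show "level_path \<beta> t \<sigma> x (lev x) = x" using level_path_nat[of \<beta> t \<sigma> x 0] by simp
  fix i assume i: "lev x \<le> i"
  then have "nat (i + 1 - lev x) = Suc (nat (i - lev x))" by simp
  then show "level_path \<beta> t \<sigma> x (i + 1) = level_path \<beta> t \<sigma> x i + e1 \<or>
      level_path \<beta> t \<sigma> x (i + 1) = level_path \<beta> t \<sigma> x i + e2"
    using bpath_step[of \<beta> t \<sigma> x "nat (i - lev x)"] i by (simp add: level_path_def)
qed (simp add: level_path_def)

lemma coalesce_level_path_iff:
  "coalesce (level_path \<beta> t \<sigma> x) (level_path \<beta> t \<sigma> y) \<longleftrightarrow>
    (\<exists>m n. bpath \<beta> t \<sigma> x m = bpath \<beta> t \<sigma> y n)"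
proof
  assume "coalesce (level_path \<beta> t \<sigma> x) (level_path \<beta> t \<sigma> y)"
  then obtain k where k: "\<And>n. k \<le> n \<Longrightarrow> level_path \<beta> t \<sigma> x n = level_path \<beta> t \<sigma> y n"
    unfolding coalesce_def by blast
  define n where "n = max k (max (lev x) (lev y))"
  have "level_path \<beta> t \<sigma> x n = level_path \<beta> t \<sigma> y n" by (rule k) (simp add: n_def)
  moreover have "lev x \<le> n" "lev y \<le> n" by (simp_all add: n_def)
  ultimately have "bpath \<beta> t \<sigma> x (nat (n - lev x)) = bpath \<beta> t \<sigma> y (nat (n - lev y))"
    by (simp add: level_path_def)
  then show "\<exists>m n. bpath \<beta> t \<sigma> x m = bpath \<beta> t \<sigma> y n" by blast
next
  assume "\<exists>m n. bpath \<beta> t \<sigma> x m = bpath \<beta> t \<sigma> y n"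
  then obtain m n where mn: "bpath \<beta> t \<sigma> x m = bpath \<beta> t \<sigma> y n" by blast
  have lev: "lev x + int m = lev y + int n"
    using lev_bpath[of \<beta> t \<sigma> x m] lev_bpath[of \<beta> t \<sigma> y n] mn by simp
  have "level_path \<beta> t \<sigma> x k = level_path \<beta> t \<sigma> y k" if k: "lev x + int m \<le> k" for k
  proof -
    define j where "j = nat (k - lev x - int m)"
    have kx: "k = lev x + int (m + j)" and ky: "k = lev y + int (n + j)" using k lev by (simp_all add: j_def)
    have "level_path \<beta> t \<sigma> x k = bpath \<beta> t \<sigma> x (m + j)" unfolding kx by (rule level_path_nat)
    also have "\<dots> = bpath \<beta> t \<sigma> y (n + j)" by (rule bpath_meet_later[OF mn])
    also have "\<dots> = level_path \<beta> t \<sigma> y k" unfolding ky by (rule level_path_nat[symmetric])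
    finally show ?thesis .
  qed
  then show "coalesce (level_path \<beta> t \<sigma> x) (level_path \<beta> t \<sigma> y)" unfolding coalesce_def by blast
qed

lemma bpath_le: "bpath \<beta> t \<sigma> x m \<le> bpath \<beta> t \<sigma> x (m + n)"
  unfolding bpath_add less_eq_prod_def bpath_def[of _ _ _ _ n]
  by (intro conjI fst_iterate_bounds[OF up_right_bstep, THEN conjunct1]
      snd_iterate_bounds[OF up_right_bstep, THEN conjunct1])

text \<open>The weight of the segment equals a Busemann increment by \<open>bpath_weights\<close>,
  and \<open>sum_weights_le\<close> bounds every competitor by the same increment.\<close>

lemma (in busemann_cocycle) geodesic_level_path:
  assumes t: "0 < t" "t < 1" and km: "lev x \<le> k" "k \<le> m"
  shows "geodesic w (level_path \<beta> t \<sigma> x k) (level_path \<beta> t \<sigma> x m) (level_path \<beta> t \<sigma> x)"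
    and "path_weight w (level_path \<beta> t \<sigma> x) k m = \<beta> t \<sigma> (level_path \<beta> t \<sigma> x k) (level_path \<beta> t \<sigma> x m)"
proof -
  let ?\<pi> = "level_path \<beta> t \<sigma> x"
  define a n where "a = nat (k - lev x)" and "n = nat (m - k)"
  have k: "k = lev x + int a" and m: "m = lev x + int (a + n)" using km by (simp_all add: a_def n_def)
  have u: "?\<pi> k = bpath \<beta> t \<sigma> x a" and v: "?\<pi> m = bpath \<beta> t \<sigma> x (a + n)"
    unfolding k m by (rule level_path_nat)+
  have lev_u: "lev (?\<pi> k) = k" unfolding u lev_bpath by (simp add: k)
  have lev_v: "lev (?\<pi> m) = m" unfolding v lev_bpath by (simp add: m)
  have "path_weight w ?\<pi> k m = (\<Sum>i<n. w (?\<pi> (k + int i)))" unfolding path_weight_nat n_def by simp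
  also have "\<dots> = (\<Sum>i<n. w (bpath \<beta> t \<sigma> (?\<pi> k) i))"
  proof (rule sum.cong[OF refl])
    fix i
    have "k + int i = lev x + int (a + i)" by (simp add: k)
    then have "?\<pi> (k + int i) = bpath \<beta> t \<sigma> x (a + i)" by (simp only: level_path_nat)
    then show "w (?\<pi> (k + int i)) = w (bpath \<beta> t \<sigma> (?\<pi> k) i)" unfolding u by (simp add: bpath_add)
  qed
  also have "\<dots> = \<beta> t \<sigma> (?\<pi> k) (bpath \<beta> t \<sigma> (?\<pi> k) n)" by (rule bpath_weights[OF t, symmetric])
  also have "bpath \<beta> t \<sigma> (?\<pi> k) n = ?\<pi> m" unfolding u v by (simp add: bpath_add)
  finally show weight: "path_weight w ?\<pi> k m = \<beta> t \<sigma> (?\<pi> k) (?\<pi> m)" .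
  show "geodesic w (?\<pi> k) (?\<pi> m) ?\<pi>" unfolding geodesic_iff lev_u lev_v
  proof (intro conjI allI impI)
    show "up_right_path (?\<pi> k) (?\<pi> m) ?\<pi>" unfolding up_right_path_def lev_u lev_v
    proof (intro conjI ballI)
      show "?\<pi> k \<le> ?\<pi> m" unfolding u v by (rule bpath_le)
      fix i assume "i \<in> {k..<m}"
      then have "lev x \<le> i" using km by simp
      from semi_inf_path_step[OF semi_inf_path_level_path this] show "?\<pi> (i + 1) - ?\<pi> i \<in> {e1, e2}"
        unfolding diff_unit_iff .
    qed simp_all
    fix \<pi>' assume \<pi>': "up_right_path (?\<pi> k) (?\<pi> m) \<pi>'"
    have step: "\<pi>' (k + int (Suc i)) = \<pi>' (k + int i) + e1 \<or> \<pi>' (k + int (Suc i)) = \<pi>' (k + int i) + e2"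
      if "i < n" for i
    proof -
      have "k + int i \<in> {k..<m}" using that by (simp add: n_def)
      then have "\<pi>' (k + int i + 1) - \<pi>' (k + int i) \<in> {e1, e2}"
        using \<pi>' unfolding up_right_path_def lev_u lev_v by blast
      then show ?thesis unfolding diff_unit_iff by (simp add: add_ac)
    qed
    have "(\<Sum>i<n. w (\<pi>' (k + int i))) \<le> \<beta> t \<sigma> (\<pi>' (k + int 0)) (\<pi>' (k + int n))"
      by (rule sum_weights_le[where \<rho> = "\<lambda>i. \<pi>' (k + int i)", OF t step])
    moreover have "\<pi>' (k + int 0) = ?\<pi> k" "\<pi>' (k + int n) = ?\<pi> m"
      using \<pi>' km unfolding up_right_path_def lev_u lev_v by (simp_all add: n_def)
    ultimately show "path_weight w \<pi>' k m \<le> path_weight w ?\<pi> k m"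
      unfolding weight by (simp add: path_weight_nat n_def)
  qed
qed

lemma (in busemann_cocycle) semi_inf_geodesic_level_path:
  "0 < t \<Longrightarrow> t < 1 \<Longrightarrow> semi_inf_geodesic w x (level_path \<beta> t \<sigma> x)"
  unfolding semi_inf_geodesic_def using semi_inf_path_level_path geodesic_level_path(1) by blast

subsection \<open>Limit points and asymptotic directions\<close>

text \<open>A constant shift of the index multiplies the quotients by a factor tending to 1. The
  cut-off e keeps the shifted indices in the range where a path is defined.\<close>

lemma ratio_limit_shift:
  fixes F :: "int \<Rightarrow> int"
  assumes k: "strict_mono (k :: nat \<Rightarrow> nat)" and lim: "(\<lambda>n. real_of_int (F (c + int (k n))) / real (k n)) \<longlonglongrightarrow> u"
  obtains k' where "strict_mono (k' :: nat \<Rightarrow> nat)" "(\<lambda>n. real_of_int (F (d + int (k' n))) / real (k' n)) \<longlonglongrightarrow> u"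
    "\<And>n. 0 < k' n" "\<And>n. e \<le> d + int (k' n)"
proof -
  define n0 where "n0 = nat (\<bar>c - d\<bar> + \<bar>e - c\<bar>) + 1"
  define k0 where "k0 n = k (n + n0)" for n
  define k' where "k' n = nat (c - d + int (k0 n))" for n
  have k0: "strict_mono k0" using k by (simp add: k0_def strict_mono_def)
  have big: "\<bar>c - d\<bar> + \<bar>e - c\<bar> < int (k0 n)" for n
    using seq_suble[OF k, of "n + n0"] unfolding k0_def n0_def by linarith
  have k': "int (k' n) = c - d + int (k0 n)" "0 < k' n" for n
    using big[of n] unfolding k'_def by linarith+
  have mono: "strict_mono k'"
  proof (rule strict_monoI)
    fix m n :: nat assume "m < n"
    then have "k0 m < k0 n" using k0 by (simp add: strict_mono_def)
    then show "k' m < k' n" using k'(1)[of m] k'(1)[of n] by linarith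
  qed
  have "(\<lambda>n. real_of_int (F (c + int (k0 n))) / real (k0 n)) \<longlonglongrightarrow> u"
    using LIMSEQ_ignore_initial_segment[OF lim, of n0] by (simp add: k0_def)
  moreover have "(\<lambda>n. 1 + real_of_int (d - c) / real (k' n)) \<longlonglongrightarrow> 1 + 0"
    by (intro tendsto_intros const_div_subseq_tendsto_0 mono)
  ultimately have "(\<lambda>n. real_of_int (F (c + int (k0 n))) / real (k0 n) * (1 + real_of_int (d - c) / real (k' n))) \<longlonglongrightarrow> u * (1 + 0)"
    by (rule tendsto_mult)
  moreover have "real_of_int (F (c + int (k0 n))) / real (k0 n) * (1 + real_of_int (d - c) / real (k' n)) =
      real_of_int (F (d + int (k' n))) / real (k' n)" for n
  proof -
    have arg: "c + int (k0 n) = d + int (k' n)" using k'(1)[of n] by simp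
    have "real (k0 n) = real (k' n) + real_of_int (d - c)"
      using arg_cong[OF k'(1)[of n], of real_of_int] by simp
    then have "1 + real_of_int (d - c) / real (k' n) = real (k0 n) / real (k' n)"
      using k'(2)[of n] by (simp add: field_simps)
    moreover have "real (k0 n) \<noteq> 0" using big[of n] by auto
    ultimately show ?thesis unfolding arg by simp
  qed
  ultimately have "(\<lambda>n. real_of_int (F (d + int (k' n))) / real (k' n)) \<longlonglongrightarrow> u" by simp
  moreover have "e \<le> d + int (k' n)" for n using k'(1)[of n] big[of n] by linarith
  ultimately show thesis using that[OF mono] k'(2) by blast
qed

text \<open>At level n the coordinates of the path add up to n, so limit points lie on the line
  through the directions and are determined by their first coordinate.\<close>

lemma seq_limit_points_path:
  assumes lev: "\<And>k. l \<le> k \<Longrightarrow> lev (\<pi> k) = k"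
  shows "seq_limit_points (\<lambda>n. rvec (\<pi> (int n)) /\<^sub>R real n) = dir ` {u. asymp_dir (\<lambda>n. \<pi> (l + int n)) u}"
proof (intro equalityI subsetI)
  fix v assume "v \<in> seq_limit_points (\<lambda>n. rvec (\<pi> (int n)) /\<^sub>R real n)"
  then obtain r where r: "strict_mono (r :: nat \<Rightarrow> nat)" "((\<lambda>n. rvec (\<pi> (int n)) /\<^sub>R real n) \<circ> r) \<longlonglongrightarrow> v"
    unfolding seq_limit_points_def by blast
  have f: "(\<lambda>n. real_of_int (fst (\<pi> (0 + int (r n)))) / real (r n)) \<longlonglongrightarrow> fst v"
    using tendsto_fst[OF r(2)] by (simp add: rvec_def o_def divide_inverse mult.commute)
  have s: "(\<lambda>n. real_of_int (snd (\<pi> (0 + int (r n)))) / real (r n)) \<longlonglongrightarrow> snd v"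
    using tendsto_snd[OF r(2)] by (simp add: rvec_def o_def divide_inverse mult.commute)
  obtain k where k: "strict_mono (k :: nat \<Rightarrow> nat)" "(\<lambda>n. real_of_int (fst (\<pi> (l + int (k n)))) / real (k n)) \<longlonglongrightarrow> fst v"
    by (rule ratio_limit_shift[of r "\<lambda>i. fst (\<pi> i)" 0 "fst v" l l, OF r(1) f]) blast
  have sum: "(\<lambda>n. real_of_int (fst (\<pi> (0 + int (r n)))) / real (r n) + real_of_int (snd (\<pi> (0 + int (r n)))) / real (r n)) \<longlonglongrightarrow> fst v + snd v"
    by (intro tendsto_add f s)
  moreover have "\<forall>\<^sub>F n in sequentially. real_of_int (fst (\<pi> (0 + int (r n)))) / real (r n) +
      real_of_int (snd (\<pi> (0 + int (r n)))) / real (r n) = 1"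
  proof (rule eventually_sequentiallyI[of "nat \<bar>l\<bar> + 1"])
    fix n assume n: "nat \<bar>l\<bar> + 1 \<le> n"
    then have big: "l \<le> int (r n)" "0 < r n" using seq_suble[OF r(1), of n] by linarith+
    have "fst (\<pi> (int (r n))) + snd (\<pi> (int (r n))) = int (r n)" using lev[OF big(1)] by (simp add: lev_def)
    then have "real_of_int (fst (\<pi> (int (r n)))) + real_of_int (snd (\<pi> (int (r n)))) = real (r n)"
      by (metis of_int_add of_int_of_nat_eq)
    then show "real_of_int (fst (\<pi> (0 + int (r n)))) / real (r n) +
      real_of_int (snd (\<pi> (0 + int (r n)))) / real (r n) = 1"
      using big(2) by (simp add: add_divide_distrib[symmetric])
  qed
  ultimately have "(\<lambda>n. 1) \<longlonglongrightarrow> fst v + snd v" by (rule Lim_transform_eventually)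
  then have "fst v + snd v = 1" using LIMSEQ_const_iff by metis
  then have "v = dir (fst v)" by (simp add: dir_fst)
  moreover have "asymp_dir (\<lambda>n. \<pi> (l + int n)) (fst v)" unfolding asymp_dir_def using k by blast
  ultimately show "v \<in> dir ` {u. asymp_dir (\<lambda>n. \<pi> (l + int n)) u}" by blast
next
  fix v assume "v \<in> dir ` {u. asymp_dir (\<lambda>n. \<pi> (l + int n)) u}"
  then obtain u k where v: "v = dir u" and k: "strict_mono (k :: nat \<Rightarrow> nat)"
    and lim: "(\<lambda>n. real_of_int (fst (\<pi> (l + int (k n)))) / real (k n)) \<longlonglongrightarrow> u"
    unfolding asymp_dir_def by auto
  obtain r where r: "strict_mono (r :: nat \<Rightarrow> nat)" and f: "(\<lambda>n. real_of_int (fst (\<pi> (0 + int (r n)))) / real (r n)) \<longlonglongrightarrow> u"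
    and pos: "\<And>n. 0 < r n" and ge: "\<And>n. l \<le> 0 + int (r n)"
    by (rule ratio_limit_shift[of k "\<lambda>i. fst (\<pi> i)" l u 0 l, OF k lim]) blast
  have "real_of_int (snd (\<pi> (int (r n)))) / real (r n) = 1 - real_of_int (fst (\<pi> (0 + int (r n)))) / real (r n)" for n
  proof -
    have "fst (\<pi> (int (r n))) + snd (\<pi> (int (r n))) = int (r n)" using lev[of "int (r n)"] ge[of n] by (simp add: lev_def)
    then have "real_of_int (snd (\<pi> (int (r n)))) = real (r n) - real_of_int (fst (\<pi> (int (r n))))"
      by (metis add_diff_cancel_left' of_int_diff of_int_of_nat_eq)
    then show ?thesis using pos[of n] by (simp add: diff_divide_distrib)
  qed
  moreover have "(\<lambda>n. 1 - real_of_int (fst (\<pi> (0 + int (r n)))) / real (r n)) \<longlonglongrightarrow> 1 - u"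
    by (intro tendsto_intros f)
  ultimately have "(\<lambda>n. real_of_int (snd (\<pi> (int (r n)))) / real (r n)) \<longlonglongrightarrow> 1 - u" by simp
  with f have "(\<lambda>n. (real_of_int (fst (\<pi> (int (r n)))) / real (r n), real_of_int (snd (\<pi> (int (r n)))) / real (r n))) \<longlonglongrightarrow> (u, 1 - u)"
    by (intro tendsto_Pair) simp_all
  then have "((\<lambda>n. rvec (\<pi> (int n)) /\<^sub>R real n) \<circ> r) \<longlonglongrightarrow> v"
    by (simp add: v dir_def rvec_def o_def divide_inverse mult.commute)
  then show "v \<in> seq_limit_points (\<lambda>n. rvec (\<pi> (int n)) /\<^sub>R real n)"
    unfolding seq_limit_points_def using r by blast
qed

lemma directed_into_iff:
  assumes "semi_inf_path x \<pi>"
  shows "directed_into A \<pi> \<longleftrightarrow> (\<forall>u. asymp_dir (\<lambda>n. \<pi> (lev x + int n)) u \<longrightarrow> dir u \<in> A)"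
proof -
  have "seq_limit_points (\<lambda>n. rvec (\<pi> (int n)) /\<^sub>R real n) = dir ` {u. asymp_dir (\<lambda>n. \<pi> (lev x + int n)) u}"
    using lev_semi_inf_path[OF assms] by (rule seq_limit_points_path)
  then show ?thesis unfolding directed_into_def by (simp only: image_subset_iff mem_Collect_eq Ball_def)
qed

section \<open>Almost sure properties of the Busemann process\<close>

lemma dir_nonneg: "0 \<le> t \<Longrightarrow> t \<le> 1 \<Longrightarrow> 0 \<le> dir t"
  by (simp add: dir_def less_eq_prod_def)

lemma filterlim_dir_left: "0 < t \<Longrightarrow> t < 1 \<Longrightarrow> filterlim dir (from_left (dir t)) (at_left t)"
  unfolding from_left_def filterlim_at
proof (intro conjI)
  assume t: "0 < t" "t < 1"
  show "\<forall>\<^sub>F x in at_left t. dir x \<in> {\<zeta> \<in> riU. prec \<zeta> (dir t)} \<and> dir x \<noteq> dir t"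
    by (rule eventually_at_leftI[OF _ t(1)]) (use t in simp)
  show "(dir \<longlongrightarrow> dir t) (at_left t)" unfolding dir_def by (intro tendsto_intros)
qed

lemma filterlim_dir_right: "0 < t \<Longrightarrow> t < 1 \<Longrightarrow> filterlim dir (from_right (dir t)) (at_right t)"
  unfolding from_right_def filterlim_at
proof (intro conjI)
  assume t: "0 < t" "t < 1"
  show "\<forall>\<^sub>F x in at_right t. dir x \<in> {\<zeta> \<in> riU. prec (dir t) \<zeta>} \<and> dir x \<noteq> dir t"
    by (rule eventually_at_rightI[OF _ t(2)]) (use t in simp)
  show "(dir \<longlongrightarrow> dir t) (at_right t)" unfolding dir_def by (intro tendsto_intros)
qed

lemma filterlim_dir_0: "filterlim dir (at e2 within riU) (at_right 0)"
  unfolding filterlim_at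
proof (intro conjI)
  show "\<forall>\<^sub>F x in at_right 0. dir x \<in> riU \<and> dir x \<noteq> e2"
    by (rule eventually_at_rightI[of _ 1]) (simp_all add: dir_def[of _, THEN arg_cong[of _ _ fst]] prod_eq_iff)
  have "(dir \<longlongrightarrow> dir 0) (at_right 0)" unfolding dir_def by (intro tendsto_intros)
  then show "(dir \<longlongrightarrow> e2) (at_right 0)" by (simp add: dir_def)
qed

lemma filterlim_dir_1: "filterlim dir (at e1 within riU) (at_left 1)"
  unfolding filterlim_at
proof (intro conjI)
  show "\<forall>\<^sub>F x in at_left 1. dir x \<in> riU \<and> dir x \<noteq> e1"
    by (rule eventually_at_leftI[of 0]) (simp_all add: prod_eq_iff)
  have "(dir \<longlongrightarrow> dir 1) (at_left 1)" unfolding dir_def by (intro tendsto_intros)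
  then show "(dir \<longlongrightarrow> e1) (at_left 1)" by (simp add: dir_def)
qed

subsection \<open>The profile of the shape function\<close>

context busemann_process
begin

abbreviation profile :: "real \<Rightarrow> real" where
  "profile t \<equiv> g (dir t)"

lemma profile_concave: "concave_profile profile"
proof
  fix r s u :: real assume *: "0 \<le> r" "r \<le> s" "s \<le> u" "u \<le> 1"
  show "(u - s) * profile r + (s - r) * profile u \<le> (u - r) * profile s"
  proof (cases "r = u")
    case False
    define \<theta> where "\<theta> = (s - r) / (u - r)"
    have ru: "0 < u - r" using * False by simp
    have \<theta>: "0 \<le> \<theta>" "\<theta> \<le> 1" using * ru by (auto simp: \<theta>_def)
    have "(1 - \<theta>) *\<^sub>R dir r + \<theta> *\<^sub>R dir u = dir s"
    proof -
      have "\<theta> * (u - r) = s - r" using ru by (simp add: \<theta>_def)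
      then have "(1 - \<theta>) * r + \<theta> * u = s" by (simp add: algebra_simps)
      moreover have "(1 - \<theta>) * (1 - r) + \<theta> * (1 - u) = 1 - ((1 - \<theta>) * r + \<theta> * u)"
        by (simp add: algebra_simps)
      ultimately show ?thesis by (simp add: dir_def)
    qed
    moreover have "(1 - \<theta>) * g (dir r) + \<theta> * g (dir u) \<le> g ((1 - \<theta>) *\<^sub>R dir r + \<theta> *\<^sub>R dir u)"
      by (rule concave_onD[OF g_concave \<theta>]) (use * in \<open>simp_all add: dir_nonneg\<close>)
    ultimately have "(1 - \<theta>) * profile r + \<theta> * profile u \<le> profile s" by simp
    then have "(u - r) * ((1 - \<theta>) * profile r + \<theta> * profile u) \<le> (u - r) * profile s"
      using ru by (intro mult_left_mono) simp_all
    moreover have th: "(u - r) * \<theta> = s - r" using ru by (simp add: \<theta>_def)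
    moreover have "(u - r) * (1 - \<theta>) = u - s" using th by (simp add: right_diff_distrib)
    ultimately show ?thesis by (simp add: distrib_left flip: mult.assoc)
  qed (use * in simp)
qed

sublocale profile: concave_profile profile
  by (rule profile_concave)

lemma grad_profile:
  assumes t: "0 < t" "t < 1" and d: "side_deriv profile t \<sigma> d"
  shows "grad g (dir t) \<sigma> = (profile t + (1 - t) * d, profile t - t * d)"
proof (rule grad_dir_eq[OF t _ _ g_homogeneous d])
  show "isCont profile t"
    using profile.continuous t by (simp add: continuous_on_eq_continuous_at)
qed simp_all

lemma grad_inner_dir:
  assumes t: "0 < t" "t < 1" and d: "side_deriv profile t \<sigma> d"
  shows "grad g (dir t) \<sigma> \<bullet> dir s = profile t + d * (s - t)"
  unfolding grad_profile[OF t d] by (simp add: dir_def algebra_simps)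

lemma U_sign_dir:
  assumes t: "0 < t" "t < 1" and d: "side_deriv profile t \<sigma> d"
  shows "U_sign g (dir t) \<sigma> = dir ` {s. 0 < s \<and> s < 1 \<and> profile s = profile t + d * (s - t)}"
proof -
  have "grad g (dir t) \<sigma> \<bullet> (dir s - dir t) = d * (s - t)" for s
    unfolding inner_diff_right grad_inner_dir[OF t d] by simp
  then show ?thesis unfolding U_sign_def riU_eq by (auto simp: diff_eq_eq)
qed

lemma affine_profile_side_deriv:
  assumes s: "affine_between profile s t" "s \<noteq> t"
  obtains a c where "\<forall>r\<in>{min s t..max s t}. profile r = a + c * r"
    "side_deriv profile t (if s < t then Minus else Plus) c"
proof -
  obtain a c where ac: "\<forall>r\<in>{min s t..max s t}. profile r = a + c * r"
    using s unfolding affine_between_def by blast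
  have "side_deriv profile t (if s < t then Minus else Plus) c"
    by (rule side_deriv_affine[of s t profile a c]) (use ac s in auto)
  then show thesis using that ac by blast
qed

text \<open>Membership means that p touches one of its two one-sided tangents at t, and by concavity
  touching means being affine in between. This is the dictionary between direction sets and affine
  pieces.\<close>

lemma U_of_dir:
  assumes t: "0 < t" "t < 1"
  shows "U_of g (dir t) = dir ` {s. 0 < s \<and> s < 1 \<and> affine_between profile s t}"
proof -
  obtain dp where dp: "side_deriv profile t Plus dp"
    and tp: "\<And>r. 0 \<le> r \<Longrightarrow> r \<le> 1 \<Longrightarrow> profile r \<le> profile t + dp * (r - t)"
    by (rule profile.side_deriv_exists[OF t, of Plus]) blast
  obtain dm where dm: "side_deriv profile t Minus dm"
    and tm: "\<And>r. 0 \<le> r \<Longrightarrow> r \<le> 1 \<Longrightarrow> profile r \<le> profile t + dm * (r - t)"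
    by (rule profile.side_deriv_exists[OF t, of Minus]) blast
  have "profile s = profile t + dm * (s - t) \<or> profile s = profile t + dp * (s - t) \<longleftrightarrow> affine_between profile s t"
    if s: "0 < s" "s < 1" for s
  proof
    assume "profile s = profile t + dm * (s - t) \<or> profile s = profile t + dp * (s - t)"
    then show "affine_between profile s t"
    proof
      assume "profile s = profile t + dm * (s - t)"
      then show ?thesis by (intro profile.touching_imp_affine[OF _ _ _ _ tm]) (use s t in simp_all)
    next
      assume "profile s = profile t + dp * (s - t)"
      then show ?thesis by (intro profile.touching_imp_affine[OF _ _ _ _ tp]) (use s t in simp_all)
    qed
  next
    assume aff: "affine_between profile s t"
    show "profile s = profile t + dm * (s - t) \<or> profile s = profile t + dp * (s - t)"
    proof (cases "s = t")
      case False
      obtain a c where ac: "\<forall>r\<in>{min s t..max s t}. profile r = a + c * r"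
        and c: "side_deriv profile t (if s < t then Minus else Plus) c"
        by (rule affine_profile_side_deriv[OF aff False])
      have "c = (if s < t then dm else dp)"
        using c side_deriv_unique[OF _ dm, of c] side_deriv_unique[OF _ dp, of c] by (auto split: if_splits)
      moreover have "profile s = a + c * s" "profile t = a + c * t" using ac by simp_all
      then have "profile s = profile t + c * (s - t)" by (simp add: algebra_simps)
      ultimately show ?thesis by (cases "s < t") simp_all
    qed simp
  qed
  then show ?thesis unfolding U_of_def U_sign_dir[OF t dp] U_sign_dir[OF t dm] by blast
qed

text \<open>If the one-sided tangent is the line with intercept a and slope c,
  \<open>grad_profile\<close> gives the gradient (a + c, a), which depends on the line only; so (B3)
  applies.\<close>

lemma B_eq_if_tangent_eq:
  assumes s: "0 < s" "s < 1" "side_deriv profile s \<sigma> c" and t: "0 < t" "t < 1" "side_deriv profile t \<sigma> c"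
    and line: "profile s = a + c * s" "profile t = a + c * t"
  shows "real_B \<omega> s \<sigma> x y = real_B \<omega> t \<sigma> x y"
proof (rule B3)
  show "grad g (dir s) \<sigma> = grad g (dir t) \<sigma>"
    unfolding grad_profile[OF s] grad_profile[OF t] line by (simp add: algebra_simps)
qed (use s t in simp_all)

lemma side_deriv_inside:
  assumes ac: "\<forall>r\<in>{s..t}. profile r = a + c * r" and r: "s < r" "r < t"
  shows "side_deriv profile r \<sigma> c"
proof (cases \<sigma>)
  case Plus
  show ?thesis by (rule side_deriv_affine[of t r profile a c]) (use ac r Plus in auto)
next
  case Minus
  show ?thesis by (rule side_deriv_affine[of s r profile a c]) (use ac r Minus in auto)
qed

lemma B_flat:
  assumes aff: "affine_between profile s t" and st: "0 < s" "t < 1" and r: "s < r" "r < t" "s < r'" "r' < t"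
  shows "real_B \<omega> r \<sigma> x y = real_B \<omega> r' \<sigma> x y"
proof -
  obtain a c where ac: "\<forall>r\<in>{s..t}. profile r = a + c * r"
    using aff r unfolding affine_between_def by (auto simp: min_def max_def)
  show ?thesis
    by (rule B_eq_if_tangent_eq[of r \<sigma> c r' a]) (use side_deriv_inside[OF ac] ac st r in simp_all)
qed

text \<open>A nontrivial affine piece ending at t makes \<open>U_of g (dir t)\<close> larger than a
  point, so under (R) g is differentiable there and all one-sided slopes agree.\<close>

lemma regularity_imp_slopes_eq:
  assumes reg: "regularity_condition g" and s: "0 < s" "s < 1" and t: "0 < t" "t < 1"
    and aff: "affine_between profile s t" "s \<noteq> t"
    and d: "side_deriv profile t \<sigma> d" and d': "side_deriv profile t \<tau> d'"
  shows "d = d'"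
proof -
  have "dir s \<in> U_of g (dir t)" unfolding U_of_dir[OF t] using s aff by blast
  then have "\<not> strictly_concave_at g (dir t)" unfolding strictly_concave_at_def using aff(2) by auto
  then have "dir t \<in> diff_dirs g" using reg t unfolding regularity_condition_def by auto
  then have "g differentiable (at (dir t))" unfolding diff_dirs_def by blast
  moreover have "dir differentiable (at t)"
    unfolding dir_def by (intro derivative_intros)
  ultimately have "(g \<circ> dir) differentiable (at t)"
    by (intro differentiable_chain_at)
  then obtain D where "((g \<circ> dir) has_field_derivative D) (at t)"
    using real_differentiable_def by blast
  then have "side_deriv profile t \<sigma> D" "side_deriv profile t \<tau> D"
    using side_deriv_differentiable[of profile D t] by (simp_all add: o_def)
  then show ?thesis using side_deriv_unique d d' by metis
qed

lemma regularity_imp_regular: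
  assumes reg: "regularity_condition g" and R: "busemann_realization (wt \<omega>) (real_B \<omega>) profile"
  shows "regular profile (real_B \<omega>)"
  unfolding regular_def
proof (intro conjI allI impI; elim conjE)
  interpret R: busemann_realization "wt \<omega>" "real_B \<omega>" profile by (rule R)
  fix s t :: real and x y
  assume s: "0 < s" "s < 1" and t: "0 < t" "t < 1" and ne: "s \<noteq> t" and aff: "affine_between profile s t"
  obtain a c where ac: "\<forall>r\<in>{min s t..max s t}. profile r = a + c * r"
    and c: "side_deriv profile t (if s < t then Minus else Plus) c"
    by (rule affine_profile_side_deriv[OF aff ne])
  have tc: "side_deriv profile t \<sigma> c" for \<sigma>
  proof -
    obtain d where d: "side_deriv profile t \<sigma> d" by (rule profile.side_deriv_exists[OF t, of \<sigma>])
    then show ?thesis using regularity_imp_slopes_eq[OF reg s t aff ne d c] by simp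
  qed
  \<comment> \<open>An interior point of the piece. It has the same tangent line as t, which
    identifies the values of one sign by (B3), while flatness identifies its value with the
    one-sided limit at t, which carries the other sign.\<close>
  define r where "r = (s + t) / 2"
  have pt: "profile t = a + c * t" using ac by simp
  have rst: "r \<in> {min s t..max s t}" using ne by (auto simp: r_def)
  have pr: "profile r = a + c * r" using ac rst by blast
  have r01: "0 < r" "r < 1" using s t by (simp_all add: r_def)
  show "real_B \<omega> t Plus x y = real_B \<omega> t Minus x y"
  proof (cases "s < t")
    case True
    then have sr: "s < r" "r < t" by (simp_all add: r_def)
    have "side_deriv profile r Plus c" by (rule side_deriv_inside[of s t a c]) (use ac True sr in simp_all)
    from B_eq_if_tangent_eq[OF r01 this t tc pr pt] have "real_B \<omega> r Plus x y = real_B \<omega> t Plus x y" .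
    moreover have "real_B \<omega> r Plus x y = real_B \<omega> t Minus x y"
      by (rule R.flat_left[OF aff s(1) sr t(2)])
    ultimately show ?thesis by simp
  next
    case False
    then have ts: "t < s" using ne by simp
    then have tr: "t < r" "r < s" by (simp_all add: r_def)
    have aff': "affine_between profile t s" using aff affine_between_sym by blast
    have "side_deriv profile r Minus c" by (rule side_deriv_inside[of t s a c]) (use ac ts tr in simp_all)
    from B_eq_if_tangent_eq[OF r01 this t tc pr pt] have "real_B \<omega> r Minus x y = real_B \<omega> t Minus x y" .
    moreover have "real_B \<omega> r Minus x y = real_B \<omega> t Plus x y"
      by (rule R.flat_right[OF aff' t(1) tr s(2)])
    ultimately show ?thesis by simp
  qed
next
  fix s t r :: real
  assume *: "0 < s" "s < t" "t < r" "r < 1" and st: "affine_between profile s t" and tr: "affine_between profile t r"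
  have t: "0 < t" "t < 1" and s: "s < 1" and ne: "s \<noteq> t" "r \<noteq> t" using * by simp_all
  have rt: "affine_between profile r t" using tr affine_between_sym by blast
  obtain a c where ac: "\<forall>q\<in>{min s t..max s t}. profile q = a + c * q"
    and c: "side_deriv profile t (if s < t then Minus else Plus) c"
    by (rule affine_profile_side_deriv[OF st ne(1)])
  obtain b d where bd: "\<forall>q\<in>{min r t..max r t}. profile q = b + d * q"
    and d: "side_deriv profile t (if r < t then Minus else Plus) d"
    by (rule affine_profile_side_deriv[OF rt ne(2)])
  \<comment> \<open>Equal slopes at the common end point put both pieces on one line.\<close>
  have cd: "c = d" by (rule regularity_imp_slopes_eq[OF reg *(1) s t st ne(1) c d])
  have "profile t = a + c * t" using ac by simp
  moreover have "profile t = b + d * t" using bd by simp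
  ultimately have ab: "a = b" using cd by simp
  show "affine_between profile s r"
  proof (rule affine_betweenI)
    show "profile q = a + c * q" if "s \<le> q" "q \<le> r" for q
    proof (cases "q \<le> t")
      case True
      then show ?thesis using ac that * by simp
    next
      case False
      then have "q \<in> {min r t..max r t}" using that * by simp
      then show ?thesis using bd ab cd by blast
    qed
  qed (use * in simp)
qed

subsection \<open>Directedness in a fixed direction\<close>

lemma finite_quadrant_sphere: "finite (quadrant_sphere n)"
proof (rule finite_subset)
  show "quadrant_sphere n \<subseteq> {0..int n} \<times> {0..int n}"
    by (auto simp: quadrant_sphere_def less_eq_prod_def)
qed simp

lemma bpath_in_quadrant_sphere: "bpath \<beta> t \<sigma> 0 n \<in> quadrant_sphere n"
proof -
  have "0 \<le> bpath \<beta> t \<sigma> 0 n" using bpath_le[of \<beta> t \<sigma> 0 0 n] by simp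
  moreover have "lev (bpath \<beta> t \<sigma> 0 n) = int n" by (simp add: lev_bpath) (simp add: lev_def)
  ultimately show ?thesis by (simp add: quadrant_sphere_def less_eq_prod_def lev_def)
qed

text \<open>Along a Busemann path from the origin the passage time equals the Busemann function. The
  two shape estimates therefore force the profile and its supporting line at t to agree
  asymptotically along the directions of the path.\<close>

lemma directed_from_origin:
  assumes t: "0 < t" "t < 1" and coc: "busemann_cocycle (wt \<omega>) (real_B \<omega>)"
    and shape_G: "(\<lambda>n. Max ((\<lambda>x. \<bar>LPT (wt \<omega>) 0 x - g (rvec x)\<bar>) ` quadrant_sphere n) / real n) \<longlonglongrightarrow> 0"
    and shape_B: "(\<lambda>n. Max ((\<lambda>x. \<bar>B \<omega> (dir t) \<sigma> 0 x - rvec x \<bullet> grad g (dir t) \<sigma>\<bar>) ` quadrant_sphere n) / real n) \<longlonglongrightarrow> 0"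
    and u: "asymp_dir (bpath (real_B \<omega>) t \<sigma> 0) u" and r: "min t u < r" "r < max t u"
  shows "affine_between profile t r"
proof -
  interpret busemann_cocycle "wt \<omega>" "real_B \<omega>" by (rule coc)
  obtain d where d: "side_deriv profile t \<sigma> d"
    and tan: "\<And>r. 0 \<le> r \<Longrightarrow> r \<le> 1 \<Longrightarrow> profile r \<le> profile t + d * (r - t)"
    by (rule profile.side_deriv_exists[OF t, of \<sigma>]) blast
  let ?v = "bpath (real_B \<omega>) t \<sigma> 0"
  define s where "s n = real_of_int (fst (?v n)) / real n" for n
  have LPT_eq: "LPT (wt \<omega>) 0 (?v n) = B \<omega> (dir t) \<sigma> 0 (?v n)" for n
  proof -
    have l0: "lev (0 :: site) = 0" by (simp add: lev_def)
    have v: "?v n = level_path (real_B \<omega>) t \<sigma> 0 (int n)"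
      using level_path_nat[of "real_B \<omega>" t \<sigma> 0 n] l0 by simp
    have z: "level_path (real_B \<omega>) t \<sigma> 0 0 = 0"
      using level_path_nat[of "real_B \<omega>" t \<sigma> 0 0] l0 by simp
    have lv: "lev (?v n) = int n" by (simp add: lev_bpath l0)
    note geo = geodesic_level_path[OF t, of 0 0 "int n" \<sigma>, unfolded z l0, folded v]
    have "geodesic (wt \<omega>) 0 (?v n) (level_path (real_B \<omega>) t \<sigma> 0)" by (rule geo(1)) simp_all
    then have "LPT (wt \<omega>) 0 (?v n) = path_weight (wt \<omega>) (level_path (real_B \<omega>) t \<sigma> 0) 0 (int n)"
      unfolding geodesic_def l0 lv by simp
    also have "\<dots> = B \<omega> (dir t) \<sigma> 0 (?v n)" by (rule geo(2)) simp_all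
    finally show ?thesis .
  qed
  have fst_v: "0 \<le> fst (?v n)" "fst (?v n) \<le> int n" "fst (?v n) + snd (?v n) = int n" for n
    using bpath_in_quadrant_sphere[of "real_B \<omega>" t \<sigma> n] by (auto simp: quadrant_sphere_def less_eq_prod_def)
  have s01: "0 \<le> s n \<and> s n \<le> 1" for n
  proof (cases "n = 0")
    case False
    have "real_of_int (fst (?v n)) \<le> real n" using fst_v(2)[of n] by linarith
    then show ?thesis using fst_v(1)[of n] False by (simp add: s_def)
  qed (simp add: s_def)
  have rv: "rvec (?v n) = real n *\<^sub>R dir (s n)" if "0 < n" for n
  proof -
    have "real_of_int (snd (?v n)) = real n - real_of_int (fst (?v n))"
      using arg_cong[OF fst_v(3)[of n], of real_of_int] by simp
    then show ?thesis using that by (simp add: rvec_def dir_def s_def right_diff_distrib)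
  qed
  let ?M = "\<lambda>n. Max ((\<lambda>x. \<bar>LPT (wt \<omega>) 0 x - g (rvec x)\<bar>) ` quadrant_sphere n) / real n +
      Max ((\<lambda>x. \<bar>B \<omega> (dir t) \<sigma> 0 x - rvec x \<bullet> grad g (dir t) \<sigma>\<bar>) ` quadrant_sphere n) / real n"
  have gap: "\<bar>profile t + d * (s n - t) - profile (s n)\<bar> \<le> ?M n" if n: "0 < n" for n
  proof -
    have "\<bar>LPT (wt \<omega>) 0 (?v n) - g (rvec (?v n))\<bar> \<le> Max ((\<lambda>x. \<bar>LPT (wt \<omega>) 0 x - g (rvec x)\<bar>) ` quadrant_sphere n)"
      by (intro Max_ge finite_imageI finite_quadrant_sphere imageI bpath_in_quadrant_sphere)
    moreover have "\<bar>B \<omega> (dir t) \<sigma> 0 (?v n) - rvec (?v n) \<bullet> grad g (dir t) \<sigma>\<bar>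
        \<le> Max ((\<lambda>x. \<bar>B \<omega> (dir t) \<sigma> 0 x - rvec x \<bullet> grad g (dir t) \<sigma>\<bar>) ` quadrant_sphere n)"
      by (intro Max_ge finite_imageI finite_quadrant_sphere imageI bpath_in_quadrant_sphere)
    ultimately have "\<bar>rvec (?v n) \<bullet> grad g (dir t) \<sigma> - g (rvec (?v n))\<bar> \<le>
        Max ((\<lambda>x. \<bar>LPT (wt \<omega>) 0 x - g (rvec x)\<bar>) ` quadrant_sphere n) +
        Max ((\<lambda>x. \<bar>B \<omega> (dir t) \<sigma> 0 x - rvec x \<bullet> grad g (dir t) \<sigma>\<bar>) ` quadrant_sphere n)"
      unfolding LPT_eq by linarith
    moreover have "rvec (?v n) \<bullet> grad g (dir t) \<sigma> = real n * (profile t + d * (s n - t))"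
      unfolding rv[OF n] using grad_inner_dir[OF t d, of "s n"] by (simp add: inner_commute)
    moreover have "g (rvec (?v n)) = real n * profile (s n)"
      unfolding rv[OF n] using s01[of n] by (intro g_homogeneous) (simp_all add: dir_nonneg)
    ultimately have "\<bar>real n * (profile t + d * (s n - t) - profile (s n))\<bar> \<le> ?M n * real n"
      using n by (simp add: right_diff_distrib distrib_right)
    then show ?thesis using n by (simp add: abs_mult mult.commute)
  qed
  obtain k where k: "strict_mono (k :: nat \<Rightarrow> nat)" and lim: "(\<lambda>n. s (k n)) \<longlonglongrightarrow> u"
    using u unfolding asymp_dir_def s_def by blast
  have "?M \<longlonglongrightarrow> 0 + 0" by (intro tendsto_add shape_G shape_B)
  then have M: "(?M \<circ> k) \<longlonglongrightarrow> 0 + 0" using k by (rule LIMSEQ_subseq_LIMSEQ)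
  have gap': "(\<lambda>n. profile t + d * (s (k n) - t) - profile (s (k n))) \<longlonglongrightarrow> 0"
  proof (rule Lim_null_comparison)
    show "(?M \<circ> k) \<longlonglongrightarrow> 0" using M by simp
    show "\<forall>\<^sub>F n in sequentially. norm (profile t + d * (s (k n) - t) - profile (s (k n))) \<le> (?M \<circ> k) n"
      using strict_mono_eventually_pos[OF k] by eventually_elim (use gap in simp)
  qed
  show ?thesis
    by (rule profile.asymptotic_touching_imp_affine[OF t _ _ lim gap' r]) (erule (1) tan, rule s01)
qed

lemma asymp_dir_translate:
  fixes \<rho> :: "nat \<Rightarrow> site"
  shows "asymp_dir (\<lambda>n. \<rho> n + z) u \<Longrightarrow> asymp_dir \<rho> u"
proof -
  assume "asymp_dir (\<lambda>n. \<rho> n + z) u"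
  then obtain k where k: "strict_mono (k :: nat \<Rightarrow> nat)"
    and lim: "(\<lambda>n. real_of_int (fst (\<rho> (k n) + z)) / real (k n)) \<longlonglongrightarrow> u"
    unfolding asymp_dir_def by blast
  have "(\<lambda>n. real_of_int (fst (\<rho> (k n) + z)) / real (k n) - real_of_int (fst z) / real (k n)) \<longlonglongrightarrow> u - 0"
    by (intro tendsto_diff lim const_div_subseq_tendsto_0 k)
  then have "(\<lambda>n. real_of_int (fst (\<rho> (k n))) / real (k n)) \<longlonglongrightarrow> u"
    by (simp add: diff_divide_distrib[symmetric])
  then show "asymp_dir \<rho> u" unfolding asymp_dir_def using k by blast
qed

lemma AE_T:
  assumes "AE \<omega> in M. P \<omega>"
  shows "AE \<omega> in M. P (T z \<omega>)"
proof -
  obtain N where N: "{\<omega> \<in> space M. \<not> P \<omega>} \<subseteq> N" "emeasure M N = 0" "N \<in> sets M"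
    using assms by (rule AE_E)
  have "emeasure M (T z -` N \<inter> space M) = 0"
    using prob_shift[OF N(3), of z] N(2) by (simp add: emeasure_eq_measure)
  then show ?thesis
    using prob_shift(2)[OF N(3)] N(1) by (intro AE_I[of _ _ "T z -` N \<inter> space M"]) (auto simp: space_M)
qed

text \<open>The shape estimates are centred at the origin; stationarity transfers their consequence
  to paths from every site.\<close>

lemma AE_directed:
  assumes t: "0 < t" "t < 1"
  shows "AE \<omega> in M. \<forall>\<sigma> x u r. asymp_dir (bpath (real_B \<omega>) t \<sigma> x) u \<longrightarrow> min t u < r \<longrightarrow> r < max t u \<longrightarrow>
    affine_between profile t r"
proof -
  let ?P = "\<lambda>\<omega>. \<forall>\<sigma> u r. asymp_dir (bpath (real_B \<omega>) t \<sigma> 0) u \<longrightarrow> min t u < r \<longrightarrow> r < max t u \<longrightarrow>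
    affine_between profile t r"
  have "dir t \<in> riU" using t by simp
  from B5_shape[OF this] have "AE \<omega> in M. ?P \<omega>"
    using AE_cocycle g_shape
  proof eventually_elim
    case (elim \<omega>)
    show ?case
      by (intro allI impI) (rule directed_from_origin[OF t elim(2,3) spec[OF elim(1)]])
  qed
  then have "AE \<omega> in M. ?P (T z \<omega>)" for z by (rule AE_T)
  then have "AE \<omega> in M. \<forall>z. ?P (T z \<omega>)" by (rule AE_all_countable[THEN iffD2, OF allI])
  moreover have "AE \<omega> in M. \<forall>x z. bstep (real_B \<omega>) t Plus (x + z) = bstep (real_B (T z \<omega>)) t Plus x + z"
    by (rule AE_field_shift[OF t])
  moreover have "AE \<omega> in M. \<forall>x z. bstep (real_B \<omega>) t Minus (x + z) = bstep (real_B (T z \<omega>)) t Minus x + z"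
    by (rule AE_field_shift[OF t])
  ultimately show ?thesis
  proof eventually_elim
    case (elim \<omega>)
    show ?case
    proof (intro allI impI)
      fix \<sigma> x u r
      assume u: "asymp_dir (bpath (real_B \<omega>) t \<sigma> x) u" and r: "min t u < r" "r < max t u"
      have shift: "bstep (real_B \<omega>) t \<sigma> (y + x) = bstep (real_B (T x \<omega>)) t \<sigma> y + x" for y
      proof (cases \<sigma>)
        case Plus
        show ?thesis unfolding Plus by (rule spec[OF spec[OF elim(2), of y], of x])
      next
        case Minus
        show ?thesis unfolding Minus by (rule spec[OF spec[OF elim(3), of y], of x])
      qed
      have "bpath (real_B \<omega>) t \<sigma> x = (\<lambda>n. bpath (real_B (T x \<omega>)) t \<sigma> 0 n + x)"
        unfolding bpath_def[abs_def]
        using iterate_shift[of "bstep (real_B \<omega>) t \<sigma>" x "bstep (real_B (T x \<omega>)) t \<sigma>" _ 0, OF shift]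
        unfolding add_0 by (rule ext)
      from u[unfolded this] have "asymp_dir (bpath (real_B (T x \<omega>)) t \<sigma> 0) u"
        by (rule asymp_dir_translate)
      from mp[OF mp[OF mp[OF spec[OF spec[OF spec[OF spec[OF elim(1), of x], of \<sigma>], of u], of r] this] r(1)] r(2)]
      show "affine_between profile t r" .
    qed
  qed
qed

lemma AE_untied:
  assumes t: "0 < t" "t < 1"
  shows "AE \<omega> in M. \<forall>\<sigma>. untied (real_B \<omega>) t \<sigma>"
proof -
  have "dir t \<in> riU" using t by simp
  from B5_no_tie[OF this] show ?thesis
    by eventually_elim (simp add: untied_def tilt_def del: split_paired_All)
qed

subsection \<open>The realization\<close>

text \<open>Countability of the rational directions allows their almost sure events to be
  intersected. The properties required at all directions come from the single event of (B1), from
  (B3) and from the deterministic profile.\<close>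

theorem AE_realization: "AE \<omega> in M. busemann_realization (wt \<omega>) (real_B \<omega>) profile"
proof -
  define Q where "Q = {q :: real. q \<in> \<rat> \<and> 0 < q \<and> q < 1}"
  have Q: "countable Q" unfolding Q_def by (rule countable_subset[OF _ countable_rat]) auto
  have "AE \<omega> in M. \<forall>q\<in>Q. \<forall>\<sigma>. untied (real_B \<omega>) q \<sigma>"
    by (rule AE_ball_countable'[OF _ Q]) (rule AE_untied, simp_all add: Q_def)
  moreover have "AE \<omega> in M. \<forall>q\<in>Q. \<forall>\<sigma> x u r. asymp_dir (bpath (real_B \<omega>) q \<sigma> x) u \<longrightarrow> min q u < r \<longrightarrow> r < max q u \<longrightarrow>
      affine_between profile q r"
    by (rule AE_ball_countable'[OF _ Q]) (rule AE_directed, simp_all add: Q_def)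
  moreover have "AE \<omega> in M. \<forall>q\<in>Q. \<forall>x y. \<exists>m n. bpath (real_B \<omega>) q Plus x m = bpath (real_B \<omega>) q Plus y n"
    by (rule AE_ball_countable'[OF _ Q]) (rule AE_coalescence, simp_all add: Q_def)
  moreover have "AE \<omega> in M. \<forall>q\<in>Q. \<forall>x y. \<exists>m n. bpath (real_B \<omega>) q Minus x m = bpath (real_B \<omega>) q Minus y n"
    by (rule AE_ball_countable'[OF _ Q]) (rule AE_coalescence, simp_all add: Q_def)
  ultimately show ?thesis
    using AE_cocycle AE_B1
  proof eventually_elim
    case (elim \<omega>)
    interpret busemann_cocycle "wt \<omega>" "real_B \<omega>" by (rule elim(5))
    note mono = elim(6)[THEN conjunct2, THEN conjunct2, THEN conjunct1]
    note lim = elim(6)[THEN conjunct2, THEN conjunct2, THEN conjunct2, THEN conjunct1]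
    note blowup = elim(6)[THEN conjunct2, THEN conjunct2, THEN conjunct2, THEN conjunct2]
    show ?case
    proof unfold_locales
      fix s t :: real and \<sigma> \<tau> x
      assume st: "0 < s" "s < t" "t < 1"
      then have d: "dir s \<in> riU" "dir t \<in> riU" "prec (dir s) (dir t)" by simp_all
      note m = mp[OF spec[OF bspec[OF bspec[OF mono d(1)] d(2)], of x] d(3)]
      show "real_B \<omega> t \<tau> x (x + e1) \<le> real_B \<omega> s \<sigma> x (x + e1)"
        by (cases \<sigma>; cases \<tau>; hypsubst; use m in linarith)
      show "real_B \<omega> s \<sigma> x (x + e2) \<le> real_B \<omega> t \<tau> x (x + e2)"
        by (cases \<sigma>; cases \<tau>; hypsubst; use m in linarith)
    next
      fix t :: real and \<sigma> x y assume t: "0 < t" "t < 1"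
      then have d: "dir t \<in> riU" by simp
      have l: "((\<lambda>\<zeta>. B \<omega> \<zeta> \<sigma> x y) \<longlongrightarrow> B \<omega> (dir t) Minus x y) (from_left (dir t))"
          "((\<lambda>\<zeta>. B \<omega> \<zeta> \<sigma> x y) \<longlongrightarrow> B \<omega> (dir t) Plus x y) (from_right (dir t))"
        using spec[OF spec[OF spec[OF bspec[OF lim d], of \<sigma>], of x], of y] by simp_all
      show "((\<lambda>s. real_B \<omega> s \<sigma> x y) \<longlongrightarrow> real_B \<omega> t Minus x y) (at_left t)"
        by (rule filterlim_compose[OF l(1) filterlim_dir_left[OF t]])
      show "((\<lambda>s. real_B \<omega> s \<sigma> x y) \<longlongrightarrow> real_B \<omega> t Plus x y) (at_right t)"
        by (rule filterlim_compose[OF l(2) filterlim_dir_right[OF t]])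
    next
      fix \<sigma> x
      have b: "filterlim (\<lambda>\<xi>. B \<omega> \<xi> \<sigma> x (x + e1)) at_top (at e2 within riU)"
          "filterlim (\<lambda>\<xi>. B \<omega> \<xi> \<sigma> x (x + e2)) at_top (at e1 within riU)"
        using spec[OF spec[OF blowup, of \<sigma>], of x] by simp_all
      show "filterlim (\<lambda>t. real_B \<omega> t \<sigma> x (x + e1)) at_top (at_right 0)"
        by (rule filterlim_compose[OF b(1) filterlim_dir_0])
      show "filterlim (\<lambda>t. real_B \<omega> t \<sigma> x (x + e2)) at_top (at_left 1)"
        by (rule filterlim_compose[OF b(2) filterlim_dir_1])
    next
      show "continuous_on {0<..<1} profile" by (rule profile.continuous)
    next
      fix s t r r' :: real and \<sigma> x y
      assume "affine_between profile s t" "0 < s" "t < 1" "s < r" "r < t" "s < r'" "r' < t"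
      then show "real_B \<omega> r \<sigma> x y = real_B \<omega> r' \<sigma> x y" by (rule B_flat)
    next
      fix q :: real and \<sigma> x y assume "q \<in> \<rat>" "0 < q" "q < 1"
      then have q: "q \<in> Q" by (simp add: Q_def)
      show "untied (real_B \<omega>) q \<sigma>" by (rule spec[OF bspec[OF elim(1) q]])
      show "\<exists>m n. bpath (real_B \<omega>) q \<sigma> x m = bpath (real_B \<omega>) q \<sigma> y n"
      proof (cases \<sigma>)
        case Plus
        show ?thesis unfolding Plus by (rule spec[OF spec[OF bspec[OF elim(3) q], of x], of y])
      next
        case Minus
        show ?thesis unfolding Minus by (rule spec[OF spec[OF bspec[OF elim(4) q], of x], of y])
      qed
      show "affine_between profile q r"
        if "asymp_dir (bpath (real_B \<omega>) q \<sigma> x) u" "min q u < r" "r < max q u" for u r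
        by (rule mp[OF mp[OF mp[OF spec[OF spec[OF spec[OF spec[OF bspec[OF elim(2) q], of \<sigma>], of x], of u], of r]
                that(1)] that(2)] that(3)])
    qed
  qed
qed

end

section \<open>Geodesics and exceptional directions\<close>

lemma bv_pair_uminus:
  assumes "bv_pair F F'"
  shows "bv_pair (\<lambda>t. - F t) (\<lambda>t. - F' t)"
proof -
  obtain f f' h h' where *: "increasing_pair f f'" "increasing_pair h h'"
    and eq: "\<forall>t. 0 < t \<longrightarrow> t < 1 \<longrightarrow> F t = f t - h t \<and> F' t = f' t - h' t"
    using assms unfolding bv_pair_def by blast
  show ?thesis unfolding bv_pair_def
    by (rule exI[of _ h], rule exI[of _ h'], rule exI[of _ f], rule exI[of _ f']) (use * eq in simp)
qed

lemma bv_pair_add: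
  assumes F: "bv_pair F F'" and G: "bv_pair G G'"
  shows "bv_pair (\<lambda>t. F t + G t) (\<lambda>t. F' t + G' t)"
proof -
  obtain f f' h h' where f: "increasing_pair f f'" "increasing_pair h h'"
    and F_eq: "\<forall>t. 0 < t \<longrightarrow> t < 1 \<longrightarrow> F t = f t - h t \<and> F' t = f' t - h' t"
    using F unfolding bv_pair_def by blast
  obtain k k' l l' where k: "increasing_pair k k'" "increasing_pair l l'"
    and G_eq: "\<forall>t. 0 < t \<longrightarrow> t < 1 \<longrightarrow> G t = k t - l t \<and> G' t = k' t - l' t"
    using G unfolding bv_pair_def by blast
  show ?thesis unfolding bv_pair_def
    by (rule exI[of _ "\<lambda>t. f t + k t"], rule exI[of _ "\<lambda>t. f' t + k' t"],
        rule exI[of _ "\<lambda>t. h t + l t"], rule exI[of _ "\<lambda>t. h' t + l' t"],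
        intro conjI increasing_pair_add f k) (use F_eq G_eq in simp)
qed

lemma bv_pair_cong:
  assumes "bv_pair F F'" and "\<And>t. 0 < t \<Longrightarrow> t < 1 \<Longrightarrow> G t = F t" "\<And>t. 0 < t \<Longrightarrow> t < 1 \<Longrightarrow> G' t = F' t"
  shows "bv_pair G G'"
  using assms unfolding bv_pair_def by simp

lemma increasing_pair_imp_bv_pair: "increasing_pair F F' \<Longrightarrow> bv_pair F F'"
  unfolding bv_pair_def
  by (rule exI[of _ F], rule exI[of _ F'], rule exI[of _ "\<lambda>_. 0"], rule exI[of _ "\<lambda>_. 0"])
    (simp add: increasing_pair_def)

text \<open>Allows a property of Busemann increments to be checked on nearest neighbours
  only.\<close>

lemma site_connected:
  assumes sym: "\<And>x y. R x y \<Longrightarrow> R y x" and trans: "\<And>x y z. R x y \<Longrightarrow> R y z \<Longrightarrow> R x z"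
    and step: "\<And>x. R x (x + e1)" "\<And>x. R x (x + e2)"
  shows "R (x :: site) y"
proof -
  have refl: "R x x" for x using trans[OF step(1) sym[OF step(1)]] .
  have h: "R x (x + (k, 0))" for x k
  proof (induction k rule: int_induct[where k = 0])
    case base
    then show ?case using refl[of x] by (simp flip: zero_prod_def)
  next
    case (step1 i)
    have "R (x + (i, 0)) (x + (i + 1, 0))" using step(1)[of "x + (i, 0)"] by (simp add: add.assoc)
    then show ?case by (rule trans[OF step1.IH])
  next
    case (step2 i)
    have "R (x + (i - 1, 0)) (x + (i, 0))" using step(1)[of "x + (i - 1, 0)"] by (simp add: add.assoc)
    then show ?case by (rule trans[OF step2.IH sym])
  qed
  have v: "R x (x + (0, k))" for x k
  proof (induction k rule: int_induct[where k = 0])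
    case base
    then show ?case using refl[of x] by (simp flip: zero_prod_def)
  next
    case (step1 i)
    have "R (x + (0, i)) (x + (0, i + 1))" using step(2)[of "x + (0, i)"] by (simp add: add.assoc)
    then show ?case by (rule trans[OF step1.IH])
  next
    case (step2 i)
    have "R (x + (0, i - 1)) (x + (0, i))" using step(2)[of "x + (0, i - 1)"] by (simp add: add.assoc)
    then show ?case by (rule trans[OF step2.IH sym])
  qed
  have "x + (fst y - fst x, 0) + (0, snd y - snd x) = y" by (simp add: prod_eq_iff)
  then show ?thesis using trans[OF h[of x "fst y - fst x"] v[of _ "snd y - snd x"]] by simp
qed

text \<open>Nearest-neighbour increments are monotone in the direction, those along e1 after a
  change of sign. The cocycle property combines finitely many of them into any other increment,
  which need not be monotone but has bounded variation.\<close>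

lemma (in busemann_realization) bv_pair_beta: "bv_pair (\<lambda>t. \<beta> t Plus x y) (\<lambda>t. \<beta> t Minus x y)"
proof (rule site_connected[where R = "\<lambda>x y. bv_pair (\<lambda>t. \<beta> t Plus x y) (\<lambda>t. \<beta> t Minus x y)"])
  fix x y z
  assume xy: "bv_pair (\<lambda>t. \<beta> t Plus x y) (\<lambda>t. \<beta> t Minus x y)"
  show "bv_pair (\<lambda>t. \<beta> t Plus y x) (\<lambda>t. \<beta> t Minus y x)"
    by (rule bv_pair_cong[OF bv_pair_uminus[OF xy]]) (rule beta_anti, assumption+)+
  assume yz: "bv_pair (\<lambda>t. \<beta> t Plus y z) (\<lambda>t. \<beta> t Minus y z)"
  show "bv_pair (\<lambda>t. \<beta> t Plus x z) (\<lambda>t. \<beta> t Minus x z)"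
    by (rule bv_pair_cong[OF bv_pair_add[OF xy yz]]) (rule cocycle[symmetric], assumption+)+
next
  fix x
  have "\<beta> s Plus x (x + e2) \<le> \<beta> t Plus x (x + e2)" if "0 < s" "s \<le> t" "t < 1" for s t
    using mono_e2[of s t Plus x Plus] that by (cases "s = t") simp_all
  then show "bv_pair (\<lambda>t. \<beta> t Plus x (x + e2)) (\<lambda>t. \<beta> t Minus x (x + e2))"
    unfolding increasing_pair_def
    by (intro increasing_pair_imp_bv_pair[unfolded increasing_pair_def] conjI allI impI lim_right lim_left)
next
  fix x
  have "- \<beta> s Plus x (x + e1) \<le> - \<beta> t Plus x (x + e1)" if "0 < s" "s \<le> t" "t < 1" for s t
    using mono_e1[of s t Plus x Plus] that by (cases "s = t") simp_all
  then have "bv_pair (\<lambda>t. - \<beta> t Plus x (x + e1)) (\<lambda>t. - \<beta> t Minus x (x + e1))"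
    by (intro increasing_pair_imp_bv_pair[unfolded increasing_pair_def] conjI allI impI tendsto_minus
        lim_right lim_left)
  from bv_pair_uminus[OF this] show "bv_pair (\<lambda>t. \<beta> t Plus x (x + e1)) (\<lambda>t. \<beta> t Minus x (x + e1))"
    by simp
qed

section \<open>Transfer from step fields to level-indexed Busemann geodesics\<close>

lemma busemann_geodesics_agree_iff:
  "(\<forall>x. busemann_geodesic b x (dir t) Plus = busemann_geodesic b x (dir t) Minus) \<longleftrightarrow>
    bstep (\<lambda>t. b (dir t)) t Plus = bstep (\<lambda>t. b (dir t)) t Minus"
  unfolding busemann_geodesic_eq level_path_eq_iff bpath_eq_iff_bstep_eq ..

lemma level_path_eq_if_bstep_eq:
  assumes "bstep \<beta> t Plus = bstep \<beta> t Minus"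
  shows "level_path \<beta> t \<sigma> x = level_path \<beta> t Plus x"
  by (cases \<sigma>) (simp_all add: level_path_def bpath_def assms)

context
  fixes w and b :: busemann and p and t :: real
  assumes R: "busemann_realization w (\<lambda>t. b (dir t)) p" and t: "0 < t" "t < 1"
begin

interpretation busemann_realization w "\<lambda>t. b (dir t)" p by (rule R)

lemma not_exceptional_iff_locally_const:
  "dir t \<in> riU - exceptional_dirs b \<longleftrightarrow> (\<forall>x y. locally_const (\<lambda>t. b (dir t)) t x y)"
proof -
  have "dir t \<in> busemann_support b x y \<longleftrightarrow> \<not> locally_const (\<lambda>t. b (dir t)) t x y" for x y
    by (rule busemann_support_iff[OF bv_pair_beta t])
  then show ?thesis unfolding exceptional_dirs_def using t by simp
qed

lemma not_exceptional_iff: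
  "dir t \<in> riU - exceptional_dirs b \<longleftrightarrow>
    (\<forall>x. busemann_geodesic b x (dir t) Plus = busemann_geodesic b x (dir t) Minus) \<and>
    (\<forall>x y \<sigma> \<tau>. coalesce (busemann_geodesic b x (dir t) \<sigma>) (busemann_geodesic b y (dir t) \<tau>))"
proof -
  let ?\<beta> = "\<lambda>t. b (dir t)"
  have "(\<forall>x y. \<exists>m n. bpath ?\<beta> t Plus x m = bpath ?\<beta> t Plus y n) \<longleftrightarrow>
      (\<forall>x y \<sigma> \<tau>. coalesce (busemann_geodesic b x (dir t) \<sigma>) (busemann_geodesic b y (dir t) \<tau>))"
    if step: "bstep ?\<beta> t Plus = bstep ?\<beta> t Minus"
  proof -
    have "coalesce (busemann_geodesic b x (dir t) \<sigma>) (busemann_geodesic b y (dir t) \<tau>) \<longleftrightarrow>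
        (\<exists>m n. bpath ?\<beta> t Plus x m = bpath ?\<beta> t Plus y n)" for x y \<sigma> \<tau>
      unfolding busemann_geodesic_eq level_path_eq_if_bstep_eq[OF step, of \<sigma> x]
        level_path_eq_if_bstep_eq[OF step, of \<tau> y] by (rule coalesce_level_path_iff)
    then show ?thesis by simp
  qed
  then show ?thesis
    unfolding not_exceptional_iff_locally_const locally_const_iff[OF t] busemann_geodesics_agree_iff by blast
qed

lemma not_exceptional_if_isolated:
  assumes iso: "\<And>x y v. v \<in> busemann_support b x y \<Longrightarrow> v isolated_in busemann_support b x y"
    and x: "busemann_geodesic b x (dir t) Plus = busemann_geodesic b x (dir t) Minus"
  shows "dir t \<in> riU - exceptional_dirs b"
proof -
  let ?\<beta> = "\<lambda>t. b (dir t)"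
  have "left_const ?\<beta> t x y \<and> right_const ?\<beta> t x y" for x y
    by (rule isolated_support_imp_one_sided_const[OF bv_pair_beta t]) (rule iso)
  then have l: "left_const ?\<beta> t x y" and r: "right_const ?\<beta> t x y" for x y by blast+
  have "bpath ?\<beta> t Plus x n = bpath ?\<beta> t Minus x n" for n
    using x unfolding busemann_geodesic_eq level_path_eq_iff by (rule spec)
  then have "bstep ?\<beta> t Plus = bstep ?\<beta> t Minus" by (rule one_agreement_imp_all[OF t l r])
  moreover have "\<forall>x y. \<exists>m n. bpath ?\<beta> t Plus x m = bpath ?\<beta> t Plus y n"
    using coalesce_right(2)[OF t r] by blast
  ultimately show ?thesis unfolding not_exceptional_iff_locally_const locally_const_iff[OF t] by (rule conjI)
qed

end

context busemann_process
begin

lemma directed_into_U_of_iff: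
  assumes t: "0 < t" "t < 1" and \<pi>: "semi_inf_path x \<pi>"
  shows "directed_into (U_of g (dir t)) \<pi> \<longleftrightarrow>
    (\<forall>u. asymp_dir (\<lambda>n. \<pi> (lev x + int n)) u \<longrightarrow> 0 < u \<and> u < 1 \<and> affine_between profile u t)"
proof -
  have "dir u \<in> U_of g (dir t) \<longleftrightarrow> 0 < u \<and> u < 1 \<and> affine_between profile u t" for u
    unfolding U_of_dir[OF t] by (subst inj_image_mem_iff) (simp_all add: inj_on_def)
  then show ?thesis unfolding directed_into_iff[OF \<pi>] by simp
qed

lemma directed_geodesic_unique:
  assumes R: "busemann_realization (wt \<omega>) (real_B \<omega>) profile" and reg: "regularity_condition g"
    and t: "0 < t" "t < 1" and step: "bstep (real_B \<omega>) t Plus = bstep (real_B \<omega>) t Minus"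
    and geo: "semi_inf_geodesic (wt \<omega>) x \<pi>" and dir: "directed_into (U_of g (dir t)) \<pi>"
  shows "\<pi> = level_path (real_B \<omega>) t Plus x"
proof (rule ext)
  interpret R: busemann_realization "wt \<omega>" "real_B \<omega>" profile by (rule R)
  have \<pi>: "semi_inf_path x \<pi>" using geo unfolding semi_inf_geodesic_def by blast
  fix k
  show "\<pi> k = level_path (real_B \<omega>) t Plus x k"
  proof (cases "lev x \<le> k")
    case True
    then obtain n where k: "k = lev x + int n" unfolding zle_iff_zadd by (rule exE)
    have "\<pi> (lev x + int n) = bpath (real_B \<omega>) t Plus (\<pi> (lev x + int 0)) n"
    proof (rule R.optimal_path_unique[OF t regularity_imp_regular[OF reg R] semi_inf_geodesic_optimal[OF geo] _ step])
      show "0 < v \<and> v < 1 \<and> affine_between profile v t"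
        if "asymp_dir (\<lambda>n. \<pi> (lev x + int n)) v" for v
        by (rule mp[OF spec[OF iffD1[OF directed_into_U_of_iff[OF t \<pi>] dir]] that])
    qed
    also have "\<pi> (lev x + int 0) = x"
      using conjunct1[OF conjunct2[OF \<pi>[unfolded semi_inf_path_def]]] by (simp only: of_nat_0 add_0_right)
    finally show ?thesis unfolding k level_path_nat .
  next
    \<comment> \<open>Below the starting level both paths have the default value of extensional
      functions.\<close>
    case False
    then have k: "k \<notin> {lev x..}" by simp
    show ?thesis
      using extensional_arb[OF conjunct1[OF \<pi>[unfolded semi_inf_path_def]] k] k by (simp add: level_path_def)
  qed
qed

lemma directed_busemann_geodesic:
  assumes R: "busemann_realization (wt \<omega>) (real_B \<omega>) profile" and t: "0 < t" "t < 1"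
  shows "semi_inf_geodesic (wt \<omega>) x (busemann_geodesic (B \<omega>) x (dir t) \<sigma>)"
    and "directed_into (U_of g (dir t)) (busemann_geodesic (B \<omega>) x (dir t) \<sigma>)"
proof -
  interpret R: busemann_realization "wt \<omega>" "real_B \<omega>" profile by (rule R)
  show "semi_inf_geodesic (wt \<omega>) x (busemann_geodesic (B \<omega>) x (dir t) \<sigma>)"
    unfolding busemann_geodesic_eq by (rule R.semi_inf_geodesic_level_path[OF t])
  show "directed_into (U_of g (dir t)) (busemann_geodesic (B \<omega>) x (dir t) \<sigma>)"
    unfolding busemann_geodesic_eq directed_into_U_of_iff[OF t semi_inf_path_level_path] level_path_nat
    by (intro allI impI) (rule R.bpath_asymp_dir[OF t])
qed

lemma not_exceptional_iff_directed_geodesics: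
  assumes R: "busemann_realization (wt \<omega>) (real_B \<omega>) profile" and reg: "regularity_condition g"
    and t: "0 < t" "t < 1"
  shows "dir t \<in> riU - exceptional_dirs (B \<omega>) \<longleftrightarrow>
    (\<forall>x. \<exists>!\<pi>. semi_inf_geodesic (wt \<omega>) x \<pi> \<and> directed_into (U_of g (dir t)) \<pi>) \<and>
    (\<forall>x y \<pi> \<pi>'.
       semi_inf_geodesic (wt \<omega>) x \<pi> \<and> directed_into (U_of g (dir t)) \<pi> \<and>
       semi_inf_geodesic (wt \<omega>) y \<pi>' \<and> directed_into (U_of g (dir t)) \<pi>' \<longrightarrow> coalesce \<pi> \<pi>')"
    (is "_ \<longleftrightarrow> ?unique \<and> ?coalesce")
proof (rule iffI)
  note geo = directed_busemann_geodesic[OF R t]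
  note iff = not_exceptional_iff[OF R t]
  assume "dir t \<in> riU - exceptional_dirs (B \<omega>)"
  note * = iffD1[OF iff this]
  have step: "bstep (real_B \<omega>) t Plus = bstep (real_B \<omega>) t Minus"
    by (rule iffD1[OF busemann_geodesics_agree_iff conjunct1[OF *]])
  have eq: "\<pi> = busemann_geodesic (B \<omega>) x (dir t) Plus"
    if "semi_inf_geodesic (wt \<omega>) x \<pi> \<and> directed_into (U_of g (dir t)) \<pi>" for x \<pi>
    unfolding busemann_geodesic_eq
    by (rule directed_geodesic_unique[OF R reg t step conjunct1[OF that] conjunct2[OF that]])
  have ?unique
  proof (rule allI)
    fix x
    show "\<exists>!\<pi>. semi_inf_geodesic (wt \<omega>) x \<pi> \<and> directed_into (U_of g (dir t)) \<pi>"
      by (rule ex1I, rule conjI[OF geo[of x Plus]], rule eq)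
  qed
  moreover have ?coalesce
  proof (intro allI impI, elim conjE)
    fix x y \<pi> \<pi>'
    assume \<pi>: "semi_inf_geodesic (wt \<omega>) x \<pi>" "directed_into (U_of g (dir t)) \<pi>"
      and \<pi>': "semi_inf_geodesic (wt \<omega>) y \<pi>'" "directed_into (U_of g (dir t)) \<pi>'"
    have "coalesce (busemann_geodesic (B \<omega>) x (dir t) Plus) (busemann_geodesic (B \<omega>) y (dir t) Plus)"
      by (rule spec[OF spec[OF spec[OF spec[OF conjunct2[OF *]]]]])
    then show "coalesce \<pi> \<pi>'" by (simp only: eq[OF conjI, OF \<pi>] eq[OF conjI, OF \<pi>'])
  qed
  ultimately show "?unique \<and> ?coalesce" ..
next
  note geo = directed_busemann_geodesic[OF R t]
  assume *: "?unique \<and> ?coalesce"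
  show "dir t \<in> riU - exceptional_dirs (B \<omega>)"
  proof (rule iffD2[OF not_exceptional_iff[OF R t]], rule conjI; intro allI)
    fix x
    \<comment> \<open>The \<open>Plus\<close> and the \<open>Minus\<close> geodesic are both
      directed geodesics from x, so uniqueness identifies them.\<close>
    note ex1 = spec[OF conjunct1[OF *], of x]
    show "busemann_geodesic (B \<omega>) x (dir t) Plus = busemann_geodesic (B \<omega>) x (dir t) Minus"
      by (rule trans[OF sym[OF the1_equality[OF ex1]] the1_equality[OF ex1]]) (rule conjI[OF geo])+
  next
    fix x y \<sigma> \<tau>
    note coal = spec[OF spec[OF spec[OF spec[OF conjunct2[OF *], of x], of y],
        of "busemann_geodesic (B \<omega>) x (dir t) \<sigma>"], of "busemann_geodesic (B \<omega>) y (dir t) \<tau>"]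
    show "coalesce (busemann_geodesic (B \<omega>) x (dir t) \<sigma>) (busemann_geodesic (B \<omega>) y (dir t) \<tau>)"
      by (rule mp[OF coal]) (rule conjI geo)+
  qed
qed

lemma AE_isolated:
  assumes "jump_process_condition M B"
  shows "AE \<omega> in M. \<forall>x y. \<forall>\<xi>\<in>busemann_support (B \<omega>) x y. \<xi> isolated_in busemann_support (B \<omega>) x y"
proof -
  obtain E where E: "prob E = 1 \<and> (\<forall>\<omega>\<in>E. \<forall>x y. \<forall>\<xi>\<in>busemann_support (B \<omega>) x y.
      \<xi> isolated_in busemann_support (B \<omega>) x y)"
    using assms unfolding jump_process_condition_def by (rule bexE)
  show ?thesis
    by (rule AE_mp[OF AE_prob_1[OF conjunct1[OF E]]], rule AE_I2, rule impI, erule bspec[OF conjunct2[OF E]])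
qed

end

theorem theorem3p9:
  fixes M :: "'a::polish_space measure"
    and T :: "site \<Rightarrow> 'a \<Rightarrow> 'a"
    and wt :: "'a \<Rightarrow> site \<Rightarrow> real"
    and g :: "real \<times> real \<Rightarrow> real"
    and B :: "'a \<Rightarrow> busemann"
  assumes "busemann_process M T wt g B"
  shows "AE \<omega> in M. \<forall>\<xi>\<in>riU.
    (\<xi> \<in> riU - exceptional_dirs (B \<omega>) \<longleftrightarrow>
       (\<forall>x. busemann_geodesic (B \<omega>) x \<xi> Plus = busemann_geodesic (B \<omega>) x \<xi> Minus) \<and>
       (\<forall>x y \<sigma> \<tau>. coalesce (busemann_geodesic (B \<omega>) x \<xi> \<sigma>) (busemann_geodesic (B \<omega>) y \<xi> \<tau>)))
    \<and>
    (regularity_condition g \<longrightarrow>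
       (\<xi> \<in> riU - exceptional_dirs (B \<omega>) \<longleftrightarrow>
          (\<forall>x. \<exists>!\<pi>. semi_inf_geodesic (wt \<omega>) x \<pi> \<and> directed_into (U_of g \<xi>) \<pi>) \<and>
          (\<forall>x y \<pi> \<pi>'.
             semi_inf_geodesic (wt \<omega>) x \<pi> \<and> directed_into (U_of g \<xi>) \<pi> \<and>
             semi_inf_geodesic (wt \<omega>) y \<pi>' \<and> directed_into (U_of g \<xi>) \<pi>' \<longrightarrow> coalesce \<pi> \<pi>')))
    \<and>
    (jump_process_condition M B \<longrightarrow>
       (\<exists>x. busemann_geodesic (B \<omega>) x \<xi> Plus = busemann_geodesic (B \<omega>) x \<xi> Minus) \<longrightarrow>
       (\<forall>y. busemann_geodesic (B \<omega>) y \<xi> Plus = busemann_geodesic (B \<omega>) y \<xi> Minus) \<and>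
       (\<forall>x y \<sigma> \<tau>. coalesce (busemann_geodesic (B \<omega>) x \<xi> \<sigma>) (busemann_geodesic (B \<omega>) y \<xi> \<tau>)) \<and>
       \<xi> \<in> riU - exceptional_dirs (B \<omega>))
    \<and>
    (regularity_condition g \<and> jump_process_condition M B \<longrightarrow>
       (\<exists>x. busemann_geodesic (B \<omega>) x \<xi> Plus = busemann_geodesic (B \<omega>) x \<xi> Minus) \<longrightarrow>
       (\<forall>x. \<exists>!\<pi>. semi_inf_geodesic (wt \<omega>) x \<pi> \<and> directed_into (U_of g \<xi>) \<pi>) \<and>
       (\<forall>x y \<pi> \<pi>'.
          semi_inf_geodesic (wt \<omega>) x \<pi> \<and> directed_into (U_of g \<xi>) \<pi> \<and>
          semi_inf_geodesic (wt \<omega>) y \<pi>' \<and> directed_into (U_of g \<xi>) \<pi>' \<longrightarrow> coalesce \<pi> \<pi>') \<and>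
       \<xi> \<in> riU - exceptional_dirs (B \<omega>))"
proof -
  interpret busemann_process M T wt g B by (rule assms)
  \<comment> \<open>The jump condition does not depend on the outcome, so it can stay as a premise
    inside the almost sure statement.\<close>
  have "AE \<omega> in M. jump_process_condition M B \<longrightarrow>
      (\<forall>x y. \<forall>\<xi>\<in>busemann_support (B \<omega>) x y. \<xi> isolated_in busemann_support (B \<omega>) x y)"
    using AE_isolated by (cases "jump_process_condition M B") simp_all
  with AE_realization show ?thesis
  proof eventually_elim
    case (elim \<omega>)
    note R = elim(1)
    show ?case
    proof (rule ballI, goal_cases)
      case (1 \<xi>)
      then obtain t where \<xi>: "\<xi> = dir t" and t: "0 < t" "t < 1" unfolding riU_eq by auto
      \<comment> \<open>Given (a) and (b), the remaining parts (c) and (d) reduce propositionally to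
        one implication: under (J), a single agreement makes the direction non-exceptional.\<close>
      have combine: "(N \<longleftrightarrow> G \<and> C) \<Longrightarrow> (r \<Longrightarrow> N \<longleftrightarrow> U \<and> D) \<Longrightarrow> (j \<Longrightarrow> A \<Longrightarrow> N) \<Longrightarrow>
          (N \<longleftrightarrow> G \<and> C) \<and> (r \<longrightarrow> (N \<longleftrightarrow> U \<and> D)) \<and> (j \<longrightarrow> A \<longrightarrow> G \<and> C \<and> N) \<and> (r \<and> j \<longrightarrow> A \<longrightarrow> U \<and> D \<and> N)"
        for N G C r U D j A by blast
      show ?case unfolding \<xi>
      proof (rule combine)
        show "dir t \<in> riU - exceptional_dirs (B \<omega>)"
          if j: "jump_process_condition M B"
            and "\<exists>x. busemann_geodesic (B \<omega>) x (dir t) Plus = busemann_geodesic (B \<omega>) x (dir t) Minus"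
          using that(2)
        proof
          fix x assume "busemann_geodesic (B \<omega>) x (dir t) Plus = busemann_geodesic (B \<omega>) x (dir t) Minus"
          then show ?thesis
            by (rule not_exceptional_if_isolated[OF R t, rotated]) (rule mp[OF elim(2) j, rule_format])
        qed
      qed (rule not_exceptional_iff[OF R t], rule not_exceptional_iff_directed_geodesics[OF R _ t])
    qed
  qed
qed

end
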